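(* Consider the $K$-user parallel MISO broadcast channel with $M$ subchannels and partial CSIT with quality parameters $\alpha_k^{[m]}\in[0,1]$, as described in the context. Suppose the users are totally ordered with respect to their CSIT qualities, i.e. there is a permutation $\pi$ of $\{1,\dots,K\}$ such that $\alpha_{\pi(1)}^{[m]}\ge\alpha_{\pi(2)}^{[m]}\ge\cdots\ge\alpha_{\pi(K)}^{[m]}$ for every $m\in\{1,\dots,M\}$. Then the subchannels are sum-DoF separable, i.e. $$d_\Sigma=\frac1M\sum_{m=1}^M d_\Sigma^{[m]},$$ where $d_\Sigma$ is the sum-DoF of the parallel channel and $d_\Sigma^{[m]}$ is the sum-DoF of the $m$-th subchannel when considered as a separate network.
   Context: **Channel.** A transmitter with $K$ antennas sends independent messages $W_1,\dots,W_K$ to $K$ single-antenna users over $M$ parallel subchannels ($K$, $M$ fixed). Over $n$ channel uses, user $k$ receives on subchannel $m$ at channel use $t\in\{1,\dots,n\}$ $$y_k^{[m]}(t)=\mathbf h_k^{[m]}(t)\,\mathbf x^{[m]}(t)+z_k^{[m]}(t),$$ where $\mathbf h_k^{[m]}(t)\in\mathbb C^{1\times K}$ is the (row) fading channel vector, $\mathbf x^{[m]}(t)\in\mathbb C^{K\times1}$ is the transmitted vector, and $z_k^{[m]}(t)\sim\mathcal N_{\mathbb C}(0,1)$ is additive white Gaussian noise (independent over $k,m,t$ and independent of the channels and messages). The absolute values of all channel coefficients are bounded away from zero and infinity. The input satisfies the joint power constraint $\frac1{nM}\sum_{t=1}^n\sum_{m=1}^M\|\mathbf x^{[m]}(t)\|^2\le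 P$. **Partial CSIT.** For all $k,m,t$, $$\mathbf h_k^{[m]}(t)=\hat{\mathbf h}_k^{[m]}(t)+\sqrt{P^{-\alpha_k^{[m]}}}\;\tilde{\mathbf h}_k^{[m]}(t),\qquad \alpha_k^{[m]}\in[0,1],$$ with estimate $\hat{\mathbf h}_k^{[m]}(t)$ and error $\tilde{\mathbf h}_k^{[m]}(t)$ in $\mathbb C^{1\times K}$. The entries of all estimates and errors are drawn from continuous joint distributions with bounded densities: there is a finite constant $f_{\max}>0$, independent of $P$ and $n$, such that for any two disjoint finite subsets $\mathcal B_1,\mathcal B_2$ of these entries (over all users, subchannels, channel uses), the conditional joint density of $\mathcal B_1$ given $\mathcal B_2$ is at most $f_{\max}^{|\mathcal B_1|}$. The channels are independent of the messages. The transmitter knows the realizations of the estimates $\hat{\mathbf h}_k^{[m]}(t)$ but not of the errors $\tilde{\mathbf h}_k^{[m]}(t)$; thus the transmitted signals over the block are functions of the messages and the estimates only. All receivers know all channel realizations. Coding may be joint across subchannels. **Rates and DoF.** Achievable rate tuples $(R_1(P),\dots,R_K(P))$ (bits per channel use, counting all $M$ subchannels together) and the capacity region $\mathcal C(P)$ are defined in the standard Shannon sense, with $n\to\infty$ and $M$ fixed. A tuple $(d_1,\dots,d_K)$ is an achievable DoF tuple if there exist $(R_1(P),\dots,R_K(P))\in\mathcal C(P)$ with $d_k=\lim_{P\to\infty}\frac{R_k(P)}{M\log P}$ for all $k$. The DoF region $\mathcal D$ is the closure of the set of achievable DoF tuples, and the sum-DoF is $d_\Sigma=\max_{(d_1,\dots,d_K)\in\mathcal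 D}\sum_{k=1}^K d_k$. **Separate network.** For fixed $m\in\{1,\dots,M\}$, the $m$-th subchannel considered as a separate network is the $K$-user MISO broadcast channel consisting of that single subchannel only: user $k$ receives $y_k^{[m]}(t)=\mathbf h_k^{[m]}(t)\,\mathbf x^{[m]}(t)+z_k^{[m]}(t)$ for $t\in\{1,\dots,n\}$, with $\mathbf h_k^{[m]}(t)=\hat{\mathbf h}_k^{[m]}(t)+\sqrt{P^{-\alpha_k^{[m]}}}\,\tilde{\mathbf h}_k^{[m]}(t)$, the same assumptions on noise, channel distributions, transmitter and receiver channel knowledge and messages as for the parallel channel, CSIT qualities $(\alpha_1^{[m]},\dots,\alpha_K^{[m]})$, power constraint $\frac1n\sum_{t=1}^n\|\mathbf x^{[m]}(t)\|^2\le P$, and DoF normalized by $\log P$ (i.e. $d_k=\lim_{P\to\infty}\frac{R_k(P)}{\log P}$); $d_\Sigma^{[m]}$ is its sum-DoF, i.e. the maximum of $\sum_{k=1}^K d_k$ over the closure of its set of achievable DoF tuples. *)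

theory Defs
  imports "HOL-Probability.Probability"
begin

text \<open>
  Users are the elements of a finite type \<open>'k\<close>, which also indexes the transmit antennas
  (\<open>K = CARD('k)\<close>); subchannels are the elements of a finite type \<open>'m\<close>. Channel uses are numbered
  from \<open>0\<close>, so a block of length \<open>n\<close> is \<open>t < n\<close>.

  The channel estimates and errors are random variables on a probability space \<open>Q\<close> whose law does
  not change with the power \<open>P\<close>; the channel itself depends on \<open>P\<close> through \<open>chan\<close>.
  The value of a CSI process in user \<open>k\<close>, subchannel \<open>m\<close>, channel use \<open>t\<close> is \<open>X k m t\<close>.
\<close>

type_synonym ('a, 'k, 'm) csi_process = "'k \<Rightarrow> 'm \<Rightarrow> nat \<Rightarrow> 'a \<Rightarrow> complex ^ 'k"

type_synonym ('k, 'm) csi_block = "'k \<times> 'm \<times> nat \<Rightarrow> complex ^ 'k"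

type_synonym ('k, 'm) encoder = "('k \<Rightarrow> nat) \<Rightarrow> ('k, 'm) csi_block \<Rightarrow> 'm \<Rightarrow> nat \<Rightarrow> complex ^ 'k"

type_synonym ('k, 'm) decoder =
  "('m \<times> nat \<Rightarrow> complex) \<times> ('k, 'm) csi_block \<times> ('k, 'm) csi_block \<Rightarrow> nat"

definition chan ::
  "('k::finite \<Rightarrow> 'm \<Rightarrow> real) \<Rightarrow> real \<Rightarrow> 'k \<Rightarrow> 'm \<Rightarrow> complex ^ 'k \<Rightarrow> complex ^ 'k \<Rightarrow> complex ^ 'k" where
  "chan \<alpha> P k m e d = e + sqrt (P powr (- \<alpha> k m)) *\<^sub>R d"


section \<open>Channel assumptions\<close>

text \<open>
  \<open>f B\<close> is a version of the joint density of \<open>(X i)\<close>, \<open>i \<in> B\<close>, with respect to Lebesgue measure on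
  \<open>B \<rightarrow> \<complex>\<close>. The conditional density of \<open>B\<^sub>1\<close> given \<open>B\<^sub>2\<close> is the quotient of the joint
  density of \<open>B\<^sub>1 \<union> B\<^sub>2\<close> by the density of \<open>B\<^sub>2\<close>, defined where the latter is positive; as
  densities are unique only almost everywhere, so is the bound.
\<close>

definition cond_density ::
  "('i set \<Rightarrow> ('i \<Rightarrow> complex) \<Rightarrow> real) \<Rightarrow> 'i set \<Rightarrow> 'i set \<Rightarrow> ('i \<Rightarrow> complex) \<Rightarrow> real" where
  "cond_density f B1 B2 x = f (B1 \<union> B2) x / f B2 (restrict x B2)"

definition bounded_densities :: "'a measure \<Rightarrow> ('i \<Rightarrow> 'a \<Rightarrow> complex) \<Rightarrow> bool" where
  "bounded_densities Q X \<longleftrightarrow>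
    (\<exists>fmax > 0. \<exists>f :: 'i set \<Rightarrow> ('i \<Rightarrow> complex) \<Rightarrow> real.
      (\<forall>B. finite B \<longrightarrow>
        (\<forall>x. 0 \<le> f B x) \<and>
        distributed Q (\<Pi>\<^sub>M i\<in>B. lborel) (\<lambda>\<omega>. \<lambda>i\<in>B. X i \<omega>) (\<lambda>x. ennreal (f B x))) \<and>
      (\<forall>B1 B2. finite B1 \<longrightarrow> finite B2 \<longrightarrow> B1 \<inter> B2 = {} \<longrightarrow>
        (AE x in \<Pi>\<^sub>M i\<in>B1 \<union> B2. lborel.
          f B2 (restrict x B2) > 0 \<longrightarrow> cond_density f B1 B2 x \<le> fmax ^ card B1)))"

datatype csi_kind = Estimate | Deviation

definition csi_entry ::
  "('a, 'k, 'm) csi_process \<Rightarrow> ('a, 'k, 'm) csi_process \<Rightarrow>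
   csi_kind \<times> 'k::finite \<times> 'm \<times> nat \<times> 'k \<Rightarrow> 'a \<Rightarrow> complex" where
  "csi_entry est err = (\<lambda>(c, k, m, t, i) \<omega>.
    (case c of Estimate \<Rightarrow> est k m t \<omega> | Deviation \<Rightarrow> err k m t \<omega>) $ i)"

locale partial_csit_bc = prob_space Q
  for Q :: "'a measure" +
  fixes est err :: "('a, 'k::finite, 'm::finite) csi_process"
    and \<alpha> :: "'k \<Rightarrow> 'm \<Rightarrow> real"
  assumes quality: "0 \<le> \<alpha> k m" "\<alpha> k m \<le> 1"
    and densities: "bounded_densities Q (csi_entry est err)"
    and coefficients: "\<exists>lo hi. 0 < lo \<and>
      (\<forall>P \<ge> 1. \<forall>k m t i. AE \<omega> in Q.
        lo \<le> cmod (chan \<alpha> P k m (est k m t \<omega>) (err k m t \<omega>) $ i) \<and>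
        cmod (chan \<alpha> P k m (est k m t \<omega>) (err k m t \<omega>) $ i) \<le> hi)"


section \<open>Codes and error probability\<close>

definition block :: "nat \<Rightarrow> ('k \<times> 'm \<times> nat) set" where
  "block n = UNIV \<times> UNIV \<times> {..<n}"

definition csi_of :: "nat \<Rightarrow> ('a, 'k, 'm) csi_process \<Rightarrow> 'a \<Rightarrow> ('k::finite, 'm) csi_block" where
  "csi_of n X \<omega> = (\<lambda>(k, m, t)\<in>block n. X k m t \<omega>)"

definition messages :: "nat \<Rightarrow> real ^ 'k \<Rightarrow> ('k::finite \<Rightarrow> nat) set" where
  "messages n R = (\<Pi>\<^sub>E k\<in>UNIV. {1..nat \<lceil>2 powr (real n * R $ k)\<rceil>})"

text \<open>The transmitter sees the estimates of the whole block only; each receiver sees its own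
  outputs and all estimates and errors of the block, which determine all channels.\<close>

definition is_code ::
  "nat \<Rightarrow> real \<Rightarrow> real ^ 'k \<Rightarrow> ('k::finite, 'm::finite) encoder \<Rightarrow> ('k \<Rightarrow> ('k, 'm) decoder) \<Rightarrow> bool"
  where
  "is_code n P R enc dec \<longleftrightarrow>
    (\<forall>w\<in>messages n R. \<forall>m. \<forall>t<n.
      (\<lambda>g. enc w g m t) \<in> borel_measurable (\<Pi>\<^sub>M j\<in>block n. borel)) \<and>
    (\<forall>w\<in>messages n R. \<forall>g.
      (1 / (real n * real CARD('m))) * (\<Sum>t<n. \<Sum>m\<in>UNIV. (norm (enc w g m t))\<^sup>2) \<le> P) \<and>
    (\<forall>k. dec k \<in> measurable
      ((\<Pi>\<^sub>M j\<in>UNIV \<times> {..<n}. borel) \<Otimes>\<^sub>M (\<Pi>\<^sub>M j\<in>block n. borel) \<Otimes>\<^sub>M (\<Pi>\<^sub>M j\<in>block n. borel))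
      (count_space UNIV))"

definition received ::
  "('k::finite \<Rightarrow> 'm \<Rightarrow> real) \<Rightarrow> nat \<Rightarrow> real \<Rightarrow> ('k, 'm) encoder \<Rightarrow> 'k \<Rightarrow> ('k \<Rightarrow> nat) \<Rightarrow>
   ('k, 'm) csi_block \<Rightarrow> ('k, 'm) csi_block \<Rightarrow> ('k \<times> 'm \<times> nat \<Rightarrow> complex) \<Rightarrow>
   'm \<times> nat \<Rightarrow> complex" where
  "received \<alpha> n P enc k w g d z = (\<lambda>(m, t)\<in>UNIV \<times> {..<n}.
    (\<Sum>i\<in>UNIV. chan \<alpha> P k m (g (k, m, t)) (d (k, m, t)) $ i * enc w g m t $ i) + z (k, m, t))"

text \<open>The circularly symmetric standard complex Gaussian distribution.\<close>

definition cgauss :: "complex measure" where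
  "cgauss = density lborel (\<lambda>z. ennreal (exp (- (cmod z)\<^sup>2) / pi))"

text \<open>The joint law of messages, channel and noise; the product makes them independent.\<close>

definition joint_law ::
  "'a measure \<Rightarrow> nat \<Rightarrow> real ^ 'k::finite \<Rightarrow>
   (('k \<Rightarrow> nat) \<times> 'a \<times> ('k \<times> 'm::finite \<times> nat \<Rightarrow> complex)) measure" where
  "joint_law Q n R =
    uniform_count_measure (messages n R) \<Otimes>\<^sub>M Q \<Otimes>\<^sub>M (\<Pi>\<^sub>M j\<in>block n. cgauss)"

definition error_prob ::
  "'a measure \<Rightarrow> ('a, 'k, 'm) csi_process \<Rightarrow> ('a, 'k, 'm) csi_process \<Rightarrow> ('k \<Rightarrow> 'm \<Rightarrow> real) \<Rightarrow>
   nat \<Rightarrow> real \<Rightarrow> real ^ 'k \<Rightarrow> ('k::finite, 'm::finite) encoder \<Rightarrow> ('k \<Rightarrow> ('k, 'm) decoder) \<Rightarrow> real"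
  where
  "error_prob Q est err \<alpha> n P R enc dec =
    measure (joint_law Q n R)
      {(w, \<omega>, z) \<in> space (joint_law Q n R).
        \<exists>k. dec k (received \<alpha> n P enc k w (csi_of n est \<omega>) (csi_of n err \<omega>) z,
                   csi_of n est \<omega>, csi_of n err \<omega>) \<noteq> w k}"


section \<open>Capacity region and degrees of freedom\<close>

definition achievable_rate ::
  "'a measure \<Rightarrow> ('a, 'k, 'm) csi_process \<Rightarrow> ('a, 'k, 'm) csi_process \<Rightarrow>
   ('k::finite \<Rightarrow> 'm::finite \<Rightarrow> real) \<Rightarrow> real \<Rightarrow> real ^ 'k \<Rightarrow> bool" where
  "achievable_rate Q est err \<alpha> P R \<longleftrightarrow>
    (\<forall>k. 0 \<le> R $ k) \<and>
    (\<exists>enc dec. (\<forall>n\<ge>1. is_code n P R (enc n) (dec n)) \<and>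
      (\<lambda>n. error_prob Q est err \<alpha> n P R (enc n) (dec n)) \<longlonglongrightarrow> 0)"

definition capacity_region ::
  "'a measure \<Rightarrow> ('a, 'k, 'm) csi_process \<Rightarrow> ('a, 'k, 'm) csi_process \<Rightarrow>
   ('k::finite \<Rightarrow> 'm::finite \<Rightarrow> real) \<Rightarrow> real \<Rightarrow> (real ^ 'k) set" where
  "capacity_region Q est err \<alpha> P = closure {R. achievable_rate Q est err \<alpha> P R}"

definition achievable_dof ::
  "'a measure \<Rightarrow> ('a, 'k, 'm) csi_process \<Rightarrow> ('a, 'k, 'm) csi_process \<Rightarrow>
   ('k::finite \<Rightarrow> 'm::finite \<Rightarrow> real) \<Rightarrow> real ^ 'k \<Rightarrow> bool" where
  "achievable_dof Q est err \<alpha> d \<longleftrightarrow>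
    (\<exists>R. (\<forall>P>1. R P \<in> capacity_region Q est err \<alpha> P) \<and>
      (\<forall>k. ((\<lambda>P. R P $ k / (real CARD('m) * log 2 P)) \<longlongrightarrow> d $ k) at_top))"

definition dof_region ::
  "'a measure \<Rightarrow> ('a, 'k, 'm) csi_process \<Rightarrow> ('a, 'k, 'm) csi_process \<Rightarrow>
   ('k::finite \<Rightarrow> 'm::finite \<Rightarrow> real) \<Rightarrow> (real ^ 'k) set" where
  "dof_region Q est err \<alpha> = closure {d. achievable_dof Q est err \<alpha> d}"

definition sum_dof ::
  "'a measure \<Rightarrow> ('a, 'k, 'm) csi_process \<Rightarrow> ('a, 'k, 'm) csi_process \<Rightarrow>
   ('k::finite \<Rightarrow> 'm::finite \<Rightarrow> real) \<Rightarrow> real" where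
  "sum_dof Q est err \<alpha> =
    (GREATEST s. s \<in> (\<lambda>d. \<Sum>k\<in>UNIV. d $ k) ` dof_region Q est err \<alpha>)"

text \<open>Restriction of a family indexed by users and subchannels to a single subchannel: the
  separate network is the parallel channel over the one-element subchannel type.\<close>

definition subchannel :: "'m \<Rightarrow> ('k \<Rightarrow> 'm \<Rightarrow> 'b) \<Rightarrow> 'k \<Rightarrow> unit \<Rightarrow> 'b" where
  "subchannel m X = (\<lambda>k _. X k m)"

definition separate_sum_dof ::
  "'a measure \<Rightarrow> ('a, 'k, 'm) csi_process \<Rightarrow> ('a, 'k, 'm) csi_process \<Rightarrow>
   ('k::finite \<Rightarrow> 'm \<Rightarrow> real) \<Rightarrow> 'm \<Rightarrow> real" where
  "separate_sum_dof Q est err \<alpha> m =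
    sum_dof Q (subchannel m est) (subchannel m err) (subchannel m \<alpha>)"

end

theory Submission
  imports Defs
begin

text \<open>
  With the users ordered as \<open>\<pi> 1, \<dots>, \<pi> K\<close> by decreasing quality, the sum-DoF is
  \<open>1 + (1/M) \<Sum>\<^sub>m \<Sum>\<^sub>i\<^sub>\<ge>\<^sub>2 \<alpha> (\<pi> i) m\<close>, which is additive over the subchannels.

  Upper bound. Replace the outputs by their integer parts \<open>q\<^sub>k\<close>: the noise costs only a factor
  \<open>C\<^sup>n\<close>, because a wider Gaussian dominates every translate of the noise by a rounding error. For a
  uniformly drawn message tuple \<open>w\<close> put
  \<open>a\<^sub>i = #{w'. w' agrees with w on the messages of \<pi> (i+1), \<dots>, \<pi> K and has the same q\<^sub>\<pi>\<^sub>i}\<close> and let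
  \<open>b\<^sub>i\<close> be the same number with agreement on \<open>\<pi> i\<close> as well. Reliable decoding forces
  \<open>b\<^sub>i \<ge> C\<^sup>-\<^sup>n a\<^sub>i\<close> with high probability. In the expectation of \<open>b\<^sub>i\<^sub>+\<^sub>1 / a\<^sub>i\<close> over the
  estimation errors of user \<open>\<pi> (i+1)\<close>, a pair of message tuples counts only if its images at that user
  align, and by the bounded densities this has probability at most the product over channel uses of
  \<open>C P\<^sup>\<alpha> / |q\<^sub>\<pi>\<^sub>i(w) - q\<^sub>\<pi>\<^sub>i(w')|\<^sup>2\<close>; dividing by \<open>a\<^sub>i\<close> turns the sum over message tuples into a sum over
  the values of \<open>q\<^sub>\<pi>\<^sub>i\<close>, which is a sum over Gaussian integers. Multiplying these bounds along the
  chain from \<open>b\<^sub>1 = 1\<close> to \<open>a\<^sub>K\<close>, and using that the power constraint leaves few values of \<open>q\<^sub>\<pi>\<^sub>K\<close>,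
  bounds the number of message tuples.

  Lower bound. On every subchannel send zero-forced private symbols of power \<open>P\<^sup>\<beta>\<close>, where
  \<open>\<beta> = \<alpha> (\<pi> 2) m\<close>, below a common symbol of power \<open>P\<close>. User \<open>k\<close> gets \<open>min \<beta> (\<alpha> k m)\<close> private
  degrees of freedom and the common symbol carries \<open>1 - \<beta>\<close>. Symbols are detected one by one; the channel
  uses spoiled by a weak gain or by loud noise form a small fraction of the block, again by the bounded
  densities, and are corrected by an outer Gilbert--Varshamov code.
\<close>

section \<open>Integration against bounded densities\<close>

text \<open>The upper bound holds for every enumeration of the users, and its value depends only on
  which user comes first, since the quality of that user is the one left out. A common order makes
  one user the best on all subchannels at once, so leaving it out is the right choice everywhere and
  the scheme meets the bound. Entropies never appear. The fibre sizes play the role of exponentiated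
  conditional entropies, and a single outcome with a single message tuple, at which all inequalities
  hold together, replaces a chain of entropy inequalities. The sum of the inverse squared moduli
  over the Gaussian integers diverges logarithmically, so the weights carry the exponent 1 +
  \<epsilon>, at a price of a factor P to the power \<epsilon> per channel use; this slack vanishes
  in the DoF limit. The power constraint bounds only the average over the block, so no single output
  is bounded, and products over the block are estimated through that average. In the scheme the
  thresholds for gains and noise are fixed before the power grows. Fading and noise then cost a
  small fixed share of the block.\<close>

interpretation complex_PiM: product_sigma_finite "\<lambda>_. lborel :: complex measure"
  by standard

lemma prod_mono_ennreal:
  fixes f g :: "'i \<Rightarrow> ennreal"
  assumes "\<And>i. i \<in> A \<Longrightarrow> f i \<le> g i"
  shows "prod f A \<le> prod g A"
  using assms by (induction A rule: infinite_finite_induct) (auto intro!: mult_mono)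

lemma emeasure_cball_complex:
  "r \<ge> 0 \<Longrightarrow> emeasure lborel (cball (c::complex) r) = ennreal (pi * r\<^sup>2)"
  by (simp add: emeasure_cball unit_ball_vol_2)

text \<open>For nonzero \<open>v\<close> the condition confines \<open>y\<close> to a disc of radius
  \<open>\<rho> / cmod v\<close>, whose area is compared with that of \<open>cball c r\<close>; for
  \<open>\<kappa> \<ge> 1\<close> the area of \<open>cball c r\<close> is already enough. So
  \<open>\<kappa>\<close> bounds the share of the disc that survives.\<close>

lemma small_ball_coordinate:
  fixes b v c :: complex
  assumes r: "r > 0" and k: "0 \<le> \<kappa>" "0 \<le> \<rho>"
    and *: "\<kappa> \<ge> 1 \<or> (v \<noteq> 0 \<and> \<rho>\<^sup>2 \<le> \<kappa> * r\<^sup>2 * (cmod v)\<^sup>2)"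
  shows "(\<integral>\<^sup>+y. indicator {y. cmod (b + v * y) \<le> \<rho>} y * indicator (cball c r) y \<partial>lborel)
    \<le> ennreal (pi * r\<^sup>2 * \<kappa>)"
proof (cases "\<kappa> \<ge> 1")
  case True
  have "(\<integral>\<^sup>+y. indicator {y. cmod (b + v * y) \<le> \<rho>} y * indicator (cball c r) y \<partial>lborel)
    \<le> (\<integral>\<^sup>+y. indicator (cball c r) y \<partial>lborel)"
    by (intro nn_integral_mono) (auto split: split_indicator)
  also have "\<dots> = ennreal (pi * r\<^sup>2)" using r by (simp add: emeasure_cball_complex)
  also have "\<dots> \<le> ennreal (pi * r\<^sup>2 * \<kappa>)"
    using True r by (intro ennreal_leI) simp
  finally show ?thesis .
next
  case False
  with * have v: "v \<noteq> 0" and le: "\<rho>\<^sup>2 \<le> \<kappa> * r\<^sup>2 * (cmod v)\<^sup>2" by auto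
  have sub: "y \<in> cball (- b / v) (\<rho> / cmod v)" if "cmod (b + v * y) \<le> \<rho>" for y
  proof -
    have "dist (- b / v) y = cmod ((b + v * y) / v)"
      using v by (simp add: dist_norm norm_minus_commute add_divide_distrib add.commute)
    also have "\<dots> \<le> \<rho> / cmod v"
      using that by (simp add: norm_divide divide_right_mono)
    finally show ?thesis by simp
  qed
  have "(\<integral>\<^sup>+y. indicator {y. cmod (b + v * y) \<le> \<rho>} y * indicator (cball c r) y \<partial>lborel)
    \<le> (\<integral>\<^sup>+y. indicator (cball (- b / v) (\<rho> / cmod v)) y \<partial>lborel)"
    by (intro nn_integral_mono) (use sub in \<open>auto split: split_indicator\<close>)
  also have "\<dots> = ennreal (pi * (\<rho> / cmod v)\<^sup>2)"
    using k by (simp add: emeasure_cball_complex)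
  also have "\<dots> \<le> ennreal (pi * r\<^sup>2 * \<kappa>)"
  proof (intro ennreal_leI)
    have "(\<rho> / cmod v)\<^sup>2 \<le> \<kappa> * r\<^sup>2"
      using le v by (simp add: power_divide divide_le_eq)
    then show "pi * (\<rho> / cmod v)\<^sup>2 \<le> pi * r\<^sup>2 * \<kappa>"
      by (simp add: mult.commute mult.left_commute)
  qed
  finally show ?thesis .
qed

lemma small_ball_measurable:
  fixes V :: "'j \<Rightarrow> 'k::finite \<Rightarrow> complex" and e :: "'j \<Rightarrow> 'k \<Rightarrow> 'i"
  assumes e: "\<And>j i. j \<in> J \<Longrightarrow> e j i \<in> D"
  shows "(\<lambda>x. (\<Prod>j\<in>J. of_bool (cmod (b j + (\<Sum>i\<in>UNIV. V j i * x (e j i))) \<le> \<rho> j)) *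
      (\<Prod>l\<in>D. of_bool (dist (c l) (x l) \<le> r)) :: ennreal)
    \<in> borel_measurable (\<Pi>\<^sub>M l\<in>D. (lborel :: complex measure))"
proof -
  have [measurable]: "(\<lambda>x. x (e j i)) \<in> borel_measurable (Pi\<^sub>M D (\<lambda>_. lborel))" if "j \<in> J" for j i
    using that e by (intro measurable_component_singleton[where M="\<lambda>_. lborel", simplified])
  have [measurable]: "(\<lambda>x. x l) \<in> borel_measurable (Pi\<^sub>M D (\<lambda>_. lborel))" if "l \<in> D" for l
    using that by (intro measurable_component_singleton[where M="\<lambda>_. lborel", simplified])
  show ?thesis
    by (intro borel_measurable_times_ennreal borel_measurable_prod_ennreal) measurable
qed

lemma small_ball_integral:
  fixes V :: "'j \<Rightarrow> 'k::finite \<Rightarrow> complex" and e :: "'j \<Rightarrow> 'k \<Rightarrow> 'i"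
  assumes J: "finite J" and inj: "inj_on (\<lambda>(j, i). e j i) (J \<times> UNIV)" and r: "r > 0"
    and D: "D = (\<lambda>(j, i). e j i) ` (J \<times> UNIV)"
    and k: "\<And>j. j \<in> J \<Longrightarrow> 0 \<le> \<kappa> j" "\<And>j. j \<in> J \<Longrightarrow> 0 \<le> \<rho> j"
    and *: "\<And>j. j \<in> J \<Longrightarrow> \<kappa> j \<ge> 1 \<or> (V j (s j) \<noteq> 0 \<and> (\<rho> j)\<^sup>2 \<le> \<kappa> j * r\<^sup>2 * (cmod (V j (s j)))\<^sup>2)"
  shows "(\<integral>\<^sup>+x. (\<Prod>j\<in>J. of_bool (cmod (b j + (\<Sum>i\<in>UNIV. V j i * x (e j i))) \<le> \<rho> j)) *
      (\<Prod>l\<in>D. of_bool (dist (c l) (x l) \<le> r)) \<partial>(\<Pi>\<^sub>M l\<in>D. lborel))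
    \<le> (\<Prod>j\<in>J. ennreal ((pi * r\<^sup>2) ^ CARD('k) * \<kappa> j))"
proof -
  let ?p = "\<lambda>j. e j (s j)"
  \<comment> \<open>The coordinates to be integrated first, one for each linear form.\<close>
  define E where "E = ?p ` J"
  have injp: "inj_on ?p J"
    using inj by (auto simp: inj_on_def)
  have E: "finite E" "E \<subseteq> D" and finD: "finite D"
    using J by (auto simp: E_def D)
  have e_eq: "e j i = e j' i' \<longleftrightarrow> j = j' \<and> i = i'" if "j \<in> J" "j' \<in> J" for j j' i i'
    using inj that by (auto simp: inj_on_def)
  have cardD: "card D = card J * CARD('k)"
    unfolding D using card_image[OF inj] by (simp add: card_cartesian_product)
  have cardE: "card E = card J" unfolding E_def by (rule card_image[OF injp])
  have DE: "D = (D - E) \<union> E" using E by auto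
  let ?F = "\<lambda>x. (\<Prod>j\<in>J. of_bool (cmod (b j + (\<Sum>i\<in>UNIV. V j i * x (e j i))) \<le> \<rho> j)) *
      (\<Prod>l\<in>D. of_bool (dist (c l) (x l) \<le> r)) :: ennreal"
  have meas: "?F \<in> borel_measurable (Pi\<^sub>M D (\<lambda>_. lborel))"
    by (rule small_ball_measurable) (auto simp: D)
  have meas': "?F \<in> borel_measurable (Pi\<^sub>M ((D - E) \<union> E) (\<lambda>_. lborel))"
    using meas DE by simp
  let ?b = "\<lambda>x j. b j + (\<Sum>i\<in>UNIV - {s j}. V j i * x (e j i))"
  define q where "q = the_inv_into J ?p"
  have q: "q (e j (s j)) = j" if "j \<in> J" for j
    unfolding q_def by (rule the_inv_into_f_f[OF injp that])
  let ?G = "\<lambda>x l y. indicator {y. cmod (?b x (q l) + V (q l) (s (q l)) * y) \<le> \<rho> (q l)} y *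
     indicator (cball (c l) r) y :: ennreal"
  have measG: "?G x l \<in> borel_measurable lborel" for x l
  proof -
    have "{y. cmod (?b x (q l) + V (q l) (s (q l)) * y) \<le> \<rho> (q l)} \<in> sets borel"
      by (intro borel_closed closed_Collect_le continuous_intros)
    then show ?thesis
      by (intro borel_measurable_times_ennreal borel_measurable_indicator)
         (auto simp del: Collect_const)
  qed
  \<comment> \<open>With the coordinates outside \<open>E\<close> fixed in \<open>x\<close>, the
    integrand is a product over \<open>E\<close> of functions of one variable each, so the inner
    integral factors.\<close>
  have step: "?F (merge (D - E) E (x, y)) =
     (\<Prod>l\<in>D - E. of_bool (dist (c l) (x l) \<le> r)) * (\<Prod>l\<in>E. ?G x l (y l))" for x y
  proof -
    let ?z = "merge (D - E) E (x, y)"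
    have zE: "?z l = y l" if "l \<in> E" for l using that by (simp add: merge_def)
    have zD: "?z l = x l" if "l \<in> D - E" for l using that by (simp add: merge_def)
    have sum: "b j + (\<Sum>i\<in>UNIV. V j i * ?z (e j i)) = ?b x j + V j (s j) * y (e j (s j))" if j: "j \<in> J" for j
    proof -
      have "(\<Sum>i\<in>UNIV. V j i * ?z (e j i)) = V j (s j) * ?z (e j (s j)) + (\<Sum>i\<in>UNIV - {s j}. V j i * ?z (e j i))"
        by (subst sum.remove[of _ "s j"]) auto
      moreover have "?z (e j (s j)) = y (e j (s j))"
        using j by (intro zE) (auto simp: E_def)
      moreover have "(\<Sum>i\<in>UNIV - {s j}. V j i * ?z (e j i)) = (\<Sum>i\<in>UNIV - {s j}. V j i * x (e j i))"
      proof (intro sum.cong refl)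
        fix i assume i: "i \<in> UNIV - {s j}"
        have "e j i \<in> D - E" using i j e_eq by (auto simp: D E_def)
        then show "V j i * ?z (e j i) = V j i * x (e j i)" by (simp only: zD)
      qed
      ultimately show ?thesis by simp
    qed
    have "(\<Prod>j\<in>J. of_bool (cmod (b j + (\<Sum>i\<in>UNIV. V j i * ?z (e j i))) \<le> \<rho> j)) =
      (\<Prod>j\<in>J. of_bool (cmod (?b x j + V j (s j) * y (e j (s j))) \<le> \<rho> j) :: ennreal)"
      by (intro prod.cong refl) (simp only: sum)
    also have "\<dots> = (\<Prod>l\<in>E. of_bool (cmod (?b x (q l) + V (q l) (s (q l)) * y l) \<le> \<rho> (q l)))"
      unfolding E_def by (subst prod.reindex[OF injp]) (auto intro!: prod.cong simp: q)
    finally have 1: "(\<Prod>j\<in>J. of_bool (cmod (b j + (\<Sum>i\<in>UNIV. V j i * ?z (e j i))) \<le> \<rho> j)) =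
      (\<Prod>l\<in>E. of_bool (cmod (?b x (q l) + V (q l) (s (q l)) * y l) \<le> \<rho> (q l)) :: ennreal)" .
    have "(\<Prod>l\<in>D. of_bool (dist (c l) (?z l) \<le> r)) =
      (\<Prod>l\<in>D - E. of_bool (dist (c l) (?z l) \<le> r)) * (\<Prod>l\<in>E. of_bool (dist (c l) (?z l) \<le> r) :: ennreal)"
      using finD E by (subst prod.subset_diff[of E]) auto
    also have "\<dots> = (\<Prod>l\<in>D - E. of_bool (dist (c l) (x l) \<le> r)) * (\<Prod>l\<in>E. of_bool (dist (c l) (y l) \<le> r))"
      by (intro arg_cong2[where f="(*)"] prod.cong refl) (simp_all only: zE zD)
    finally have 2: "(\<Prod>l\<in>D. of_bool (dist (c l) (?z l) \<le> r)) =
      (\<Prod>l\<in>D - E. of_bool (dist (c l) (x l) \<le> r)) * (\<Prod>l\<in>E. of_bool (dist (c l) (y l) \<le> r) :: ennreal)" .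
    have 3: "(\<Prod>l\<in>E. ?G x l (y l)) = (\<Prod>l\<in>E. of_bool (cmod (?b x (q l) + V (q l) (s (q l)) * y l) \<le> \<rho> (q l))) *
      (\<Prod>l\<in>E. of_bool (dist (c l) (y l) \<le> r))"
      unfolding prod.distrib[symmetric] by (intro prod.cong refl) (simp add: indicator_def)
    show ?thesis unfolding 1 2 3
      by (simp only: mult.assoc mult.left_commute mult.commute)
  qed
  have G: "(\<integral>\<^sup>+y. (\<Prod>l\<in>E. ?G x l (y l)) \<partial>Pi\<^sub>M E (\<lambda>_. lborel)) \<le> (\<Prod>j\<in>J. ennreal (pi * r\<^sup>2 * \<kappa> j))" for x
  proof -
    have "(\<integral>\<^sup>+y. (\<Prod>l\<in>E. ?G x l (y l)) \<partial>Pi\<^sub>M E (\<lambda>_. lborel)) = (\<Prod>l\<in>E. \<integral>\<^sup>+y. ?G x l y \<partial>lborel)"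
      by (rule complex_PiM.product_nn_integral_prod[OF E(1) measG])
    also have "\<dots> = (\<Prod>j\<in>J. \<integral>\<^sup>+y. ?G x (e j (s j)) y \<partial>lborel)"
      unfolding E_def by (subst prod.reindex[OF injp]) auto
    also have "\<dots> \<le> (\<Prod>j\<in>J. ennreal (pi * r\<^sup>2 * \<kappa> j))"
    proof (intro prod_mono_ennreal)
      fix j assume j: "j \<in> J"
      show "(\<integral>\<^sup>+y. ?G x (e j (s j)) y \<partial>lborel) \<le> ennreal (pi * r\<^sup>2 * \<kappa> j)"
        unfolding q[OF j] by (rule small_ball_coordinate[OF r k(1,2)[OF j] *[OF j]])
    qed
    finally show ?thesis .
  qed
  have "(\<integral>\<^sup>+x. ?F x \<partial>Pi\<^sub>M D (\<lambda>_. lborel)) = (\<integral>\<^sup>+x. ?F x \<partial>Pi\<^sub>M ((D - E) \<union> E) (\<lambda>_. lborel))"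
    using DE by simp
  also have "\<dots> = (\<integral>\<^sup>+x. (\<integral>\<^sup>+y. ?F (merge (D - E) E (x, y)) \<partial>Pi\<^sub>M E (\<lambda>_. lborel)) \<partial>Pi\<^sub>M (D - E) (\<lambda>_. lborel))"
    by (rule complex_PiM.product_nn_integral_fold[OF _ _ _ meas']) (use finD E in auto)
  also have "\<dots> = (\<integral>\<^sup>+x. (\<Prod>l\<in>D - E. of_bool (dist (c l) (x l) \<le> r)) * 
     (\<integral>\<^sup>+y. (\<Prod>l\<in>E. ?G x l (y l)) \<partial>Pi\<^sub>M E (\<lambda>_. lborel)) \<partial>Pi\<^sub>M (D - E) (\<lambda>_. lborel))"
    unfolding step
  proof (intro nn_integral_cong nn_integral_cmult borel_measurable_prod_ennreal)
    fix x l assume "l \<in> E"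
    then have [measurable]: "(\<lambda>x. x l) \<in> borel_measurable (Pi\<^sub>M E (\<lambda>_. lborel))"
      by (intro measurable_component_singleton[where M="\<lambda>_. lborel", simplified])
    show "(\<lambda>y. ?G x l (y l)) \<in> borel_measurable (Pi\<^sub>M E (\<lambda>_. lborel))"
      by (rule measurable_compose[OF _ measG]) simp
  qed
  also have "\<dots> \<le> (\<integral>\<^sup>+x. (\<Prod>j\<in>J. ennreal (pi * r\<^sup>2 * \<kappa> j)) * (\<Prod>l\<in>D - E. indicator (cball (c l) r) (x l))
       \<partial>Pi\<^sub>M (D - E) (\<lambda>_. lborel))"
  proof (intro nn_integral_mono)
    fix x
    have eq: "(\<Prod>l\<in>D - E. of_bool (dist (c l) (x l) \<le> r)) = (\<Prod>l\<in>D - E. indicator (cball (c l) r) (x l) :: ennreal)"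
      by (simp add: indicator_def)
    show "(\<Prod>l\<in>D - E. of_bool (dist (c l) (x l) \<le> r)) * (\<integral>\<^sup>+y. (\<Prod>l\<in>E. ?G x l (y l)) \<partial>Pi\<^sub>M E (\<lambda>_. lborel))
      \<le> (\<Prod>j\<in>J. ennreal (pi * r\<^sup>2 * \<kappa> j)) * (\<Prod>l\<in>D - E. indicator (cball (c l) r) (x l))"
      unfolding eq by (subst mult.commute) (intro mult_right_mono G, simp)
  qed
  also have "\<dots> = (\<Prod>j\<in>J. ennreal (pi * r\<^sup>2 * \<kappa> j)) * 
      (\<integral>\<^sup>+x. (\<Prod>l\<in>D - E. indicator (cball (c l) r) (x l)) \<partial>Pi\<^sub>M (D - E) (\<lambda>_. lborel))"
  proof (intro nn_integral_cmult borel_measurable_prod_ennreal)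
    fix l assume "l \<in> D - E"
    then have [measurable]: "(\<lambda>x. x l) \<in> borel_measurable (Pi\<^sub>M (D - E) (\<lambda>_. lborel))"
      by (intro measurable_component_singleton[where M="\<lambda>_. lborel", simplified])
    show "(\<lambda>x. indicator (cball (c l) r) (x l)) \<in> borel_measurable (Pi\<^sub>M (D - E) (\<lambda>_. lborel))"
      by (rule measurable_compose[where N=borel]) (auto intro!: borel_measurable_indicator borel_closed)
  qed
  also have "(\<integral>\<^sup>+x. (\<Prod>l\<in>D - E. indicator (cball (c l) r) (x l)) \<partial>Pi\<^sub>M (D - E) (\<lambda>_. lborel))
     = (\<Prod>l\<in>D - E. \<integral>\<^sup>+y. indicator (cball (c l) r) y \<partial>lborel)"
    using finD by (intro complex_PiM.product_nn_integral_prod) (auto intro!: borel_measurable_indicator borel_closed)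
  also have "\<dots> = ennreal ((pi * r\<^sup>2) ^ card (D - E))"
    using r by (simp add: emeasure_cball_complex ennreal_power)
  also have "card (D - E) = card J * (CARD('k) - 1)"
    using E finD by (simp add: card_Diff_subset cardD cardE right_diff_distrib')
  also have "(\<Prod>j\<in>J. ennreal (pi * r\<^sup>2 * \<kappa> j)) * ennreal ((pi * r\<^sup>2) ^ (card J * (CARD('k) - 1))) =
     (\<Prod>j\<in>J. ennreal ((pi * r\<^sup>2) ^ CARD('k) * \<kappa> j))"
  proof -
    have "(\<Prod>j\<in>J. ennreal (pi * r\<^sup>2 * \<kappa> j)) * ennreal ((pi * r\<^sup>2) ^ (card J * (CARD('k) - 1))) =
      ennreal ((\<Prod>j\<in>J. (pi * r\<^sup>2 * \<kappa> j)) * (\<Prod>j\<in>J. ((pi * r\<^sup>2) ^ (CARD('k) - 1))))"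
    proof -
      have "(\<Prod>j\<in>J. ennreal (pi * r\<^sup>2 * \<kappa> j)) = ennreal (\<Prod>j\<in>J. pi * r\<^sup>2 * \<kappa> j)"
        using k r by (intro prod_ennreal) simp
      moreover have "(pi * r\<^sup>2) ^ (card J * (CARD('k) - 1)) = (\<Prod>j\<in>J. (pi * r\<^sup>2) ^ (CARD('k) - 1))"
        by (simp add: power_mult[symmetric] mult.commute)
      moreover have "0 \<le> (\<Prod>j\<in>J. pi * r\<^sup>2 * \<kappa> j)"
        using k r by (intro prod_nonneg) simp
      ultimately show ?thesis
        using r by (simp only: ennreal_mult prod_nonneg zero_le_power pi_ge_zero zero_le_power2 mult_nonneg_nonneg)
    qed
    also have "(\<Prod>j\<in>J. (pi * r\<^sup>2 * \<kappa> j)) * (\<Prod>j\<in>J. ((pi * r\<^sup>2) ^ (CARD('k) - 1))) =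
      (\<Prod>j\<in>J. (pi * r\<^sup>2) ^ CARD('k) * \<kappa> j)"
      unfolding prod.distrib[symmetric]
      by (intro prod.cong refl) (simp add: power_eq_if)
    also have "ennreal \<dots> = (\<Prod>j\<in>J. ennreal ((pi * r\<^sup>2) ^ CARD('k) * \<kappa> j))"
      using k r by (intro prod_ennreal[symmetric]) simp
    finally show ?thesis .
  qed
  finally show ?thesis .
qed

text \<open>A conditional density bounded by a constant may be replaced by that constant times Lebesgue
  measure; where the density of the conditioning entries vanishes, so does the joint density.\<close>

lemma (in prob_space) bounded_densities_nn_integral:
  fixes X :: "'i \<Rightarrow> 'a \<Rightarrow> complex"
  assumes "bounded_densities M X"
  obtains fmax where "fmax > 0"
    "\<And>B1 B2 F b. finite B1 \<Longrightarrow> finite B2 \<Longrightarrow> B1 \<inter> B2 = {} \<Longrightarrow>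
      F \<in> borel_measurable (\<Pi>\<^sub>M i\<in>B1 \<union> B2. lborel) \<Longrightarrow>
      (\<And>y. y \<in> space (\<Pi>\<^sub>M i\<in>B2. (lborel :: complex measure)) \<Longrightarrow>
        (\<integral>\<^sup>+x. F (merge B2 B1 (y, x)) \<partial>(\<Pi>\<^sub>M i\<in>B1. lborel)) \<le> b) \<Longrightarrow>
      (\<integral>\<^sup>+\<omega>. F (\<lambda>i\<in>B1 \<union> B2. X i \<omega>) \<partial>M) \<le> ennreal (fmax ^ card B1) * b"
proof -
  obtain fmax f where fmax: "fmax > 0" and A1: "\<forall>B. finite B \<longrightarrow> (\<forall>x. 0 \<le> f B x) \<and>
        distributed M (\<Pi>\<^sub>M i\<in>B. lborel) (\<lambda>\<omega>. \<lambda>i\<in>B. X i \<omega>) (\<lambda>x. ennreal (f B x))"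
    and A2: "\<forall>B1 B2. finite B1 \<longrightarrow> finite B2 \<longrightarrow> B1 \<inter> B2 = {} \<longrightarrow>
        (AE x in \<Pi>\<^sub>M i\<in>B1 \<union> B2. lborel.
          f B2 (restrict x B2) > 0 \<longrightarrow> cond_density f B1 B2 x \<le> fmax ^ card B1)"
    using assms unfolding bounded_densities_def by (elim exE conjE) (rule that)
  have f0: "\<And>B x. finite B \<Longrightarrow> 0 \<le> f B x"
    and dist: "\<And>B. finite B \<Longrightarrow> distributed M (\<Pi>\<^sub>M i\<in>B. lborel) (\<lambda>\<omega>. \<lambda>i\<in>B. X i \<omega>) (\<lambda>x. ennreal (f B x))"
    using A1 by simp_all
  note cond = A2[rule_format]
  show thesis
  proof (rule that[OF fmax])
    fix B1 B2 :: "'i set" and F :: "('i \<Rightarrow> complex) \<Rightarrow> ennreal" and b :: ennreal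
    assume B: "finite B1" "finite B2" "B1 \<inter> B2 = {}"
      and F[measurable]: "F \<in> borel_measurable (\<Pi>\<^sub>M i\<in>B1 \<union> B2. (lborel :: complex measure))"
      and b: "\<And>y. y \<in> space (\<Pi>\<^sub>M i\<in>B2. (lborel :: complex measure)) \<Longrightarrow>
        (\<integral>\<^sup>+x. F (merge B2 B1 (y, x)) \<partial>(\<Pi>\<^sub>M i\<in>B1. lborel)) \<le> b"
    let ?B = "B1 \<union> B2"
    let ?P = "\<lambda>B. \<Pi>\<^sub>M i\<in>B. (lborel :: complex measure)"
    have dB: "distributed M (?P ?B) (\<lambda>\<omega>. \<lambda>i\<in>?B. X i \<omega>) (\<lambda>x. ennreal (f ?B x))"
      and d2: "distributed M (?P B2) (\<lambda>\<omega>. \<lambda>i\<in>B2. X i \<omega>) (\<lambda>x. ennreal (f B2 x))"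
      using B by (auto intro!: dist)
    have [measurable]: "(\<lambda>x. ennreal (f B2 x)) \<in> borel_measurable (?P B2)"
      using d2 by (simp add: distributed_def)
    have restr[measurable]: "(\<lambda>x. restrict x B2) \<in> ?P ?B \<rightarrow>\<^sub>M ?P B2"
      by (rule measurable_restrict_subset) auto
    have "AE x in ?P ?B. ennreal (f B2 (restrict x B2)) = 0 \<longrightarrow> ennreal (f ?B x) = 0"
      by (rule subdensity[OF restr dB d2]) (auto simp: comp_def fun_eq_iff)
    \<comment> \<open>The bound on the quotient becomes an inequality without division, valid also
      where \<open>f B2\<close> vanishes.\<close>
    with cond[OF B] have ae: "AE x in ?P ?B. ennreal (f ?B x) \<le> ennreal (fmax ^ card B1) * ennreal (f B2 (restrict x B2))"
    proof eventually_elim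
      case (elim x)
      show ?case
      proof (cases "f B2 (restrict x B2) > 0")
        case True
        with elim have "f ?B x \<le> fmax ^ card B1 * f B2 (restrict x B2)"
          by (simp add: cond_density_def divide_le_eq)
        then show ?thesis using fmax f0 B by (simp add: ennreal_mult[symmetric])
      next
        case False
        then have "f B2 (restrict x B2) = 0" using f0[OF B(2)] by (simp add: antisym)
        then show ?thesis using elim by simp
      qed
    qed
    have "(\<integral>\<^sup>+\<omega>. F (\<lambda>i\<in>?B. X i \<omega>) \<partial>M) = (\<integral>\<^sup>+x. ennreal (f ?B x) * F x \<partial>?P ?B)"
      by (rule distributed_nn_integral[OF dB F, symmetric])
    also have "\<dots> \<le> (\<integral>\<^sup>+x. ennreal (fmax ^ card B1) * (ennreal (f B2 (restrict x B2)) * F x) \<partial>?P ?B)"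
    proof (rule nn_integral_mono_AE, use ae in eventually_elim)
      fix x assume "ennreal (f ?B x) \<le> ennreal (fmax ^ card B1) * ennreal (f B2 (restrict x B2))"
      then show "ennreal (f ?B x) * F x \<le> ennreal (fmax ^ card B1) * (ennreal (f B2 (restrict x B2)) * F x)"
        unfolding mult.assoc[symmetric] by (rule mult_right_mono) simp
    qed
    also have "\<dots> = ennreal (fmax ^ card B1) * (\<integral>\<^sup>+x. ennreal (f B2 (restrict x B2)) * F x \<partial>?P ?B)"
      by (rule nn_integral_cmult) measurable
    also have "(\<integral>\<^sup>+x. ennreal (f B2 (restrict x B2)) * F x \<partial>?P ?B) =
      (\<integral>\<^sup>+x. ennreal (f B2 (restrict x B2)) * F x \<partial>?P (B2 \<union> B1))"
      by (simp add: Un_commute)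
    also have "\<dots> = (\<integral>\<^sup>+y. (\<integral>\<^sup>+x. ennreal (f B2 (restrict (merge B2 B1 (y, x)) B2)) * F (merge B2 B1 (y, x)) \<partial>?P B1) \<partial>?P B2)"
    proof (rule complex_PiM.product_nn_integral_fold)
      show "(\<lambda>x. ennreal (f B2 (restrict x B2)) * F x) \<in> borel_measurable (?P (B2 \<union> B1))"
        unfolding Un_commute[of B2 B1] by measurable
    qed (use B in auto)
    also have "\<dots> = (\<integral>\<^sup>+y. ennreal (f B2 y) * (\<integral>\<^sup>+x. F (merge B2 B1 (y, x)) \<partial>?P B1) \<partial>?P B2)"
    proof (rule nn_integral_cong)
      fix y assume y: "y \<in> space (?P B2)"
      have "restrict (merge B2 B1 (y, x)) B2 = y" for x
        using y by (auto simp: fun_eq_iff merge_def space_PiM PiE_iff extensional_def)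
      moreover have "(\<lambda>x. F (merge B2 B1 (y, x))) \<in> borel_measurable (?P B1)"
      proof -
        have "(\<lambda>x. merge B2 B1 (y, x)) \<in> ?P B1 \<rightarrow>\<^sub>M ?P (B2 \<union> B1)"
          using y by (intro measurable_compose[OF measurable_Pair1' measurable_merge])
        then show ?thesis unfolding Un_commute[of B2 B1] by (rule measurable_compose[OF _ F])
      qed
      ultimately show "(\<integral>\<^sup>+x. ennreal (f B2 (restrict (merge B2 B1 (y, x)) B2)) * F (merge B2 B1 (y, x)) \<partial>?P B1) =
        ennreal (f B2 y) * (\<integral>\<^sup>+x. F (merge B2 B1 (y, x)) \<partial>?P B1)"
        by (simp add: nn_integral_cmult)
    qed
    also have "\<dots> \<le> (\<integral>\<^sup>+y. ennreal (f B2 y) * b \<partial>?P B2)"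
      using b by (intro nn_integral_mono mult_left_mono) auto
    also have "\<dots> = b"
      using distributed_nn_integral[OF d2, of "\<lambda>_. b"] emeasure_space_1 by simp
    finally show "(\<integral>\<^sup>+\<omega>. F (\<lambda>i\<in>?B. X i \<omega>) \<partial>M) \<le> ennreal (fmax ^ card B1) * b"
      by (meson mult_left_mono zero_le order_trans)
  qed
qed

section \<open>Gaussian noise and channel estimates as random variables\<close>

text \<open>The density is the product of normal densities of the real and the imaginary part. The
  value \<open>sqrt (1/2)\<close> of \<open>s\<close> gives \<open>cgauss\<close>, the value 1 gives
  \<open>cgauss_wide\<close> up to its constant.\<close>

lemma nn_integral_complex_gauss:
  assumes s: "s > 0"
  shows "(\<integral>\<^sup>+z. ennreal (exp (- (cmod z)\<^sup>2 / (2 * s\<^sup>2)) / (2 * pi * s\<^sup>2)) \<partial>lborel) = 1"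
proof -
  have eq: "ennreal (exp (- (cmod z)\<^sup>2 / (2 * s\<^sup>2)) / (2 * pi * s\<^sup>2)) =
    (\<Prod>b\<in>Basis. ennreal (normal_density 0 s (z \<bullet> b)))" for z :: complex
  proof -
    have "(\<Prod>b\<in>Basis. normal_density 0 s (z \<bullet> b)) = normal_density 0 s (Re z) * normal_density 0 s (Im z)"
      by (simp add: Basis_complex_def inner_complex_def)
    also have "\<dots> = (exp (- (Re z)\<^sup>2 / (2 * s\<^sup>2)) * exp (- (Im z)\<^sup>2 / (2 * s\<^sup>2))) / (sqrt (2 * pi * s\<^sup>2))\<^sup>2"
      by (simp add: normal_density_def power2_eq_square)
    also have "\<dots> = exp (- (cmod z)\<^sup>2 / (2 * s\<^sup>2)) / (2 * pi * s\<^sup>2)"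
    proof -
      have "- (cmod z)\<^sup>2 / (2 * s\<^sup>2) = - (Re z)\<^sup>2 / (2 * s\<^sup>2) + - (Im z)\<^sup>2 / (2 * s\<^sup>2)"
        by (simp only: cmod_power2 add_divide_distrib[symmetric]) simp
      then have "exp (- (cmod z)\<^sup>2 / (2 * s\<^sup>2)) = exp (- (Re z)\<^sup>2 / (2 * s\<^sup>2)) * exp (- (Im z)\<^sup>2 / (2 * s\<^sup>2))"
        by (simp only: exp_add)
      then show ?thesis by simp
    qed
    finally show ?thesis by (simp add: prod_ennreal)
  qed
  have "(\<integral>\<^sup>+z. (\<Prod>b\<in>Basis. ennreal (normal_density 0 s (z \<bullet> b))) \<partial>(lborel :: complex measure)) =
     (\<Prod>b\<in>(Basis :: complex set). (\<integral>\<^sup>+x. ennreal (normal_density 0 s x) \<partial>lborel))"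
    by (intro nn_integral_lborel_prod) auto
  also have "\<dots> = 1"
    using s by (subst nn_integral_eq_integral) auto
  finally show ?thesis unfolding eq .
qed

lemma space_cgauss[simp]: "space cgauss = UNIV"
  and sets_cgauss[simp, measurable_cong]: "sets cgauss = sets borel"
  by (simp_all add: cgauss_def)

lemma prob_space_cgauss: "prob_space cgauss"
proof
  have "emeasure cgauss (space cgauss) = (\<integral>\<^sup>+z. ennreal (exp (- (cmod z)\<^sup>2) / pi) \<partial>lborel)"
    by (simp add: cgauss_def emeasure_density)
  also have "\<dots> = 1"
    using nn_integral_complex_gauss[of "sqrt (1/2)"] by simp
  finally show "emeasure cgauss (space cgauss) = 1" .
qed

text \<open>A Gaussian of twice the variance, scaled up so that its density dominates that of every
  standard Gaussian whose centre is the rounding error of a complex number.\<close>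

definition cgauss_wide :: "complex measure" where
  "cgauss_wide = density lborel (\<lambda>z. ennreal (exp 2 * (exp (- (cmod z)\<^sup>2 / 2) / pi)))"

lemma space_cgauss_wide[simp]: "space cgauss_wide = UNIV"
  and sets_cgauss_wide[simp, measurable_cong]: "sets cgauss_wide = sets borel"
  by (simp_all add: cgauss_wide_def)

lemma emeasure_cgauss_wide: "emeasure cgauss_wide UNIV = ennreal (2 * exp 2)"
proof -
  have "emeasure cgauss_wide UNIV = (\<integral>\<^sup>+z. ennreal (exp 2 * (exp (- (cmod z)\<^sup>2 / 2) / pi)) \<partial>lborel)"
    by (simp add: cgauss_wide_def emeasure_density)
  also have "\<dots> = (\<integral>\<^sup>+z. ennreal (2 * exp 2) * ennreal (exp (- (cmod z)\<^sup>2 / (2 * 1\<^sup>2)) / (2 * pi * 1\<^sup>2)) \<partial>lborel)"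
    by (intro nn_integral_cong) (simp add: ennreal_mult[symmetric])
  also have "\<dots> = ennreal (2 * exp 2)"
    using nn_integral_complex_gauss[of 1] by (subst nn_integral_cmult) simp_all
  finally show ?thesis .
qed

lemma finite_measure_cgauss_wide: "finite_measure cgauss_wide"
  by standard (simp add: emeasure_cgauss_wide)

lemma nn_integral_lborel_shift:
  fixes r :: complex and F :: "complex \<Rightarrow> ennreal"
  assumes [measurable]: "F \<in> borel_measurable borel"
  shows "(\<integral>\<^sup>+z. F (r + z) \<partial>lborel) = (\<integral>\<^sup>+z. F z \<partial>lborel)"
proof -
  have "(\<integral>\<^sup>+z. F z \<partial>lborel) = (\<integral>\<^sup>+z. F z \<partial>(distr lborel borel ((+) r)))"
    by (simp add: lborel_distr_plus)
  also have "\<dots> = (\<integral>\<^sup>+z. F (r + z) \<partial>lborel)"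
    by (subst nn_integral_distr) auto
  finally show ?thesis ..
qed

text \<open>The square \<open>(cmod z)\<^sup>2\<close> is at most
  \<open>2 * (cmod (z - r))\<^sup>2 + 2 * (cmod r)\<^sup>2\<close>, and a rounding error has squared
  modulus at most 2. Halving yields the exponent \<open>2 - (cmod z)\<^sup>2 / 2\<close>, the source
  of both the doubled variance and the factor \<open>exp 2\<close> in
  \<open>cgauss_wide\<close>.\<close>

lemma cgauss_shift:
  fixes r :: complex and F :: "complex \<Rightarrow> ennreal"
  assumes [measurable]: "F \<in> borel_measurable borel" and r: "cmod r \<le> sqrt 2"
  shows "(\<integral>\<^sup>+z. F (r + z) \<partial>cgauss) \<le> (\<integral>\<^sup>+z. F z \<partial>cgauss_wide)"
proof -
  have "(\<integral>\<^sup>+z. F (r + z) \<partial>cgauss) = (\<integral>\<^sup>+z. ennreal (exp (- (cmod z)\<^sup>2) / pi) * F (r + z) \<partial>lborel)"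
    unfolding cgauss_def by (subst nn_integral_density) auto
  also have "\<dots> = (\<integral>\<^sup>+z. ennreal (exp (- (cmod ((r + z) - r))\<^sup>2) / pi) * F (r + z) \<partial>lborel)"
    by simp
  also have "\<dots> = (\<integral>\<^sup>+z. ennreal (exp (- (cmod (z - r))\<^sup>2) / pi) * F z \<partial>lborel)"
    by (rule nn_integral_lborel_shift) measurable
  also have "\<dots> \<le> (\<integral>\<^sup>+z. ennreal (exp 2 * (exp (- (cmod z)\<^sup>2 / 2) / pi)) * F z \<partial>lborel)"
  proof (intro nn_integral_mono mult_right_mono ennreal_leI)
    fix z :: complex
    have "(cmod z)\<^sup>2 \<le> (cmod (z - r) + cmod r)\<^sup>2"
      using norm_triangle_ineq[of "z - r" r] by (intro power_mono) auto
    also have "\<dots> \<le> 2 * (cmod (z - r))\<^sup>2 + 2 * (cmod r)\<^sup>2"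
      using zero_le_power2[of "cmod (z - r) - cmod r"] by (simp add: power2_eq_square algebra_simps)
    also have "(cmod r)\<^sup>2 \<le> 2"
      using power_mono[OF r, of 2] by simp
    finally have "- (cmod (z - r))\<^sup>2 \<le> 2 + - (cmod z)\<^sup>2 / 2" by simp
    then have "exp (- (cmod (z - r))\<^sup>2) \<le> exp (2 + - (cmod z)\<^sup>2 / 2)" by simp
    then show "exp (- (cmod (z - r))\<^sup>2) / pi \<le> exp 2 * (exp (- (cmod z)\<^sup>2 / 2) / pi)"
      by (subst (asm) exp_add) (simp add: divide_right_mono)
  qed simp
  also have "\<dots> = (\<integral>\<^sup>+z. F z \<partial>cgauss_wide)"
    unfolding cgauss_wide_def by (subst nn_integral_density) auto
  finally show ?thesis .
qed

interpretation cgauss: product_prob_space "\<lambda>_. cgauss" UNIV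
  by (simp add: product_prob_space_def product_sigma_finite_def product_prob_space_axioms_def
      prob_space_cgauss prob_space_imp_sigma_finite)

interpretation cgauss_wide: product_sigma_finite "\<lambda>_. cgauss_wide"
  by (simp add: product_sigma_finite_def finite_measure.axioms(1) finite_measure_cgauss_wide)

text \<open>\<open>cgauss_shift\<close> applied to one coordinate at a time. The shifts may differ
  and may be zero, so the noise of one user can be moved while that of the others stays.\<close>

lemma PiM_cgauss_shift:
  fixes F :: "('i \<Rightarrow> complex) \<Rightarrow> ennreal"
  assumes "finite I" "F \<in> borel_measurable (\<Pi>\<^sub>M i\<in>I. borel)"
    and "\<And>i. i \<in> I \<Longrightarrow> cmod (r i) \<le> sqrt 2"
  shows "(\<integral>\<^sup>+z. F (\<lambda>i\<in>I. r i + z i) \<partial>(\<Pi>\<^sub>M i\<in>I. cgauss)) \<le> (\<integral>\<^sup>+z. F z \<partial>(\<Pi>\<^sub>M i\<in>I. cgauss_wide))"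
  using assms
proof (induction I arbitrary: F)
  case empty
  have "(\<integral>\<^sup>+z. F (\<lambda>i\<in>{}. r i + z i) \<partial>(\<Pi>\<^sub>M i\<in>{}. cgauss)) = F (\<lambda>_. undefined)"
    by (simp add: PiM_empty nn_integral_count_space_finite restrict_def)
  moreover have "(\<integral>\<^sup>+z. F z \<partial>(\<Pi>\<^sub>M i\<in>{}. cgauss_wide)) = F (\<lambda>_. undefined)"
    by (simp add: PiM_empty nn_integral_count_space_finite)
  ultimately show ?case by (simp only: order_refl)
next
  case (insert j I)
  note F = \<open>F \<in> borel_measurable (\<Pi>\<^sub>M i\<in>insert j I. borel)\<close>
  have upd: "(\<lambda>(x, y). x(j := y)) \<in> (\<Pi>\<^sub>M i\<in>I. borel) \<Otimes>\<^sub>M borel \<rightarrow>\<^sub>M (\<Pi>\<^sub>M i\<in>insert j I. (borel :: complex measure))"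
    using measurable_add_dim[of j I "\<lambda>_. borel :: complex measure"] by simp
  have sgc: "sets (\<Pi>\<^sub>M i\<in>A. cgauss) = sets (\<Pi>\<^sub>M i\<in>A. borel)"
    and sgw: "sets (\<Pi>\<^sub>M i\<in>A. cgauss_wide) = sets (\<Pi>\<^sub>M i\<in>A. borel)" for A :: "'i set"
    by (auto intro!: sets_PiM_cong)
  have shift: "(\<lambda>z. \<lambda>i\<in>A. r i + z i) \<in> (\<Pi>\<^sub>M i\<in>A. borel) \<rightarrow>\<^sub>M (\<Pi>\<^sub>M i\<in>A. borel)" for A :: "'i set"
    by (intro measurable_restrict borel_measurable_add borel_measurable_const measurable_component_singleton)
  let ?G = "\<lambda>x. \<integral>\<^sup>+y. F (x(j := y)) \<partial>cgauss_wide"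
  have FG: "(\<lambda>(x, y). F (x(j := y))) \<in> borel_measurable ((\<Pi>\<^sub>M i\<in>I. borel) \<Otimes>\<^sub>M cgauss_wide)"
  proof -
    have "(\<lambda>p. F ((\<lambda>(x, y). x(j := y)) p)) \<in> borel_measurable ((\<Pi>\<^sub>M i\<in>I. borel) \<Otimes>\<^sub>M borel)"
      by (rule measurable_compose[OF upd F])
    also have "borel_measurable ((\<Pi>\<^sub>M i\<in>I. borel) \<Otimes>\<^sub>M borel) = borel_measurable ((\<Pi>\<^sub>M i\<in>I. borel) \<Otimes>\<^sub>M cgauss_wide)"
      by (intro measurable_cong_sets sets_pair_measure_cong) auto
    finally show ?thesis by (simp only: case_prod_beta')
  qed
  have G: "?G \<in> borel_measurable (\<Pi>\<^sub>M i\<in>I. borel)"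
    by (rule sigma_finite_measure.borel_measurable_nn_integral[OF
        finite_measure.axioms(1)[OF finite_measure_cgauss_wide] FG])
  have "(\<integral>\<^sup>+z. F (\<lambda>i\<in>insert j I. r i + z i) \<partial>(\<Pi>\<^sub>M i\<in>insert j I. cgauss)) =
    (\<integral>\<^sup>+x. (\<integral>\<^sup>+y. F (\<lambda>i\<in>insert j I. r i + (x(j := y)) i) \<partial>cgauss) \<partial>(\<Pi>\<^sub>M i\<in>I. cgauss))"
  proof (rule cgauss.product_nn_integral_insert)
    show "(\<lambda>z. F (\<lambda>i\<in>insert j I. r i + z i)) \<in> borel_measurable (\<Pi>\<^sub>M i\<in>insert j I. cgauss)"
      unfolding measurable_cong_sets[OF sgc refl] by (rule measurable_compose[OF shift F])
  qed (use insert in auto)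
  also have "\<dots> = (\<integral>\<^sup>+x. (\<integral>\<^sup>+y. F ((\<lambda>i\<in>I. r i + x i)(j := r j + y)) \<partial>cgauss) \<partial>(\<Pi>\<^sub>M i\<in>I. cgauss))"
    using insert.hyps by (intro nn_integral_cong arg_cong[where f=F]) (auto simp: fun_eq_iff)
  also have "\<dots> \<le> (\<integral>\<^sup>+x. ?G (\<lambda>i\<in>I. r i + x i) \<partial>(\<Pi>\<^sub>M i\<in>I. cgauss))"
  proof (rule nn_integral_mono)
    fix x
    have "(\<lambda>y. ((\<lambda>i\<in>I. r i + x i)(j := y))) \<in> borel \<rightarrow>\<^sub>M (\<Pi>\<^sub>M i\<in>insert j I. (borel :: complex measure))"
      by (rule measurable_component_update) (use insert.hyps in \<open>auto simp: space_PiM\<close>)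
    then have "(\<lambda>y. F ((\<lambda>i\<in>I. r i + x i)(j := y))) \<in> borel_measurable borel"
      by (rule measurable_compose[OF _ F])
    then show "(\<integral>\<^sup>+y. F ((\<lambda>i\<in>I. r i + x i)(j := r j + y)) \<partial>cgauss) \<le> ?G (\<lambda>i\<in>I. r i + x i)"
      using insert.prems by (intro cgauss_shift) auto
  qed
  also have "\<dots> \<le> (\<integral>\<^sup>+x. ?G x \<partial>(\<Pi>\<^sub>M i\<in>I. cgauss_wide))"
    by (rule insert.IH[OF G]) (use insert.prems in simp)
  also have "\<dots> = (\<integral>\<^sup>+z. F z \<partial>(\<Pi>\<^sub>M i\<in>insert j I. cgauss_wide))"
  proof (rule cgauss_wide.product_nn_integral_insert[symmetric])
    show "F \<in> borel_measurable (\<Pi>\<^sub>M i\<in>insert j I. cgauss_wide)"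
      unfolding measurable_cong_sets[OF sgw refl] by (rule F)
  qed (use insert in auto)
  finally show ?case .
qed

lemma emeasure_PiM_cgauss_wide:
  assumes "finite I"
  shows "emeasure (\<Pi>\<^sub>M i\<in>I. cgauss_wide) (space (\<Pi>\<^sub>M i\<in>I. cgauss_wide)) = ennreal ((2 * exp 2) ^ card I)"
proof -
  have "emeasure (\<Pi>\<^sub>M i\<in>I. cgauss_wide) (Pi\<^sub>E I (\<lambda>_. UNIV)) = (\<Prod>i\<in>I. emeasure cgauss_wide UNIV)"
    by (rule cgauss_wide.emeasure_PiM) (use assms in auto)
  then show ?thesis
    by (simp add: space_PiM emeasure_cgauss_wide ennreal_power)
qed

lemma borel_measurable_vec_iff:
  fixes f :: "'a \<Rightarrow> complex ^ 'k::finite"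
  shows "f \<in> borel_measurable M \<longleftrightarrow> (\<forall>i. (\<lambda>x. f x $ i) \<in> borel_measurable M)"
proof
  assume f: "f \<in> borel_measurable M"
  have nth: "(\<lambda>v :: complex ^ 'k. v $ i) \<in> borel_measurable borel" for i
    by (intro borel_measurable_continuous_onI linear_continuous_on bounded_linear_vec_nth)
  have "(\<lambda>x. f x $ i) \<in> borel_measurable M" for i
    by (rule measurable_compose[OF f nth])
  then show "\<forall>i. (\<lambda>x. f x $ i) \<in> borel_measurable M" ..
next
  assume *: "\<forall>i. (\<lambda>x. f x $ i) \<in> borel_measurable M"
  show "f \<in> borel_measurable M"
  proof (subst borel_measurable_euclidean_space, rule ballI)
    fix b :: "complex ^ 'k" assume "b \<in> Basis"
    then obtain i u where "b = axis i u" unfolding Basis_vec_def by blast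
    then have "f x \<bullet> b = f x $ i \<bullet> u" for x
      by (simp add: inner_axis)
    moreover have "(\<lambda>x. f x $ i \<bullet> u) \<in> borel_measurable M"
      by (intro borel_measurable_inner borel_measurable_const) (use * in blast)
    ultimately show "(\<lambda>x. f x \<bullet> b) \<in> borel_measurable M" by (simp only:)
  qed
qed

lemma borel_measurable_vec_nth[measurable (raw)]:
  fixes f :: "'a \<Rightarrow> complex ^ 'k::finite"
  shows "f \<in> borel_measurable M \<Longrightarrow> (\<lambda>x. f x $ i) \<in> borel_measurable M"
  by (simp add: borel_measurable_vec_iff)

lemma finite_block[simp]: "finite (block n :: ('k::finite \<times> 'm::finite \<times> nat) set)"
  by (simp add: block_def)

lemma card_block: "card (block n :: ('k::finite \<times> 'm::finite \<times> nat) set) = CARD('k) * CARD('m) * n"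
  by (simp add: block_def card_cartesian_product)

lemma mem_block[simp]: "(k, m, t) \<in> block n \<longleftrightarrow> t < n"
  by (simp add: block_def)

section \<open>Scalar entries and blocks of channel vectors\<close>

definition entry_block :: "nat \<Rightarrow> (csi_kind \<times> 'k \<times> 'm \<times> nat \<times> 'k) set" where
  "entry_block n = UNIV \<times> UNIV \<times> UNIV \<times> {..<n} \<times> UNIV"

text \<open>The density assumption speaks of scalar entries, the codes of blocks of vectors; through
  this map a function of the block is integrated entry by entry.\<close>

definition csi_from :: "nat \<Rightarrow> csi_kind \<Rightarrow> (csi_kind \<times> 'k::finite \<times> 'm \<times> nat \<times> 'k \<Rightarrow> complex) \<Rightarrow> ('k, 'm) csi_block" where
  "csi_from n c x = (\<lambda>(k, m, t)\<in>block n. \<chi> i. x (c, k, m, t, i))"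

lemma UNIV_csi_kind: "UNIV = {Estimate, Deviation}"
  using csi_kind.exhaust by auto

lemma finite_entry_block[simp]: "finite (entry_block n :: (csi_kind \<times> 'k::finite \<times> 'm::finite \<times> nat \<times> 'k) set)"
  by (simp add: entry_block_def UNIV_csi_kind)

lemma mem_entry_block[simp]: "(c, k, m, t, i) \<in> entry_block n \<longleftrightarrow> t < n"
  by (simp add: entry_block_def)

lemma csi_from_nth: "t < n \<Longrightarrow> csi_from n c x (k, m, t) $ i = x (c, k, m, t, i)"
  by (simp add: csi_from_def)

lemma csi_of_eq_csi_from:
  "csi_of n est \<omega> = csi_from n Estimate (\<lambda>l\<in>entry_block n. csi_entry est err l \<omega>)"
  "csi_of n err \<omega> = csi_from n Deviation (\<lambda>l\<in>entry_block n. csi_entry est err l \<omega>)"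
  by (auto simp: csi_of_def csi_from_def fun_eq_iff csi_entry_def vec_eq_iff block_def)

lemma csi_from_measurable[measurable]:
  "csi_from n c \<in> (\<Pi>\<^sub>M l\<in>entry_block n. lborel) \<rightarrow>\<^sub>M (\<Pi>\<^sub>M j\<in>block n. (borel :: (complex ^ 'k::finite) measure))"
proof -
  have "(\<lambda>x. (\<lambda>(k, m, t). \<chi> i. x (c, k, m, t, i)) j) \<in> (\<Pi>\<^sub>M l\<in>entry_block n. lborel) \<rightarrow>\<^sub>M (borel :: (complex ^ 'k::finite) measure)"
    if j: "j \<in> block n" for j :: "'k \<times> 'm \<times> nat"
  proof -
    obtain k m t where j': "j = (k, m, t)" by (cases j)
    have "(\<lambda>x. x (c, k, m, t, i)) \<in> borel_measurable (\<Pi>\<^sub>M l\<in>entry_block n. (lborel :: complex measure))" for i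
      using j j' by (intro measurable_component_singleton[where M="\<lambda>_. lborel", simplified]) simp
    then show ?thesis by (simp add: j' borel_measurable_vec_iff)
  qed
  then show ?thesis
    unfolding csi_from_def[abs_def] by (intro measurable_restrict) auto
qed

section \<open>Counting Gaussian integers\<close>

definition gauss_floor :: "complex \<Rightarrow> complex" where
  "gauss_floor z = Complex (of_int \<lfloor>Re z\<rfloor>) (of_int \<lfloor>Im z\<rfloor>)"

definition gauss_ints :: "complex set" where
  "gauss_ints = range (\<lambda>(a, b). Complex (of_int a) (of_int b))"

lemma gauss_floor_in: "gauss_floor z \<in> gauss_ints"
  by (auto simp: gauss_floor_def gauss_ints_def)

lemma gauss_ints_diff: "y \<in> gauss_ints \<Longrightarrow> z \<in> gauss_ints \<Longrightarrow> y - z \<in> gauss_ints"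
  by (auto simp: gauss_ints_def image_iff complex_eq_iff of_int_diff[symmetric] simp del: of_int_diff)

lemma cmod_le_sqrt2:
  assumes "\<bar>Re z\<bar> \<le> 1" "\<bar>Im z\<bar> \<le> 1"
  shows "cmod z \<le> sqrt 2"
  unfolding cmod_def
  using assms power_le_one[of "\<bar>Re z\<bar>" 2] power_le_one[of "\<bar>Im z\<bar>" 2] by (intro real_sqrt_le_mono) simp

lemma cmod_frac: "cmod (z - gauss_floor z) \<le> sqrt 2"
  by (rule cmod_le_sqrt2) (simp_all add: gauss_floor_def abs_le_iff, linarith+)

lemma gauss_floor_eq_imp_dist: "gauss_floor y = gauss_floor z \<Longrightarrow> cmod (y - z) \<le> sqrt 2"
proof (rule cmod_le_sqrt2)
  assume eq: "gauss_floor y = gauss_floor z"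
  then have "\<lfloor>Re y\<rfloor> = \<lfloor>Re z\<rfloor>" "\<lfloor>Im y\<rfloor> = \<lfloor>Im z\<rfloor>"
    by (auto simp: gauss_floor_def complex_eq_iff)
  then show "\<bar>Re (y - z)\<bar> \<le> 1" "\<bar>Im (y - z)\<bar> \<le> 1"
    by (simp_all add: abs_le_iff) linarith+
qed

lemma cmod_gauss_floor_diff: "cmod (gauss_floor y - gauss_floor z) \<le> cmod (y - z) + sqrt 2"
proof -
  let ?r = "(gauss_floor y - gauss_floor z) - (y - z)"
  have "cmod ?r \<le> sqrt 2"
    by (rule cmod_le_sqrt2) (simp_all add: gauss_floor_def abs_le_iff, linarith+)
  moreover have "cmod (gauss_floor y - gauss_floor z) \<le> cmod (y - z) + cmod ?r"
    by (metis diff_add_cancel norm_triangle_ineq add.commute)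
  ultimately show ?thesis by simp
qed

lemma cmod_gauss_floor: "cmod (gauss_floor y) \<le> cmod y + sqrt 2"
  using cmod_gauss_floor_diff[of y 0] by (simp add: gauss_floor_def zero_complex.code[symmetric])

text \<open>Up to the factor 4 the weight base dominates a product of one function of the real part
  and one of the imaginary part, so the lattice sum is at most a multiple of the square of a
  convergent one-dimensional series. With exponent exactly 1 the sums would grow like a logarithm;
  hence the slack \<open>\<epsilon>\<close>.\<close>

lemma sum_gauss_ints_bound:
  fixes \<epsilon> :: real
  assumes e: "\<epsilon> > 0"
  obtains Z where "Z \<ge> 1" "\<And>B. finite B \<Longrightarrow> B \<subseteq> gauss_ints \<Longrightarrow> (\<Sum>z\<in>B. max 1 ((cmod z)\<^sup>2) powr (- (1 + \<epsilon>))) \<le> Z"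
proof -
  let ?s = "- (1 + \<epsilon>)"
  define f where "f n = real (Suc n) powr ?s" for n
  have summ: "summable f"
  proof -
    have "summable (\<lambda>n. real n powr ?s)" using e by (simp add: summable_real_powr_iff)
    then show ?thesis unfolding f_def by (subst summable_Suc_iff)
  qed
  define T where "T = 2 * suminf f"
  have f0: "f n \<ge> 0" for n by (simp add: f_def)
  define h where "h a = (1 + real_of_int \<bar>a\<bar>) powr ?s" for a :: int
  have T: "(\<Sum>a\<in>{- int N..int N}. h a) \<le> T" for N
  proof -
    have "(\<Sum>a\<in>{- int N..int N}. h a) \<le> (\<Sum>a\<in>int ` {..N} \<union> (\<lambda>n. - int n) ` {..N}. h a)"
    proof (intro sum_mono2)
      show "{- int N..int N} \<subseteq> int ` {..N} \<union> (\<lambda>n. - int n) ` {..N}"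
      proof
        fix a assume a: "a \<in> {- int N..int N}"
        show "a \<in> int ` {..N} \<union> (\<lambda>n. - int n) ` {..N}"
        proof (cases "a \<ge> 0")
          case True then show ?thesis using a by (intro UnI1 image_eqI[of _ _ "nat a"]) auto
        next
          case False then show ?thesis using a by (intro UnI2 image_eqI[of _ _ "nat (- a)"]) auto
        qed
      qed
    qed (auto simp: h_def)
    also have "\<dots> \<le> (\<Sum>a\<in>int ` {..N}. h a) + (\<Sum>a\<in>(\<lambda>n. - int n) ` {..N}. h a)"
    proof -
      have "(\<Sum>a\<in>int ` {..N} \<inter> (\<lambda>n. - int n) ` {..N}. h a) \<ge> 0"
        by (intro sum_nonneg) (simp add: h_def)
      then show ?thesis
        by (subst sum_Un) auto
    qed
    also have "(\<Sum>a\<in>int ` {..N}. h a) = (\<Sum>n\<le>N. f n)"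
      by (subst sum.reindex) (auto simp: h_def f_def add.commute inj_on_def intro!: sum.cong)
    also have "(\<Sum>a\<in>(\<lambda>n. - int n) ` {..N}. h a) = (\<Sum>n\<le>N. f n)"
      by (subst sum.reindex) (auto simp: h_def f_def add.commute inj_on_def intro!: sum.cong)
    also have "(\<Sum>n\<le>N. f n) + (\<Sum>n\<le>N. f n) \<le> T"
      using sum_le_suminf[OF summ, of "{..N}"] f0 by (simp add: T_def)
    finally show ?thesis by simp
  qed
  have hle: "max 1 ((cmod (Complex (of_int a) (of_int b)))\<^sup>2) powr ?s \<le> 4 powr (1 + \<epsilon>) * (h a * h b)" for a b
  proof -
    let ?m = "max 1 ((cmod (Complex (of_int a) (of_int b)))\<^sup>2)"
    \<comment> \<open>Off the origin the squared modulus is at least 1 and the product is at most 2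
      plus twice the squared modulus, hence at most four times it.\<close>
    have "(1 + real_of_int \<bar>a\<bar>) * (1 + real_of_int \<bar>b\<bar>) \<le> 4 * ?m"
    proof (cases "a = 0 \<and> b = 0")
      case False
      have "1 \<le> (cmod (Complex (of_int a) (of_int b)))\<^sup>2"
      proof -
        have "1 \<le> a\<^sup>2 + b\<^sup>2"
          using False by (simp add: int_one_le_iff_zero_less sum_power2_gt_zero_iff)
        then have "real_of_int 1 \<le> real_of_int (a\<^sup>2 + b\<^sup>2)" by (simp only: of_int_le_iff)
        then show ?thesis by (simp add: cmod_power2)
      qed
      moreover have "(1 + real_of_int \<bar>a\<bar>) * (1 + real_of_int \<bar>b\<bar>) \<le> 2 + 2 * (of_int a)\<^sup>2 + 2 * (of_int b)\<^sup>2"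
      proof -
        let ?x = "real_of_int \<bar>a\<bar>" and ?y = "real_of_int \<bar>b\<bar>"
        \<comment> \<open>This sum of squares expands to an inequality slightly stronger than the
          one wanted.\<close>
        have "0 \<le> (?x - 1)\<^sup>2 + (?y - 1)\<^sup>2 + (?x - ?y)\<^sup>2 + ?x\<^sup>2 + ?y\<^sup>2" by simp
        also have "\<dots> = 2 + 3 * ?x\<^sup>2 + 3 * ?y\<^sup>2 - 2 * ?x - 2 * ?y - 2 * ?x * ?y"
          by (simp add: power2_eq_square algebra_simps)
        finally have "2 * ((1 + ?x) * (1 + ?y)) \<le> 4 + 3 * ?x\<^sup>2 + 3 * ?y\<^sup>2"
          by (simp add: algebra_simps)
        moreover have "?x\<^sup>2 = (of_int a)\<^sup>2" "?y\<^sup>2 = (of_int b)\<^sup>2" by (simp_all add: power2_eq_square)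
        ultimately show ?thesis 
          using zero_le_power2[of "of_int a :: real"] zero_le_power2[of "of_int b :: real"] by linarith
      qed
      ultimately show ?thesis by (simp add: cmod_power2)
    qed auto
    then have "(4 * ?m) powr ?s \<le> ((1 + real_of_int \<bar>a\<bar>) * (1 + real_of_int \<bar>b\<bar>)) powr ?s"
      using e by (intro powr_mono2') auto
    also have "\<dots> = h a * h b" by (simp add: h_def powr_mult)
    finally have "4 powr ?s * ?m powr ?s \<le> h a * h b" by (simp add: powr_mult)
    then have "4 powr (1 + \<epsilon>) * (4 powr ?s * ?m powr ?s) \<le> 4 powr (1 + \<epsilon>) * (h a * h b)"
      by (intro mult_left_mono) auto
    moreover have "(4::real) powr (1 + \<epsilon>) * (4 powr ?s * ?m powr ?s) = ?m powr ?s"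
      by (simp add: powr_add[symmetric] mult.assoc[symmetric])
    ultimately show ?thesis by (simp only:)
  qed
  define Z where "Z = max 1 (4 powr (1 + \<epsilon>) * (T * T))"
  show ?thesis
  proof (rule that[of Z])
    show "Z \<ge> 1" by (simp add: Z_def)
    fix B assume B: "finite B" "B \<subseteq> gauss_ints"
    let ?c = "\<lambda>(a, b). Complex (of_int a) (of_int b)"
    have injc: "inj ?c" by (auto simp: inj_def)
    define I where "I = ?c -` B"
    have I: "finite I" "B = ?c ` I"
      using B unfolding I_def gauss_ints_def by (auto intro!: finite_vimageI[OF _ injc])
    obtain N where N: "I \<subseteq> {- int N..int N} \<times> {- int N..int N}"
    proof -
      define N where "N = (\<Sum>(a, b)\<in>I. nat \<bar>a\<bar> + nat \<bar>b\<bar>)"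
      have "nat \<bar>a\<bar> + nat \<bar>b\<bar> \<le> N" if "(a, b) \<in> I" for a b
        unfolding N_def using member_le_sum[of "(a, b)" I "\<lambda>(a, b). nat \<bar>a\<bar> + nat \<bar>b\<bar>"] that I(1) by auto
      then show ?thesis by (intro that[of N]) fastforce
    qed
    have h0: "h a \<ge> 0" for a by (simp add: h_def)
    have "(\<Sum>z\<in>B. max 1 ((cmod z)\<^sup>2) powr ?s) = (\<Sum>p\<in>I. max 1 ((cmod (?c p))\<^sup>2) powr ?s)"
      unfolding I(2) by (subst sum.reindex) (auto intro: inj_on_subset[OF injc])
    also have "\<dots> \<le> (\<Sum>p\<in>I. 4 powr (1 + \<epsilon>) * (h (fst p) * h (snd p)))"
      using hle by (intro sum_mono) (auto simp: split_beta)
    also have "\<dots> \<le> (\<Sum>p\<in>{- int N..int N} \<times> {- int N..int N}. 4 powr (1 + \<epsilon>) * (h (fst p) * h (snd p)))"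
      using N h0 by (intro sum_mono2) auto
    also have "\<dots> = 4 powr (1 + \<epsilon>) * ((\<Sum>a\<in>{- int N..int N}. h a) * (\<Sum>a\<in>{- int N..int N}. h a))"
      unfolding sum_product sum.cartesian_product by (simp only: sum_distrib_left case_prod_beta')
    also have "\<dots> \<le> 4 powr (1 + \<epsilon>) * (T * T)"
      using T[of N] h0 by (intro mult_left_mono mult_mono) (auto intro!: sum_nonneg order_trans[OF _ T[of N]])
    also have "\<dots> \<le> Z" by (simp add: Z_def)
    finally show "(\<Sum>z\<in>B. max 1 ((cmod z)\<^sup>2) powr ?s) \<le> Z" .
  qed
qed

text \<open>Enlarging \<open>L\<close> to the full product of its coordinate ranges turns the sum of
  products into a product of sums, each of them a lattice sum over the differences from
  \<open>l0 j\<close>.\<close>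

lemma sum_gauss_int_functions_bound:
  fixes \<epsilon> :: real
  assumes Z: "\<And>B. finite B \<Longrightarrow> B \<subseteq> gauss_ints \<Longrightarrow> (\<Sum>z\<in>B. max 1 ((cmod z)\<^sup>2) powr (- (1 + \<epsilon>))) \<le> Z"
    and L: "finite L" "finite J" and ext: "\<And>l. l \<in> L \<Longrightarrow> l \<in> extensional J"
    and gi: "\<And>l j. l \<in> L \<Longrightarrow> j \<in> J \<Longrightarrow> l j - l0 j \<in> gauss_ints"
  shows "(\<Sum>l\<in>L. \<Prod>j\<in>J. max 1 ((cmod (l j - l0 j))\<^sup>2) powr (- (1 + \<epsilon>))) \<le> Z ^ card J"
proof -
  let ?f = "\<lambda>z :: complex. max 1 ((cmod z)\<^sup>2) powr (- (1 + \<epsilon>))"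
  define B where "B j = (\<lambda>l. l j) ` L" for j
  have LB: "L \<subseteq> PiE J B" using ext unfolding B_def PiE_def Pi_def by blast
  have "(\<Sum>l\<in>L. \<Prod>j\<in>J. ?f (l j - l0 j)) \<le> (\<Sum>l\<in>PiE J B. \<Prod>j\<in>J. ?f (l j - l0 j))"
    using L by (intro sum_mono2 LB prod_nonneg finite_PiE) (auto simp: B_def)
  also have "\<dots> = (\<Prod>j\<in>J. \<Sum>y\<in>B j. ?f (y - l0 j))"
    by (rule prod_sum_PiE[symmetric]) (use L in \<open>auto simp: B_def\<close>)
  also have "\<dots> \<le> (\<Prod>j\<in>J. Z)"
  proof (intro prod_mono conjI sum_nonneg)
    fix j assume j: "j \<in> J"
    have "(\<Sum>y\<in>B j. ?f (y - l0 j)) = (\<Sum>z\<in>(\<lambda>y. y - l0 j) ` B j. ?f z)"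
      by (subst sum.reindex) (auto simp: inj_on_def)
    also have "\<dots> \<le> Z"
      using L gi j by (intro Z) (auto simp: B_def)
    finally show "(\<Sum>y\<in>B j. ?f (y - l0 j)) \<le> Z" .
  qed auto
  also have "\<dots> = Z ^ card J" by simp
  finally show ?thesis .
qed

text \<open>Under a constraint on the mean a product is largest when all factors agree. Each factor
  is bounded through the tangent of the logarithm at \<open>1 + A\<close>; the resulting exponents
  have a nonpositive sum.\<close>

lemma prod_one_plus_le:
  fixes a :: "'j \<Rightarrow> real" and A :: real
  assumes "\<And>j. j \<in> J \<Longrightarrow> a j \<ge> 0" and A: "A \<ge> 0" and sum: "(\<Sum>j\<in>J. a j) \<le> A * card J"
  shows "(\<Prod>j\<in>J. 1 + a j) \<le> (1 + A) ^ card J"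
proof -
  have "(\<Prod>j\<in>J. 1 + a j) \<le> (\<Prod>j\<in>J. (1 + A) * exp ((a j - A) / (1 + A)))"
  proof (intro prod_mono conjI)
    fix j assume "j \<in> J"
    then show "0 \<le> 1 + a j" using assms by simp
    have "1 + a j = (1 + A) * (1 + (a j - A) / (1 + A))"
      using A by (simp add: field_simps)
    also have "\<dots> \<le> (1 + A) * exp ((a j - A) / (1 + A))"
      using A by (intro mult_left_mono exp_ge_add_one_self) auto
    finally show "1 + a j \<le> (1 + A) * exp ((a j - A) / (1 + A))" .
  qed
  also have "\<dots> = (1 + A) ^ card J * exp (\<Sum>j\<in>J. (a j - A) / (1 + A))"
    by (cases "finite J") (auto simp: prod.distrib exp_sum)
  also have "(\<Sum>j\<in>J. (a j - A) / (1 + A)) = ((\<Sum>j\<in>J. a j) - A * card J) / (1 + A)"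
    by (simp add: sum_divide_distrib[symmetric] sum_subtractf mult.commute)
  also have "(1 + A) ^ card J * exp \<dots> \<le> (1 + A) ^ card J * 1"
    using A sum by (intro mult_left_mono) (auto simp: divide_nonpos_pos)
  finally show ?thesis by simp
qed

text \<open>For each observed value the decoder names a single class, so the elements decoded
  correctly there all lie in one class. If that class has less than the share
  \<open>\<delta>\<close> of the fibre, so do they, whatever the decoder is.\<close>

lemma card_low_posterior_le:
  fixes a :: "'w \<Rightarrow> 'x" and c :: "'w \<Rightarrow> 'y"
  assumes "finite W" and "\<delta> \<ge> 0"
  shows "real (card {w\<in>W. D (a w) = c w \<and>
      real (card {u\<in>W. a u = a w \<and> c u = c w}) < \<delta> * real (card {u\<in>W. a u = a w})}) \<le> \<delta> * card W"
    (is "real (card ?S) \<le> _")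
proof -
  define S where "S = ?S"
  have S: "finite S" "S \<subseteq> W" using assms by (auto simp: S_def)
  have group: "(\<Sum>x\<in>a ` W. real (card {w\<in>V. a w = x})) = card V" if "V \<subseteq> W" for V
    using sum.group[of V "a ` W" a "\<lambda>_. 1::real"] assms that by (auto simp: finite_subset)
  have "real (card S) = (\<Sum>x\<in>a ` W. real (card {w\<in>S. a w = x}))"
    using group[OF S(2)] by simp
  also have "\<dots> \<le> (\<Sum>x\<in>a ` W. \<delta> * real (card {u\<in>W. a u = x}))"
  proof (rule sum_mono)
    fix x assume "x \<in> a ` W"
    show "real (card {w\<in>S. a w = x}) \<le> \<delta> * real (card {u\<in>W. a u = x})"
    proof (cases "{w\<in>S. a w = x} = {}")
      case True
      then show ?thesis using assms by (simp only: card.empty) simp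
    next
      case False
      then obtain w where w: "w \<in> S" "a w = x" by auto
      have "card {v\<in>S. a v = x} \<le> card {u\<in>W. a u = a w \<and> c u = c w}"
      proof (intro card_mono subsetI)
        fix v assume v: "v \<in> {v\<in>S. a v = x}"
        then have "c v = D x" "c w = D x" "v \<in> W" using w by (auto simp: S_def)
        then show "v \<in> {u\<in>W. a u = a w \<and> c u = c w}" using v w by simp
      qed (use assms in simp)
      also have "real \<dots> \<le> \<delta> * real (card {u\<in>W. a u = x})"
        using w by (simp add: S_def)
      finally show ?thesis by simp
    qed
  qed
  also have "\<dots> = \<delta> * card W"
    using group[of W] by (simp add: sum_distrib_left[symmetric])
  finally show ?thesis by (simp add: S_def)
qed

text \<open>The weights give every fibre total mass 1, so a sum over elements becomes a sum over
  attained values.\<close>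

lemma sum_over_fibres:
  fixes f :: "'l \<Rightarrow> real"
  assumes "finite S"
  shows "(\<Sum>w\<in>S. f (l w) / real (card {u\<in>S. l u = l w})) = (\<Sum>x\<in>l ` S. f x)"
proof -
  have "(\<Sum>w\<in>S. f (l w) / real (card {u\<in>S. l u = l w})) =
    (\<Sum>x\<in>l ` S. \<Sum>w\<in>{w\<in>S. l w = x}. f (l w) / real (card {u\<in>S. l u = l w}))"
    using assms by (intro sum.group[symmetric]) auto
  also have "\<dots> = (\<Sum>x\<in>l ` S. f x)"
  proof (rule sum.cong[OF refl])
    fix x assume x: "x \<in> l ` S"
    then have "card {u\<in>S. l u = x} \<noteq> 0" using assms by auto
    moreover have "(\<Sum>w\<in>{w\<in>S. l w = x}. f (l w) / real (card {u\<in>S. l u = l w})) =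
      (\<Sum>w\<in>{w\<in>S. l w = x}. f x / real (card {u\<in>S. l u = x}))"
      by (intro sum.cong) auto
    ultimately show "(\<Sum>w\<in>{w\<in>S. l w = x}. f (l w) / real (card {u\<in>S. l u = l w})) = f x"
      by simp
  qed
  finally show ?thesis .
qed

section \<open>Quantised outputs\<close>

definition clean_output ::
  "('k::finite \<Rightarrow> 'm \<Rightarrow> real) \<Rightarrow> real \<Rightarrow> ('k, 'm) encoder \<Rightarrow> 'k \<Rightarrow> ('k \<Rightarrow> nat) \<Rightarrow>
   ('k, 'm) csi_block \<Rightarrow> ('k, 'm) csi_block \<Rightarrow> 'm \<Rightarrow> nat \<Rightarrow> complex" where
  "clean_output \<alpha> P enc k w g d m t =
    (\<Sum>i\<in>UNIV. chan \<alpha> P k m (g (k, m, t)) (d (k, m, t)) $ i * enc w g m t $ i)"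

definition quantized_output ::
  "('k::finite \<Rightarrow> 'm \<Rightarrow> real) \<Rightarrow> nat \<Rightarrow> real \<Rightarrow> ('k, 'm) encoder \<Rightarrow> 'k \<Rightarrow> ('k \<Rightarrow> nat) \<Rightarrow>
   ('k, 'm) csi_block \<Rightarrow> ('k, 'm) csi_block \<Rightarrow> 'm \<times> nat \<Rightarrow> complex" where
  "quantized_output \<alpha> n P enc k w g d =
    (\<lambda>(m, t)\<in>UNIV \<times> {..<n}. gauss_floor (clean_output \<alpha> P enc k w g d m t))"

abbreviation csi_space :: "nat \<Rightarrow> ('k::finite, 'm) csi_block measure" where
  "csi_space n \<equiv> \<Pi>\<^sub>M j\<in>block n. borel"

definition bounded_chan ::
  "('k::finite \<Rightarrow> 'm \<Rightarrow> real) \<Rightarrow> real \<Rightarrow> real \<Rightarrow> nat \<Rightarrow> ('k, 'm) csi_block \<Rightarrow> ('k, 'm) csi_block \<Rightarrow> bool" where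
  "bounded_chan \<alpha> hi P n g d \<longleftrightarrow>
    (\<forall>k m. \<forall>t<n. \<forall>i. cmod (chan \<alpha> P k m (g (k, m, t)) (d (k, m, t)) $ i) \<le> hi)"

lemma received_clean_output:
  "received \<alpha> n P enc k w g d z =
    (\<lambda>(m, t)\<in>UNIV \<times> {..<n}. clean_output \<alpha> P enc k w g d m t + z (k, m, t))"
  by (simp add: received_def clean_output_def)

lemma chan_nth: "chan \<alpha> P k m e d $ i = e $ i + sqrt (P powr (- \<alpha> k m)) *\<^sub>R d $ i"
  by (simp add: chan_def)

lemma chan_measurable[measurable]:
  "e \<in> borel_measurable M \<Longrightarrow> d \<in> borel_measurable M \<Longrightarrow> (\<lambda>x. chan \<alpha> P k m (e x) (d x)) \<in> borel_measurable M"
  unfolding chan_def by (intro borel_measurable_add borel_measurable_const_scaleR)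

lemma csi_component_measurable:
  "t < n \<Longrightarrow> (\<lambda>g. g (k, m, t)) \<in> borel_measurable (csi_space n :: ('k::finite, 'm) csi_block measure)"
  by (intro measurable_component_singleton[where M="\<lambda>_. borel"]) simp

lemma chan_nth_measurable:
  assumes "t < n"
  shows "(\<lambda>(g, d). chan \<alpha> P k m (g (k, m, t)) (d (k, m, t)) $ i) \<in>
    borel_measurable (csi_space n \<Otimes>\<^sub>M (csi_space n :: ('k::finite, 'm) csi_block measure))"
proof -
  show ?thesis unfolding case_prod_beta'
    by (intro borel_measurable_vec_nth chan_measurable
      measurable_compose[OF measurable_fst csi_component_measurable[OF assms]]
      measurable_compose[OF measurable_snd csi_component_measurable[OF assms]])
qed

lemma clean_output_measurable:
  assumes code: "is_code n P R enc dec" and w: "w \<in> messages n R" and t: "t < n"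
  shows "(\<lambda>(g, d). clean_output \<alpha> P enc k w g d m t) \<in>
    borel_measurable (csi_space n \<Otimes>\<^sub>M (csi_space n :: ('k::finite, 'm::finite) csi_block measure))"
proof -
  have "(\<lambda>g. enc w g m t) \<in> borel_measurable (csi_space n)"
    using code w t by (auto simp: is_code_def)
  from measurable_compose[OF measurable_fst this]
  show ?thesis unfolding clean_output_def case_prod_beta'
    by (intro borel_measurable_sum borel_measurable_times chan_nth_measurable[OF t, unfolded case_prod_beta']
        borel_measurable_vec_nth)
qed

lemma clean_output_cong:
  "d (k, m, t) = d' (k, m, t) \<Longrightarrow> clean_output \<alpha> P enc k w g d m t = clean_output \<alpha> P enc k w g d' m t"
  by (simp add: clean_output_def)

text \<open>The output of user \<open>k\<close> reads only the deviations of user \<open>k\<close>.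
  Those of another user can therefore be integrated out with this output held fixed.\<close>

lemma quantized_output_cong:
  "(\<And>m t. t < n \<Longrightarrow> d (k, m, t) = d' (k, m, t)) \<Longrightarrow>
    quantized_output \<alpha> n P enc k w g d = quantized_output \<alpha> n P enc k w g d'"
  by (auto simp: quantized_output_def fun_eq_iff clean_output_cong[of d k _ _ d'])

lemma gauss_floor_measurable[measurable]: "gauss_floor \<in> borel_measurable borel"
proof -
  have "gauss_floor = (\<lambda>z. of_real (of_int \<lfloor>Re z\<rfloor>) + \<i> * of_real (of_int \<lfloor>Im z\<rfloor>))"
    by (auto simp: gauss_floor_def complex_eq_iff)
  moreover have "(\<lambda>z. complex_of_real (of_int \<lfloor>Re z\<rfloor>) + \<i> * of_real (of_int \<lfloor>Im z\<rfloor>)) \<in> borel_measurable borel"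
    by measurable
  ultimately show ?thesis by simp
qed

lemma quantized_output_eq_measurable:
  assumes code: "is_code n P R enc dec" and w: "w \<in> messages n R" "w' \<in> messages n R"
  shows "Measurable.pred (csi_space n \<Otimes>\<^sub>M (csi_space n :: ('k::finite, 'm::finite) csi_block measure))
    (\<lambda>(g, d). quantized_output \<alpha> n P enc k w g d = quantized_output \<alpha> n P enc k w' g d)"
proof -
  have "quantized_output \<alpha> n P enc k w g d = quantized_output \<alpha> n P enc k w' g d \<longleftrightarrow>
    (\<forall>j\<in>UNIV \<times> {..<n}. gauss_floor (clean_output \<alpha> P enc k w g d (fst j) (snd j)) =
      gauss_floor (clean_output \<alpha> P enc k w' g d (fst j) (snd j)))" for g d
    by (auto simp: quantized_output_def fun_eq_iff restrict_def)
  moreover have "Measurable.pred (csi_space n \<Otimes>\<^sub>M (csi_space n :: ('k::finite, 'm::finite) csi_block measure))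
    (\<lambda>p. \<forall>j\<in>UNIV \<times> {..<n}. gauss_floor (clean_output \<alpha> P enc k w (fst p) (snd p) (fst j) (snd j)) =
      gauss_floor (clean_output \<alpha> P enc k w' (fst p) (snd p) (fst j) (snd j)))"
  proof (intro pred_intros_finite)
    fix j :: "'m \<times> nat" assume "j \<in> UNIV \<times> {..<n}"
    then have t: "snd j < n" by auto
    note [measurable] = clean_output_measurable[OF code w(1) t, unfolded case_prod_beta']
      clean_output_measurable[OF code w(2) t, unfolded case_prod_beta']
    show "Measurable.pred (csi_space n \<Otimes>\<^sub>M csi_space n)
      (\<lambda>p. gauss_floor (clean_output \<alpha> P enc k w (fst p) (snd p) (fst j) (snd j)) =
        gauss_floor (clean_output \<alpha> P enc k w' (fst p) (snd p) (fst j) (snd j)))"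
      by measurable
  qed simp
  ultimately show ?thesis by (simp add: case_prod_beta')
qed

lemma bounded_chan_measurable:
  "Measurable.pred (csi_space n \<Otimes>\<^sub>M (csi_space n :: ('k::finite, 'm::finite) csi_block measure))
    (\<lambda>(g, d). bounded_chan \<alpha> hi P n g d)"
proof -
  have "bounded_chan \<alpha> hi P n g d \<longleftrightarrow> (\<forall>j\<in>UNIV \<times> UNIV \<times> {..<n} \<times> UNIV.
     cmod (chan \<alpha> P (fst j) (fst (snd j)) (g (fst j, fst (snd j), fst (snd (snd j)))) 
        (d (fst j, fst (snd j), fst (snd (snd j)))) $ snd (snd (snd j))) \<le> hi)" for g d :: "('k, 'm) csi_block"
    by (auto simp: bounded_chan_def)
  moreover have "Measurable.pred (csi_space n \<Otimes>\<^sub>M (csi_space n :: ('k::finite, 'm::finite) csi_block measure))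
    (\<lambda>p. \<forall>j\<in>UNIV \<times> UNIV \<times> {..<n} \<times> UNIV.
     cmod (chan \<alpha> P (fst j) (fst (snd j)) ((fst p) (fst j, fst (snd j), fst (snd (snd j)))) 
        ((snd p) (fst j, fst (snd j), fst (snd (snd j)))) $ snd (snd (snd j))) \<le> hi)"
  proof (intro pred_intros_finite)
    fix j :: "'k \<times> 'm \<times> nat \<times> 'k" assume "j \<in> UNIV \<times> UNIV \<times> {..<n} \<times> UNIV"
    then have t: "fst (snd (snd j)) < n" by auto
    note chan_nth_measurable[OF t, unfolded case_prod_beta', measurable]
    show "Measurable.pred (csi_space n \<Otimes>\<^sub>M csi_space n)
      (\<lambda>p. cmod (chan \<alpha> P (fst j) (fst (snd j)) ((fst p) (fst j, fst (snd j), fst (snd (snd j)))) 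
        ((snd p) (fst j, fst (snd j), fst (snd (snd j)))) $ snd (snd (snd j))) \<le> hi)"
      by measurable
  qed simp
  ultimately show ?thesis by (simp add: case_prod_beta')
qed

section \<open>Channel state as random variables, with its almost sure bounds\<close>

context partial_csit_bc
begin

lemma csi_entry_measurable: "csi_entry est err l \<in> borel_measurable Q"
proof -
  obtain f where "distributed Q (\<Pi>\<^sub>M i\<in>{l}. lborel) (\<lambda>\<omega>. \<lambda>i\<in>{l}. csi_entry est err i \<omega>) (\<lambda>x. ennreal (f {l} x))"
  proof -
    from densities obtain f where "\<forall>B. finite B \<longrightarrow> (\<forall>x. 0 \<le> f B x) \<and>
        distributed Q (\<Pi>\<^sub>M i\<in>B. lborel) (\<lambda>\<omega>. \<lambda>i\<in>B. csi_entry est err i \<omega>) (\<lambda>x. ennreal (f B x))"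
      unfolding bounded_densities_def by (elim exE conjE) (rule that)
    then show ?thesis by (intro that[of f]) simp
  qed
  then have "(\<lambda>\<omega>. \<lambda>i\<in>{l}. csi_entry est err i \<omega>) \<in> Q \<rightarrow>\<^sub>M (\<Pi>\<^sub>M i\<in>{l}. lborel)"
    by (simp add: distributed_def)
  then have "(\<lambda>\<omega>. (\<lambda>i\<in>{l}. csi_entry est err i \<omega>) l) \<in> Q \<rightarrow>\<^sub>M (lborel :: complex measure)"
    by (rule measurable_compose[OF _ measurable_component_singleton]) simp
  then show ?thesis by simp
qed

lemma csi_entries_measurable:
  "(\<lambda>\<omega>. \<lambda>l\<in>entry_block n. csi_entry est err l \<omega>) \<in> Q \<rightarrow>\<^sub>M (\<Pi>\<^sub>M l\<in>entry_block n. lborel)"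
  by (intro measurable_restrict) (simp add: csi_entry_measurable)

lemma csi_of_measurable[measurable]:
  "csi_of n est \<in> Q \<rightarrow>\<^sub>M csi_space n" "csi_of n err \<in> Q \<rightarrow>\<^sub>M csi_space n"
proof -
  have "csi_of n est = (\<lambda>\<omega>. csi_from n Estimate (\<lambda>l\<in>entry_block n. csi_entry est err l \<omega>))"
    "csi_of n err = (\<lambda>\<omega>. csi_from n Deviation (\<lambda>l\<in>entry_block n. csi_entry est err l \<omega>))"
    by (intro ext csi_of_eq_csi_from)+
  then show "csi_of n est \<in> Q \<rightarrow>\<^sub>M csi_space n" "csi_of n err \<in> Q \<rightarrow>\<^sub>M csi_space n"
    using measurable_compose[OF csi_entries_measurable csi_from_measurable] by simp_all
qed

text \<open>The locale provides a null set for each power and each entry; as a block has finitely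
  many entries, one null set serves the whole block at a given power.\<close>

lemma coefficient_bounds:
  obtains lo hi where "0 < lo" "0 < hi"
    "\<And>P n. P \<ge> 1 \<Longrightarrow> AE \<omega> in Q. bounded_chan \<alpha> hi P n (csi_of n est \<omega>) (csi_of n err \<omega>)"
    "\<And>P n. P \<ge> 1 \<Longrightarrow> AE \<omega> in Q. \<forall>k m. \<forall>t<n. \<forall>i.
       lo \<le> cmod (chan \<alpha> P k m (csi_of n est \<omega> (k, m, t)) (csi_of n err \<omega> (k, m, t)) $ i)"
proof -
  obtain lo hi where lo: "0 < lo" and
    b: "\<And>P k m t i. P \<ge> 1 \<Longrightarrow> AE \<omega> in Q.
        lo \<le> cmod (chan \<alpha> P k m (est k m t \<omega>) (err k m t \<omega>) $ i) \<and>
        cmod (chan \<alpha> P k m (est k m t \<omega>) (err k m t \<omega>) $ i) \<le> hi"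
    using coefficients by blast
  show thesis
  \<comment> \<open>The maximum with 1 makes the upper bound visibly positive.\<close>
  proof (rule that[OF lo, of "max hi 1"])
    fix P :: real and n assume P: "P \<ge> 1"
    have "AE \<omega> in Q. \<forall>j\<in>UNIV \<times> UNIV \<times> {..<n} \<times> UNIV. (case j of (k, m, t, i) \<Rightarrow>
        lo \<le> cmod (chan \<alpha> P k m (est k m t \<omega>) (err k m t \<omega>) $ i) \<and>
        cmod (chan \<alpha> P k m (est k m t \<omega>) (err k m t \<omega>) $ i) \<le> hi)"
      using b[OF P] by (intro AE_finite_allI) auto
    then show "AE \<omega> in Q. bounded_chan \<alpha> (max hi 1) P n (csi_of n est \<omega>) (csi_of n err \<omega>)"
      and "AE \<omega> in Q. \<forall>k m. \<forall>t<n. \<forall>i.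
       lo \<le> cmod (chan \<alpha> P k m (csi_of n est \<omega> (k, m, t)) (csi_of n err \<omega> (k, m, t)) $ i)"
      by (auto simp: bounded_chan_def csi_of_def block_def elim!: eventually_mono intro: max.coboundedI1)
  qed simp
qed

end

text \<open>In the application \<open>M j\<close> is the largest entry of an input difference and
  \<open>r j\<close> the resulting difference of quantised outputs. With
  \<open>x = 1 + (M j)\<^sup>2\<close>, the factor \<open>1 / x\<close> is split into
  \<open>x powr \<epsilon>\<close> and \<open>x powr (- (1 + \<epsilon>))\<close>. The second
  becomes a summable weight in \<open>r j\<close>; the product of the first over the block is
  controlled by the average power.\<close>

lemma alignment_weight_bound:
  fixes M A :: "'j \<Rightarrow> real" and r :: "'j \<Rightarrow> complex" and P \<epsilon> c :: real
  assumes fin: "finite J" and M: "(\<Sum>j\<in>J. (M j)\<^sup>2) \<le> 4 * P * card J" and P: "P \<ge> 1"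
    and r: "\<And>j. j \<in> J \<Longrightarrow> max 1 ((cmod (r j))\<^sup>2) \<le> c * (1 + (M j)\<^sup>2)"
    and e: "\<epsilon> > 0" and A: "\<And>j. j \<in> J \<Longrightarrow> A j \<ge> 0" and c: "c \<ge> 1"
  shows "(\<Prod>j\<in>J. A j / (1 + (M j)\<^sup>2)) \<le>
    (\<Prod>j\<in>J. A j * c powr (1 + \<epsilon>) * (5 * P) powr \<epsilon>) * (\<Prod>j\<in>J. max 1 ((cmod (r j))\<^sup>2) powr (- (1 + \<epsilon>)))"
proof -
  let ?r = "\<lambda>j. max 1 ((cmod (r j))\<^sup>2)"
  have "(\<Prod>j\<in>J. A j / (1 + (M j)\<^sup>2)) \<le>
    (\<Prod>j\<in>J. (A j * c powr (1 + \<epsilon>)) * ((1 + (M j)\<^sup>2) powr \<epsilon> * ?r j powr (- (1 + \<epsilon>))))"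
  proof (intro prod_mono conjI)
    fix j assume j: "j \<in> J"
    let ?x = "1 + (M j)\<^sup>2"
    have x: "?x > 0" by (simp add: add_pos_nonneg)
    show "0 \<le> A j / ?x" using A[OF j] x by simp
    have "(c * ?x) powr (- (1 + \<epsilon>)) \<le> ?r j powr (- (1 + \<epsilon>))"
      using r[OF j] e by (intro powr_mono2') auto
    then have "c powr (- (1 + \<epsilon>)) * ?x powr (- (1 + \<epsilon>)) \<le> ?r j powr (- (1 + \<epsilon>))"
      using c x by (simp add: powr_mult)
    then have "(c powr (1 + \<epsilon>) * ?x powr \<epsilon>) * (c powr (- (1 + \<epsilon>)) * ?x powr (- (1 + \<epsilon>)))
      \<le> (c powr (1 + \<epsilon>) * ?x powr \<epsilon>) * ?r j powr (- (1 + \<epsilon>))"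
      by (intro mult_left_mono) auto
    also have "(c powr (1 + \<epsilon>) * ?x powr \<epsilon>) * (c powr (- (1 + \<epsilon>)) * ?x powr (- (1 + \<epsilon>))) =
      (c powr (1 + \<epsilon>) * c powr (- (1 + \<epsilon>))) * (?x powr \<epsilon> * ?x powr (- (1 + \<epsilon>)))"
      by (simp only: ac_simps)
    also have "\<dots> = 1 / ?x"
      using c x by (simp add: powr_add[symmetric] powr_minus_divide)
    finally have "A j * (1 / ?x) \<le> A j * ((c powr (1 + \<epsilon>) * ?x powr \<epsilon>) * ?r j powr (- (1 + \<epsilon>)))"
      using A[OF j] by (intro mult_left_mono) auto
    then show "A j / ?x \<le> (A j * c powr (1 + \<epsilon>)) * (?x powr \<epsilon> * ?r j powr (- (1 + \<epsilon>)))"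
      by (simp only: mult.assoc mult_1_right times_divide_eq_right)
  qed
  also have "\<dots> = (\<Prod>j\<in>J. A j * c powr (1 + \<epsilon>)) * ((\<Prod>j\<in>J. 1 + (M j)\<^sup>2) powr \<epsilon>) * (\<Prod>j\<in>J. ?r j powr (- (1 + \<epsilon>)))"
    by (simp add: prod.distrib prod_powr_distrib add_nonneg_nonneg mult.assoc)
  also have "\<dots> \<le> (\<Prod>j\<in>J. A j * c powr (1 + \<epsilon>)) * (((5 * P) ^ card J) powr \<epsilon>) * (\<Prod>j\<in>J. ?r j powr (- (1 + \<epsilon>)))"
  proof (intro mult_right_mono mult_left_mono powr_mono2)
    have "(\<Prod>j\<in>J. 1 + (M j)\<^sup>2) \<le> (1 + 4 * P) ^ card J"
      using P M by (intro prod_one_plus_le) auto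
    also have "\<dots> \<le> (5 * P) ^ card J"
      using P by (intro power_mono) auto
    finally show "(\<Prod>j\<in>J. 1 + (M j)\<^sup>2) \<le> (5 * P) ^ card J" .
  qed (use e A in \<open>auto intro!: prod_nonneg\<close>)
  also have "((5 * P) ^ card J) powr \<epsilon> = (\<Prod>j\<in>J. (5 * P) powr \<epsilon>)"
    using P prod_powr_distrib[of "\<lambda>_. 5 * P" J \<epsilon>] by simp
  finally show ?thesis by (simp add: prod.distrib)
qed

text \<open>The number of message tuples that a receiver with side information \<open>v\<close> and
  quantised output \<open>q\<close> cannot tell apart from \<open>w\<close>; its logarithm stands in
  for a conditional entropy.\<close>

definition fibre_card :: "'w set \<Rightarrow> ('w \<Rightarrow> 'v) \<Rightarrow> ('w \<Rightarrow> 'q) \<Rightarrow> 'w \<Rightarrow> real" where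
  "fibre_card W v q w = real (card {u\<in>W. v u = v w \<and> q u = q w})"

lemma fibre_card_sum:
  "finite W \<Longrightarrow> fibre_card W v q w = (\<Sum>u\<in>W. of_bool (v u = v w \<and> q u = q w))"
  unfolding fibre_card_def by (subst sum_of_bool_eq) (auto intro!: arg_cong[where f=card])

lemma fibre_card_pos: "finite W \<Longrightarrow> w \<in> W \<Longrightarrow> fibre_card W v q w > 0"
  by (auto simp: fibre_card_def card_gt_0_iff)

lemma fibre_card_nonneg[simp]: "fibre_card W v q w \<ge> 0"
  by (simp add: fibre_card_def)

lemma finite_messages[simp]: "finite (messages n R)"
  by (simp add: messages_def finite_PiE)

lemma messages_nonempty: "messages n R \<noteq> {}"
proof -
  have "1 \<le> nat \<lceil>2 powr (real n * R $ k)\<rceil>" for k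
  proof -
    have "0 < \<lceil>2 powr (real n * R $ k)\<rceil>" by simp
    then show ?thesis by linarith
  qed
  then have "{1..nat \<lceil>2 powr (real n * R $ k)\<rceil>} \<noteq> {}" for k unfolding atLeastatMost_empty_iff by simp
  then show ?thesis unfolding messages_def PiE_eq_empty_iff by simp
qed

lemma of_bool_measurable:
  "Measurable.pred M p \<Longrightarrow> (\<lambda>x. of_bool (p x) :: real) \<in> borel_measurable M"
  by (rule measurable_compose[of p M "count_space UNIV"]) auto

lemma fibre_card_measurable:
  assumes code: "is_code n P R enc dec" and w: "w \<in> messages n R"
  shows "(\<lambda>(g, d). fibre_card (messages n R) v (\<lambda>w. quantized_output \<alpha> n P enc k w g d) w) \<in>
    borel_measurable (csi_space n \<Otimes>\<^sub>M (csi_space n :: ('k::finite, 'm::finite) csi_block measure))"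
  unfolding case_prod_beta' fibre_card_sum[OF finite_messages]
proof (intro borel_measurable_sum of_bool_measurable)
  fix u assume u: "u \<in> messages n R"
  note quantized_output_eq_measurable[OF code u w, unfolded case_prod_beta', measurable]
  show "Measurable.pred (csi_space n \<Otimes>\<^sub>M (csi_space n :: ('k::finite, 'm::finite) csi_block measure))
     (\<lambda>x. v u = v w \<and> quantized_output \<alpha> n P enc k u (fst x) (snd x) =
           quantized_output \<alpha> n P enc k w (fst x) (snd x))"
    by measurable
qed

lemma code_power:
  fixes enc :: "('k::finite, 'm::finite) encoder"
  assumes code: "is_code n P R enc dec" and w: "w \<in> messages n R"
  shows "(\<Sum>(m, t)\<in>UNIV \<times> {..<n}. (norm (enc w g m t))\<^sup>2) \<le> P * real (card ((UNIV :: 'm set) \<times> {..<n}))"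
proof (cases "n = 0")
  case False
  have "(1 / (real n * real CARD('m))) * (\<Sum>t<n. \<Sum>m\<in>UNIV. (norm (enc w g m t))\<^sup>2) \<le> P"
    using code w by (auto simp: is_code_def)
  then have "(\<Sum>t<n. \<Sum>m\<in>UNIV. (norm (enc w g m t))\<^sup>2) \<le> P * (real n * real CARD('m))"
    using False by (simp add: divide_le_eq)
  moreover have "(\<Sum>t<n. \<Sum>m\<in>UNIV. (norm (enc w g m t))\<^sup>2) = (\<Sum>(m, t)\<in>UNIV \<times> {..<n}. (norm (enc w g m t))\<^sup>2)"
    by (subst sum.swap) (simp add: sum.cartesian_product)
  ultimately show ?thesis by (simp add: card_cartesian_product mult.commute)
qed auto

lemma ex_largest_component: "\<exists>i. \<forall>i'. cmod ((x :: complex ^ 'k::finite) $ i') \<le> cmod (x $ i)"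
proof -
  have "Max (range (\<lambda>i. cmod (x $ i))) \<in> range (\<lambda>i. cmod (x $ i))"
    by (intro Max_in) auto
  then obtain i where "Max (range (\<lambda>i. cmod (x $ i))) = cmod (x $ i)" by (rule imageE)
  then have "cmod (x $ i') \<le> cmod (x $ i)" for i'
    using Max_ge[of "range (\<lambda>i. cmod (x $ i))" "cmod (x $ i')"] by auto
  then show ?thesis by blast
qed

lemma clean_output_diff_bound:
  fixes enc :: "('k::finite, 'm::finite) encoder"
  assumes bd: "\<And>i. cmod (chan \<alpha> P k m (g (k, m, t)) (d (k, m, t)) $ i) \<le> hi"
    and M: "\<And>i. cmod ((enc u g m t - enc w g m t) $ i) \<le> M"
  shows "cmod (clean_output \<alpha> P enc k u g d m t - clean_output \<alpha> P enc k w g d m t) \<le> real CARD('k) * hi * M"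
proof -
  let ?h = "\<lambda>i. chan \<alpha> P k m (g (k, m, t)) (d (k, m, t)) $ i"
  have "clean_output \<alpha> P enc k u g d m t - clean_output \<alpha> P enc k w g d m t =
    (\<Sum>i\<in>UNIV. ?h i * (enc u g m t - enc w g m t) $ i)"
    by (simp add: clean_output_def sum_subtractf[symmetric] right_diff_distrib)
  also have "cmod \<dots> \<le> (\<Sum>i\<in>(UNIV :: 'k set). hi * M)"
  proof (intro sum_norm_le)
    fix i
    show "cmod (?h i * (enc u g m t - enc w g m t) $ i) \<le> hi * M"
      unfolding norm_mult using bd[of i] M[of i] by (intro mult_mono) (auto intro: order_trans[OF norm_ge_zero])
  qed
  finally show ?thesis by (simp add: mult.assoc)
qed

section \<open>Aligned image sets\<close>

text \<open>After the sums are exchanged, \<open>u\<close> is fixed and \<open>w\<close> runs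
  through the class of \<open>u\<close>. Dividing by the fibre size of \<open>l w\<close> within
  this class collapses the sum over \<open>w\<close> to one over distinct values of
  \<open>l\<close>, which is a lattice sum.\<close>

lemma sum_aligned_pairs_bound:
  fixes l :: "'w \<Rightarrow> 'j \<Rightarrow> complex" and v :: "'w \<Rightarrow> 'v"
  assumes Z: "\<And>B. finite B \<Longrightarrow> B \<subseteq> gauss_ints \<Longrightarrow> (\<Sum>z\<in>B. max 1 ((cmod z)\<^sup>2) powr (- (1 + \<epsilon>))) \<le> Z"
    and W: "finite W" and J: "finite J"
    and ext: "\<And>w. w \<in> W \<Longrightarrow> l w \<in> extensional J"
    and gi: "\<And>w j. w \<in> W \<Longrightarrow> j \<in> J \<Longrightarrow> l w j \<in> gauss_ints"
  shows "(\<Sum>w\<in>W. \<Sum>u\<in>{u\<in>W. v u = v w}. (1 / fibre_card W v l w) *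
      (\<Prod>j\<in>J. max 1 ((cmod (l u j - l w j))\<^sup>2) powr (- (1 + \<epsilon>)))) \<le> real (card W) * Z ^ card J"
proof -
  let ?p = "\<lambda>x y. \<Prod>j\<in>J. max 1 ((cmod (x j - y j))\<^sup>2) powr (- (1 + \<epsilon>))"
  have "(\<Sum>w\<in>W. \<Sum>u\<in>{u\<in>W. v u = v w}. (1 / fibre_card W v l w) * ?p (l u) (l w)) =
    (\<Sum>u\<in>W. \<Sum>w\<in>{w\<in>W. v u = v w}. (1 / fibre_card W v l w) * ?p (l u) (l w))"
    by (rule sum.swap_restrict[OF W W])
  also have "\<dots> = (\<Sum>u\<in>W. \<Sum>w\<in>{w\<in>W. v w = v u}. ?p (l w) (l u) / real (card {x\<in>{w\<in>W. v w = v u}. l x = l w}))"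
  proof (intro sum.cong refl)
    fix u w assume "w \<in> {w\<in>W. v w = v u}"
    then have w: "v w = v u" by simp
    have "fibre_card W v l w = real (card {x\<in>{w\<in>W. v w = v u}. l x = l w})"
      unfolding fibre_card_def w by (simp add: conj_ac)
    then show "(1 / fibre_card W v l w) * ?p (l u) (l w) = ?p (l w) (l u) / real (card {x\<in>{w\<in>W. v w = v u}. l x = l w})"
      by (simp add: norm_minus_commute)
  qed (auto simp: eq_commute)
  also have "\<dots> = (\<Sum>u\<in>W. \<Sum>x\<in>l ` {w\<in>W. v w = v u}. ?p x (l u))"
    using W by (intro sum.cong refl sum_over_fibres) simp
  also have "\<dots> \<le> (\<Sum>u\<in>W. Z ^ card J)"
    using W J ext gi by (intro sum_mono sum_gauss_int_functions_bound[OF Z] gauss_ints_diff) auto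
  finally show ?thesis by simp
qed

text \<open>The link of the chain between two users with equal side information. Given everything
  but the deviations of user \<open>k'\<close>, the denominators are fixed, and the numerators count
  pairs of tuples with equal outputs at \<open>k'\<close>. A large output difference at
  \<open>k\<close> forces a large input difference, which these deviations spread over many outputs
  at \<open>k'\<close>, so that such pairs seldom align.\<close>

lemma (in partial_csit_bc) aligned_images_bound:
  fixes hi \<epsilon> :: real
  assumes hi: "0 < hi"
    and bd: "\<And>P n. P \<ge> 1 \<Longrightarrow> AE \<omega> in Q. bounded_chan \<alpha> hi P n (csi_of n est \<omega>) (csi_of n err \<omega>)"
    and e: "\<epsilon> > 0"
  obtains C where "C \<ge> 1"
    "\<And>n P R enc dec k k' (v :: ('k \<Rightarrow> nat) \<Rightarrow> 'v). P \<ge> 1 \<Longrightarrow> is_code n P R enc dec \<Longrightarrow> k \<noteq> k' \<Longrightarrow>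
      (\<integral>\<^sup>+\<omega>. ennreal (\<Sum>w\<in>messages n R.
          fibre_card (messages n R) v (\<lambda>w. quantized_output \<alpha> n P enc k' w (csi_of n est \<omega>) (csi_of n err \<omega>)) w /
          fibre_card (messages n R) v (\<lambda>w. quantized_output \<alpha> n P enc k w (csi_of n est \<omega>) (csi_of n err \<omega>)) w) \<partial>Q)
      \<le> ennreal (real (card (messages n R)) * (\<Prod>(m, t)\<in>UNIV \<times> {..<n}. C * P powr (\<alpha> k' m + \<epsilon>)))"
proof -
  obtain fmax where fmax: "fmax > 0" and density:
    "\<And>B1 B2 F b. finite B1 \<Longrightarrow> finite B2 \<Longrightarrow> B1 \<inter> B2 = {} \<Longrightarrow>
      F \<in> borel_measurable (\<Pi>\<^sub>M i\<in>B1 \<union> B2. lborel) \<Longrightarrow>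
      (\<And>y. y \<in> space (\<Pi>\<^sub>M i\<in>B2. (lborel :: complex measure)) \<Longrightarrow>
        (\<integral>\<^sup>+x. F (merge B2 B1 (y, x)) \<partial>(\<Pi>\<^sub>M i\<in>B1. lborel)) \<le> b) \<Longrightarrow>
      (\<integral>\<^sup>+\<omega>. F (\<lambda>i\<in>B1 \<union> B2. csi_entry est err i \<omega>) \<partial>Q) \<le> ennreal (fmax ^ card B1) * b"
  proof (rule bounded_densities_nn_integral[OF densities], goal_cases)
    case (1 fmax)
    show ?case by (rule 1(1), rule 1(2), rule 1(3))
  qed
  obtain Z where Z1: "Z \<ge> 1" and Z: "\<And>B. finite B \<Longrightarrow> B \<subseteq> gauss_ints \<Longrightarrow> (\<Sum>z\<in>B. max 1 ((cmod z)\<^sup>2) powr (- (1 + \<epsilon>))) \<le> Z"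
  proof (rule sum_gauss_ints_bound[OF e], goal_cases)
    case (1 Z)
    show ?case by (rule 1(1), rule 1(2), rule 1(3))
  qed
  define K where "K = CARD('k)"
  \<comment> \<open>\<open>c1\<close> covers both cases of the small-ball estimate below: 2 for
    input differences below 1 and \<open>4 / hi\<^sup>2\<close> for the others. \<open>c2\<close>
    comes from squaring \<open>real K * hi * mx u w j + sqrt 2\<close>, and \<open>vol\<close> is
    the volume of the product of discs that holds one channel vector.\<close>
  define c1 where "c1 = 4 / hi\<^sup>2 + 2"
  define c2 where "c2 = 2 * (real K * hi)\<^sup>2 + 4"
  define vol where "vol = (pi * hi\<^sup>2) ^ K"
  define C where "C = max 1 (fmax ^ K * vol * c1 * c2 powr (1 + \<epsilon>) * 5 powr \<epsilon> * Z)"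
  have c12: "c1 \<ge> 2" "c1 \<ge> 4 / hi\<^sup>2" "c2 \<ge> 4" and vol: "vol > 0"
    using hi by (auto simp: c1_def c2_def vol_def)
  show thesis
  proof (rule that)
    show "C \<ge> 1" by (simp add: C_def)
    fix n and P :: real and R :: "real ^ 'k" and k k' :: 'k and enc :: "('k, 'm) encoder" and dec :: "'k \<Rightarrow> ('k, 'm) decoder" and v :: "('k \<Rightarrow> nat) \<Rightarrow> 'v"
    assume P: "P \<ge> 1" and code: "is_code n P R enc dec" and kk': "k \<noteq> k'"
    define W where "W = messages n R"
    have finW: "finite W" by (simp add: W_def)
    define J where "J = (UNIV :: 'm set) \<times> {..<n}"
    \<comment> \<open>The entries integrated out are the deviations of user \<open>k'\<close> in the
      whole block.\<close>
    define ent where "ent j i = (Deviation, k', fst j, snd j, i)" for j :: "'m \<times> nat" and i :: 'k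
    define D where "D = (\<lambda>(j, i). ent j i) ` (J \<times> UNIV)"
    define B2 where "B2 = entry_block n - D"
    have J: "finite J" by (simp add: J_def)
    have inj: "inj_on (\<lambda>(j, i). ent j i) (J \<times> UNIV)" by (auto simp: inj_on_def ent_def)
    have D: "finite D" "D \<subseteq> entry_block n" by (auto simp: D_def J_def ent_def)
    have cardD: "card D = card J * K"
      unfolding D_def using card_image[OF inj] by (simp add: card_cartesian_product K_def)
    have memD: "(c, k1, m, t, i) \<in> D \<longleftrightarrow> c = Deviation \<and> k1 = k' \<and> t < n" for c k1 m t i
      by (auto simp: D_def J_def ent_def image_iff)
    let ?q = "\<lambda>k w g d. quantized_output \<alpha> n P enc k w g d"
    let ?na = "\<lambda>g d. fibre_card W v (\<lambda>w. ?q k w g d)"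
    let ?nb = "\<lambda>g d. fibre_card W v (\<lambda>w. ?q k' w g d)"
    \<comment> \<open>At power 1 the channel is estimate plus deviation, so the second bound
      confines each deviation to a disc about minus its estimate; the first controls the outputs at
      the actual power. Both hold almost surely.\<close>
    define bnd where "bnd g d \<longleftrightarrow> bounded_chan \<alpha> hi P n g d \<and> bounded_chan \<alpha> hi 1 n g d" for g d
    define H where "H g d = ennreal (of_bool (bnd g d) * (\<Sum>w\<in>W. ?nb g d w / ?na g d w))" for g d
    define F where "F x = H (csi_from n Estimate x) (csi_from n Deviation x)" for x
    have H_meas: "(\<lambda>p. H (fst p) (snd p)) \<in> borel_measurable (csi_space n \<Otimes>\<^sub>M csi_space n)"
    proof -
      have "Measurable.pred (csi_space n \<Otimes>\<^sub>M csi_space n) (\<lambda>p. bnd (fst p) (snd p))"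
        unfolding bnd_def
        by (intro pred_intros_logic bounded_chan_measurable[unfolded case_prod_beta'])
      then show ?thesis unfolding H_def
        by (intro measurable_compose[OF _ measurable_ennreal] borel_measurable_times of_bool_measurable
            borel_measurable_sum borel_measurable_divide
            fibre_card_measurable[OF code, folded W_def, unfolded case_prod_beta'])
    qed
    have F_meas: "F \<in> borel_measurable (\<Pi>\<^sub>M i\<in>D \<union> B2. lborel)"
    proof -
      have "D \<union> B2 = entry_block n" using D by (auto simp: B2_def)
      moreover have "(\<lambda>x. (csi_from n Estimate x, csi_from n Deviation x)) \<in>
        (\<Pi>\<^sub>M i\<in>entry_block n. lborel) \<rightarrow>\<^sub>M (csi_space n \<Otimes>\<^sub>M (csi_space n :: ('k, 'm) csi_block measure))"
        by (intro measurable_Pair csi_from_measurable)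
      from measurable_compose[OF this H_meas] have "F \<in> borel_measurable (\<Pi>\<^sub>M i\<in>entry_block n. lborel)"
        by (simp add: F_def[abs_def])
      ultimately show ?thesis by simp
    qed
    let ?b = "real (card W) * ((\<Prod>j\<in>J. vol * (c1 * P powr \<alpha> k' (fst j)) * c2 powr (1 + \<epsilon>) * (5 * P) powr \<epsilon>) * Z ^ card J)"
    have inner: "(\<integral>\<^sup>+x. F (merge B2 D (y, x)) \<partial>(\<Pi>\<^sub>M i\<in>D. lborel)) \<le> ennreal ?b" for y
    proof -
      define g0 :: "('k, 'm) csi_block" where "g0 = csi_from n Estimate y"
      define d0 :: "('k, 'm) csi_block" where "d0 = csi_from n Deviation y"
      let ?z = "\<lambda>x. merge B2 D (y, x)"
      have B2n: "(Estimate, k1, m, t, i) \<in> B2" "k1 \<noteq> k' \<Longrightarrow> (Deviation, k1, m, t, i) \<in> B2" if "t < n" for k1 m t i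
        using that by (auto simp: B2_def memD)
      have est_z: "csi_from n Estimate (?z x) = g0" for x
        unfolding g0_def csi_from_def using B2n
        by (auto simp: fun_eq_iff restrict_def block_def merge_def vec_eq_iff)
      have dev_k: "csi_from n Deviation (?z x) (k1, m, t) = d0 (k1, m, t)" if "k1 \<noteq> k'" "t < n" for x k1 m t
        unfolding d0_def using B2n that by (auto simp: csi_from_def merge_def vec_eq_iff)
      have dev_k': "csi_from n Deviation (?z x) (k', m, t) $ i = x (Deviation, k', m, t, i)" if "t < n" for x m t i
        using that by (auto simp: csi_from_nth merge_def memD B2_def)
      let ?dz = "\<lambda>x. csi_from n Deviation (?z x)"
      define l where "l w = ?q k w g0 d0" for w
      have lz: "?q k w g0 (?dz x) = l w" for w x
        unfolding l_def using kk' by (intro quantized_output_cong dev_k)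
      define nl where "nl w = fibre_card W v l w" for w
      have nl: "?na g0 (?dz x) w = nl w" for x w
        unfolding nl_def lz ..
      have nl_pos: "nl w > 0" if "w \<in> W" for w
        unfolding nl_def by (rule fibre_card_pos[OF finW that])
      let ?S = "\<lambda>w. {u\<in>W. v u = v w}"
      show ?thesis
      \<comment> \<open>The channel of user \<open>k\<close> reads frozen entries only. If it breaks
        the bound, the indicator in \<open>F\<close> vanishes for every \<open>x\<close>; otherwise
        the bound is available throughout the integration.\<close>
      proof (cases "\<forall>m. \<forall>t<n. \<forall>i. cmod (chan \<alpha> P k m (g0 (k, m, t)) (d0 (k, m, t)) $ i) \<le> hi")
        case False
        then obtain m t i where t: "t < n" and "\<not> cmod (chan \<alpha> P k m (g0 (k, m, t)) (d0 (k, m, t)) $ i) \<le> hi"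
          by auto
        then have "\<not> bnd g0 (?dz x)" for x
          unfolding bnd_def bounded_chan_def using dev_k[OF kk' t, of x m] by metis
        then have "F (?z x) = 0" for x by (simp add: F_def H_def est_z)
        then show ?thesis by simp
      next
        case True
        \<comment> \<open>The input difference of two tuples. The encoder sees the estimates only,
          so it is constant in the integration variable; this is where the ignorance of the
          transmitter enters.\<close>
        define \<Delta> where "\<Delta> u w j = enc u g0 (fst j) (snd j) - enc w g0 (fst j) (snd j)" for u w j
        obtain s where s: "\<And>u w j i. cmod (\<Delta> u w j $ i) \<le> cmod (\<Delta> u w j $ s u w j)"
        proof -
          have "\<forall>u w j. \<exists>i. \<forall>i'. cmod (\<Delta> u w j $ i') \<le> cmod (\<Delta> u w j $ i)"
            using ex_largest_component by blast
          then show ?thesis using that by metis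
        qed
        define mx where "mx u w j = cmod (\<Delta> u w j $ s u w j)" for u w j
        define sc where "sc j = complex_of_real (sqrt (P powr (- \<alpha> k' (fst j))))" for j :: "'m \<times> nat"
        define V where "V u w j i = sc j * \<Delta> u w j $ i" for u w j i
        define b where "b u w j = (\<Sum>i\<in>UNIV. g0 (k', fst j, snd j) $ i * \<Delta> u w j $ i)" for u w j
        define cc where "cc e = (case e of (_ :: csi_kind, k1 :: 'k, m, t, i) \<Rightarrow> - (g0 (k1, m, t) $ i))" for e
        \<comment> \<open>The indicator that the outputs of \<open>k'\<close> differ by at most
          \<open>sqrt 2\<close>, as they do when they have the same integer part, and that the
          deviations lie in their discs.\<close>
        define T where "T u w x = (\<Prod>j\<in>J. of_bool (cmod (b u w j + (\<Sum>i\<in>UNIV. V u w j i * x (ent j i))) \<le> sqrt 2)) *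
            (\<Prod>e\<in>D. of_bool (dist (cc e) (x e) \<le> hi) :: ennreal)" for u w x
        have T_meas: "T u w \<in> borel_measurable (\<Pi>\<^sub>M i\<in>D. lborel)" for u w
          unfolding T_def[abs_def] by (rule small_ball_measurable) (auto simp: D_def)
        have F_le: "F (?z x) \<le> (\<Sum>w\<in>W. \<Sum>u\<in>?S w. ennreal (1 / nl w) * T u w x)" for x
        proof (cases "bnd g0 (?dz x)")
          case False
          then show ?thesis by (simp add: F_def H_def est_z)
        next
          case bt: True
          have one: "of_bool (?q k' u g0 (?dz x) = ?q k' w g0 (?dz x)) \<le> T u w x" if "u \<in> W" "w \<in> W" for u w
          proof (cases "?q k' u g0 (?dz x) = ?q k' w g0 (?dz x)")
            case eq: True
            have "cmod (b u w j + (\<Sum>i\<in>UNIV. V u w j i * x (ent j i))) \<le> sqrt 2" if j: "j \<in> J" for j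
            proof -
              obtain m t where jmt: "j = (m, t)" "t < n" using j by (auto simp: J_def)
              have "gauss_floor (clean_output \<alpha> P enc k' u g0 (?dz x) m t) = gauss_floor (clean_output \<alpha> P enc k' w g0 (?dz x) m t)"
                using fun_cong[OF eq, of "(m, t)"] jmt by (simp add: quantized_output_def)
              from gauss_floor_eq_imp_dist[OF this]
              have "cmod (clean_output \<alpha> P enc k' u g0 (?dz x) m t - clean_output \<alpha> P enc k' w g0 (?dz x) m t) \<le> sqrt 2" .
              also have "clean_output \<alpha> P enc k' u g0 (?dz x) m t - clean_output \<alpha> P enc k' w g0 (?dz x) m t =
                b u w j + (\<Sum>i\<in>UNIV. V u w j i * x (ent j i))"
                unfolding clean_output_def b_def sum_subtractf[symmetric] sum.distrib[symmetric]
                using jmt(2) by (intro sum.cong refl)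
                  (simp add: jmt chan_nth dev_k' V_def sc_def \<Delta>_def ent_def scaleR_conv_of_real algebra_simps)
              finally show ?thesis .
            qed
            moreover have "dist (cc e) (x e) \<le> hi" if e: "e \<in> D" for e
            proof -
              obtain m t i where emt: "e = (Deviation, k', m, t, i)" "t < n"
                using e by (auto simp: D_def J_def ent_def)
              have "cmod (chan \<alpha> 1 k' m (g0 (k', m, t)) (?dz x (k', m, t)) $ i) \<le> hi"
                using bt emt by (simp add: bnd_def bounded_chan_def)
              moreover have "dist (cc e) (x e) = cmod (g0 (k', m, t) $ i + x e)"
                by (simp add: cc_def emt dist_norm norm_minus_commute[of "- _"] add.commute)
              ultimately show ?thesis using emt by (simp add: chan_nth dev_k')
            qed
            ultimately show ?thesis by (simp add: T_def)
          qed simp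
          have "F (?z x) = ennreal (\<Sum>w\<in>W. \<Sum>u\<in>?S w. (1 / nl w) * of_bool (?q k' u g0 (?dz x) = ?q k' w g0 (?dz x)))"
          proof -
            have "?nb g0 (?dz x) w / nl w = (\<Sum>u\<in>?S w. (1 / nl w) * of_bool (?q k' u g0 (?dz x) = ?q k' w g0 (?dz x)))" for w
            proof -
              have "?nb g0 (?dz x) w = (\<Sum>u\<in>?S w. of_bool (?q k' u g0 (?dz x) = ?q k' w g0 (?dz x)))"
                unfolding fibre_card_sum[OF finW] sum.inter_filter[OF finW]
                by (intro sum.cong) auto
              then show ?thesis unfolding sum_distrib_left[symmetric] by simp
            qed
            then show ?thesis using bt by (simp only: F_def H_def est_z nl) simp
          qed
          also have "\<dots> = (\<Sum>w\<in>W. \<Sum>u\<in>?S w. ennreal (1 / nl w) * of_bool (?q k' u g0 (?dz x) = ?q k' w g0 (?dz x)))"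
          proof -
            have "ennreal ((1 / nl w) * of_bool p) = ennreal (1 / nl w) * of_bool p" for w p
              by (cases p) auto
            moreover have "0 \<le> (1 / nl w) * of_bool p" for w p by (simp add: nl_def)
            ultimately show ?thesis
              by (simp add: sum_ennreal[symmetric] sum_nonneg del: sum_of_bool_eq sum_of_bool_mult_eq sum_mult_of_bool_eq)
          qed
          also have "\<dots> \<le> (\<Sum>w\<in>W. \<Sum>u\<in>?S w. ennreal (1 / nl w) * T u w x)"
            by (intro sum_mono mult_left_mono one) auto
          finally show ?thesis .
        qed
        define A where "A j = vol * (c1 * P powr \<alpha> k' (fst j))" for j :: "'m \<times> nat"
        have A0: "A j \<ge> 0" for j using vol c12 by (simp add: A_def)
        let ?r = "\<lambda>u w. \<Prod>j\<in>J. max 1 ((cmod (l u j - l w j))\<^sup>2) powr (- (1 + \<epsilon>))"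
        let ?p = "\<Prod>j\<in>J. A j * c2 powr (1 + \<epsilon>) * (5 * P) powr \<epsilon>"
        have p0: "?p \<ge> 0" using A0 by (intro prod_nonneg) auto
        have T_int: "(\<integral>\<^sup>+x. T u w x \<partial>(\<Pi>\<^sub>M i\<in>D. lborel)) \<le> ennreal (?p * ?r u w)" if uw: "u \<in> W" "w \<in> W" for u w
        proof -
          \<comment> \<open>Then \<open>vol * \<kappa> j\<close> is
            \<open>A j / (1 + (mx u w j)\<^sup>2)\<close>, the form that
            \<open>alignment_weight_bound\<close> expects.\<close>
          define \<kappa> where "\<kappa> j = c1 * P powr \<alpha> k' (fst j) / (1 + (mx u w j)\<^sup>2)" for j
          have "(\<integral>\<^sup>+x. T u w x \<partial>(\<Pi>\<^sub>M i\<in>D. lborel)) \<le> (\<Prod>j\<in>J. ennreal ((pi * hi\<^sup>2) ^ CARD('k) * \<kappa> j))"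
            unfolding T_def
          proof (rule small_ball_integral[OF J inj hi D_def, where s = "s u w"])
            fix j assume "j \<in> J"
            have den: "1 + (mx u w j)\<^sup>2 > 0" by (simp add: add_pos_nonneg)
            show "0 \<le> \<kappa> j" using den c12 by (simp add: \<kappa>_def)
            have P1: "P powr \<alpha> k' (fst j) \<ge> 1" using P quality by (simp add: ge_one_powr_ge_zero)
            show "\<kappa> j \<ge> 1 \<or> (V u w j (s u w j) \<noteq> 0 \<and>
              (sqrt 2)\<^sup>2 \<le> \<kappa> j * hi\<^sup>2 * (cmod (V u w j (s u w j)))\<^sup>2)"
            \<comment> \<open>For small input differences the trivial alternative
              \<open>\<kappa> j \<ge> 1\<close> holds; for the others the coefficient at the largest
              entry has squared modulus at least
              \<open>P powr (- \<alpha> k' (fst j))\<close>.\<close>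
            proof (cases "mx u w j \<ge> 1")
              case False
              then have "(mx u w j)\<^sup>2 \<le> 1" by (simp add: mx_def power_le_one)
              then have "1 + (mx u w j)\<^sup>2 \<le> 2 * 1" by simp
              also have "\<dots> \<le> c1 * P powr \<alpha> k' (fst j)"
                using c12 P1 by (intro mult_mono) auto
              finally show ?thesis using den by (simp add: \<kappa>_def)
            next
              case mx1: True
              then have mx2: "(mx u w j)\<^sup>2 \<ge> 1" by simp
              have cV: "(cmod (V u w j (s u w j)))\<^sup>2 = P powr (- \<alpha> k' (fst j)) * (mx u w j)\<^sup>2"
                by (simp add: V_def sc_def mx_def norm_mult power_mult_distrib)
              have "2 * (1 + (mx u w j)\<^sup>2) \<le> 4 * (mx u w j)\<^sup>2" using mx2 by simp
              also have "\<dots> = (4 / hi\<^sup>2) * (hi\<^sup>2 * (mx u w j)\<^sup>2)" using hi by simp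
              also have "\<dots> \<le> c1 * (hi\<^sup>2 * (mx u w j)\<^sup>2)"
                using c12 by (intro mult_right_mono) auto
              finally have "2 \<le> c1 * (hi\<^sup>2 * (mx u w j)\<^sup>2) / (1 + (mx u w j)\<^sup>2)"
                using den by (simp add: le_divide_eq)
              also have "\<dots> = c1 * (P powr \<alpha> k' (fst j) * P powr (- \<alpha> k' (fst j))) * (hi\<^sup>2 * (mx u w j)\<^sup>2) / (1 + (mx u w j)\<^sup>2)"
                using P by (simp add: powr_add[symmetric])
              also have "\<dots> = \<kappa> j * hi\<^sup>2 * (cmod (V u w j (s u w j)))\<^sup>2"
                unfolding cV \<kappa>_def by simp
              finally show ?thesis using mx1 P by (auto simp: V_def sc_def mx_def)
            qed
          qed simp
          also have "\<dots> = ennreal (\<Prod>j\<in>J. A j / (1 + (mx u w j)\<^sup>2))"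
          proof -
            have "(pi * hi\<^sup>2) ^ CARD('k) * \<kappa> j = A j / (1 + (mx u w j)\<^sup>2)" for j
              by (simp add: \<kappa>_def A_def vol_def K_def)
            then show ?thesis using A0 by (simp add: prod_ennreal)
          qed
          also have "\<dots> \<le> ennreal (?p * ?r u w)"
          proof (intro ennreal_leI alignment_weight_bound J P e A0)
            show "c2 \<ge> 1" using c12 by simp
            \<comment> \<open>Two codewords of average power \<open>P\<close> have a difference of
              average power at most \<open>4 * P\<close>.\<close>
            have "(\<Sum>j\<in>J. (mx u w j)\<^sup>2) \<le> (\<Sum>j\<in>J. 2 * (case j of (m, t) \<Rightarrow> (norm (enc u g0 m t))\<^sup>2) + 2 * (case j of (m, t) \<Rightarrow> (norm (enc w g0 m t))\<^sup>2))"
            proof (rule sum_mono)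
              fix j :: "'m \<times> nat"
              obtain m t where j: "j = (m, t)" by (cases j)
              have "mx u w j \<le> norm (\<Delta> u w j)"
                unfolding mx_def by (rule Finite_Cartesian_Product.norm_nth_le)
              also have "\<dots> \<le> norm (enc u g0 m t) + norm (enc w g0 m t)"
                unfolding \<Delta>_def j by (simp add: norm_triangle_ineq4)
              finally have "(mx u w j)\<^sup>2 \<le> (norm (enc u g0 m t) + norm (enc w g0 m t))\<^sup>2"
                by (intro power_mono) (simp_all add: mx_def)
              also have "\<dots> \<le> 2 * (norm (enc u g0 m t))\<^sup>2 + 2 * (norm (enc w g0 m t))\<^sup>2"
                using zero_le_power2[of "norm (enc u g0 m t) - norm (enc w g0 m t)"]
                by (simp add: power2_eq_square algebra_simps)
              finally show "(mx u w j)\<^sup>2 \<le> 2 * (case j of (m, t) \<Rightarrow> (norm (enc u g0 m t))\<^sup>2) + 2 * (case j of (m, t) \<Rightarrow> (norm (enc w g0 m t))\<^sup>2)"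
                by (simp add: j)
            qed
            also have "\<dots> \<le> 2 * (P * real (card J)) + 2 * (P * real (card J))"
              unfolding sum.distrib sum_distrib_left[symmetric] J_def
              using uw unfolding W_def by (intro add_mono mult_left_mono code_power[OF code]) auto
            finally show "(\<Sum>j\<in>J. (mx u w j)\<^sup>2) \<le> 4 * P * real (card J)" by simp
            fix j assume "j \<in> J"
            then obtain m t where j: "j = (m, t)" "t < n" by (auto simp: J_def)
            have mx0: "mx u w j \<ge> 0" by (simp add: mx_def)
            have lj: "l u j - l w j = gauss_floor (clean_output \<alpha> P enc k u g0 d0 m t) - gauss_floor (clean_output \<alpha> P enc k w g0 d0 m t)" 
              using j by (simp add: l_def quantized_output_def)
            have "cmod (l u j - l w j) \<le> cmod (clean_output \<alpha> P enc k u g0 d0 m t - clean_output \<alpha> P enc k w g0 d0 m t) + sqrt 2"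
              unfolding lj by (rule cmod_gauss_floor_diff)
            also have "\<dots> \<le> real K * hi * mx u w j + sqrt 2"
              unfolding K_def
            proof (intro add_right_mono clean_output_diff_bound)
              show "cmod (chan \<alpha> P k m (g0 (k, m, t)) (d0 (k, m, t)) $ i) \<le> hi" for i
                using True j by blast
              show "cmod ((enc u g0 m t - enc w g0 m t) $ i) \<le> mx u w j" for i
                using s[of u w j i] by (simp add: mx_def \<Delta>_def j)
            qed
            finally have "(cmod (l u j - l w j))\<^sup>2 \<le> (real K * hi * mx u w j + sqrt 2)\<^sup>2"
              by (intro power_mono) auto
            also have "\<dots> \<le> 2 * (real K * hi * mx u w j)\<^sup>2 + 2 * (sqrt 2)\<^sup>2"
              using zero_le_power2[of "real K * hi * mx u w j - sqrt 2"]
              by (simp only: power2_sum power2_diff)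
            also have "\<dots> = 2 * (real K * hi)\<^sup>2 * (mx u w j)\<^sup>2 + 4"
              by (simp add: power_mult_distrib)
            also have "\<dots> \<le> c2 * (mx u w j)\<^sup>2 + c2"
              by (intro add_mono mult_right_mono) (auto simp: c2_def)
            also have "\<dots> = c2 * (1 + (mx u w j)\<^sup>2)" by (simp add: algebra_simps)
            finally have "(cmod (l u j - l w j))\<^sup>2 \<le> c2 * (1 + (mx u w j)\<^sup>2)" .
            moreover have "1 * 1 \<le> c2 * (1 + (mx u w j)\<^sup>2)"
              using c12 by (intro mult_mono) auto
            ultimately show "max 1 ((cmod (l u j - l w j))\<^sup>2) \<le> c2 * (1 + (mx u w j)\<^sup>2)" by simp
          qed
          finally show ?thesis .
        qed
        have "(\<integral>\<^sup>+x. F (?z x) \<partial>(\<Pi>\<^sub>M i\<in>D. lborel)) \<le>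
          (\<integral>\<^sup>+x. (\<Sum>w\<in>W. \<Sum>u\<in>?S w. ennreal (1 / nl w) * T u w x) \<partial>(\<Pi>\<^sub>M i\<in>D. lborel))"
          by (intro nn_integral_mono F_le)
        also have "\<dots> = (\<Sum>w\<in>W. \<Sum>u\<in>?S w. ennreal (1 / nl w) * (\<integral>\<^sup>+x. T u w x \<partial>(\<Pi>\<^sub>M i\<in>D. lborel)))"
          using T_meas by (simp add: nn_integral_sum nn_integral_cmult borel_measurable_sum)
        also have "\<dots> \<le> (\<Sum>w\<in>W. \<Sum>u\<in>?S w. ennreal (1 / nl w) * ennreal (?p * ?r u w))"
          by (intro sum_mono mult_left_mono T_int) auto
        also have "\<dots> = ennreal (\<Sum>w\<in>W. \<Sum>u\<in>?S w. (1 / nl w) * (?p * ?r u w))"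
        proof -
          have r0: "0 \<le> ?p * ?r u w" for u w
            by (intro mult_nonneg_nonneg p0 prod_nonneg) simp
          have n0: "0 \<le> 1 / nl w" for w by (simp add: nl_def)
          have nn: "0 \<le> (1 / nl w) * (?p * ?r u w)" for u w
            by (intro mult_nonneg_nonneg[of "1 / nl w"] r0 n0)
          have "ennreal (1 / nl w) * ennreal (?p * ?r u w) = ennreal ((1 / nl w) * (?p * ?r u w))" for u w
            by (intro ennreal_mult[symmetric] r0 n0)
          then show ?thesis
            using nn by (simp only: sum_ennreal sum_nonneg)
        qed
        also have "\<dots> = ennreal (?p * (\<Sum>w\<in>W. \<Sum>u\<in>?S w. (1 / nl w) * ?r u w))"
          by (simp only: sum_distrib_left mult.left_commute)
        also have "\<dots> \<le> ennreal (?p * (real (card W) * Z ^ card J))"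
          unfolding nl_def using p0
        proof (intro ennreal_leI mult_left_mono sum_aligned_pairs_bound[OF Z finW J])
          show "l w \<in> extensional J" for w
            by (simp add: l_def quantized_output_def J_def)
          show "l w j \<in> gauss_ints" if "j \<in> J" for w j
            using that by (auto simp: l_def quantized_output_def J_def gauss_floor_in)
        qed
        also have "?p * (real (card W) * Z ^ card J) = ?b" by (simp add: A_def)
        finally show ?thesis .
      qed
    qed
    have DB: "D \<union> B2 = entry_block n" using D by (auto simp: B2_def)
    have "(\<integral>\<^sup>+\<omega>. ennreal (\<Sum>w\<in>W. ?nb (csi_of n est \<omega>) (csi_of n err \<omega>) w / ?na (csi_of n est \<omega>) (csi_of n err \<omega>) w) \<partial>Q)
      = (\<integral>\<^sup>+\<omega>. F (\<lambda>i\<in>D \<union> B2. csi_entry est err i \<omega>) \<partial>Q)"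
    proof (rule nn_integral_cong_AE)
      show "AE \<omega> in Q. ennreal (\<Sum>w\<in>W. ?nb (csi_of n est \<omega>) (csi_of n err \<omega>) w / ?na (csi_of n est \<omega>) (csi_of n err \<omega>) w)
        = F (\<lambda>i\<in>D \<union> B2. csi_entry est err i \<omega>)"
        using bd[OF P, of n] bd[of 1 n, simplified]
        by eventually_elim
          (simp add: F_def H_def bnd_def DB csi_of_eq_csi_from(1)[of n est _ err, symmetric] csi_of_eq_csi_from(2)[of n err _ est, symmetric])
    qed
    also have "\<dots> \<le> ennreal (fmax ^ card D) * ennreal ?b"
      by (rule density[OF D(1) _ _ F_meas inner]) (auto simp: B2_def)
    also have "\<dots> = ennreal (fmax ^ card D * ?b)"
      using fmax by (intro ennreal_mult[symmetric] mult_nonneg_nonneg prod_nonneg) (use vol c12 Z1 in auto)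
    also have "\<dots> \<le> ennreal (real (card W) * (\<Prod>(m, t)\<in>J. C * P powr (\<alpha> k' m + \<epsilon>)))"
    proof (intro ennreal_leI)
      have "fmax ^ card D * ?b = real (card W) * ((\<Prod>j\<in>J. fmax ^ K) * (\<Prod>j\<in>J. vol * (c1 * P powr \<alpha> k' (fst j)) * c2 powr (1 + \<epsilon>) * (5 * P) powr \<epsilon>) * (\<Prod>j\<in>J. Z))"
        by (simp add: cardD power_mult[symmetric] mult.commute mult.left_commute)
      also have "\<dots> = real (card W) * (\<Prod>j\<in>J. fmax ^ K * vol * c1 * c2 powr (1 + \<epsilon>) * 5 powr \<epsilon> * Z * P powr (\<alpha> k' (fst j) + \<epsilon>))"
        unfolding prod.distrib[symmetric]
        using P by (intro arg_cong[where f="(*) _"] prod.cong refl) (simp add: powr_add powr_mult)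
      also have "\<dots> \<le> real (card W) * (\<Prod>j\<in>J. C * P powr (\<alpha> k' (fst j) + \<epsilon>))"
        using fmax vol c12 Z1
        by (intro mult_left_mono prod_mono conjI mult_right_mono mult_nonneg_nonneg) (auto simp: C_def)
      finally show "fmax ^ card D * ?b \<le> real (card W) * (\<Prod>(m, t)\<in>J. C * P powr (\<alpha> k' m + \<epsilon>))"
        by (simp add: case_prod_beta')
    qed
    finally show "(\<integral>\<^sup>+\<omega>. ennreal (\<Sum>w\<in>messages n R.
          fibre_card (messages n R) v (\<lambda>w. quantized_output \<alpha> n P enc k' w (csi_of n est \<omega>) (csi_of n err \<omega>)) w /
          fibre_card (messages n R) v (\<lambda>w. quantized_output \<alpha> n P enc k w (csi_of n est \<omega>) (csi_of n err \<omega>)) w) \<partial>Q)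
      \<le> ennreal (real (card (messages n R)) * (\<Prod>(m, t)\<in>UNIV \<times> {..<n}. C * P powr (\<alpha> k' m + \<epsilon>)))"
      by (simp only: W_def J_def)
  qed
qed

section \<open>Decoding and posterior probabilities\<close>

lemma sets_PiM_cgauss: "sets (\<Pi>\<^sub>M j\<in>I. cgauss) = sets (\<Pi>\<^sub>M j\<in>I. borel)"
  "sets (\<Pi>\<^sub>M j\<in>I. cgauss_wide) = sets (\<Pi>\<^sub>M j\<in>I. borel)"
  by (auto intro!: sets_PiM_cong)

lemma dec_measurable:
  assumes code: "is_code n P R enc dec"
    and y: "y \<in> M \<rightarrow>\<^sub>M (\<Pi>\<^sub>M j\<in>UNIV \<times> {..<n}. borel)"
    and g: "g \<in> M \<rightarrow>\<^sub>M csi_space n" and d: "d \<in> M \<rightarrow>\<^sub>M csi_space n"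
  shows "(\<lambda>x. dec k (y x, g x, d x)) \<in> M \<rightarrow>\<^sub>M count_space UNIV"
proof -
  have "dec k \<in> (\<Pi>\<^sub>M j\<in>UNIV \<times> {..<n}. borel) \<Otimes>\<^sub>M csi_space n \<Otimes>\<^sub>M csi_space n \<rightarrow>\<^sub>M count_space UNIV"
    using code by (auto simp: is_code_def)
  then show ?thesis
    by (rule measurable_compose[rotated]) (intro measurable_Pair y g d)
qed

text \<open>The received signal is the quantised output plus a rounding error plus noise. Once the
  rounding error is absorbed into the wider noise, the decoder depends on \<open>w\<close> only
  through the quantised output, and \<open>card_low_posterior_le\<close> applies for every noise
  value. The last factor is the total mass of the wider noise.\<close>

lemma low_posterior_integral:
  fixes enc :: "('k::finite, 'm::finite) encoder" and v :: "('k \<Rightarrow> nat) \<Rightarrow> 'v"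
  assumes code: "is_code n P R enc dec" and g: "g \<in> space (csi_space n)" and d: "d \<in> space (csi_space n)"
    and \<delta>: "\<delta> \<ge> 0"
  defines "W \<equiv> messages n R"
  shows "(\<integral>\<^sup>+z. ennreal (\<Sum>w\<in>W. of_bool (dec k (received \<alpha> n P enc k w g d z, g, d) = w k \<and>
      fibre_card W (\<lambda>w. (v w, w k)) (\<lambda>w. quantized_output \<alpha> n P enc k w g d) w <
      \<delta> * fibre_card W v (\<lambda>w. quantized_output \<alpha> n P enc k w g d) w)) \<partial>(\<Pi>\<^sub>M j\<in>block n. cgauss))
    \<le> ennreal (\<delta> * card W * (2 * exp 2) ^ (CARD('k) * CARD('m) * n))"
proof -
  let ?J = "(UNIV :: 'm set) \<times> {..<n}"
  define q where "q w = quantized_output \<alpha> n P enc k w g d" for w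
  define B where "B w \<longleftrightarrow> fibre_card W (\<lambda>w. (v w, w k)) q w < \<delta> * fibre_card W v q w" for w
  define D where "D x z = dec k (\<lambda>(m, t)\<in>?J. x (m, t) + z (k, m, t), g, d)" for x :: "'m \<times> nat \<Rightarrow> complex" and z
  define F where "F w z = (of_bool (D (q w) z = w k \<and> B w) :: real)" for w z
  \<comment> \<open>Only the noise of user \<open>k\<close> is moved by the rounding error; all
    other coordinates have shift 0.\<close>
  define r where "r w j = (case j of (k1, m, t) \<Rightarrow>
    if k1 = k then clean_output \<alpha> P enc k w g d m t - gauss_floor (clean_output \<alpha> P enc k w g d m t) else 0)" for w j
  have finW: "finite W" by (simp add: W_def)
  have F_meas: "(\<lambda>z. ennreal (F w z)) \<in> borel_measurable (\<Pi>\<^sub>M j\<in>block n. borel)" for w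
  proof -
    have "(\<lambda>z. \<lambda>j\<in>?J. q w (fst j, snd j) + z (k, fst j, snd j)) \<in>
      (\<Pi>\<^sub>M j\<in>block n. borel) \<rightarrow>\<^sub>M (\<Pi>\<^sub>M j\<in>?J. borel)"
      by (intro measurable_restrict borel_measurable_add borel_measurable_const
          measurable_component_singleton[where M="\<lambda>_. borel"]) auto
    then have "(\<lambda>z. D (q w) z) \<in> (\<Pi>\<^sub>M j\<in>block n. borel) \<rightarrow>\<^sub>M count_space UNIV"
      unfolding D_def case_prod_beta' by (intro dec_measurable[OF code] measurable_const g d)
    then have "Measurable.pred (\<Pi>\<^sub>M j\<in>block n. borel) (\<lambda>z. D (q w) z = w k \<and> B w)"
      by measurable
    then show ?thesis unfolding F_def
      by (intro measurable_compose[OF _ measurable_ennreal] of_bool_measurable)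
  qed
  have shift: "F w (\<lambda>j\<in>block n. r w j + z j) = of_bool (dec k (received \<alpha> n P enc k w g d z, g, d) = w k \<and> B w)" for w z
  proof -
    have "(\<lambda>(m, t)\<in>?J. q w (m, t) + (\<lambda>j\<in>block n. r w j + z j) (k, m, t)) = received \<alpha> n P enc k w g d z"
      unfolding received_clean_output
      by (auto simp: fun_eq_iff q_def r_def quantized_output_def restrict_def)
    then show ?thesis by (simp only: F_def D_def)
  qed
  have shifted_meas: "(\<lambda>z. ennreal (F w (\<lambda>j\<in>block n. r w j + z j))) \<in> borel_measurable (\<Pi>\<^sub>M j\<in>block n. cgauss)" for w
  proof -
    have "(\<lambda>z. \<lambda>j\<in>block n. r w j + z j) \<in> (\<Pi>\<^sub>M j\<in>block n. borel) \<rightarrow>\<^sub>M (\<Pi>\<^sub>M j\<in>block n. borel)"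
      by (intro measurable_restrict borel_measurable_add borel_measurable_const
          measurable_component_singleton[where M="\<lambda>_. borel"])
    from measurable_compose[OF this F_meas] show ?thesis
      unfolding measurable_cong_sets[OF sets_PiM_cgauss(1) refl] .
  qed
  have "(\<integral>\<^sup>+z. ennreal (\<Sum>w\<in>W. F w (\<lambda>j\<in>block n. r w j + z j)) \<partial>(\<Pi>\<^sub>M j\<in>block n. cgauss)) =
    (\<integral>\<^sup>+z. (\<Sum>w\<in>W. ennreal (F w (\<lambda>j\<in>block n. r w j + z j))) \<partial>(\<Pi>\<^sub>M j\<in>block n. cgauss))"
    by (intro nn_integral_cong sum_ennreal[symmetric]) (simp add: F_def)
  also have "\<dots> = (\<Sum>w\<in>W. \<integral>\<^sup>+z. ennreal (F w (\<lambda>j\<in>block n. r w j + z j)) \<partial>(\<Pi>\<^sub>M j\<in>block n. cgauss))"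
    by (intro nn_integral_sum shifted_meas)
  also have "\<dots> \<le> (\<Sum>w\<in>W. \<integral>\<^sup>+z. ennreal (F w z) \<partial>(\<Pi>\<^sub>M j\<in>block n. cgauss_wide))"
    by (intro sum_mono PiM_cgauss_shift F_meas) (auto simp: r_def cmod_frac)
  also have "\<dots> = (\<integral>\<^sup>+z. (\<Sum>w\<in>W. ennreal (F w z)) \<partial>(\<Pi>\<^sub>M j\<in>block n. cgauss_wide))"
    by (intro nn_integral_sum[symmetric]) (simp only: measurable_cong_sets[OF sets_PiM_cgauss(2) refl] F_meas)
  also have "\<dots> \<le> (\<integral>\<^sup>+z. ennreal (\<delta> * card W) \<partial>(\<Pi>\<^sub>M j\<in>(block n :: ('k \<times> 'm \<times> nat) set). cgauss_wide))"
  proof (intro nn_integral_mono)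
    fix z
    have "(\<Sum>w\<in>W. F w z) = real (card {w\<in>W. D (q w) z = w k \<and> B w})"
      unfolding F_def using finW by (subst sum_of_bool_eq) (auto intro!: arg_cong[where f=card])
    also have "{w\<in>W. D (q w) z = w k \<and> B w} =
      {w\<in>W. (\<lambda>x. D (snd x) z) (v w, q w) = w k \<and>
      real (card {u\<in>W. (v u, q u) = (v w, q w) \<and> u k = w k}) < \<delta> * real (card {u\<in>W. (v u, q u) = (v w, q w)})}"
      unfolding B_def fibre_card_def by (simp add: conj_ac)
    also have "real (card \<dots>) \<le> \<delta> * card W"
      by (rule card_low_posterior_le[OF finW \<delta>])
    finally have "(\<Sum>w\<in>W. F w z) \<le> \<delta> * card W" .
    then show "(\<Sum>w\<in>W. ennreal (F w z)) \<le> ennreal (\<delta> * card W)"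
      by (subst sum_ennreal) (auto simp: F_def intro!: ennreal_leI)
  qed
  also have "\<dots> = ennreal (\<delta> * card W) * ennreal ((2 * exp 2) ^ card (block n :: ('k \<times> 'm \<times> nat) set))"
    by (simp add: emeasure_PiM_cgauss_wide)
  also have "\<dots> = ennreal (\<delta> * card W * (2 * exp 2) ^ (CARD('k) * CARD('m) * n))"
    using \<delta> by (simp add: ennreal_mult card_block)
  finally show ?thesis
    by (simp only: shift B_def q_def[abs_def])
qed

context partial_csit_bc
begin

definition decoding_error ::
  "nat \<Rightarrow> real \<Rightarrow> ('k, 'm) encoder \<Rightarrow> ('k \<Rightarrow> ('k, 'm) decoder) \<Rightarrow> ('k \<Rightarrow> nat) \<Rightarrow> 'a \<Rightarrow> ('k \<times> 'm \<times> nat \<Rightarrow> complex) \<Rightarrow> bool"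
  where "decoding_error n P enc dec w \<omega> z \<longleftrightarrow>
    (\<exists>k. dec k (received \<alpha> n P enc k w (csi_of n est \<omega>) (csi_of n err \<omega>) z, csi_of n est \<omega>, csi_of n err \<omega>) \<noteq> w k)"

abbreviation noise_law :: "nat \<Rightarrow> ('k \<times> 'm \<times> nat \<Rightarrow> complex) measure" where
  "noise_law n \<equiv> \<Pi>\<^sub>M j\<in>block n. cgauss"

lemma prob_space_noise_law: "prob_space (noise_law n)"
  by (rule prob_space_PiM) (rule prob_space_cgauss)

lemma dec_received_measurable:
  assumes code: "is_code n P R enc dec" and w: "w \<in> messages n R"
  shows "(\<lambda>(\<omega>, z). dec k (received \<alpha> n P enc k w (csi_of n est \<omega>) (csi_of n err \<omega>) z, csi_of n est \<omega>, csi_of n err \<omega>))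
    \<in> Q \<Otimes>\<^sub>M noise_law n \<rightarrow>\<^sub>M count_space UNIV"
proof -
  have csi: "(\<lambda>p. csi_of n est (fst p)) \<in> Q \<Otimes>\<^sub>M noise_law n \<rightarrow>\<^sub>M csi_space n"
    "(\<lambda>p. csi_of n err (fst p)) \<in> Q \<Otimes>\<^sub>M noise_law n \<rightarrow>\<^sub>M csi_space n"
    by measurable
  have "(\<lambda>p. \<lambda>j\<in>UNIV \<times> {..<n}. clean_output \<alpha> P enc k w (csi_of n est (fst p)) (csi_of n err (fst p)) (fst j) (snd j) +
      snd p (k, fst j, snd j)) \<in> Q \<Otimes>\<^sub>M noise_law n \<rightarrow>\<^sub>M (\<Pi>\<^sub>M j\<in>UNIV \<times> {..<n}. borel)"
  proof (intro measurable_restrict borel_measurable_add)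
    fix j :: "'m \<times> nat" assume "j \<in> UNIV \<times> {..<n}"
    then have t: "snd j < n" by auto
    from measurable_compose[OF measurable_Pair[OF csi] clean_output_measurable[OF code w t]]
    show "(\<lambda>p. clean_output \<alpha> P enc k w (csi_of n est (fst p)) (csi_of n err (fst p)) (fst j) (snd j))
      \<in> borel_measurable (Q \<Otimes>\<^sub>M noise_law n)" by simp
    have "(\<lambda>z. z (k, fst j, snd j)) \<in> noise_law n \<rightarrow>\<^sub>M cgauss"
      using t by (intro measurable_component_singleton) (simp add: block_def mem_Times_iff)
    then have "(\<lambda>z. z (k, fst j, snd j)) \<in> borel_measurable (noise_law n)"
      by (simp add: measurable_cong_sets[OF refl sets_cgauss])
    from measurable_compose[OF measurable_snd this]
    show "(\<lambda>p. snd p (k, fst j, snd j)) \<in> borel_measurable (Q \<Otimes>\<^sub>M noise_law n)" .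
  qed
  then show ?thesis
    unfolding received_clean_output case_prod_beta' by (intro dec_measurable[OF code] csi)
qed

lemma decoding_error_measurable:
  assumes code: "is_code n P R enc dec" and w: "w \<in> messages n R"
  shows "Measurable.pred (Q \<Otimes>\<^sub>M noise_law n) (\<lambda>(\<omega>, z). decoding_error n P enc dec w \<omega> z)"
proof -
  note dec_received_measurable[OF code w, unfolded case_prod_beta', measurable]
  show ?thesis unfolding decoding_error_def case_prod_beta' by measurable
qed

text \<open>Fubini for the joint law; the uniform law of the messages becomes an average under the
  integral over the noise.\<close>

lemma error_prob_eq:
  assumes code: "is_code n P R enc dec"
  shows "ennreal (error_prob Q est err \<alpha> n P R enc dec) =
    (\<integral>\<^sup>+\<omega>. \<integral>\<^sup>+z. ennreal ((\<Sum>w\<in>messages n R. of_bool (decoding_error n P enc dec w \<omega> z)) / card (messages n R)) \<partial>noise_law n \<partial>Q)"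
proof -
  define W where "W = messages n R"
  have W: "finite W" "W \<noteq> {}" by (auto simp: W_def messages_nonempty)
  then have cW: "real (card W) > 0" by (simp add: card_gt_0_iff)
  let ?N = "Q \<Otimes>\<^sub>M noise_law n" and ?U = "uniform_count_measure W"
  interpret N: prob_space "noise_law n :: ('k \<times> 'm \<times> nat \<Rightarrow> complex) measure" by (rule prob_space_noise_law)
  interpret QN: pair_prob_space Q "noise_law n :: ('k \<times> 'm \<times> nat \<Rightarrow> complex) measure" ..
  interpret U: prob_space ?U using W by (intro prob_space_uniform_count_measure)
  interpret J: pair_prob_space ?U ?N ..
  let ?E = "\<lambda>w \<omega> z. decoding_error n P enc dec w \<omega> z"
  have setsU: "sets ?U = sets (count_space W)" by (simp add: sets_uniform_count_measure)
  have E: "(\<lambda>p. ?E (fst p) (fst (snd p)) (snd (snd p))) \<in> ?U \<Otimes>\<^sub>M ?N \<rightarrow>\<^sub>M count_space UNIV"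
  proof -
    have "(\<lambda>p. ?E (fst p) (fst (snd p)) (snd (snd p))) \<in> count_space W \<Otimes>\<^sub>M ?N \<rightarrow>\<^sub>M count_space UNIV"
    proof (rule measurable_pair_measure_countable1)
      show "countable W" using W by (simp add: countable_finite)
      fix w assume "w \<in> W"
      then show "(\<lambda>y. ?E (fst (w, y)) (fst (snd (w, y))) (snd (snd (w, y)))) \<in> ?N \<rightarrow>\<^sub>M count_space UNIV"
        using decoding_error_measurable[OF code, of w] by (simp add: W_def case_prod_beta')
    qed
    then show ?thesis
      using measurable_cong_sets[OF sets_pair_measure_cong[OF setsU refl] refl] by blast
  qed
  have ind: "(\<lambda>p. ennreal (of_bool (?E (fst p) (fst (snd p)) (snd (snd p))))) \<in> borel_measurable (?U \<Otimes>\<^sub>M ?N)"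
    by (rule measurable_compose[OF E]) simp
  let ?A = "{p \<in> space (joint_law Q n R). ?E (fst p) (fst (snd p)) (snd (snd p))}"
  have jl: "joint_law Q n R = ?U \<Otimes>\<^sub>M ?N" by (simp add: joint_law_def W_def)
  have "ennreal (error_prob Q est err \<alpha> n P R enc dec) = emeasure (?U \<Otimes>\<^sub>M ?N) ?A"
    unfolding error_prob_def decoding_error_def jl J.emeasure_eq_measure by (simp add: case_prod_beta')
  also have "\<dots> = (\<integral>\<^sup>+p. ennreal (of_bool (?E (fst p) (fst (snd p)) (snd (snd p)))) \<partial>(?U \<Otimes>\<^sub>M ?N))"
  proof -
    have A: "?A \<in> sets (?U \<Otimes>\<^sub>M ?N)" unfolding jl using E by measurable
    show ?thesis
      unfolding nn_integral_indicator[OF A, symmetric]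
      by (intro nn_integral_cong) (auto simp: jl indicator_def)
  qed
  also have "\<dots> = (\<integral>\<^sup>+w. \<integral>\<^sup>+p. ennreal (of_bool (?E w (fst p) (snd p))) \<partial>?N \<partial>?U)"
    using QN.P.nn_integral_fst[OF ind] by simp
  also have "\<dots> = (\<Sum>w\<in>W. (\<integral>\<^sup>+p. ennreal (of_bool (?E w (fst p) (snd p))) \<partial>?N) / ennreal (card W))"
  proof -
    have "(\<integral>\<^sup>+w. f w \<partial>?U) = (\<Sum>w\<in>W. f w / ennreal (card W))" for f :: "('k \<Rightarrow> nat) \<Rightarrow> ennreal"
      unfolding uniform_count_measure_def using W cW
      by (subst nn_integral_point_measure_finite) (auto simp: divide_ennreal_def inverse_ennreal mult.commute inverse_eq_divide intro!: sum.cong)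
    then show ?thesis .
  qed
  also have "\<dots> = (\<Sum>w\<in>W. (\<integral>\<^sup>+p. ennreal (of_bool (?E w (fst p) (snd p)) / card W) \<partial>?N))"
  proof (intro sum.cong refl)
    fix w assume w: "w \<in> W"
    have m: "(\<lambda>p. ennreal (of_bool (?E w (fst p) (snd p)))) \<in> borel_measurable ?N"
      by (intro measurable_compose[OF _ measurable_ennreal] of_bool_measurable)
        (use decoding_error_measurable[OF code, of w] w in \<open>simp add: W_def case_prod_beta'\<close>)
    show "(\<integral>\<^sup>+p. ennreal (of_bool (?E w (fst p) (snd p))) \<partial>?N) / ennreal (card W) =
      (\<integral>\<^sup>+p. ennreal (of_bool (?E w (fst p) (snd p)) / card W) \<partial>?N)"
      using cW by (subst nn_integral_divide[OF m, symmetric]) (simp add: divide_ennreal)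
  qed
  also have "\<dots> = (\<integral>\<^sup>+p. (\<Sum>w\<in>W. ennreal (of_bool (?E w (fst p) (snd p)) / card W)) \<partial>?N)"
  proof (intro nn_integral_sum[symmetric])
    fix w assume w: "w \<in> W"
    show "(\<lambda>p. ennreal (of_bool (?E w (fst p) (snd p)) / card W)) \<in> borel_measurable ?N"
      by (intro measurable_compose[OF _ measurable_ennreal] borel_measurable_divide borel_measurable_const of_bool_measurable)
        (use decoding_error_measurable[OF code, of w] w in \<open>simp add: W_def case_prod_beta'\<close>)
  qed
  also have "\<dots> = (\<integral>\<^sup>+p. ennreal ((\<Sum>w\<in>W. of_bool (?E w (fst p) (snd p))) / card W) \<partial>?N)"
    by (simp add: sum_divide_distrib del: sum_of_bool_eq)
  also have "\<dots> = (\<integral>\<^sup>+\<omega>. \<integral>\<^sup>+z. ennreal ((\<Sum>w\<in>W. of_bool (?E w \<omega> z)) / card W) \<partial>noise_law n \<partial>Q)"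
  proof -
    have m: "(\<lambda>p. ennreal ((\<Sum>w\<in>W. of_bool (?E w (fst p) (snd p))) / card W)) \<in> borel_measurable ?N"
      by (intro measurable_compose[OF _ measurable_ennreal] borel_measurable_divide borel_measurable_const borel_measurable_sum of_bool_measurable)
        (use decoding_error_measurable[OF code] in \<open>simp add: W_def case_prod_beta'\<close>)
    show ?thesis using N.nn_integral_fst[OF m] by simp
  qed
  finally show ?thesis unfolding W_def .
qed

end

lemma cmod_clean_output_le:
  fixes enc :: "('k::finite, 'm::finite) encoder"
  assumes bd: "\<And>i. cmod (chan \<alpha> P k m (g (k, m, t)) (d (k, m, t)) $ i) \<le> hi"
  shows "cmod (clean_output \<alpha> P enc k w g d m t) \<le> real CARD('k) * hi * norm (enc w g m t)"
proof -
  have "cmod (clean_output \<alpha> P enc k w g d m t) \<le> (\<Sum>i\<in>(UNIV :: 'k set). hi * norm (enc w g m t))"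
    unfolding clean_output_def
  proof (intro sum_norm_le)
    fix i
    show "cmod (chan \<alpha> P k m (g (k, m, t)) (d (k, m, t)) $ i * enc w g m t $ i) \<le> hi * norm (enc w g m t)"
      unfolding norm_mult using bd[of i] Finite_Cartesian_Product.norm_nth_le[of "enc w g m t" i]
      by (intro mult_mono) (auto intro: order_trans[OF norm_ge_zero])
  qed
  then show ?thesis by (simp add: mult.assoc)
qed

text \<open>Without side information each output value has total weight 1, so the sum counts the
  attained outputs. As only the average power is bounded, these need not lie in a fixed box. Instead
  the power constraint bounds the product of their lattice weights from below, and comparison with
  the full lattice sum yields the count.\<close>

lemma output_fibre_sum_bound:
  fixes enc :: "('k::finite, 'm::finite) encoder" and v :: "('k \<Rightarrow> nat) \<Rightarrow> 'v"
  assumes Z: "\<And>B. finite B \<Longrightarrow> B \<subseteq> gauss_ints \<Longrightarrow> (\<Sum>z\<in>B. max 1 ((cmod z)\<^sup>2) powr (- (1 + \<epsilon>))) \<le> Z"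
    and e: "\<epsilon> > 0" and P: "P \<ge> 1"
    and code: "is_code n P R enc dec" and bd: "bounded_chan \<alpha> hi P n g d"
    and v: "\<And>w w'. v w = v w'"
  defines "W \<equiv> messages n R" and "c \<equiv> 2 * (real CARD('k) * hi)\<^sup>2 + 4"
  shows "(\<Sum>w\<in>W. 1 / fibre_card W v (\<lambda>w. quantized_output \<alpha> n P enc k w g d) w)
    \<le> ((2 * c * P) powr (1 + \<epsilon>) * Z) ^ (CARD('m) * n)"
proof -
  let ?J = "(UNIV :: 'm set) \<times> {..<n}"
  define q where "q w = quantized_output \<alpha> n P enc k w g d" for w
  let ?f = "\<lambda>x. \<Prod>j\<in>?J. max 1 ((cmod (x j - 0))\<^sup>2) powr (- (1 + \<epsilon>))"
  let ?L = "((2 * c * P) ^ card ?J) powr (1 + \<epsilon>)"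
  have finW: "finite W" by (simp add: W_def)
  have c4: "c \<ge> 4" by (simp add: c_def)
  have low: "1 \<le> ?L * ?f (q w)" if w: "w \<in> W" for w
  proof -
    have qj: "max 1 ((cmod (q w j - 0))\<^sup>2) \<le> c * (1 + (case j of (m, t) \<Rightarrow> (norm (enc w g m t))\<^sup>2))" if j: "j \<in> ?J" for j
    proof -
      obtain m t where jmt: "j = (m, t)" "t < n" using j by auto
      let ?x = "real CARD('k) * hi * norm (enc w g m t)"
      have "cmod (clean_output \<alpha> P enc k w g d m t) \<le> ?x"
        using bd jmt by (intro cmod_clean_output_le) (auto simp: bounded_chan_def)
      then have "cmod (q w j) \<le> ?x + sqrt 2"
        using cmod_gauss_floor[of "clean_output \<alpha> P enc k w g d m t"] jmt by (simp add: q_def quantized_output_def)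
      then have "(cmod (q w j))\<^sup>2 \<le> (?x + sqrt 2)\<^sup>2" by (intro power_mono) auto
      also have "\<dots> \<le> 2 * ?x\<^sup>2 + 2 * (sqrt 2)\<^sup>2"
        using zero_le_power2[of "?x - sqrt 2"] by (simp only: power2_sum power2_diff)
      also have "\<dots> = 2 * (real CARD('k) * hi)\<^sup>2 * (norm (enc w g m t))\<^sup>2 + 4"
        by (simp add: power_mult_distrib)
      also have "\<dots> \<le> c * (norm (enc w g m t))\<^sup>2 + c"
        by (intro add_mono mult_right_mono) (auto simp: c_def)
      finally have "(cmod (q w j))\<^sup>2 \<le> c * (1 + (norm (enc w g m t))\<^sup>2)" by (simp add: algebra_simps)
      moreover have "1 * 1 \<le> c * (1 + (norm (enc w g m t))\<^sup>2)"
        using c4 by (intro mult_mono) auto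
      ultimately show ?thesis by (simp add: jmt)
    qed
    have "(\<Prod>j\<in>?J. max 1 ((cmod (q w j - 0))\<^sup>2)) \<le> (\<Prod>j\<in>?J. c * (1 + (case j of (m, t) \<Rightarrow> (norm (enc w g m t))\<^sup>2)))"
      using qj by (intro prod_mono) auto
    also have "\<dots> = c ^ card ?J * (\<Prod>j\<in>?J. 1 + (case j of (m, t) \<Rightarrow> (norm (enc w g m t))\<^sup>2))"
      unfolding prod.distrib by simp
    also have "\<dots> \<le> c ^ card ?J * (1 + P) ^ card ?J"
      using c4 P code_power[OF code, of w g] w unfolding W_def
      by (intro mult_left_mono prod_one_plus_le) (auto simp: case_prod_beta')
    also have "\<dots> \<le> c ^ card ?J * (2 * P) ^ card ?J"
      using c4 P by (intro mult_left_mono power_mono) auto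
    also have "\<dots> = (2 * c * P) ^ card ?J"
      by (simp add: power_mult_distrib)
    finally have le: "(\<Prod>j\<in>?J. max 1 ((cmod (q w j - 0))\<^sup>2)) \<le> (2 * c * P) ^ card ?J" .
    let ?p = "\<Prod>j\<in>?J. max 1 ((cmod (q w j - 0))\<^sup>2)"
    have p1: "?p \<ge> 1" by (intro prod_ge_1) simp
    have "?f (q w) = ?p powr (- (1 + \<epsilon>))" by (simp only: prod_powr_distrib)
    moreover have "1 = y powr (1 + \<epsilon>) * y powr (- (1 + \<epsilon>))" if "y \<ge> 1" for y
      using that by (simp add: powr_add[symmetric])
    from this[OF p1] have "1 = ?p powr (1 + \<epsilon>) * ?p powr (- (1 + \<epsilon>))" .
    moreover have "\<dots> \<le> ?L * ?p powr (- (1 + \<epsilon>))"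
      using le p1 e by (intro mult_right_mono powr_mono2) auto
    ultimately show ?thesis by simp
  qed
  have "(\<Sum>w\<in>W. 1 / fibre_card W v q w) \<le> (\<Sum>w\<in>W. ?L * ?f (q w) / fibre_card W v q w)"
    using low by (intro sum_mono divide_right_mono) auto
  also have "\<dots> = ?L * (\<Sum>w\<in>W. ?f (q w) / real (card {u\<in>W. q u = q w}))"
  proof -
    have "fibre_card W v q w = real (card {u\<in>W. q u = q w})" for w
      unfolding fibre_card_def using v by metis
    then show ?thesis by (simp only: sum_distrib_left times_divide_eq_right)
  qed
  also have "\<dots> = ?L * (\<Sum>x\<in>q ` W. ?f x)"
    using sum_over_fibres[OF finW, of ?f q] by simp
  also have "\<dots> \<le> ?L * Z ^ card ?J"
  proof (intro mult_left_mono)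
    have "(\<Sum>x\<in>q ` W. \<Prod>j\<in>?J. max 1 ((cmod (x j - (\<lambda>_. 0) j))\<^sup>2) powr (- (1 + \<epsilon>))) \<le> Z ^ card ?J"
      by (rule sum_gauss_int_functions_bound[OF Z])
        (use finW in \<open>auto simp: q_def quantized_output_def gauss_floor_in\<close>)
    then show "(\<Sum>x\<in>q ` W. ?f x) \<le> Z ^ card ?J" by simp
  qed simp
  also have "?L = ((2 * c * P) powr (1 + \<epsilon>)) ^ card ?J"
    using prod_powr_distrib[of "\<lambda>_. 2 * c * P" ?J "1 + \<epsilon>"] by simp
  finally show ?thesis by (simp add: q_def[abs_def] power_mult_distrib card_cartesian_product)
qed

text \<open>The two inequalities alternate from \<open>b 1 = 1\<close> upwards: \<open>post\<close>
  passes from \<open>b\<close> to \<open>a\<close> at the same user, \<open>step\<close> to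
  \<open>b\<close> at the next one. Each user decoded costs a factor
  \<open>1 / \<delta>\<close>.\<close>

lemma posterior_chain_bound:
  fixes a b \<beta> :: "nat \<Rightarrow> real"
  assumes \<delta>: "\<delta> > 0" and b1: "b 1 = 1"
    and post: "\<And>i. 1 \<le> i \<Longrightarrow> i \<le> K \<Longrightarrow> \<delta> * a i \<le> b i"
    and step: "\<And>i. 1 \<le> i \<Longrightarrow> i < K \<Longrightarrow> b (Suc i) \<le> \<beta> i * a i"
    and \<beta>: "\<And>i. \<beta> i \<ge> 0" and i: "1 \<le> i" "i \<le> K"
  shows "a i \<le> (1 / \<delta>) ^ i * (\<Prod>j\<in>{1..<i}. \<beta> j)"
  using i
proof (induction i rule: nat_induct_at_least)
  case base
  then show ?case using post[of 1] b1 \<delta> by (simp add: le_divide_eq mult.commute)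
next
  case (Suc i)
  have "a (Suc i) \<le> (1 / \<delta>) * b (Suc i)"
    using post[of "Suc i"] Suc.prems \<delta> by (simp add: le_divide_eq mult.commute)
  also have "\<dots> \<le> (1 / \<delta>) * (\<beta> i * a i)"
    using step[of i] Suc \<delta> by (intro mult_left_mono) auto
  also have "\<dots> \<le> (1 / \<delta>) * (\<beta> i * ((1 / \<delta>) ^ i * (\<Prod>j\<in>{1..<i}. \<beta> j)))"
    using Suc \<delta> \<beta> by (intro mult_left_mono) auto
  also have "\<dots> = (1 / \<delta>) ^ Suc i * (\<Prod>j\<in>{1..<Suc i}. \<beta> j)"
    using Suc.hyps by (simp add: prod.atLeastLessThan_Suc)
  finally show ?case .
qed

text \<open>The users are ordered as \<open>\<pi> 1, \<dots>, \<pi> K\<close>; the tail \<open>later_messages \<pi> i w\<close> is the side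
  information of user \<open>\<pi> i\<close> in the chain of bounds.\<close>

definition later_messages :: "(nat \<Rightarrow> 'k::finite) \<Rightarrow> nat \<Rightarrow> ('k \<Rightarrow> nat) \<Rightarrow> nat \<Rightarrow> nat" where
  "later_messages \<pi> i w = (\<lambda>j\<in>{i<..CARD('k)}. w (\<pi> j))"

lemma later_messages_eq_iff:
  "later_messages \<pi> i u = later_messages \<pi> i (w :: 'k::finite \<Rightarrow> nat) \<longleftrightarrow> (\<forall>j\<in>{i<..CARD('k)}. u (\<pi> j) = w (\<pi> j))"
  by (auto simp: later_messages_def fun_eq_iff restrict_def)

lemma later_messages_Suc:
  assumes "i < CARD('k)"
  shows "(later_messages \<pi> (Suc i) u, u (\<pi> (Suc i))) = (later_messages \<pi> (Suc i) w, w (\<pi> (Suc i)))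
    \<longleftrightarrow> later_messages \<pi> i u = later_messages \<pi> i (w :: 'k::finite \<Rightarrow> nat)"
proof -
  have "{i<..CARD('k)} = insert (Suc i) {Suc i<..CARD('k)}" using assms by auto
  then show ?thesis by (auto simp: later_messages_eq_iff)
qed

text \<open>The side information of the next user together with its own message is the side
  information of the current user. So the two fibre sizes in one link of the chain refer to the same
  classes, as \<open>aligned_images_bound\<close> requires.\<close>

lemma fibre_card_later_Suc:
  assumes "i < CARD('k)"
  shows "fibre_card W (\<lambda>w. (later_messages \<pi> (Suc i) w, w (\<pi> (Suc i)))) q w =
    fibre_card W (later_messages \<pi> i) q (w :: 'k::finite \<Rightarrow> nat)"
  unfolding fibre_card_def later_messages_Suc[OF assms] ..

text \<open>The start of the chain: the tail after index 0 comprises all messages and leaves a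
  single tuple.\<close>

lemma fibre_card_all:
  fixes w :: "'k::finite \<Rightarrow> nat"
  assumes \<pi>: "bij_betw \<pi> {1..CARD('k)} UNIV" and w: "w \<in> W"
  shows "fibre_card W (later_messages \<pi> 0) q w = 1"
proof -
  have "u = w" if "later_messages \<pi> 0 u = later_messages \<pi> 0 w" for u
  proof
    fix k
    have "k \<in> \<pi> ` {1..CARD('k)}" using \<pi> by (simp add: bij_betw_def)
    then obtain j where "j \<in> {1..CARD('k)}" "k = \<pi> j" by blast
    then show "u k = w k" using that by (auto simp: later_messages_eq_iff)
  qed
  then have "{u\<in>W. later_messages \<pi> 0 u = later_messages \<pi> 0 w \<and> q u = q w} = {w}"
    using w by blast
  then show ?thesis by (simp add: fibre_card_def)
qed

context partial_csit_bc
begin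

lemma fibre_card_csi_measurable:
  assumes code: "is_code n P R enc dec" and w: "w \<in> messages n R"
  shows "(\<lambda>\<omega>. fibre_card (messages n R) v (\<lambda>w. quantized_output \<alpha> n P enc k w (csi_of n est \<omega>) (csi_of n err \<omega>)) w)
    \<in> borel_measurable Q"
proof -
  have "(\<lambda>\<omega>. (csi_of n est \<omega>, csi_of n err \<omega>)) \<in> Q \<rightarrow>\<^sub>M csi_space n \<Otimes>\<^sub>M csi_space n" by measurable
  from measurable_compose[OF this fibre_card_measurable[OF code w]] show ?thesis by simp
qed

text \<open>Either some user errs, or the posterior probability of its message is low although it decodes
  correctly; the latter is rare under a wider Gaussian noise, hence also under the actual one.\<close>

lemma low_posterior_expectation:
  fixes \<pi> :: "nat \<Rightarrow> 'k" and v :: "nat \<Rightarrow> ('k \<Rightarrow> nat) \<Rightarrow> 'v"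
  assumes code: "is_code n P R enc dec" and \<delta>: "\<delta> \<ge> 0" and I: "finite I"
  defines "W \<equiv> messages n R"
  shows "(\<integral>\<^sup>+\<omega>. ennreal (\<Sum>w\<in>W. of_bool (\<exists>i\<in>I.
      fibre_card W (\<lambda>w. (v i w, w (\<pi> i))) (\<lambda>w. quantized_output \<alpha> n P enc (\<pi> i) w (csi_of n est \<omega>) (csi_of n err \<omega>)) w <
      \<delta> * fibre_card W (v i) (\<lambda>w. quantized_output \<alpha> n P enc (\<pi> i) w (csi_of n est \<omega>) (csi_of n err \<omega>)) w)) \<partial>Q)
    \<le> ennreal (card W * (error_prob Q est err \<alpha> n P R enc dec + card I * (\<delta> * (2 * exp 2) ^ (CARD('k) * CARD('m) * n))))"
proof -
  let ?g = "csi_of n est" and ?d = "csi_of n err"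
  let ?q = "\<lambda>i \<omega> w. quantized_output \<alpha> n P enc (\<pi> i) w (?g \<omega>) (?d \<omega>)"
  define low where "low i \<omega> w \<longleftrightarrow> fibre_card W (\<lambda>w. (v i w, w (\<pi> i))) (?q i \<omega>) w < \<delta> * fibre_card W (v i) (?q i \<omega>) w" for i \<omega> w
  define ok where "ok i w \<omega> z \<longleftrightarrow> dec (\<pi> i) (received \<alpha> n P enc (\<pi> i) w (?g \<omega>) (?d \<omega>) z, ?g \<omega>, ?d \<omega>) = w (\<pi> i)" for i w \<omega> z
  define C where "C = (2 * exp 2 :: real) ^ (CARD('k) * CARD('m) * n)"
  have W: "finite W" "W \<noteq> {}" by (auto simp: W_def messages_nonempty)
  then have cW: "real (card W) > 0" by (simp add: card_gt_0_iff)
  interpret N: prob_space "noise_law n :: ('k \<times> 'm \<times> nat \<Rightarrow> complex) measure" by (rule prob_space_noise_law)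
  let ?E = "\<lambda>w \<omega> z. decoding_error n P enc dec w \<omega> z"
  let ?S = "\<lambda>\<omega> z. ennreal (\<Sum>w\<in>W. of_bool (?E w \<omega> z))"
  have S_meas: "(\<lambda>p. ?S (fst p) (snd p)) \<in> borel_measurable (Q \<Otimes>\<^sub>M noise_law n)"
    by (intro measurable_compose[OF _ measurable_ennreal] borel_measurable_sum of_bool_measurable)
      (use decoding_error_measurable[OF code] in \<open>simp add: W_def case_prod_beta'\<close>)
  have pointwise: "ennreal (\<Sum>w\<in>W. of_bool (\<exists>i\<in>I. low i \<omega> w)) \<le>
    (\<integral>\<^sup>+z. ?S \<omega> z \<partial>noise_law n) + ennreal (card I * (\<delta> * card W * C))" if \<omega>: "\<omega> \<in> space Q" for \<omega>
  proof -
    let ?T = "\<lambda>i z. ennreal (\<Sum>w\<in>W. of_bool (ok i w \<omega> z \<and> low i \<omega> w))"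
    have T_meas: "?T i \<in> borel_measurable (noise_law n)" for i
    proof (intro measurable_compose[OF _ measurable_ennreal] borel_measurable_sum of_bool_measurable)
      fix w assume "w \<in> W"
      from measurable_compose[OF measurable_Pair1'[OF \<omega>] dec_received_measurable[OF code this[unfolded W_def]], of "\<pi> i"]
      have "(\<lambda>z. dec (\<pi> i) (received \<alpha> n P enc (\<pi> i) w (?g \<omega>) (?d \<omega>) z, ?g \<omega>, ?d \<omega>)) \<in> noise_law n \<rightarrow>\<^sub>M count_space UNIV"
        by simp
      then show "Measurable.pred (noise_law n) (\<lambda>z. ok i w \<omega> z \<and> low i \<omega> w)"
        unfolding ok_def by measurable
    qed
    have S\<omega>: "?S \<omega> \<in> borel_measurable (noise_law n)"
      using measurable_compose[OF measurable_Pair1'[OF \<omega>] S_meas] by simp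
    have "ennreal (\<Sum>w\<in>W. of_bool (\<exists>i\<in>I. low i \<omega> w)) = (\<integral>\<^sup>+z. ennreal (\<Sum>w\<in>W. of_bool (\<exists>i\<in>I. low i \<omega> w)) \<partial>noise_law n)"
      by (simp add: N.emeasure_space_1)
    also have "\<dots> \<le> (\<integral>\<^sup>+z. ?S \<omega> z + (\<Sum>i\<in>I. ?T i z) \<partial>noise_law n)"
    proof (rule nn_integral_mono)
      fix z
      \<comment> \<open>A tuple with low posterior at some \<open>i\<close> either makes some user
        err or is decoded correctly at \<open>i\<close>; the latter is what
        \<open>low_posterior_integral\<close> bounds.\<close>
      have "(\<Sum>w\<in>W. of_bool (\<exists>i\<in>I. low i \<omega> w)) \<le> (\<Sum>w\<in>W. of_bool (?E w \<omega> z) + (\<Sum>i\<in>I. of_bool (ok i w \<omega> z \<and> low i \<omega> w)) :: real)"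
      proof (rule sum_mono)
        fix w
        show "of_bool (\<exists>i\<in>I. low i \<omega> w) \<le> (of_bool (?E w \<omega> z) + (\<Sum>i\<in>I. of_bool (ok i w \<omega> z \<and> low i \<omega> w)) :: real)"
        proof (cases "(\<exists>i\<in>I. low i \<omega> w) \<and> \<not> ?E w \<omega> z")
          case True
          then obtain i where i: "i \<in> I" "low i \<omega> w" "ok i w \<omega> z"
            by (auto simp: decoding_error_def ok_def)
          have "of_bool (ok i w \<omega> z \<and> low i \<omega> w) \<le> (\<Sum>i\<in>I. of_bool (ok i w \<omega> z \<and> low i \<omega> w) :: real)"
            by (rule member_le_sum) (use i I in auto)
          then show ?thesis using i True by simp
        next
          case False
          have "0 \<le> (\<Sum>i\<in>I. of_bool (ok i w \<omega> z \<and> low i \<omega> w) :: real)" by (intro sum_nonneg) simp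
          with False show ?thesis by auto
        qed
      qed
      also have "\<dots> = (\<Sum>w\<in>W. of_bool (?E w \<omega> z)) + (\<Sum>i\<in>I. \<Sum>w\<in>W. of_bool (ok i w \<omega> z \<and> low i \<omega> w))"
        unfolding sum.distrib by (subst (2) sum.swap) (rule refl)
      finally have "ennreal (\<Sum>w\<in>W. of_bool (\<exists>i\<in>I. low i \<omega> w)) \<le>
        ennreal ((\<Sum>w\<in>W. of_bool (?E w \<omega> z)) + (\<Sum>i\<in>I. \<Sum>w\<in>W. of_bool (ok i w \<omega> z \<and> low i \<omega> w)))"
        by (rule ennreal_leI)
      also have "\<dots> = ?S \<omega> z + (\<Sum>i\<in>I. ?T i z)"
        by (subst ennreal_plus) (auto simp del: sum_of_bool_eq intro!: sum_nonneg sum_ennreal[symmetric])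
      finally show "ennreal (\<Sum>w\<in>W. of_bool (\<exists>i\<in>I. low i \<omega> w)) \<le> ?S \<omega> z + (\<Sum>i\<in>I. ?T i z)" .
    qed
    also have "\<dots> = (\<integral>\<^sup>+z. ?S \<omega> z \<partial>noise_law n) + (\<Sum>i\<in>I. \<integral>\<^sup>+z. ?T i z \<partial>noise_law n)"
      using nn_integral_add[OF S\<omega> borel_measurable_sum[of I ?T, OF T_meas]] nn_integral_sum[of I ?T, OF T_meas]
      by simp
    also have "\<dots> \<le> (\<integral>\<^sup>+z. ?S \<omega> z \<partial>noise_law n) + (\<Sum>i\<in>I. ennreal (\<delta> * card W * C))"
    proof (intro add_left_mono sum_mono)
      fix i
      have "?g \<omega> \<in> space (csi_space n)" "?d \<omega> \<in> space (csi_space n)"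
        using measurable_space[OF csi_of_measurable(1) \<omega>] measurable_space[OF csi_of_measurable(2) \<omega>] by auto
      from low_posterior_integral[OF code this \<delta>, of "\<pi> i" \<alpha> "v i"]
      show "(\<integral>\<^sup>+z. ?T i z \<partial>noise_law n) \<le> ennreal (\<delta> * card W * C)"
        by (simp only: ok_def low_def W_def C_def)
    qed
    also have "(\<Sum>i\<in>I. ennreal (\<delta> * card W * C)) = ennreal (card I * (\<delta> * card W * C))"
      using \<delta> by (simp add: ennreal_mult C_def ennreal_of_nat_eq_real_of_nat)
    finally show ?thesis .
  qed
  have "(\<integral>\<^sup>+\<omega>. ennreal (\<Sum>w\<in>W. of_bool (\<exists>i\<in>I. low i \<omega> w)) \<partial>Q) \<le>
    (\<integral>\<^sup>+\<omega>. (\<integral>\<^sup>+z. ?S \<omega> z \<partial>noise_law n) + ennreal (card I * (\<delta> * card W * C)) \<partial>Q)"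
    by (rule nn_integral_mono) (rule pointwise)
  also have "\<dots> = (\<integral>\<^sup>+\<omega>. (\<integral>\<^sup>+z. ?S \<omega> z \<partial>noise_law n) \<partial>Q) + ennreal (card I * (\<delta> * card W * C))"
    using N.borel_measurable_nn_integral_fst[OF S_meas]
    by (subst nn_integral_add) (simp_all add: emeasure_space_1)
  also have "(\<integral>\<^sup>+\<omega>. (\<integral>\<^sup>+z. ?S \<omega> z \<partial>noise_law n) \<partial>Q) = ennreal (card W) * ennreal (error_prob Q est err \<alpha> n P R enc dec)"
  proof -
    let ?S' = "\<lambda>\<omega> z. ennreal ((\<Sum>w\<in>W. of_bool (?E w \<omega> z)) / card W)"
    have S'_meas: "(\<lambda>p. ?S' (fst p) (snd p)) \<in> borel_measurable (Q \<Otimes>\<^sub>M noise_law n)"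
      by (intro measurable_compose[OF _ measurable_ennreal] borel_measurable_divide borel_measurable_const borel_measurable_sum of_bool_measurable)
        (use decoding_error_measurable[OF code] in \<open>simp add: W_def case_prod_beta'\<close>)
    have SS: "?S \<omega> z = ennreal (card W) * ?S' \<omega> z" for \<omega> z
      using cW by (subst ennreal_mult[symmetric]) (auto simp del: sum_of_bool_eq intro!: sum_nonneg divide_nonneg_nonneg)
    have "(\<integral>\<^sup>+z. ?S \<omega> z \<partial>noise_law n) = ennreal (card W) * (\<integral>\<^sup>+z. ?S' \<omega> z \<partial>noise_law n)" if "\<omega> \<in> space Q" for \<omega>
      unfolding SS using measurable_compose[OF measurable_Pair1'[OF that] S'_meas] by (subst nn_integral_cmult) auto
    then have "(\<integral>\<^sup>+\<omega>. (\<integral>\<^sup>+z. ?S \<omega> z \<partial>noise_law n) \<partial>Q) = (\<integral>\<^sup>+\<omega>. ennreal (card W) * (\<integral>\<^sup>+z. ?S' \<omega> z \<partial>noise_law n) \<partial>Q)"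
      by (rule nn_integral_cong)
    also have "\<dots> = ennreal (card W) * (\<integral>\<^sup>+\<omega>. \<integral>\<^sup>+z. ?S' \<omega> z \<partial>noise_law n \<partial>Q)"
      using N.borel_measurable_nn_integral_fst[OF S'_meas] by (intro nn_integral_cmult) simp
    finally show ?thesis unfolding error_prob_eq[OF code] W_def .
  qed
  also have "ennreal (card W) * ennreal (error_prob Q est err \<alpha> n P R enc dec) + ennreal (card I * (\<delta> * card W * C)) =
    ennreal (card W * (error_prob Q est err \<alpha> n P R enc dec + card I * (\<delta> * C)))"
    using \<delta> by (subst ennreal_mult[symmetric], simp, simp add: error_prob_def)
      (subst ennreal_plus[symmetric], auto simp: error_prob_def C_def algebra_simps)
  finally show ?thesis unfolding low_def C_def .
qed

end

section \<open>Upper bound on the sum rate\<close>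

context partial_csit_bc
begin

text \<open>Three things must hold at one outcome and one tuple: no low posterior, no excessive
  ratio along the chain, and a final fibre that is not too small. On average each fails by a
  controlled amount only, so some pair satisfies all three, and there the chain of inequalities is
  deterministic.\<close>

lemma message_count_bound:
  fixes \<pi> :: "nat \<Rightarrow> 'k" and \<epsilon> :: real
  assumes \<pi>: "bij_betw \<pi> {1..CARD('k)} UNIV" and e: "\<epsilon> > 0"
  obtains C where "C \<ge> 1"
    "\<And>n P R enc dec. n \<ge> 1 \<Longrightarrow> P \<ge> 1 \<Longrightarrow> is_code n P R enc dec \<Longrightarrow>
      error_prob Q est err \<alpha> n P R enc dec \<le> 1 / 8 \<Longrightarrow>
      real (card (messages n R)) \<le>
        (C * P powr (CARD('m) * (1 + \<epsilon>) + (\<Sum>i\<in>{1..<CARD('k)}. \<Sum>m\<in>UNIV. \<alpha> (\<pi> (Suc i)) m + \<epsilon>))) ^ n"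
proof -
  define K where "K = CARD('k)"
  define M where "M = CARD('m)"
  have K1: "K \<ge> 1" by (simp add: K_def Suc_leI)
  obtain lo hi where hi: "0 < hi" and bd: "\<And>P n. P \<ge> 1 \<Longrightarrow> AE \<omega> in Q. bounded_chan \<alpha> hi P n (csi_of n est \<omega>) (csi_of n err \<omega>)"
    using coefficient_bounds by metis
  obtain Z where Z1: "Z \<ge> 1" and Z: "\<And>B. finite B \<Longrightarrow> B \<subseteq> gauss_ints \<Longrightarrow> (\<Sum>z\<in>B. max 1 ((cmod z)\<^sup>2) powr (- (1 + \<epsilon>))) \<le> Z"
    using sum_gauss_ints_bound[OF e] by metis
  obtain C1 where C1: "C1 \<ge> 1" and aligned:
    "\<And>n P R enc dec k k' (v :: ('k \<Rightarrow> nat) \<Rightarrow> nat \<Rightarrow> nat). P \<ge> 1 \<Longrightarrow> is_code n P R enc dec \<Longrightarrow> k \<noteq> k' \<Longrightarrow>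
      (\<integral>\<^sup>+\<omega>. ennreal (\<Sum>w\<in>messages n R.
          fibre_card (messages n R) v (\<lambda>w. quantized_output \<alpha> n P enc k' w (csi_of n est \<omega>) (csi_of n err \<omega>)) w /
          fibre_card (messages n R) v (\<lambda>w. quantized_output \<alpha> n P enc k w (csi_of n est \<omega>) (csi_of n err \<omega>)) w) \<partial>Q)
      \<le> ennreal (real (card (messages n R)) * (\<Prod>(m, t)\<in>UNIV \<times> {..<n}. C1 * P powr (\<alpha> k' m + \<epsilon>)))"
  proof (rule aligned_images_bound[where 'v = "nat \<Rightarrow> nat", OF hi _ e], goal_cases)
    case (1 P n) show ?case by (rule bd[OF 1(2)])
  next
    case (2 C)
    show ?case by (rule 2(1), rule 2(2), rule 2(3))
  qed
  define c where "c = 2 * (real K * hi)\<^sup>2 + 4"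
  define Cw where "Cw = (2 * exp 2 :: real) ^ (K * M)"
  define C0 where "C0 = (4 * real K) ^ K * (4 * real K) ^ K * 4"
  define C where "C = C0 * Cw ^ K * ((2 * c) powr (1 + \<epsilon>) * Z) ^ M * (C1 ^ M) ^ (K - 1)"
  have c4: "c \<ge> 4" by (simp add: c_def)
  have Cw1: "Cw \<ge> 1" unfolding Cw_def by (intro one_le_power) (use exp_ge_add_one_self[of 2] in simp)
  have C01: "C0 \<ge> 1"
  proof -
    have "(4 * real K) ^ K \<ge> 1" using K1 by (intro one_le_power) simp
    then have "1 * 1 * 1 \<le> (4 * real K) ^ K * (4 * real K) ^ K * 4" by (intro mult_mono) auto
    then show ?thesis by (simp add: C0_def)
  qed
  show thesis
  proof (rule that)
    have "(2 * c) powr (1 + \<epsilon>) * Z \<ge> 1 * 1"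
      using c4 e Z1 by (intro mult_mono ge_one_powr_ge_zero) auto
    then have "1 * 1 * 1 * 1 \<le> C0 * Cw ^ K * ((2 * c) powr (1 + \<epsilon>) * Z) ^ M * (C1 ^ M) ^ (K - 1)"
      using C01 Cw1 C1 by (intro mult_mono one_le_power) auto
    then show "C \<ge> 1" by (simp add: C_def)
    fix n :: nat and P :: real and R :: "real ^ 'k" and enc :: "('k, 'm) encoder" and dec :: "'k \<Rightarrow> ('k, 'm) decoder"
    assume n: "n \<ge> 1" and P: "P \<ge> 1" and code: "is_code n P R enc dec"
      and err8: "error_prob Q est err \<alpha> n P R enc dec \<le> 1 / 8"
    define W where "W = messages n R"
    have W: "finite W" "W \<noteq> {}" by (auto simp: W_def messages_nonempty)
    then have cW: "real (card W) > 0" by (simp add: card_gt_0_iff)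
    \<comment> \<open>Chosen so that the low-posterior terms of the \<open>K\<close> users sum to
      \<open>K * \<delta> * Cw ^ n = 1 / 4\<close>.\<close>
    define \<delta> where "\<delta> = 1 / (4 * K * Cw ^ n)"
    have \<delta>: "\<delta> > 0" using K1 Cw1 by (simp add: \<delta>_def)
    define \<beta> where "\<beta> i = (\<Prod>(m, t)\<in>(UNIV :: 'm set) \<times> {..<n}. C1 * P powr (\<alpha> (\<pi> (Suc i)) m + \<epsilon>))" for i
    have \<beta>: "\<beta> i > 0" for i unfolding \<beta>_def using C1 P by (intro prod_pos) auto
    define \<beta>0 where "\<beta>0 = ((2 * c * P) powr (1 + \<epsilon>) * Z) ^ (M * n)"
    have \<beta>0: "\<beta>0 > 0" using c4 P Z1 by (simp add: \<beta>0_def)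
    let ?q = "\<lambda>i \<omega> w. quantized_output \<alpha> n P enc (\<pi> i) w (csi_of n est \<omega>) (csi_of n err \<omega>)"
    define a where "a i \<omega> w = fibre_card W (later_messages \<pi> i) (?q i \<omega>) w" for i \<omega> w
    define b where "b i \<omega> w = fibre_card W (\<lambda>w. (later_messages \<pi> i w, w (\<pi> i))) (?q i \<omega>) w" for i \<omega> w
    have a_pos: "a i \<omega> w > 0" if "w \<in> W" for i \<omega> w
      unfolding a_def by (rule fibre_card_pos[OF W(1) that])
    have a_meas: "a i \<omega> w \<ge> 0" "b i \<omega> w \<ge> 0" for i \<omega> w by (simp_all add: a_def b_def)
    have am: "(\<lambda>\<omega>. a i \<omega> w) \<in> borel_measurable Q" "(\<lambda>\<omega>. b i \<omega> w) \<in> borel_measurable Q" if "w \<in> W" for i w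
      unfolding a_def b_def W_def using that W_def fibre_card_csi_measurable[OF code] by blast+
    have b_Suc: "b (Suc i) \<omega> w = fibre_card W (later_messages \<pi> i) (?q (Suc i) \<omega>) w" if "i < K" for i \<omega> w
      unfolding b_def using fibre_card_later_Suc[of i] that by (simp add: K_def)
    define bad where "bad \<omega> w \<longleftrightarrow> (\<exists>i\<in>{1..K}. b i \<omega> w < \<delta> * a i \<omega> w)" for \<omega> w
    define T1 where "T1 \<omega> = (\<Sum>w\<in>W. of_bool (bad \<omega> w) :: real)" for \<omega>
    define T2 where "T2 i \<omega> = (\<Sum>w\<in>W. b (Suc i) \<omega> w / a i \<omega> w)" for i \<omega>
    define T3 where "T3 \<omega> = (\<Sum>w\<in>W. 1 / a K \<omega> w)" for \<omega>
    have T1: "(\<integral>\<^sup>+\<omega>. ennreal (T1 \<omega>) \<partial>Q) \<le> ennreal (card W * (3 / 8))"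
    proof -
      have "(\<integral>\<^sup>+\<omega>. ennreal (T1 \<omega>) \<partial>Q) \<le> ennreal (card W * (error_prob Q est err \<alpha> n P R enc dec +
        card {1..K} * (\<delta> * (2 * exp 2) ^ (CARD('k) * CARD('m) * n))))"
        unfolding T1_def bad_def a_def b_def W_def using \<delta> by (intro low_posterior_expectation[OF code]) auto
      also have "card {1..K} * (\<delta> * (2 * exp 2) ^ (CARD('k) * CARD('m) * n)) = 1 / 4"
      proof -
        have "(2 * exp 2 :: real) ^ (CARD('k) * CARD('m) * n) = Cw ^ n"
          by (simp add: Cw_def K_def M_def power_mult)
        then show ?thesis using K1 Cw1 by (simp add: \<delta>_def)
      qed
      also have "ennreal (card W * (error_prob Q est err \<alpha> n P R enc dec + 1 / 4)) \<le> ennreal (card W * (3 / 8))"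
        using err8 by (intro ennreal_leI mult_left_mono) auto
      finally show ?thesis .
    qed
    have T2: "(\<integral>\<^sup>+\<omega>. ennreal (T2 i \<omega>) \<partial>Q) \<le> ennreal (card W * \<beta> i)" if i: "i \<in> {1..<K}" for i
    proof -
      have "\<pi> i \<noteq> \<pi> (Suc i)"
        using \<pi> i by (auto simp: bij_betw_def K_def dest: inj_onD)
      from aligned[OF P code this, of "later_messages \<pi> i"] show ?thesis
        using i by (simp add: T2_def \<beta>_def a_def b_Suc W_def)
    qed
    have T3: "AE \<omega> in Q. T3 \<omega> \<le> \<beta>0"
      using bd[OF P, of n]
    proof eventually_elim
      case (elim \<omega>)
      have "later_messages \<pi> K w = later_messages \<pi> K w'" for w w' :: "'k \<Rightarrow> nat"
        by (simp add: later_messages_eq_iff K_def)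
      from output_fibre_sum_bound[where k = "\<pi> K", OF Z e P code elim this]
      show ?case by (simp add: T3_def a_def W_def \<beta>0_def c_def K_def M_def)
    qed
    \<comment> \<open>The weights make the three parts average to at most 3/8, 1/4 and 1/4, in total
      7/8, so \<open>G\<close> is below 1 somewhere. Any single requirement that fails would alone
      bring \<open>G\<close> to at least 1.\<close>
    define G where "G \<omega> w = of_bool (bad \<omega> w) + (\<Sum>i\<in>{1..<K}. (b (Suc i) \<omega> w / a i \<omega> w) * (1 / (4 * K * \<beta> i))) +
       (1 / a K \<omega> w) * (card W / (4 * \<beta>0))" for \<omega> w
    have "\<exists>\<omega> w. w \<in> W \<and> G \<omega> w < 1"
    proof (rule ccontr)
      assume "\<not> ?thesis"
      then have G1: "G \<omega> w \<ge> 1" if "w \<in> W" for \<omega> w using that not_less by blast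
      have nonneg: "T1 \<omega> \<ge> 0" "T2 i \<omega> \<ge> 0" "T3 \<omega> \<ge> 0" for i \<omega>
        unfolding T1_def T2_def T3_def using a_meas by (auto intro!: sum_nonneg divide_nonneg_nonneg simp del: sum_of_bool_eq)
      have T1m: "T1 \<in> borel_measurable Q"
        unfolding T1_def bad_def
        by (intro borel_measurable_sum of_bool_measurable pred_intros_finite borel_measurable_pred_less
            borel_measurable_times borel_measurable_const am) auto
      have T2m: "T2 i \<in> borel_measurable Q" for i
        unfolding T2_def by (intro borel_measurable_sum borel_measurable_divide am)
      have sumG: "(\<Sum>w\<in>W. G \<omega> w) = T1 \<omega> + (\<Sum>i\<in>{1..<K}. T2 i \<omega> * (1 / (4 * K * \<beta> i))) + T3 \<omega> * (card W / (4 * \<beta>0))" for \<omega>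
        unfolding G_def sum.distrib T1_def T2_def T3_def sum_distrib_right by (subst sum.swap) (rule refl)
      have "ennreal (card W) = (\<integral>\<^sup>+\<omega>. ennreal (card W) \<partial>Q)" by (simp add: emeasure_space_1)
      also have "\<dots> \<le> (\<integral>\<^sup>+\<omega>. (ennreal (T1 \<omega>) + (\<Sum>i\<in>{1..<K}. ennreal (T2 i \<omega>) * ennreal (1 / (4 * K * \<beta> i)))) + ennreal (card W / 4) \<partial>Q)"
      proof (intro nn_integral_mono_AE, use T3 in eventually_elim)
        case (elim \<omega>)
        have "real (card W) = (\<Sum>w\<in>W. 1)" by simp
        also have "\<dots> \<le> (\<Sum>w\<in>W. G \<omega> w)" by (intro sum_mono G1)
        also have "\<dots> \<le> T1 \<omega> + (\<Sum>i\<in>{1..<K}. T2 i \<omega> * (1 / (4 * K * \<beta> i))) + \<beta>0 * (card W / (4 * \<beta>0))"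
          unfolding sumG using elim \<beta>0 by (intro add_left_mono mult_right_mono) auto
        also have "\<beta>0 * (card W / (4 * \<beta>0)) = card W / 4" using \<beta>0 by simp
        finally have "ennreal (card W) \<le> ennreal (T1 \<omega> + (\<Sum>i\<in>{1..<K}. T2 i \<omega> * (1 / (4 * K * \<beta> i))) + card W / 4)"
          by (rule ennreal_leI)
        also have "\<dots> = (ennreal (T1 \<omega>) + (\<Sum>i\<in>{1..<K}. ennreal (T2 i \<omega>) * ennreal (1 / (4 * K * \<beta> i)))) + ennreal (card W / 4)"
        proof -
          have t0: "0 \<le> T2 i \<omega> * (1 / (4 * K * \<beta> i))" for i using nonneg \<beta>[of i] by simp
          have "ennreal (\<Sum>i\<in>{1..<K}. T2 i \<omega> * (1 / (4 * K * \<beta> i))) = (\<Sum>i\<in>{1..<K}. ennreal (T2 i \<omega> * (1 / (4 * K * \<beta> i))))"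
            using t0 by (intro sum_ennreal[symmetric])
          also have "\<dots> = (\<Sum>i\<in>{1..<K}. ennreal (T2 i \<omega>) * ennreal (1 / (4 * K * \<beta> i)))"
            using nonneg \<beta> by (intro sum.cong refl ennreal_mult) (auto simp: less_imp_le)
          finally have "ennreal (\<Sum>i\<in>{1..<K}. T2 i \<omega> * (1 / (4 * K * \<beta> i))) = (\<Sum>i\<in>{1..<K}. ennreal (T2 i \<omega>) * ennreal (1 / (4 * K * \<beta> i)))" .
          moreover have "0 \<le> (\<Sum>i\<in>{1..<K}. T2 i \<omega> * (1 / (4 * K * \<beta> i)))" using t0 by (intro sum_nonneg)
          ultimately show ?thesis using nonneg by (simp add: ennreal_plus)
        qed
        finally show ?case .
      qed
      also have "\<dots> = (\<integral>\<^sup>+\<omega>. ennreal (T1 \<omega>) \<partial>Q) + (\<Sum>i\<in>{1..<K}. (\<integral>\<^sup>+\<omega>. ennreal (T2 i \<omega>) \<partial>Q) * ennreal (1 / (4 * K * \<beta> i))) + ennreal (card W / 4)"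
      proof -
        have m1: "(\<lambda>\<omega>. ennreal (T1 \<omega>)) \<in> borel_measurable Q" using T1m by measurable
        have m2: "(\<lambda>\<omega>. ennreal (T2 i \<omega>) * ennreal (1 / (4 * K * \<beta> i))) \<in> borel_measurable Q" for i using T2m by measurable
        have m2': "(\<lambda>\<omega>. ennreal (T2 i \<omega>)) \<in> borel_measurable Q" for i using T2m by measurable
        have m3: "(\<lambda>\<omega>. \<Sum>i\<in>{1..<K}. ennreal (T2 i \<omega>) * ennreal (1 / (4 * K * \<beta> i))) \<in> borel_measurable Q"
          by (intro borel_measurable_sum m2)
        show ?thesis
          using m1 m3 nn_integral_sum[of "{1..<K}" "\<lambda>i \<omega>. ennreal (T2 i \<omega>) * ennreal (1 / (4 * K * \<beta> i))" Q, OF m2]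
            nn_integral_multc[OF m2']
          by (simp add: nn_integral_add borel_measurable_add emeasure_space_1)
      qed
      also have "\<dots> \<le> ennreal (card W * (3 / 8)) + (\<Sum>i\<in>{1..<K}. ennreal (card W * \<beta> i) * ennreal (1 / (4 * K * \<beta> i))) + ennreal (card W / 4)"
        by (intro add_mono T1 sum_mono mult_right_mono T2) auto
      also have "(\<Sum>i\<in>{1..<K}. ennreal (card W * \<beta> i) * ennreal (1 / (4 * K * \<beta> i))) = (\<Sum>i\<in>{1..<K}. ennreal (card W / (4 * K)))"
        by (intro sum.cong refl) (use \<beta> in \<open>simp add: ennreal_mult[symmetric] less_imp_le less_imp_neq[THEN not_sym]\<close>)
      also have "\<dots> = ennreal ((K - 1) * (card W / (4 * K)))"
        by (subst ennreal_mult) (simp_all add: ennreal_of_nat_eq_real_of_nat)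
      also have "\<dots> \<le> ennreal (card W / 4)"
      proof -
        have "real (K - 1) * (real (card W) / (4 * real K)) \<le> real K * (real (card W) / (4 * real K))"
          by (intro mult_right_mono) auto
        also have "\<dots> = real (card W) / 4" using K1 by simp
        finally show ?thesis using K1 by (intro ennreal_leI) (simp add: of_nat_diff)
      qed
      finally have "ennreal (card W) \<le> ennreal (card W * (3 / 8)) + ennreal (card W / 4) + ennreal (card W / 4)"
        by (simp add: add_mono)
      also have "\<dots> = ennreal (card W * (7 / 8))"
        by (simp add: ennreal_plus[symmetric] del: ennreal_plus)
      finally show False using cW by (simp add: ennreal_le_iff)
    qed
    then obtain \<omega> w where w: "w \<in> W" and G1: "G \<omega> w < 1" by auto
    have t2: "0 \<le> (b (Suc i) \<omega> w / a i \<omega> w) * (1 / (4 * K * \<beta> i))" for i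
      using a_meas \<beta>[of i] by (intro mult_nonneg_nonneg divide_nonneg_nonneg) auto
    have t2s: "0 \<le> (\<Sum>i\<in>{1..<K}. (b (Suc i) \<omega> w / a i \<omega> w) * (1 / (4 * K * \<beta> i)))"
      by (intro sum_nonneg t2)
    have t3: "0 \<le> (1 / a K \<omega> w) * (card W / (4 * \<beta>0))"
      using a_meas \<beta>0 by (intro mult_nonneg_nonneg divide_nonneg_nonneg) auto
    have not_bad: "\<not> bad \<omega> w" using G1 t2s t3 by (cases "bad \<omega> w") (auto simp: G_def)
    have step: "b (Suc i) \<omega> w \<le> (4 * K * \<beta> i) * a i \<omega> w" if i: "1 \<le> i" "i < K" for i
    proof -
      have "(b (Suc i) \<omega> w / a i \<omega> w) * (1 / (4 * K * \<beta> i)) \<le> (\<Sum>i\<in>{1..<K}. (b (Suc i) \<omega> w / a i \<omega> w) * (1 / (4 * K * \<beta> i)))"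
        using i t2 by (intro member_le_sum) auto
      also have "\<dots> \<le> G \<omega> w" using t3 by (simp add: G_def)
      finally have "b (Suc i) \<omega> w / (a i \<omega> w * (4 * K * \<beta> i)) < 1" using G1 by simp
      then show ?thesis using a_pos[OF w, of i \<omega>] \<beta>[of i] K1 by (simp add: divide_less_eq mult.commute)
    qed
    have last: "card W \<le> 4 * \<beta>0 * a K \<omega> w"
    proof -
      have "(1 / a K \<omega> w) * (card W / (4 * \<beta>0)) < 1"
        using G1 t2s by (simp add: G_def) (use not_bad in simp)
      then have "card W / (a K \<omega> w * (4 * \<beta>0)) < 1" by simp
      then show ?thesis using a_pos[OF w, of K \<omega>] \<beta>0 by (simp add: divide_less_eq mult.commute mult.left_commute)
    qed
    have "a K \<omega> w \<le> (1 / \<delta>) ^ K * (\<Prod>j\<in>{1..<K}. 4 * K * \<beta> j)"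
    proof (rule posterior_chain_bound[where b = "\<lambda>i. b i \<omega> w" and a = "\<lambda>i. a i \<omega> w" and K = K, OF \<delta>])
      show "b 1 \<omega> w = 1"
        using b_Suc[of 0 \<omega> w] K1 fibre_card_all[OF \<pi> w] by simp
      show "\<delta> * a i \<omega> w \<le> b i \<omega> w" if "1 \<le> i" "i \<le> K" for i
        using not_bad that by (auto simp: bad_def not_less)
      show "0 \<le> 4 * K * \<beta> i" for i using \<beta>[of i] by simp
    qed (use step K1 in auto)
    then have "card W \<le> 4 * \<beta>0 * ((1 / \<delta>) ^ K * (\<Prod>j\<in>{1..<K}. 4 * K * \<beta> j))"
      using \<beta>0 by (intro order_trans[OF last] mult_left_mono) auto
    also have "\<dots> = (4 * (4 * real K) ^ K * (4 * real K) ^ (K - 1)) * (\<beta>0 * (Cw ^ K) ^ n * (\<Prod>j\<in>{1..<K}. \<beta> j))"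
      by (simp add: \<delta>_def prod.distrib power_mult_distrib power_mult[symmetric] mult.commute mult.left_commute)
    \<comment> \<open>The prefactor does not grow with \<open>n\<close>; since
      \<open>C0 \<ge> 1\<close> and \<open>n \<ge> 1\<close>, it can be hidden in an
      \<open>n\<close>-th power, and the whole bound becomes one.\<close>
    also have "\<dots> \<le> C0 ^ n * (\<beta>0 * (Cw ^ K) ^ n * (\<Prod>j\<in>{1..<K}. \<beta> j))"
    proof (intro mult_right_mono mult_nonneg_nonneg prod_nonneg)
      have "4 * (4 * real K) ^ K * (4 * real K) ^ (K - 1) \<le> 4 * (4 * real K) ^ K * (4 * real K) ^ K"
        using K1 by (intro mult_left_mono power_increasing) auto
      also have "\<dots> = C0 ^ 1" by (simp add: C0_def)
      also have "\<dots> \<le> C0 ^ n" using C01 n by (intro power_increasing) auto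
      finally show "4 * (4 * real K) ^ K * (4 * real K) ^ (K - 1) \<le> C0 ^ n" .
    qed (use \<beta>0 Cw1 \<beta> in \<open>auto simp: less_imp_le\<close>)
    also have "\<dots> = (C * P powr (M * (1 + \<epsilon>) + (\<Sum>i\<in>{1..<K}. \<Sum>m\<in>UNIV. \<alpha> (\<pi> (Suc i)) m + \<epsilon>))) ^ n"
    proof -
      have b0: "\<beta>0 = (((2 * c) powr (1 + \<epsilon>) * Z) ^ M * P powr (M * (1 + \<epsilon>))) ^ n"
      proof -
        have "((2 * c * P) powr (1 + \<epsilon>) * Z) ^ M = ((2 * c) powr (1 + \<epsilon>) * Z) ^ M * (P powr (1 + \<epsilon>)) ^ M"
          using c4 P by (simp add: powr_mult power_mult_distrib)
        also have "(P powr (1 + \<epsilon>)) ^ M = P powr (M * (1 + \<epsilon>))"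
          using P by (simp add: powr_power mult.commute)
        finally show ?thesis by (simp add: \<beta>0_def power_mult)
      qed
      have bi: "\<beta> i = (C1 ^ M * P powr (\<Sum>m\<in>UNIV. \<alpha> (\<pi> (Suc i)) m + \<epsilon>)) ^ n" for i
      proof -
        have "\<beta> i = (\<Prod>m\<in>UNIV. \<Prod>t<n. C1 * P powr (\<alpha> (\<pi> (Suc i)) m + \<epsilon>))"
          unfolding \<beta>_def by (rule prod.cartesian_product[symmetric])
        also have "\<dots> = (\<Prod>m\<in>UNIV. C1 * P powr (\<alpha> (\<pi> (Suc i)) m + \<epsilon>)) ^ n"
          by (simp add: prod_power_distrib)
        also have "(\<Prod>m\<in>UNIV. C1 * P powr (\<alpha> (\<pi> (Suc i)) m + \<epsilon>)) = C1 ^ M * P powr (\<Sum>m\<in>UNIV. \<alpha> (\<pi> (Suc i)) m + \<epsilon>)"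
          using P by (simp add: prod.distrib powr_sum M_def)
        finally show ?thesis .
      qed
      have "(\<Prod>j\<in>{1..<K}. \<beta> j) = (\<Prod>j\<in>{1..<K}. C1 ^ M * P powr (\<Sum>m\<in>UNIV. \<alpha> (\<pi> (Suc j)) m + \<epsilon>)) ^ n"
        unfolding bi by (simp add: prod_power_distrib)
      also have "(\<Prod>j\<in>{1..<K}. C1 ^ M * P powr (\<Sum>m\<in>UNIV. \<alpha> (\<pi> (Suc j)) m + \<epsilon>)) =
        (C1 ^ M) ^ (K - 1) * P powr (\<Sum>i\<in>{1..<K}. \<Sum>m\<in>UNIV. \<alpha> (\<pi> (Suc i)) m + \<epsilon>)"
        using P by (simp add: prod.distrib powr_sum)
      finally have bp: "(\<Prod>j\<in>{1..<K}. \<beta> j) = ((C1 ^ M) ^ (K - 1) * P powr (\<Sum>i\<in>{1..<K}. \<Sum>m\<in>UNIV. \<alpha> (\<pi> (Suc i)) m + \<epsilon>)) ^ n" .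
      show ?thesis
        unfolding b0 bp C_def powr_add power_mult_distrib[symmetric]
        by (simp only: mult.assoc mult.left_commute mult.commute)
    qed
    finally show "real (card (messages n R)) \<le>
        (C * P powr (CARD('m) * (1 + \<epsilon>) + (\<Sum>i\<in>{1..<CARD('k)}. \<Sum>m\<in>UNIV. \<alpha> (\<pi> (Suc i)) m + \<epsilon>))) ^ n"
      by (simp only: W_def K_def M_def)
  qed
qed

lemma sum_capacity_bound:
  fixes \<pi> :: "nat \<Rightarrow> 'k" and \<epsilon> :: real
  assumes \<pi>: "bij_betw \<pi> {1..CARD('k)} UNIV" and e: "\<epsilon> > 0"
  obtains C where "\<And>P R. P \<ge> 1 \<Longrightarrow> R \<in> capacity_region Q est err \<alpha> P \<Longrightarrow>
      (\<Sum>k\<in>UNIV. R $ k) \<le> C + (CARD('m) + (\<Sum>i\<in>{1..<CARD('k)}. \<Sum>m\<in>UNIV. \<alpha> (\<pi> (Suc i)) m) + \<epsilon>) * log 2 P"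
proof -
  \<comment> \<open>The slack enters the exponent \<open>CARD('m) * CARD('k)\<close> times:
    \<open>CARD('m)\<close> times in the count of outputs of the last user, and as often in each of
    the \<open>CARD('k) - 1\<close> links.\<close>
  define \<epsilon>1 where "\<epsilon>1 = \<epsilon> / (CARD('m) * CARD('k))"
  have e1: "\<epsilon>1 > 0" using e by (simp add: \<epsilon>1_def)
  define X where "X = CARD('m) * (1 + \<epsilon>1) + (\<Sum>i\<in>{1..<CARD('k)}. \<Sum>m\<in>UNIV. \<alpha> (\<pi> (Suc i)) m + \<epsilon>1)"
  have X: "X = CARD('m) + (\<Sum>i\<in>{1..<CARD('k)}. \<Sum>m\<in>UNIV. \<alpha> (\<pi> (Suc i)) m) + \<epsilon>"
  proof -
    have "X = CARD('m) + (\<Sum>i\<in>{1..<CARD('k)}. \<Sum>m\<in>UNIV. \<alpha> (\<pi> (Suc i)) m) + (1 + real (CARD('k) - 1)) * (CARD('m) * \<epsilon>1)"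
      unfolding X_def sum.distrib by (simp add: algebra_simps)
    moreover have "1 + real (CARD('k) - 1) = CARD('k)" by (simp add: of_nat_diff Suc_leI)
    ultimately show ?thesis by (simp add: \<epsilon>1_def)
  qed
  obtain C where C: "C \<ge> 1" and count: "\<And>n P R enc dec. n \<ge> 1 \<Longrightarrow> P \<ge> 1 \<Longrightarrow> is_code n P R enc dec \<Longrightarrow>
      error_prob Q est err \<alpha> n P R enc dec \<le> 1 / 8 \<Longrightarrow> real (card (messages n R)) \<le> (C * P powr X) ^ n"
    unfolding X_def
  proof (rule message_count_bound[OF \<pi> e1], goal_cases)
    case (1 C)
    show ?case by (rule 1(1), rule 1(2), rule 1(3))
  qed
  show thesis
  proof (rule that)
    fix P :: real and R :: "real ^ 'k"
    assume P: "P \<ge> 1" and R: "R \<in> capacity_region Q est err \<alpha> P"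
    have "(\<Sum>k\<in>UNIV. R $ k) \<le> log 2 C + X * log 2 P" if "achievable_rate Q est err \<alpha> P R" for R
    proof -
      from that obtain enc dec where code: "\<And>n. n \<ge> 1 \<Longrightarrow> is_code n P R (enc n) (dec n)"
        and lim: "(\<lambda>n. error_prob Q est err \<alpha> n P R (enc n) (dec n)) \<longlonglongrightarrow> 0"
        by (auto simp: achievable_rate_def)
      \<comment> \<open>One block length with small error is enough, because the counting bound
        holds for each \<open>n\<close> with the same constant.\<close>
      have "eventually (\<lambda>n. error_prob Q est err \<alpha> n P R (enc n) (dec n) < 1 / 8) sequentially"
        using order_tendstoD(2)[OF lim, of "1/8"] by simp
      then have "eventually (\<lambda>n. error_prob Q est err \<alpha> n P R (enc n) (dec n) < 1 / 8 \<and> n \<ge> 1) sequentially"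
        using eventually_ge_at_top[of 1] by (rule eventually_conj)
      then obtain n where n: "n \<ge> 1" "error_prob Q est err \<alpha> n P R (enc n) (dec n) < 1 / 8"
        by (auto simp: eventually_sequentially)
      have "2 powr (real n * (\<Sum>k\<in>UNIV. R $ k)) = (\<Prod>k\<in>UNIV. 2 powr (real n * R $ k))"
        by (simp add: powr_sum sum_distrib_left)
      also have "\<dots> \<le> (\<Prod>k\<in>UNIV. real (nat \<lceil>2 powr (real n * R $ k)\<rceil>))"
        by (intro prod_mono conjI) (auto intro: order_trans[OF le_of_int_ceiling])
      also have "\<dots> = real (card (messages n R))"
        by (simp add: messages_def card_PiE)
      also have "\<dots> \<le> (C * P powr X) ^ n"
        by (rule count[OF n(1) P code[OF n(1)]]) (use n in simp)
      finally have "log 2 (2 powr (real n * (\<Sum>k\<in>UNIV. R $ k))) \<le> log 2 ((C * P powr X) ^ n)"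
        using C P by (intro log_mono) auto
      then have "real n * (\<Sum>k\<in>UNIV. R $ k) \<le> real n * (log 2 C + X * log 2 P)"
        using C P by (simp add: log_nat_power log_mult log_powr)
      then show ?thesis using n by simp
    qed
    then have "{R. achievable_rate Q est err \<alpha> P R} \<subseteq> {R. (\<Sum>k\<in>UNIV. R $ k) \<le> log 2 C + X * log 2 P}" by auto
    moreover have "closed {R :: real ^ 'k. (\<Sum>k\<in>UNIV. R $ k) \<le> log 2 C + X * log 2 P}"
      by (intro closed_Collect_le continuous_intros)
    ultimately have "capacity_region Q est err \<alpha> P \<subseteq> {R. (\<Sum>k\<in>UNIV. R $ k) \<le> log 2 C + X * log 2 P}"
      unfolding capacity_region_def by (rule closure_minimal)
    with R show "(\<Sum>k\<in>UNIV. R $ k) \<le> log 2 C + (CARD('m) + (\<Sum>i\<in>{1..<CARD('k)}. \<Sum>m\<in>UNIV. \<alpha> (\<pi> (Suc i)) m) + \<epsilon>) * log 2 P"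
      by (auto simp: X)
  qed
qed

text \<open>Dividing by \<open>CARD('m) * log 2 P\<close> removes the additive constant, the slack
  is arbitrary, and a linear inequality passes to the closure. The bound is valid for every
  enumeration of the users, whatever their qualities.\<close>

lemma sum_dof_region_bound:
  fixes \<pi> :: "nat \<Rightarrow> 'k"
  assumes \<pi>: "bij_betw \<pi> {1..CARD('k)} UNIV" and d: "d \<in> dof_region Q est err \<alpha>"
  shows "(\<Sum>k\<in>UNIV. d $ k) \<le> 1 + (\<Sum>i\<in>{1..<CARD('k)}. \<Sum>m\<in>UNIV. \<alpha> (\<pi> (Suc i)) m) / CARD('m)"
proof -
  define S where "S = (\<Sum>i\<in>{1..<CARD('k)}. \<Sum>m\<in>UNIV. \<alpha> (\<pi> (Suc i)) m)"
  have "(\<Sum>k\<in>UNIV. d $ k) \<le> 1 + S / CARD('m)" if ach: "achievable_dof Q est err \<alpha> d" for d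
  proof (rule field_le_epsilon)
    fix \<epsilon> :: real assume e: "\<epsilon> > 0"
    define \<epsilon>1 where "\<epsilon>1 = \<epsilon> * CARD('m)"
    have e1: "\<epsilon>1 > 0" using e by (simp add: \<epsilon>1_def)
    from ach obtain R where R: "\<And>P. P > 1 \<Longrightarrow> R P \<in> capacity_region Q est err \<alpha> P"
      and lim: "\<And>k. ((\<lambda>P. R P $ k / (real CARD('m) * log 2 P)) \<longlongrightarrow> d $ k) at_top"
      by (auto simp: achievable_dof_def)
    obtain C where C: "\<And>P R. P \<ge> 1 \<Longrightarrow> R \<in> capacity_region Q est err \<alpha> P \<Longrightarrow>
      (\<Sum>k\<in>UNIV. R $ k) \<le> C + (CARD('m) + S + \<epsilon>1) * log 2 P"
      unfolding S_def using sum_capacity_bound[OF \<pi> e1] by blast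
    have "((\<lambda>P. \<Sum>k\<in>UNIV. R P $ k / (real CARD('m) * log 2 P)) \<longlongrightarrow> (\<Sum>k\<in>UNIV. d $ k)) at_top"
      by (intro tendsto_sum lim)
    moreover have "((\<lambda>P. C / CARD('m) * (1 / log 2 P) + (CARD('m) + S + \<epsilon>1) / CARD('m)) \<longlongrightarrow>
       C / CARD('m) * 0 + (CARD('m) + S + \<epsilon>1) / CARD('m)) at_top"
    proof (intro tendsto_intros)
      have "((\<lambda>P::real. ln 2 / ln P) \<longlongrightarrow> 0) at_top"
        by (intro tendsto_divide_0[OF tendsto_const] filterlim_at_top_imp_at_infinity ln_at_top)
      then show "((\<lambda>P::real. 1 / log 2 P) \<longlongrightarrow> 0) at_top"
        by (simp add: log_def)
    qed
    moreover have "eventually (\<lambda>P. (\<Sum>k\<in>UNIV. R P $ k / (real CARD('m) * log 2 P)) \<le>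
      C / CARD('m) * (1 / log 2 P) + (CARD('m) + S + \<epsilon>1) / CARD('m)) at_top"
      using eventually_gt_at_top[of 1]
    proof eventually_elim
      case (elim P)
      then have l: "log 2 P > 0" by simp
      have "(\<Sum>k\<in>UNIV. R P $ k / (real CARD('m) * log 2 P)) = (\<Sum>k\<in>UNIV. R P $ k) / (real CARD('m) * log 2 P)"
        by (simp add: sum_divide_distrib)
      also have "\<dots> \<le> (C + (CARD('m) + S + \<epsilon>1) * log 2 P) / (real CARD('m) * log 2 P)"
        using C[of P "R P"] R elim l by (intro divide_right_mono) auto
      also have "\<dots> = C / CARD('m) * (1 / log 2 P) + (CARD('m) + S + \<epsilon>1) / CARD('m)"
        using l by (simp add: add_divide_distrib)
      finally show ?case .
    qed
    ultimately have "(\<Sum>k\<in>UNIV. d $ k) \<le> C / CARD('m) * 0 + (CARD('m) + S + \<epsilon>1) / CARD('m)"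
      by (intro tendsto_le[of at_top]) auto
    also have "\<dots> = 1 + S / CARD('m) + \<epsilon>" by (simp add: add_divide_distrib \<epsilon>1_def)
    finally show "(\<Sum>k\<in>UNIV. d $ k) \<le> 1 + S / CARD('m) + \<epsilon>" .
  qed
  then have "{d. achievable_dof Q est err \<alpha> d} \<subseteq> {d. (\<Sum>k\<in>UNIV. d $ k) \<le> 1 + S / CARD('m)}" by auto
  moreover have "closed {d :: real ^ 'k. (\<Sum>k\<in>UNIV. d $ k) \<le> 1 + S / CARD('m)}"
    by (intro closed_Collect_le continuous_intros)
  ultimately have "dof_region Q est err \<alpha> \<subseteq> {d. (\<Sum>k\<in>UNIV. d $ k) \<le> 1 + S / CARD('m)}"
    unfolding dof_region_def by (rule closure_minimal)
  with d show ?thesis by (auto simp: S_def)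
qed

end

section \<open>Codes and zero-forcing directions\<close>

text \<open>A word in the ball is determined by a set of at most \<open>r\<close> altered positions
  and the letters there. Bounding the number of such sets by \<open>2 ^ n\<close> is generous, but
  costs only one bit per channel use, which does not grow with the power.\<close>

lemma card_hamming_ball_le:
  fixes A :: "'x set"
  assumes A: "finite A" "A \<noteq> {}" and y: "y \<in> {..<n} \<rightarrow>\<^sub>E A"
  shows "card {x \<in> {..<n} \<rightarrow>\<^sub>E A. card {t\<in>{..<n}. x t \<noteq> y t} \<le> r} \<le> 2 ^ n * card A ^ r"
proof -
  let ?B = "\<lambda>T. \<Pi>\<^sub>E t\<in>{..<n}. if t \<in> T then A else {y t}"
  have fin: "finite (?B T)" for T using A by (intro finite_PiE) auto
  have "{x \<in> {..<n} \<rightarrow>\<^sub>E A. card {t\<in>{..<n}. x t \<noteq> y t} \<le> r} \<subseteq> (\<Union>T\<in>{T\<in>Pow {..<n}. card T \<le> r}. ?B T)"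
  proof
    fix x assume "x \<in> {x \<in> {..<n} \<rightarrow>\<^sub>E A. card {t\<in>{..<n}. x t \<noteq> y t} \<le> r}"
    then have "x \<in> ?B {t\<in>{..<n}. x t \<noteq> y t}" "{t\<in>{..<n}. x t \<noteq> y t} \<in> {T\<in>Pow {..<n}. card T \<le> r}"
      by (auto simp: PiE_iff)
    then show "x \<in> (\<Union>T\<in>{T\<in>Pow {..<n}. card T \<le> r}. ?B T)" by blast
  qed
  then have "card {x \<in> {..<n} \<rightarrow>\<^sub>E A. card {t\<in>{..<n}. x t \<noteq> y t} \<le> r} \<le> card (\<Union>T\<in>{T\<in>Pow {..<n}. card T \<le> r}. ?B T)"
    using fin by (intro card_mono) auto
  also have "\<dots> \<le> (\<Sum>T\<in>{T\<in>Pow {..<n}. card T \<le> r}. card (?B T))"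
    by (rule card_UN_le) simp
  also have "\<dots> \<le> (\<Sum>T\<in>{T\<in>Pow {..<n}. card T \<le> r}. card A ^ r)"
  proof (rule sum_mono)
    fix T assume T: "T \<in> {T\<in>Pow {..<n}. card T \<le> r}"
    have "card (?B T) = (\<Prod>t\<in>{..<n}. if t \<in> T then card A else 1)"
      by (simp add: card_PiE if_distrib[of card] cong: if_cong)
    also have "\<dots> = card A ^ card T"
      using T by (subst prod.inter_restrict[symmetric]) (auto simp: Int_absorb1)
    also have "\<dots> \<le> card A ^ r"
      using T A by (intro power_increasing) (auto simp: Suc_le_eq card_gt_0_iff)
    finally show "card (?B T) \<le> card A ^ r" .
  qed
  also have "\<dots> \<le> 2 ^ n * card A ^ r"
  proof -
    have "card {T\<in>Pow {..<n}. card T \<le> r} \<le> card (Pow {..<n})"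
      by (intro card_mono) auto
    then show ?thesis by (simp add: card_Pow)
  qed
  finally show ?thesis .
qed

text \<open>Greedy choice: as long as fewer than \<open>N\<close> words are chosen, the balls about
  them do not exhaust the space. The alternative \<open>N \<le> 1\<close> serves users of rate zero,
  for which the volume condition may fail. All indices get a word over the alphabet, so that every
  input obeys the power constraint.\<close>

lemma gilbert_varshamov:
  fixes A :: "'x set"
  assumes A: "finite A" "A \<noteq> {}" and N: "N \<le> 1 \<or> N * (2 ^ n * card A ^ r) \<le> card A ^ n"
  shows "\<exists>c. (\<forall>i. c i \<in> {..<n} \<rightarrow>\<^sub>E A) \<and> (\<forall>i\<in>{1..N}. \<forall>j\<in>{1..N}. i \<noteq> j \<longrightarrow> r < card {t\<in>{..<n}. c i t \<noteq> c j t})"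
proof -
  let ?W = "{..<n} \<rightarrow>\<^sub>E A"
  have finW: "finite ?W" using A by (intro finite_PiE) auto
  have cardW: "card ?W = card A ^ n" by (simp add: card_PiE)
  have "?W \<noteq> {}" using A by (simp add: PiE_eq_empty_iff)
  then obtain x0 where x0: "x0 \<in> ?W" by blast
  have "\<exists>c. (\<forall>i. c i \<in> ?W) \<and> (\<forall>i\<in>{1..N'}. \<forall>j\<in>{1..N'}. i \<noteq> j \<longrightarrow> r < card {t\<in>{..<n}. c i t \<noteq> c j t})" if "N' \<le> N" for N'
    using that
  proof (induction N')
    case 0
    then show ?case using x0 by (intro exI[of _ "\<lambda>_. x0"]) auto
  next
    case (Suc N')
    then obtain c where c: "\<forall>i. c i \<in> ?W"
      "\<forall>i\<in>{1..N'}. \<forall>j\<in>{1..N'}. i \<noteq> j \<longrightarrow> r < card {t\<in>{..<n}. c i t \<noteq> c j t}" by auto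
    show ?case
    proof (cases "N' = 0")
      case True
      then show ?thesis using x0 by (intro exI[of _ "\<lambda>_. x0"]) auto
    next
      case False
      let ?ball = "\<lambda>i. {x\<in>?W. card {t\<in>{..<n}. x t \<noteq> c i t} \<le> r}"
      have "card (\<Union>i\<in>{1..N'}. ?ball i) \<le> (\<Sum>i\<in>{1..N'}. card (?ball i))"
        by (rule card_UN_le) simp
      also have "\<dots> \<le> (\<Sum>i\<in>{1..N'}. 2 ^ n * card A ^ r)"
        using c by (intro sum_mono card_hamming_ball_le A) auto
      also have "\<dots> = N' * (2 ^ n * card A ^ r)" by simp
      also have "\<dots> < N * (2 ^ n * card A ^ r)"
        using Suc.prems A by (intro mult_strict_right_mono) (auto simp: card_gt_0_iff)
      also have "\<dots> \<le> card ?W" using N Suc.prems False cardW by auto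
      finally have "\<not> ?W \<subseteq> (\<Union>i\<in>{1..N'}. ?ball i)"
        using card_mono[of "\<Union>i\<in>{1..N'}. ?ball i" ?W] finW by fastforce
      then obtain x where x: "x \<in> ?W" and x': "x \<notin> (\<Union>i\<in>{1..N'}. ?ball i)" by blast
      have x: "x \<in> ?W" "\<And>i. i \<in> {1..N'} \<Longrightarrow> r < card {t\<in>{..<n}. x t \<noteq> c i t}"
      proof -
        show "r < card {t\<in>{..<n}. x t \<noteq> c i t}" if "i \<in> {1..N'}" for i
        proof (rule ccontr)
          assume "\<not> r < card {t\<in>{..<n}. x t \<noteq> c i t}"
          then have "x \<in> ?ball i" using x by simp
          then show False using x' that by blast
        qed
      qed (rule x)
      have sym: "{t\<in>{..<n}. c i t \<noteq> x t} = {t\<in>{..<n}. x t \<noteq> c i t}" for i by auto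
      show ?thesis
      proof (intro exI[of _ "c(Suc N' := x)"] conjI allI ballI impI)
        fix i show "(c(Suc N' := x)) i \<in> ?W" using c x by auto
      next
        fix i j assume ij: "i \<in> {1..Suc N'}" "j \<in> {1..Suc N'}" "i \<noteq> j"
        then consider "i = Suc N'" "j \<in> {1..N'}" | "j = Suc N'" "i \<in> {1..N'}" | "i \<in> {1..N'}" "j \<in> {1..N'}"
          by fastforce
        then show "r < card {t\<in>{..<n}. (c(Suc N' := x)) i t \<noteq> (c(Suc N' := x)) j t}"
        proof cases
          case 1
          then show ?thesis using x(2)[of j] by simp
        next
          case 2
          then show ?thesis using x(2)[of i] sym[of i] by simp
        next
          case 3
          then show ?thesis using c(2) ij by auto
        qed
      qed
    qed
  qed
  from this[of N] show ?thesis by simp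
qed

text \<open>A union bound over the index sets of size at least \<open>x\<close>, of which there are
  at most \<open>2 ^ card J\<close>. A product bound for each set takes the place of
  independence.\<close>

lemma (in prob_space) many_bad_events_le:
  fixes bad :: "'j \<Rightarrow> 'a \<Rightarrow> bool" and \<epsilon> x :: real
  assumes J: "finite J" and meas: "\<And>j. j \<in> J \<Longrightarrow> Measurable.pred M (bad j)"
    and \<epsilon>: "0 < \<epsilon>" "\<epsilon> \<le> 1"
    and le: "\<And>S. S \<subseteq> J \<Longrightarrow> emeasure M {\<omega>\<in>space M. \<forall>j\<in>S. bad j \<omega>} \<le> ennreal (\<epsilon> ^ card S)"
  shows "emeasure M {\<omega>\<in>space M. x \<le> real (card {j\<in>J. bad j \<omega>})} \<le> ennreal (2 ^ card J * \<epsilon> powr x)"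
proof -
  let ?\<S> = "{S\<in>Pow J. x \<le> real (card S)}"
  have finS: "finite S" if "S \<in> ?\<S>" for S using that J finite_subset by auto
  have sets: "{\<omega>\<in>space M. \<forall>j\<in>S. bad j \<omega>} \<in> sets M" if "S \<in> ?\<S>" for S
    using that finS[OF that] meas by (intro sets.sets_Collect_finite_All) (auto simp: pred_def)
  have "emeasure M {\<omega>\<in>space M. x \<le> real (card {j\<in>J. bad j \<omega>})} \<le>
    emeasure M (\<Union>S\<in>?\<S>. {\<omega>\<in>space M. \<forall>j\<in>S. bad j \<omega>})"
  proof (rule emeasure_mono)
    show "(\<Union>S\<in>?\<S>. {\<omega>\<in>space M. \<forall>j\<in>S. bad j \<omega>}) \<in> sets M"
      using J sets by (intro sets.finite_UN) auto
    show "{\<omega>\<in>space M. x \<le> real (card {j\<in>J. bad j \<omega>})} \<subseteq> (\<Union>S\<in>?\<S>. {\<omega>\<in>space M. \<forall>j\<in>S. bad j \<omega>})"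
    proof
      fix \<omega> assume "\<omega> \<in> {\<omega>\<in>space M. x \<le> real (card {j\<in>J. bad j \<omega>})}"
      then show "\<omega> \<in> (\<Union>S\<in>?\<S>. {\<omega>\<in>space M. \<forall>j\<in>S. bad j \<omega>})"
        by (intro UN_I[of "{j\<in>J. bad j \<omega>}"]) auto
    qed
  qed
  also have "\<dots> \<le> (\<Sum>S\<in>?\<S>. emeasure M {\<omega>\<in>space M. \<forall>j\<in>S. bad j \<omega>})"
    using J sets by (intro emeasure_subadditive_finite) auto
  also have "\<dots> \<le> (\<Sum>S\<in>?\<S>. ennreal (\<epsilon> powr x))"
  proof (rule sum_mono)
    fix S assume S: "S \<in> ?\<S>"
    have "emeasure M {\<omega>\<in>space M. \<forall>j\<in>S. bad j \<omega>} \<le> ennreal (\<epsilon> ^ card S)"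
      using S by (intro le) auto
    also have "\<epsilon> ^ card S = \<epsilon> powr real (card S)" using \<epsilon> by (simp add: powr_realpow)
    also have "ennreal \<dots> \<le> ennreal (\<epsilon> powr x)"
      using S \<epsilon> by (intro ennreal_leI powr_mono') auto
    finally show "emeasure M {\<omega>\<in>space M. \<forall>j\<in>S. bad j \<omega>} \<le> ennreal (\<epsilon> powr x)" .
  qed
  also have "\<dots> = ennreal (card ?\<S> * \<epsilon> powr x)"
    by (simp add: ennreal_mult ennreal_of_nat_eq_real_of_nat)
  also have "\<dots> \<le> ennreal (2 ^ card J * \<epsilon> powr x)"
  proof (intro ennreal_leI mult_right_mono)
    have "card ?\<S> \<le> card (Pow J)" using J by (intro card_mono) auto
    then have "card ?\<S> \<le> 2 ^ card J" using J by (simp add: card_Pow)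
    then have "real (card ?\<S>) \<le> real (2 ^ card J)" by (simp only: of_nat_le_iff)
    then show "real (card ?\<S>) \<le> 2 ^ card J" by simp
  qed simp
  finally show ?thesis .
qed

section \<open>Approximate zero-forcing directions\<close>

definition dense_sphere :: "nat \<Rightarrow> complex ^ 'k::finite" where
  "dense_sphere = (SOME f. (\<forall>i. norm (f i) = 1) \<and> sphere 0 1 \<subseteq> closure (range f))"

lemma dense_sphere:
  "norm (dense_sphere i :: complex ^ 'k::finite) = 1"
  "sphere 0 1 \<subseteq> closure (range (dense_sphere :: nat \<Rightarrow> complex ^ 'k))"
proof -
  have "\<exists>f :: nat \<Rightarrow> complex ^ 'k. (\<forall>i. norm (f i) = 1) \<and> sphere 0 1 \<subseteq> closure (range f)"
  proof -
    obtain T :: "(complex ^ 'k) set" where T: "countable T" "T \<subseteq> sphere 0 1" "sphere 0 1 \<subseteq> closure T"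
      by (rule separable)
    have ne: "sphere (0 :: complex ^ 'k) 1 \<noteq> {}" by simp
    then have "T \<noteq> {}" using T by auto
    then have range: "range (from_nat_into T) = T" using T by (intro range_from_nat_into)
    have "norm (from_nat_into T i) = 1" for i
    proof -
      have "from_nat_into T i \<in> sphere 0 1" using T(2) range by blast
      then show ?thesis by simp
    qed
    then show ?thesis using T(3) range by (intro exI[of _ "from_nat_into T"]) simp
  qed
  from someI_ex[OF this] show "norm (dense_sphere i :: complex ^ 'k) = 1"
    "sphere 0 1 \<subseteq> closure (range (dense_sphere :: nat \<Rightarrow> complex ^ 'k))"
    unfolding dense_sphere_def by blast+
qed

definition row_times :: "complex ^ 'k::finite \<Rightarrow> complex ^ 'k \<Rightarrow> complex" where
  "row_times h x = (\<Sum>i\<in>UNIV. h $ i * x $ i)"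

text \<open>An approximate zero-forcing direction for user \<open>k\<close>; choosing it from a countable set makes
  it a measurable function of the estimates of the other users.\<close>

definition zero_forcing :: "real \<Rightarrow> ('k \<Rightarrow> complex ^ 'k::finite) \<Rightarrow> 'k \<Rightarrow> complex ^ 'k" where
  "zero_forcing \<delta> H k = dense_sphere (LEAST i. \<forall>l. l \<noteq> k \<longrightarrow> cmod (row_times (H l) (dense_sphere i)) \<le> \<delta>)"

lemma norm_zero_forcing[simp]: "norm (zero_forcing \<delta> H k) = 1"
  by (simp add: zero_forcing_def dense_sphere)

lemma cmod_row_times_le:
  assumes "\<And>i. cmod (h $ i) \<le> b" "norm x \<le> c"
  shows "cmod (row_times (h :: complex ^ 'k::finite) x) \<le> real CARD('k) * (b * c)"
proof -
  have "cmod (row_times h x) \<le> (\<Sum>i\<in>(UNIV :: 'k set). b * c)"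
    unfolding row_times_def
  proof (intro sum_norm_le)
    fix i
    show "cmod (h $ i * x $ i) \<le> b * c"
      unfolding norm_mult using assms(1)[of i] assms(2) Finite_Cartesian_Product.norm_nth_le[of x i]
      by (intro mult_mono) (auto intro: order_trans[OF norm_ge_zero])
  qed
  then show ?thesis by simp
qed

text \<open>There is one condition fewer than there are unknowns: the square matrix with rows
  \<open>H l\<close> and with row \<open>k\<close> replaced by 0 is singular, and a kernel vector
  can be normalised.\<close>

lemma ex_orthogonal_direction:
  fixes H :: "'k \<Rightarrow> complex ^ 'k::finite"
  shows "\<exists>x :: complex ^ 'k. norm x = 1 \<and> (\<forall>l. l \<noteq> k \<longrightarrow> row_times (H l) x = 0)"
proof -
  define A :: "complex ^ 'k ^ 'k" where "A = (\<chi> l. if l = k then 0 else H l)"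
  have "row k A = 0" by (simp add: row_def A_def vec_eq_iff)
  then have "det A = 0" by (rule det_zero_row)
  then obtain x where x: "x \<noteq> 0" "A *v x = 0"
    using invertible_det_nz[of A] by (metis invertible_left_inverse matrix_left_invertible_ker)
  have orth: "row_times (H l) x = 0" if "l \<noteq> k" for l
    using that arg_cong[OF x(2), of "\<lambda>v. v $ l"] by (simp add: matrix_vector_mult_def A_def row_times_def)
  have "row_times (H l) (c *\<^sub>R x) = c *\<^sub>R row_times (H l) x" for l c
    unfolding row_times_def scaleR_sum_right by simp
  then show ?thesis using x orth by (intro exI[of _ "(1 / norm x) *\<^sub>R x"]) simp
qed

text \<open>A member of the dense sequence that is close enough to an exact null direction meets all
  conditions, so the \<open>LEAST\<close> in \<open>zero_forcing\<close> is attained.\<close>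

lemma row_times_zero_forcing:
  fixes H :: "'k \<Rightarrow> complex ^ 'k::finite"
  assumes \<delta>: "\<delta> > 0" and l: "l \<noteq> k"
  shows "cmod (row_times (H l) (zero_forcing \<delta> H k)) \<le> \<delta>"
proof -
  obtain x where x: "norm x = 1" "\<And>l. l \<noteq> k \<Longrightarrow> row_times (H l) x = 0"
    using ex_orthogonal_direction[of k H] by blast
  define B where "B = (\<Sum>l\<in>UNIV. \<Sum>i\<in>UNIV. cmod (H l $ i)) + 1"
  have B: "cmod (H l $ i) \<le> B" for l i
  proof -
    have "cmod (H l $ i) \<le> (\<Sum>i\<in>UNIV. cmod (H l $ i))" by (rule member_le_sum) auto
    also have "\<dots> \<le> (\<Sum>l\<in>UNIV. \<Sum>i\<in>UNIV. cmod (H l $ i))" by (rule member_le_sum) (auto intro: sum_nonneg)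
    finally show ?thesis by (simp add: B_def)
  qed
  have B1: "B \<ge> 1" unfolding B_def by (simp add: sum_nonneg)
  define e where "e = \<delta> / (real CARD('k) * B)"
  have e: "e > 0" using \<delta> B1 by (simp add: e_def)
  have "x \<in> closure (range dense_sphere)" using x dense_sphere(2) by auto
  then obtain i where i: "dist (dense_sphere i) x < e"
    using e unfolding closure_approachable by blast
  have "\<forall>l. l \<noteq> k \<longrightarrow> cmod (row_times (H l) (dense_sphere i)) \<le> \<delta>"
  proof (intro allI impI)
    fix l assume "l \<noteq> k"
    then have "row_times (H l) (dense_sphere i) = row_times (H l) (dense_sphere i - x)"
      using x(2)[of l] by (simp add: row_times_def right_diff_distrib sum_subtractf)
    also have "cmod \<dots> \<le> real CARD('k) * (B * e)"
      using i by (intro cmod_row_times_le B) (simp add: dist_norm)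
    also have "\<dots> = \<delta>" using B1 by (simp add: e_def)
    finally show "cmod (row_times (H l) (dense_sphere i)) \<le> \<delta>" .
  qed
  from LeastI[where P = "\<lambda>i. \<forall>l. l \<noteq> k \<longrightarrow> cmod (row_times (H l) (dense_sphere i)) \<le> \<delta>", OF this] l
  show ?thesis unfolding zero_forcing_def by blast
qed

text \<open>The direction for \<open>k\<close> ignores row \<open>k\<close>. This keeps the wanted
  gain an affine function of the estimate of user \<open>k\<close>.\<close>

lemma zero_forcing_cong:
  "(\<And>l. l \<noteq> k \<Longrightarrow> H l = H' l) \<Longrightarrow> zero_forcing \<delta> H k = zero_forcing \<delta> H' k"
  unfolding zero_forcing_def by (intro arg_cong[where f=dense_sphere] arg_cong[where f=Least] ext) auto

lemma row_times_measurable: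
  "f \<in> borel_measurable M \<Longrightarrow> g \<in> borel_measurable M \<Longrightarrow> (\<lambda>x. row_times (f x) (g x)) \<in> borel_measurable M"
  unfolding row_times_def by (intro borel_measurable_sum borel_measurable_times borel_measurable_vec_nth)

lemma zero_forcing_measurable:
  fixes H :: "'a \<Rightarrow> 'k \<Rightarrow> complex ^ 'k::finite"
  assumes "\<And>l. (\<lambda>x. H x l) \<in> borel_measurable M"
  shows "(\<lambda>x. zero_forcing \<delta> (H x) k) \<in> borel_measurable M"
proof -
  have "(\<lambda>x. LEAST i. \<forall>l. l \<noteq> k \<longrightarrow> cmod (row_times (H x l) (dense_sphere i)) \<le> \<delta>) \<in> M \<rightarrow>\<^sub>M count_space UNIV"
  proof (intro measurable_Least)
    fix i
    have [measurable]: "(\<lambda>x. row_times (H x l) (dense_sphere i)) \<in> borel_measurable M" for l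
      by (intro row_times_measurable assms borel_measurable_const)
    show "(\<lambda>x. \<forall>l. l \<noteq> k \<longrightarrow> cmod (row_times (H x l) (dense_sphere i)) \<le> \<delta>) \<in> M \<rightarrow>\<^sub>M count_space UNIV"
      by measurable
  qed
  then show ?thesis unfolding zero_forcing_def
    by (rule measurable_compose) simp
qed

section \<open>Weak gains and loud noise\<close>

text \<open>The leakage \<open>P powr (- (1 / 2))\<close> never exceeds the estimation error level
  \<open>P powr (- \<alpha> k m / 2)\<close>, since qualities are at most 1 and
  \<open>P \<ge> 1\<close>; exact orthogonality would not lower the order of the
  interference.\<close>

definition direction :: "real \<Rightarrow> ('k::finite, 'm) csi_block \<Rightarrow> 'k \<Rightarrow> 'm \<Rightarrow> nat \<Rightarrow> complex ^ 'k" where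
  "direction P g k m t = zero_forcing (P powr (- (1 / 2))) (\<lambda>l. g (l, m, t)) k"

definition gain ::
  "('k::finite \<Rightarrow> 'm \<Rightarrow> real) \<Rightarrow> real \<Rightarrow> 'k \<Rightarrow> 'k \<Rightarrow> ('k, 'm) csi_block \<Rightarrow> ('k, 'm) csi_block \<Rightarrow> 'm \<Rightarrow> nat \<Rightarrow> complex" where
  "gain \<alpha> P k l g d m t = row_times (chan \<alpha> P k m (g (k, m, t)) (d (k, m, t))) (direction P g l m t)"

lemma norm_direction[simp]: "norm (direction P g k m t) = 1"
  by (simp add: direction_def)

lemma direction_cong:
  "(\<And>l. l \<noteq> k \<Longrightarrow> g (l, m, t) = g' (l, m, t)) \<Longrightarrow> direction P g k m t = direction P g' k m t"
  unfolding direction_def by (intro zero_forcing_cong) simp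

lemma direction_measurable:
  assumes "t < n"
  shows "(\<lambda>g. direction P g k m t) \<in> borel_measurable (csi_space n :: ('k::finite, 'm::finite) csi_block measure)"
  unfolding direction_def by (intro zero_forcing_measurable csi_component_measurable assms)

lemma gain_measurable:
  assumes t: "t < n"
  shows "(\<lambda>(g, d). gain \<alpha> P k l g d m t) \<in>
    borel_measurable (csi_space n \<Otimes>\<^sub>M (csi_space n :: ('k::finite, 'm::finite) csi_block measure))"
  unfolding gain_def case_prod_beta'
  by (intro row_times_measurable chan_measurable measurable_compose[OF measurable_fst csi_component_measurable[OF t]]
      measurable_compose[OF measurable_snd csi_component_measurable[OF t]]
      measurable_compose[OF measurable_fst direction_measurable[OF t]])

lemma cmod_gain_le:
  fixes g :: "('k::finite, 'm) csi_block"
  assumes "bounded_chan \<alpha> hi P n g d" "t < n"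
  shows "cmod (gain \<alpha> P k l g d m t) \<le> real CARD('k) * hi"
  unfolding gain_def using assms
  by (intro order_trans[OF cmod_row_times_le[where b = hi and c = 1]])
    (auto simp: bounded_chan_def)

lemma row_times_chan:
  "row_times (chan \<alpha> P k m e d) x = row_times e x + of_real (sqrt (P powr (- \<alpha> k m))) * row_times d x"
  unfolding row_times_def chan_nth by (simp add: scaleR_conv_of_real distrib_right sum.distrib sum_distrib_left mult.assoc)

lemma sqrt_powr: "P > 0 \<Longrightarrow> sqrt (P powr x) = P powr (x / 2)"
  by (simp add: powr_half_sqrt[symmetric] powr_powr)

text \<open>The estimate of user \<open>k\<close> sees at most the zero-forcing leakage, and the
  deviation is attenuated by \<open>P powr (- \<alpha> k m / 2)\<close>. At quality 0 nothing is
  attenuated, and the bound on the channel itself suffices.\<close>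

lemma interference_le:
  fixes g :: "('k::finite, 'm) csi_block"
  assumes bd: "bounded_chan \<alpha> hi P n g d" and t: "t < n" and P: "P \<ge> 1"
    and dev: "\<alpha> k m > 0 \<Longrightarrow> (\<And>i. cmod (d (k, m, t) $ i) \<le> 4 * hi)" and hi: "hi \<ge> 0"
    and q: "0 \<le> \<alpha> k m" "\<alpha> k m \<le> 1" and kl: "k \<noteq> l"
  shows "cmod (gain \<alpha> P k l g d m t) \<le> (1 + 4 * real CARD('k) * hi) * P powr (- \<alpha> k m / 2)"
proof (cases "\<alpha> k m = 0")
  case True
  have "cmod (gain \<alpha> P k l g d m t) \<le> real CARD('k) * hi" by (rule cmod_gain_le[OF bd t])
  also have "\<dots> \<le> (1 + 4 * real CARD('k) * hi)" using hi by simp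
  finally show ?thesis using True P by simp
next
  case False
  then have a: "\<alpha> k m > 0" using q by simp
  let ?u = "direction P g l m t"
  have "cmod (gain \<alpha> P k l g d m t) \<le> cmod (row_times (g (k, m, t)) ?u) + P powr (- \<alpha> k m / 2) * cmod (row_times (d (k, m, t)) ?u)"
    unfolding gain_def row_times_chan using P
    by (intro order_trans[OF norm_triangle_ineq]) (simp add: norm_mult sqrt_powr)
  also have "\<dots> \<le> P powr (- (1 / 2)) + P powr (- \<alpha> k m / 2) * (real CARD('k) * (4 * hi * 1))"
  proof (intro add_mono mult_left_mono)
    show "cmod (row_times (g (k, m, t)) ?u) \<le> P powr (- (1 / 2))"
      unfolding direction_def using P kl row_times_zero_forcing[of "P powr (- (1 / 2))" k l "\<lambda>l. g (l, m, t)"] by simp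
    show "cmod (row_times (d (k, m, t)) ?u) \<le> real CARD('k) * (4 * hi * 1)"
      using dev[OF a] by (intro cmod_row_times_le) auto
  qed simp
  also have "\<dots> \<le> P powr (- \<alpha> k m / 2) + P powr (- \<alpha> k m / 2) * (real CARD('k) * (4 * hi * 1))"
    using P q by (intro add_right_mono powr_mono) auto
  finally show ?thesis by (simp add: algebra_simps)
qed

context partial_csit_bc
begin

text \<open>The coefficient bound holds at every power. At power 1 the channel is estimate plus
  deviation; at power \<open>4 powr (1 / \<alpha> k m)\<close> it is estimate plus half the
  deviation. Subtracting isolates half the deviation. At quality 0 the channel does not vary with
  the power, and nothing can be read off.\<close>

lemma deviation_bound:
  assumes bd: "\<And>P n. P \<ge> 1 \<Longrightarrow> AE \<omega> in Q. bounded_chan \<alpha> hi P n (csi_of n est \<omega>) (csi_of n err \<omega>)"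
  shows "AE \<omega> in Q. \<forall>k m. \<forall>t<n. \<forall>i. \<alpha> k m > 0 \<longrightarrow> cmod (csi_of n err \<omega> (k, m, t) $ i) \<le> 4 * hi"
proof -
  let ?P = "\<lambda>k m. if \<alpha> k m > 0 then 4 powr (1 / \<alpha> k m) else 1"
  have "?P k m \<ge> 1" for k m by (auto intro: ge_one_powr_ge_zero)
  then have "AE \<omega> in Q. \<forall>p\<in>UNIV. bounded_chan \<alpha> hi (?P (fst p) (snd p)) n (csi_of n est \<omega>) (csi_of n err \<omega>)"
    by (intro AE_finite_allI bd) auto
  with bd[of 1 n, OF order_refl] show ?thesis
  proof eventually_elim
    case (elim \<omega>)
    show ?case
    proof (intro allI impI)
      fix k m t i assume t: "t < n" and a: "\<alpha> k m > 0"
      let ?e = "csi_of n est \<omega> (k, m, t) $ i" and ?d = "csi_of n err \<omega> (k, m, t) $ i"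
      have 1: "cmod (?e + ?d) \<le> hi"
        using elim(1) t by (auto simp: bounded_chan_def chan_nth)
      have "bounded_chan \<alpha> hi (4 powr (1 / \<alpha> k m)) n (csi_of n est \<omega>) (csi_of n err \<omega>)"
        using elim(2)[rule_format, of "(k, m)"] a by simp
      then have "cmod (chan \<alpha> (4 powr (1 / \<alpha> k m)) k m (csi_of n est \<omega> (k, m, t)) (csi_of n err \<omega> (k, m, t)) $ i) \<le> hi"
        using t by (simp add: bounded_chan_def)
      moreover have "sqrt ((4 powr (1 / \<alpha> k m)) powr (- \<alpha> k m)) = 1 / 2"
        using a by (simp add: powr_powr powr_minus_divide real_sqrt_divide)
      ultimately have 2: "cmod (?e + (1 / 2) *\<^sub>R ?d) \<le> hi"
        by (simp add: chan_nth)
      have "cmod ((1 / 2) *\<^sub>R ?d) = cmod ((?e + ?d) - (?e + (1 / 2) *\<^sub>R ?d))"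
        by (simp add: scaleR_conv_of_real)
      also have "\<dots> \<le> cmod (?e + ?d) + cmod (?e + (1 / 2) *\<^sub>R ?d)" by (rule norm_triangle_ineq4)
      finally show "cmod ?d \<le> 4 * hi" using 1 2 by simp
    qed
  qed
qed

text \<open>Given all other entries, the gain is an affine function of the estimate of user
  \<open>k\<close>, and its coefficients form a unit vector, because the direction depends on the
  other estimates only. Integrating over estimates and not over deviations, whose effect may shrink
  with the power, makes the constant uniform in \<open>P\<close>.\<close>

lemma weak_gain_probability:
  fixes hi :: real
  assumes hi: "0 < hi"
    and bd: "\<And>P n. P \<ge> 1 \<Longrightarrow> AE \<omega> in Q. bounded_chan \<alpha> hi P n (csi_of n est \<omega>) (csi_of n err \<omega>)"
  obtains C where "C > 0"
    "\<And>n P k S \<eta>. P \<ge> 1 \<Longrightarrow> S \<subseteq> UNIV \<times> {..<n} \<Longrightarrow> \<eta> \<ge> 0 \<Longrightarrow>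
      emeasure Q {\<omega>\<in>space Q. \<forall>j\<in>S. cmod (gain \<alpha> P k k (csi_of n est \<omega>) (csi_of n err \<omega>) (fst j) (snd j)) \<le> \<eta>}
      \<le> ennreal ((C * \<eta>\<^sup>2) ^ card S)"
proof -
  obtain fmax where fmax: "fmax > 0" and density:
    "\<And>B1 B2 F b. finite B1 \<Longrightarrow> finite B2 \<Longrightarrow> B1 \<inter> B2 = {} \<Longrightarrow>
      F \<in> borel_measurable (\<Pi>\<^sub>M i\<in>B1 \<union> B2. lborel) \<Longrightarrow>
      (\<And>y. y \<in> space (\<Pi>\<^sub>M i\<in>B2. (lborel :: complex measure)) \<Longrightarrow>
        (\<integral>\<^sup>+x. F (merge B2 B1 (y, x)) \<partial>(\<Pi>\<^sub>M i\<in>B1. lborel)) \<le> b) \<Longrightarrow>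
      (\<integral>\<^sup>+\<omega>. F (\<lambda>i\<in>B1 \<union> B2. csi_entry est err i \<omega>) \<partial>Q) \<le> ennreal (fmax ^ card B1) * b"
  proof (rule bounded_densities_nn_integral[OF densities], goal_cases)
    case (1 fmax)
    show ?case by (rule 1(1), rule 1(2), rule 1(3))
  qed
  define K where "K = CARD('k)"
  have K1: "K \<ge> 1" by (simp add: K_def Suc_leI)
  define C where "C = fmax ^ K * (pi * hi\<^sup>2) ^ K * (K / hi\<^sup>2)"
  show thesis
  proof (rule that)
    show "C > 0" using fmax hi K1 by (simp add: C_def)
    fix n :: nat and P :: real and k :: 'k and S :: "('m \<times> nat) set" and \<eta> :: real
    assume P: "P \<ge> 1" and S: "S \<subseteq> UNIV \<times> {..<n}" and \<eta>: "\<eta> \<ge> 0"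
    have finS: "finite S" using S finite_subset by (auto intro: finite_subset)
    define ent where "ent j i = (Estimate, k, fst j, snd j, i)" for j :: "'m \<times> nat" and i :: 'k
    define D where "D = (\<lambda>(j, i). ent j i) ` (S \<times> UNIV)"
    define B2 where "B2 = entry_block n - D"
    have inj: "inj_on (\<lambda>(j, i). ent j i) (S \<times> UNIV)" by (auto simp: inj_on_def ent_def)
    have D: "finite D" "D \<subseteq> entry_block n" using finS S by (auto simp: D_def ent_def)
    have cardD: "card D = card S * K"
      unfolding D_def using card_image[OF inj] by (simp add: card_cartesian_product K_def)
    have memD: "(c, k1, m, t, i) \<in> D \<longleftrightarrow> c = Estimate \<and> k1 = k \<and> (m, t) \<in> S" for c k1 m t i
      by (force simp: D_def ent_def image_iff)
    define H where "H g d = ennreal (of_bool (bounded_chan \<alpha> hi P n g d \<and>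
      (\<forall>j\<in>S. cmod (gain \<alpha> P k k g d (fst j) (snd j)) \<le> \<eta>)))" for g d
    define F where "F x = H (csi_from n Estimate x) (csi_from n Deviation x)" for x
    have H_meas: "(\<lambda>p. H (fst p) (snd p)) \<in> borel_measurable (csi_space n \<Otimes>\<^sub>M csi_space n)"
    proof -
      have "Measurable.pred (csi_space n \<Otimes>\<^sub>M csi_space n) (\<lambda>p. \<forall>j\<in>S. cmod (gain \<alpha> P k k (fst p) (snd p) (fst j) (snd j)) \<le> \<eta>)"
      proof (intro pred_intros_finite finS)
        fix j assume "j \<in> S"
        then have t: "snd j < n" using S by auto
        note gain_measurable[OF t, unfolded case_prod_beta', measurable]
        show "Measurable.pred (csi_space n \<Otimes>\<^sub>M csi_space n) (\<lambda>p. cmod (gain \<alpha> P k k (fst p) (snd p) (fst j) (snd j)) \<le> \<eta>)"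
          by measurable
      qed
      then show ?thesis unfolding H_def
        by (intro measurable_compose[OF _ measurable_ennreal] of_bool_measurable
          pred_intros_logic bounded_chan_measurable[unfolded case_prod_beta'])
    qed
    have DB: "D \<union> B2 = entry_block n" using D by (auto simp: B2_def)
    have F_meas: "F \<in> borel_measurable (\<Pi>\<^sub>M i\<in>D \<union> B2. lborel)"
    proof -
      have "(\<lambda>x. (csi_from n Estimate x, csi_from n Deviation x)) \<in>
        (\<Pi>\<^sub>M i\<in>entry_block n. lborel) \<rightarrow>\<^sub>M (csi_space n \<Otimes>\<^sub>M (csi_space n :: ('k, 'm) csi_block measure))"
        by (intro measurable_Pair csi_from_measurable)
      from measurable_compose[OF this H_meas] show ?thesis
        by (simp add: F_def[abs_def] DB)
    qed
    \<comment> \<open>The factor \<open>K\<close> comes from the largest entry of a unit vector with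
      \<open>K\<close> entries, whose square is at least \<open>1 / K\<close>.\<close>
    define \<kappa> where "\<kappa> = K * \<eta>\<^sup>2 / hi\<^sup>2"
    have inner: "(\<integral>\<^sup>+x. F (merge B2 D (y, x)) \<partial>(\<Pi>\<^sub>M i\<in>D. lborel)) \<le> ennreal (((pi * hi\<^sup>2) ^ K * \<kappa>) ^ card S)" for y
    proof -
      let ?z = "\<lambda>x. merge B2 D (y, x)"
      define g0 :: "('k, 'm) csi_block" where "g0 = csi_from n Estimate y"
      define d0 :: "('k, 'm) csi_block" where "d0 = csi_from n Deviation y"
      have dev_z: "csi_from n Deviation (?z x) = d0" for x
        unfolding d0_def csi_from_def using memD
        by (auto simp: fun_eq_iff restrict_def block_def merge_def vec_eq_iff B2_def)
      have est_l: "csi_from n Estimate (?z x) (l, m, t) = g0 (l, m, t)" if "l \<noteq> k" "t < n" for x l m t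
        unfolding g0_def using memD that by (auto simp: csi_from_def merge_def vec_eq_iff B2_def)
      have est_k: "csi_from n Estimate (?z x) (k, fst j, snd j) $ i = x (ent j i)" if "j \<in> S" for x j i
        using that S memD by (cases j) (auto simp: csi_from_nth merge_def B2_def ent_def)
      define V where "V j i = direction P g0 k (fst j) (snd j) $ i" for j i
      define sc where "sc j = complex_of_real (sqrt (P powr (- \<alpha> k (fst j))))" for j :: "'m \<times> nat"
      define b where "b j = (\<Sum>i\<in>UNIV. sc j * d0 (k, fst j, snd j) $ i * V j i)" for j
      \<comment> \<open>By the coefficient bound at power \<open>P\<close>, each estimate entry lies
        in a disc about minus the scaled deviation.\<close>
      define cc where "cc e = (case e of (_ :: csi_kind, k1 :: 'k, m, t, i) \<Rightarrow> - (sc (m, t) * d0 (k1, m, t) $ i))" for e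
      obtain s where s: "\<And>j i. cmod (V j i) \<le> cmod (V j (s j))"
      proof -
        have "\<forall>j. \<exists>i. \<forall>i'. cmod (V j i') \<le> cmod (V j i)"
          unfolding V_def using ex_largest_component by blast
        then show ?thesis using that by metis
      qed
      have V2: "K * (cmod (V j (s j)))\<^sup>2 \<ge> 1" for j
      proof -
        have "1 = (norm (direction P g0 k (fst j) (snd j)))\<^sup>2" by simp
        also have "\<dots> = (\<Sum>i\<in>UNIV. (cmod (V j i))\<^sup>2)"
          unfolding norm_vec_def L2_set_def V_def by (simp add: sum_nonneg)
        also have "\<dots> \<le> (\<Sum>i\<in>(UNIV :: 'k set). (cmod (V j (s j)))\<^sup>2)"
          using s by (intro sum_mono power_mono) auto
        finally show ?thesis by (simp add: K_def)
      qed
      have "F (?z x) \<le> (\<Prod>j\<in>S. of_bool (cmod (b j + (\<Sum>i\<in>UNIV. V j i * x (ent j i))) \<le> \<eta>)) *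
            (\<Prod>e\<in>D. of_bool (dist (cc e) (x e) \<le> hi))" for x
      proof (cases "bounded_chan \<alpha> hi P n (csi_from n Estimate (?z x)) d0 \<and>
          (\<forall>j\<in>S. cmod (gain \<alpha> P k k (csi_from n Estimate (?z x)) d0 (fst j) (snd j)) \<le> \<eta>)")
        case False
        then show ?thesis by (auto simp: F_def H_def dev_z)
      next
        case True
        have "cmod (b j + (\<Sum>i\<in>UNIV. V j i * x (ent j i))) \<le> \<eta>" if j: "j \<in> S" for j
        proof -
          have t: "snd j < n" using j S by auto
          have dir: "direction P (csi_from n Estimate (?z x)) k (fst j) (snd j) = direction P g0 k (fst j) (snd j)"
            by (intro direction_cong est_l t)
          have "gain \<alpha> P k k (csi_from n Estimate (?z x)) d0 (fst j) (snd j) = b j + (\<Sum>i\<in>UNIV. V j i * x (ent j i))"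
            unfolding gain_def dir row_times_def chan_nth est_k[OF j] b_def sum.distrib[symmetric] V_def[symmetric]
            by (intro sum.cong refl) (simp add: sc_def scaleR_conv_of_real algebra_simps)
          then show ?thesis using True j by metis
        qed
        moreover have "dist (cc e) (x e) \<le> hi" if e: "e \<in> D" for e
        proof -
          obtain j i where je: "e = ent j i" "j \<in> S" using e by (auto simp: D_def)
          have t: "snd j < n" using je S by auto
          have "cmod (chan \<alpha> P k (fst j) (csi_from n Estimate (?z x) (k, fst j, snd j)) (d0 (k, fst j, snd j)) $ i) \<le> hi"
            using True t unfolding bounded_chan_def by blast
          moreover have "dist (cc e) (x e) = cmod (x e + sc j * d0 (k, fst j, snd j) $ i)"
            by (simp add: cc_def je ent_def sc_def dist_norm norm_minus_commute[of "- _"] del: prod.collapse)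
          ultimately show ?thesis by (simp add: chan_nth est_k[OF je(2)] sc_def scaleR_conv_of_real je(1) del: prod.collapse)
        qed
        ultimately show ?thesis using True by (simp add: F_def H_def dev_z)
      qed
      then have "(\<integral>\<^sup>+x. F (?z x) \<partial>(\<Pi>\<^sub>M i\<in>D. lborel)) \<le>
        (\<integral>\<^sup>+x. (\<Prod>j\<in>S. of_bool (cmod (b j + (\<Sum>i\<in>UNIV. V j i * x (ent j i))) \<le> \<eta>)) *
            (\<Prod>e\<in>D. of_bool (dist (cc e) (x e) \<le> hi)) \<partial>(\<Pi>\<^sub>M i\<in>D. lborel))"
        by (intro nn_integral_mono)
      also have "\<dots> \<le> (\<Prod>j\<in>S. ennreal ((pi * hi\<^sup>2) ^ CARD('k) * \<kappa>))"
      proof (rule small_ball_integral[OF finS inj hi D_def, where s = s])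
        fix j
        show "0 \<le> \<kappa>" by (simp add: \<kappa>_def)
        show "1 \<le> \<kappa> \<or> V j (s j) \<noteq> 0 \<and> \<eta>\<^sup>2 \<le> \<kappa> * hi\<^sup>2 * (cmod (V j (s j)))\<^sup>2"
        proof -
          have "V j (s j) \<noteq> 0" using V2[of j] by auto
          moreover have "\<eta>\<^sup>2 * 1 \<le> \<eta>\<^sup>2 * (K * (cmod (V j (s j)))\<^sup>2)"
            by (intro mult_left_mono V2) simp
          ultimately show ?thesis using hi by (simp add: \<kappa>_def mult.commute mult.left_commute)
        qed
      qed (use \<eta> in auto)
      also have "\<dots> = ennreal (((pi * hi\<^sup>2) ^ K * \<kappa>) ^ card S)"
        by (subst prod_constant, subst ennreal_power) (auto simp: \<kappa>_def K_def)
      finally show ?thesis .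
    qed
    let ?A = "{\<omega>\<in>space Q. \<forall>j\<in>S. cmod (gain \<alpha> P k k (csi_of n est \<omega>) (csi_of n err \<omega>) (fst j) (snd j)) \<le> \<eta>}"
    have A: "?A \<in> sets Q"
    proof -
      have "Measurable.pred Q (\<lambda>\<omega>. \<forall>j\<in>S. cmod (gain \<alpha> P k k (csi_of n est \<omega>) (csi_of n err \<omega>) (fst j) (snd j)) \<le> \<eta>)"
      proof (intro pred_intros_finite finS)
        fix j assume "j \<in> S"
        then have t: "snd j < n" using S by auto
        have "(\<lambda>\<omega>. (csi_of n est \<omega>, csi_of n err \<omega>)) \<in> Q \<rightarrow>\<^sub>M csi_space n \<Otimes>\<^sub>M csi_space n" by measurable
        from measurable_compose[OF this gain_measurable[OF t]]
        have [measurable]: "(\<lambda>\<omega>. gain \<alpha> P k k (csi_of n est \<omega>) (csi_of n err \<omega>) (fst j) (snd j)) \<in> borel_measurable Q" by simp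
        show "Measurable.pred Q (\<lambda>\<omega>. cmod (gain \<alpha> P k k (csi_of n est \<omega>) (csi_of n err \<omega>) (fst j) (snd j)) \<le> \<eta>)"
          by measurable
      qed
      then show ?thesis by (simp add: pred_def)
    qed
    have "emeasure Q ?A = (\<integral>\<^sup>+\<omega>. indicator ?A \<omega> \<partial>Q)" using A by simp
    also have "\<dots> = (\<integral>\<^sup>+\<omega>. F (\<lambda>i\<in>D \<union> B2. csi_entry est err i \<omega>) \<partial>Q)"
    proof (rule nn_integral_cong_AE)
      show "AE \<omega> in Q. indicator ?A \<omega> = F (\<lambda>i\<in>D \<union> B2. csi_entry est err i \<omega>)"
        using bd[OF P, of n] AE_space
        by eventually_elim
          (simp add: F_def H_def DB csi_of_eq_csi_from(1)[of n est _ err, symmetric]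
            csi_of_eq_csi_from(2)[of n err _ est, symmetric] indicator_def)
    qed
    also have "\<dots> \<le> ennreal (fmax ^ card D) * ennreal (((pi * hi\<^sup>2) ^ K * \<kappa>) ^ card S)"
      by (rule density[OF D(1) _ _ F_meas inner]) (auto simp: B2_def)
    also have "\<dots> = ennreal (fmax ^ card D * ((pi * hi\<^sup>2) ^ K * \<kappa>) ^ card S)"
      using fmax by (intro ennreal_mult[symmetric]) (auto simp: \<kappa>_def)
    also have "fmax ^ card D * ((pi * hi\<^sup>2) ^ K * \<kappa>) ^ card S = (C * \<eta>\<^sup>2) ^ card S"
    proof -
      have "fmax ^ card D = (fmax ^ K) ^ card S" by (simp add: cardD power_mult[symmetric] mult.commute)
      moreover have "fmax ^ K * ((pi * hi\<^sup>2) ^ K * \<kappa>) = C * \<eta>\<^sup>2" by (simp add: C_def \<kappa>_def)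
      ultimately show ?thesis by (simp only: power_mult_distrib[symmetric])
    qed
    finally show "emeasure Q ?A \<le> ennreal ((C * \<eta>\<^sup>2) ^ card S)" .
  qed
qed

text \<open>The tail of one noise sample tends to zero, and the samples are independent; so the
  threshold does not depend on the block.\<close>

lemma loud_noise_probability:
  assumes e: "\<epsilon> > (0 :: real)"
  obtains \<tau> where "\<tau> \<ge> 0"
    "\<And>n S. S \<subseteq> block n \<Longrightarrow> emeasure (noise_law n) {z\<in>space (noise_law n). \<forall>j\<in>S. \<tau> < cmod (z j)} \<le> ennreal (\<epsilon> ^ card S)"
proof -
  have fin: "finite_measure cgauss" by (rule prob_space.finite_measure[OF prob_space_cgauss])
  let ?A = "\<lambda>i::nat. {z. real i < cmod z}"
  have A: "?A i \<in> sets cgauss" for i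
    unfolding sets_cgauss by (intro borel_open open_Collect_less continuous_intros)
  have "(\<lambda>i. measure cgauss (?A i)) \<longlonglongrightarrow> measure cgauss (\<Inter>i. ?A i)"
    using A by (intro finite_measure.finite_Lim_measure_decseq[OF fin]) (auto simp: decseq_def intro: le_less_trans)
  moreover have "(\<Inter>i. ?A i) = {}"
  proof -
    have "\<exists>i. \<not> real i < cmod z" for z using reals_Archimedean2[of "cmod z"] by (auto simp: not_less intro: less_imp_le)
    then show ?thesis by auto
  qed
  ultimately have "(\<lambda>i. measure cgauss (?A i)) \<longlonglongrightarrow> 0" by simp
  from order_tendstoD(2)[OF this e] obtain i where i: "measure cgauss (?A i) < \<epsilon>"
    by (auto simp: eventually_sequentially)
  show thesis
  proof (rule that[of "real i"])
    fix n and S :: "('k \<times> 'm \<times> nat) set" assume S: "S \<subseteq> block n"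
    interpret N: product_prob_space "\<lambda>_. cgauss" "block n :: ('k \<times> 'm \<times> nat) set" ..
    have finS: "finite S" by (rule finite_subset[OF S finite_block])
    have "emeasure (noise_law n) {z\<in>space (noise_law n). \<forall>j\<in>S. z j \<in> ?A i} = (\<Prod>j\<in>S. emeasure cgauss (?A i))"
      by (rule N.emeasure_PiM_Collect[OF S finS]) (rule A)
    also have "\<dots> = ennreal (measure cgauss (?A i)) ^ card S" by (simp add: finite_measure.emeasure_eq_measure[OF fin])
    also have "\<dots> \<le> ennreal \<epsilon> ^ card S" using i by (intro power_mono ennreal_leI) auto
    also have "\<dots> = ennreal (\<epsilon> ^ card S)" using e by (simp add: ennreal_power)
    finally show "emeasure (noise_law n) {z\<in>space (noise_law n). \<forall>j\<in>S. real i < cmod (z j)} \<le> ennreal (\<epsilon> ^ card S)"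
      by simp
  qed simp
qed

end

section \<open>The superposition scheme\<close>

definition grid :: "nat \<Rightarrow> complex set" where
  "grid q = (\<lambda>(a, b). Complex (real a) (real b)) ` ({..<q} \<times> {..<q})"

text \<open>The side of a square grid with about \<open>P powr (x - \<epsilon>)\<close> points, that
  is, \<open>x - \<epsilon>\<close> degrees of freedom. The maximum with 1 leaves the grid with the
  single point 0 when there is no rate to carry.\<close>

definition level_size :: "real \<Rightarrow> real \<Rightarrow> real \<Rightarrow> nat" where
  "level_size P \<epsilon> x = max 1 (nat \<lfloor>P powr ((x - \<epsilon>) / 2)\<rfloor>)"

lemma finite_grid[simp]: "finite (grid q)" by (simp add: grid_def)

lemma card_grid: "card (grid q) = q\<^sup>2"
proof -
  have "inj_on (\<lambda>(a, b). Complex (real a) (real b)) ({..<q} \<times> {..<q})" by (auto simp: inj_on_def)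
  from card_image[OF this] show ?thesis by (simp add: grid_def power2_eq_square)
qed

lemma zero_in_grid: "q \<ge> 1 \<Longrightarrow> 0 \<in> grid q"
  by (auto simp: grid_def image_iff complex_eq_iff intro!: bexI[of _ "(0, 0)"])

lemma grid_1[simp]: "grid (Suc 0) = {0}"
  by (simp add: grid_def lessThan_Suc complex_eq_iff)

lemma grid_separated: "c \<in> grid q \<Longrightarrow> c' \<in> grid q' \<Longrightarrow> c \<noteq> c' \<Longrightarrow> 1 \<le> cmod (c - c')"
proof -
  assume "c \<in> grid q" "c' \<in> grid q'" "c \<noteq> c'"
  then obtain a b a' b' :: nat where c: "c = Complex (real a) (real b)" "c' = Complex (real a') (real b')" and ne: "a \<noteq> a' \<or> b \<noteq> b'"
    by (auto simp: grid_def)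
  from ne show ?thesis
  proof
    assume "a \<noteq> a'"
    then have "1 \<le> \<bar>Re (c - c')\<bar>" by (simp add: c)
    also have "\<dots> \<le> cmod (c - c')" by (rule abs_Re_le_cmod)
    finally show ?thesis .
  next
    assume "b \<noteq> b'"
    then have "1 \<le> \<bar>Im (c - c')\<bar>" by (simp add: c)
    also have "\<dots> \<le> cmod (c - c')" by (rule abs_Im_le_cmod)
    finally show ?thesis .
  qed
qed

lemma grid_cmod_le:
  assumes "c \<in> grid q"
  shows "cmod c \<le> sqrt 2 * real (q - 1)"
proof -
  obtain a b where c: "c = Complex (real a) (real b)" "a < q" "b < q" using assms by (auto simp: grid_def)
  have "(cmod c)\<^sup>2 = (real a)\<^sup>2 + (real b)\<^sup>2" by (simp add: c cmod_power2)
  also have "\<dots> \<le> (real (q - 1))\<^sup>2 + (real (q - 1))\<^sup>2"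
    using c by (intro add_mono power_mono) auto
  also have "\<dots> = (sqrt 2 * real (q - 1))\<^sup>2" by (simp add: power_mult_distrib)
  finally show ?thesis by (rule power2_le_imp_le) simp
qed

lemma level_size_ge1: "level_size P \<epsilon> x \<ge> 1" by (simp add: level_size_def)

lemma level_size_ge:
  shows "P powr ((x - \<epsilon>) / 2) \<le> 2 * real (level_size P \<epsilon> x)"
proof (cases "P powr ((x - \<epsilon>) / 2) \<ge> 1")
  case True
  let ?X = "P powr ((x - \<epsilon>) / 2)"
  have "1 \<le> \<lfloor>?X\<rfloor>" using True by simp
  then have "?X \<le> 2 * real_of_int \<lfloor>?X\<rfloor>" by linarith
  also have "\<dots> = 2 * real (nat \<lfloor>?X\<rfloor>)" using True by simp
  finally show ?thesis by (simp add: level_size_def)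
next
  case False
  then show ?thesis by (simp add: level_size_def)
qed

text \<open>Spacing times diameter: the rate exponents cancel and the power exponent
  \<open>b\<close> remains. When the grid has shrunk to 0 the spacing alone may exceed the budget,
  but then nothing is sent.\<close>

lemma amplitude_grid_le:
  assumes P: "P \<ge> 1" and c: "c \<in> grid (level_size P \<epsilon> x)"
  shows "P powr ((b - x + \<epsilon>) / 2) * cmod c \<le> sqrt 2 * P powr (b / 2)"
proof (cases "nat \<lfloor>P powr ((x - \<epsilon>) / 2)\<rfloor> \<le> 1")
  case True
  then have "c = 0" using c by (simp add: level_size_def max_def split: if_splits)
  then show ?thesis by simp
next
  case False
  let ?X = "P powr ((x - \<epsilon>) / 2)"
  have "real (level_size P \<epsilon> x - 1) \<le> real (nat \<lfloor>?X\<rfloor>)" using False by (simp add: level_size_def)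
  also have "\<dots> \<le> ?X" by simp
  finally have "cmod c \<le> sqrt 2 * ?X"
    using grid_cmod_le[OF c] by (smt (verit, best) mult_left_mono real_sqrt_ge_zero)
  then have "P powr ((b - x + \<epsilon>) / 2) * cmod c \<le> P powr ((b - x + \<epsilon>) / 2) * (sqrt 2 * ?X)"
    by (intro mult_left_mono) auto
  also have "\<dots> = sqrt 2 * (P powr ((b - x + \<epsilon>) / 2) * ?X)" by simp
  also have "P powr ((b - x + \<epsilon>) / 2) * ?X = P powr (b / 2)"
    unfolding powr_add[symmetric] by (simp add: field_simps)
  finally show ?thesis .
qed

text \<open>Successive detection: \<open>gap1\<close> separates different common symbols even
  against the full swing of the private ones; once the common symbols agree, \<open>gap2\<close>
  separates the private symbols.\<close>

lemma detection_unique: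
  fixes h \<gamma> y c c' s s' :: complex and A B \<rho> X b :: real
  assumes c: "c \<in> grid q1" "c' \<in> grid q1" and s: "s \<in> grid q2" "s' \<in> grid q2"
    and obs: "cmod (y - of_real A * h * c - of_real B * \<gamma> * s) \<le> \<rho>" "cmod (y - of_real A * h * c' - of_real B * \<gamma> * s') \<le> \<rho>"
    and A: "A \<ge> 0" and B: "B \<ge> 0" and h: "lo \<le> cmod h" and \<gamma>: "\<eta> \<le> cmod \<gamma>" "cmod \<gamma> \<le> b"
    and X: "B * cmod s \<le> X" "B * cmod s' \<le> X" 
    and gap1: "2 * \<rho> + 2 * (b * X) < A * lo" and gap2: "2 * \<rho> < B * \<eta>"
  shows "c = c' \<and> s = s'"
proof -
  let ?u = "of_real A * h * (c - c') + of_real B * \<gamma> * (s - s')"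
  have "?u = (y - of_real A * h * c' - of_real B * \<gamma> * s') - (y - of_real A * h * c - of_real B * \<gamma> * s)"
    by (simp add: algebra_simps)
  then have u: "cmod ?u \<le> 2 * \<rho>" using norm_triangle_ineq4 obs by (smt (verit))
  have cc: "c = c'"
  proof (rule ccontr)
    assume "c \<noteq> c'"
    then have "1 \<le> cmod (c - c')" using c grid_separated by blast
    then have "A * cmod h * 1 \<le> A * cmod h * cmod (c - c')"
      using A by (intro mult_left_mono) auto
    with mult_left_mono[OF h A] have "A * lo \<le> A * cmod h * cmod (c - c')" by simp
    also have "\<dots> = cmod (?u - of_real B * \<gamma> * (s - s'))" using A by (simp add: norm_mult)
    also have "\<dots> \<le> cmod ?u + cmod (of_real B * \<gamma> * (s - s'))" by (rule norm_triangle_ineq4)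
    also have "cmod (of_real B * \<gamma> * (s - s')) = cmod \<gamma> * (B * cmod (s - s'))" using B by (simp add: norm_mult)
    also have "\<dots> \<le> b * (X + X)"
    proof (intro mult_mono)
      have "B * cmod (s - s') \<le> B * (cmod s + cmod s')" using B by (intro mult_left_mono norm_triangle_ineq4)
      also have "\<dots> \<le> X + X" using X by (simp add: distrib_left)
      finally show "B * cmod (s - s') \<le> X + X" .
      show "0 \<le> b" using \<gamma> by (meson norm_ge_zero order_trans)
    qed (use \<gamma> B in auto)
    finally have "A * lo \<le> 2 * \<rho> + 2 * (b * X)" using u by simp
    then show False using gap1 by simp
  qed
  have "s = s'"
  proof (rule ccontr)
    assume "s \<noteq> s'"
    then have "1 \<le> cmod (s - s')" using s grid_separated by blast
    then have "B * cmod \<gamma> * 1 \<le> B * cmod \<gamma> * cmod (s - s')"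
      using B by (intro mult_left_mono) auto
    with mult_left_mono[OF \<gamma>(1) B] have "B * \<eta> \<le> B * cmod \<gamma> * cmod (s - s')" by simp
    also have "\<dots> = cmod ?u" using B cc by (simp add: norm_mult)
    finally show False using u gap2 by simp
  qed
  with cc show ?thesis by simp
qed

text \<open>\<open>\<beta> m\<close> is the power exponent of the private layer;
  \<open>\<eta>\<close> and \<open>\<tau>\<close> are the thresholds for weak gains and loud noise.
  The two conditions \<open>large\<close> are the gaps of \<open>detection_unique\<close> with the
  common powers of \<open>P\<close> cancelled; for positive \<open>\<epsilon>\<close> they hold at
  all large powers.\<close>

locale superposition = partial_csit_bc Q est err \<alpha>
  for Q :: "'a measure" and est err :: "('a, 'k::finite, 'm::finite) csi_process" and \<alpha> +
  fixes \<beta> :: "'m \<Rightarrow> real" and k0 :: 'k and P lo hi \<eta> \<tau> \<epsilon> :: real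
  assumes P1: "P \<ge> 1" and \<beta>: "0 \<le> \<beta> m" "\<beta> m \<le> 1"
    and lo: "lo > 0" and hi: "hi > 0" and \<eta>: "\<eta> > 0" and \<tau>: "\<tau> \<ge> 0"
    and large: "2 * (real CARD('k) * (1 + 4 * real CARD('k) * hi) + \<tau>) + 2 * (real CARD('k) * hi) < P powr (\<epsilon> / 2) * (lo / (sqrt 2 * (real CARD('k) + 1)))"
      "2 * (real CARD('k) * (1 + 4 * real CARD('k) * hi) + \<tau>) < P powr (\<epsilon> / 2) * (\<eta> / (sqrt 2 * (real CARD('k) + 1)))"
begin

text \<open>One common and \<open>CARD('k)\<close> private symbols are superposed, each of norm at
  most \<open>amp * sqrt 2 * sqrt P\<close>, where \<open>sqrt 2\<close> is the diagonal of the
  grid; this constant keeps their sum within \<open>sqrt P\<close>.\<close>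

definition "amp = 1 / (sqrt 2 * (real CARD('k) + 1))"
definition "level k m = min (\<beta> m) (\<alpha> k m)"
definition "common_amp m = amp * P powr ((\<beta> m + \<epsilon>) / 2)"
text \<open>The spacing lies just above the interference: the private layers of the other users
  arrive attenuated by the quality of user \<open>k\<close>, with power exponent at most
  \<open>\<beta> m - level k m\<close>, and \<open>\<epsilon>\<close> opens the gap. In the same way
  the common spacing lies just above the private layer.\<close>

definition "private_amp k m = amp * P powr ((\<beta> m - level k m + \<epsilon>) / 2)"
definition "common_size m = level_size P \<epsilon> (1 - \<beta> m)"
definition "private_size k m = level_size P \<epsilon> (level k m)"
definition "tolerance k m = (real CARD('k) * (1 + 4 * real CARD('k) * hi) + \<tau>) * P powr ((\<beta> m - level k m) / 2)"

text \<open>User \<open>k0\<close> owns the common symbols, so those of the other users carry nothing.\<close>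

definition alphabet :: "'k \<Rightarrow> ('m \<Rightarrow> complex \<times> complex) set" where
  "alphabet k = (\<Pi>\<^sub>E m\<in>UNIV. grid (if k = k0 then common_size m else 1) \<times> grid (private_size k m))"

text \<open>The common symbols leave from antenna \<open>k0\<close> alone. Since every channel
  coefficient has modulus at least \<open>lo\<close>, all users hear this antenna.\<close>

definition encode :: "('k \<Rightarrow> nat \<Rightarrow> nat \<Rightarrow> 'm \<Rightarrow> complex \<times> complex) \<Rightarrow> ('k, 'm) encoder" where
  "encode cw w g m t = (\<chi> i. (if i = k0 then of_real (common_amp m) * fst (cw k0 (w k0) t m) else 0) +
     (\<Sum>k\<in>UNIV. of_real (private_amp k m) * snd (cw k (w k) t m) * direction P g k m t $ i))"

definition residual :: "'k \<Rightarrow> ('m \<times> nat \<Rightarrow> complex) \<Rightarrow> ('k, 'm) csi_block \<Rightarrow> ('k, 'm) csi_block \<Rightarrow> complex \<Rightarrow> complex \<Rightarrow> 'm \<Rightarrow> nat \<Rightarrow> complex" where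
  "residual k y g d c s m t = y (m, t) - of_real (common_amp m) * chan \<alpha> P k m (g (k, m, t)) (d (k, m, t)) $ k0 * c
     - of_real (private_amp k m) * gain \<alpha> P k k g d m t * s"

text \<open>For a user other than \<open>k0\<close> the common symbol is a nuisance and is
  quantified away; user \<open>k0\<close> has to match it with its own codeword.\<close>

definition consistent :: "'k \<Rightarrow> ('m \<times> nat \<Rightarrow> complex) \<Rightarrow> ('k, 'm) csi_block \<Rightarrow> ('k, 'm) csi_block \<Rightarrow> ('m \<Rightarrow> complex \<times> complex) \<Rightarrow> 'm \<Rightarrow> nat \<Rightarrow> bool" where
  "consistent k y g d \<sigma> m t \<longleftrightarrow>
    (\<exists>c\<in>grid (common_size m). (k = k0 \<longrightarrow> c = fst (\<sigma> m)) \<and> cmod (residual k y g d c (snd (\<sigma> m)) m t) \<le> tolerance k m)"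

definition conflicts :: "nat \<Rightarrow> 'k \<Rightarrow> ('m \<times> nat \<Rightarrow> complex) \<Rightarrow> ('k, 'm) csi_block \<Rightarrow> ('k, 'm) csi_block \<Rightarrow> (nat \<Rightarrow> 'm \<Rightarrow> complex \<times> complex) \<Rightarrow> nat" where
  "conflicts n k y g d x = card {t\<in>{..<n}. \<exists>m. \<not> consistent k y g d (x t) m t}"

definition decode :: "nat \<Rightarrow> nat \<Rightarrow> ('k \<Rightarrow> nat) \<Rightarrow> ('k \<Rightarrow> nat \<Rightarrow> nat \<Rightarrow> 'm \<Rightarrow> complex \<times> complex) \<Rightarrow> 'k \<Rightarrow> ('k, 'm) decoder" where
  "decode n r N cw k = (\<lambda>(y, g, d). LEAST i. 1 \<le> i \<and> i \<le> N k \<and> conflicts n k y g d (cw k i) \<le> r)"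

definition regular :: "nat \<Rightarrow> ('k, 'm) csi_block \<Rightarrow> ('k, 'm) csi_block \<Rightarrow> bool" where
  "regular n g d \<longleftrightarrow> bounded_chan \<alpha> hi P n g d \<and>
    (\<forall>k m. \<forall>t<n. \<forall>i. lo \<le> cmod (chan \<alpha> P k m (g (k, m, t)) (d (k, m, t)) $ i)) \<and>
    (\<forall>k m. \<forall>t<n. \<forall>i. \<alpha> k m > 0 \<longrightarrow> cmod (d (k, m, t) $ i) \<le> 4 * hi)"

lemma amp: "amp > 0" by (simp add: amp_def add_nonneg_pos)

lemma amp_nonneg[simp]: "common_amp m \<ge> 0" "private_amp k m \<ge> 0"
  using amp by (simp_all add: common_amp_def private_amp_def)

lemma level_bounds: "0 \<le> level k m" "level k m \<le> \<beta> m" "level k m \<le> \<alpha> k m"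
  using quality \<beta> by (auto simp: level_def)

lemma common_symbol_le:
  assumes "c \<in> grid (common_size m)"
  shows "common_amp m * cmod c \<le> amp * sqrt 2 * P powr (1 / 2)"
proof -
  have "P powr ((1 - (1 - \<beta> m) + \<epsilon>) / 2) * cmod c \<le> sqrt 2 * P powr (1 / 2)"
    using assms unfolding common_size_def by (rule amplitude_grid_le[OF P1])
  then have "amp * (P powr ((\<beta> m + \<epsilon>) / 2) * cmod c) \<le> amp * (sqrt 2 * P powr (1 / 2))"
    using amp by (intro mult_left_mono) auto
  then show ?thesis by (simp add: common_amp_def mult.assoc)
qed

lemma private_symbol_le:
  assumes "s \<in> grid (private_size k m)"
  shows "private_amp k m * cmod s \<le> amp * sqrt 2 * P powr (\<beta> m / 2)"
proof -
  have "P powr ((\<beta> m - level k m + \<epsilon>) / 2) * cmod s \<le> sqrt 2 * P powr (\<beta> m / 2)"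
    using assms unfolding private_size_def by (rule amplitude_grid_le[OF P1])
  then have "amp * (P powr ((\<beta> m - level k m + \<epsilon>) / 2) * cmod s) \<le> amp * (sqrt 2 * P powr (\<beta> m / 2))"
    using amp by (intro mult_left_mono) auto
  then show ?thesis by (simp add: private_amp_def mult.assoc)
qed

lemma alphabet_grid:
  assumes "\<sigma> \<in> alphabet k"
  shows "snd (\<sigma> m) \<in> grid (private_size k m)" "k = k0 \<Longrightarrow> fst (\<sigma> m) \<in> grid (common_size m)" "k \<noteq> k0 \<Longrightarrow> fst (\<sigma> m) = 0"
proof -
  have "\<sigma> m \<in> grid (if k = k0 then common_size m else 1) \<times> grid (private_size k m)"
    using assms by (auto simp: alphabet_def PiE_iff)
  then show "snd (\<sigma> m) \<in> grid (private_size k m)" "k = k0 \<Longrightarrow> fst (\<sigma> m) \<in> grid (common_size m)" "k \<noteq> k0 \<Longrightarrow> fst (\<sigma> m) = 0"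
    by auto
qed

lemma norm_encode_le:
  assumes cw: "\<And>k. cw k (w k) t \<in> alphabet k"
  shows "norm (encode cw w g m t) \<le> sqrt P"
proof -
  let ?x = "axis k0 (of_real (common_amp m) * fst (cw k0 (w k0) t m)) :: complex ^ 'k"
  let ?u = "\<lambda>k. \<chi> i. of_real (private_amp k m) * snd (cw k (w k) t m) * direction P g k m t $ i"
  have eq: "encode cw w g m t = ?x + (\<Sum>k\<in>UNIV. ?u k)"
    by (simp add: vec_eq_iff encode_def axis_def sum_component)
  have nu: "norm (?u k) = private_amp k m * cmod (snd (cw k (w k) t m))" for k
  proof -
    have "norm (?u k) = L2_set (\<lambda>i. cmod (of_real (private_amp k m) * snd (cw k (w k) t m)) * cmod (direction P g k m t $ i)) UNIV"
      by (simp add: norm_vec_def norm_mult)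
    also have "\<dots> = cmod (of_real (private_amp k m) * snd (cw k (w k) t m)) * norm (direction P g k m t)"
      unfolding norm_vec_def by (rule L2_set_right_distrib[symmetric]) simp
    finally show ?thesis by (simp add: norm_mult)
  qed
  have "norm (encode cw w g m t) \<le> norm ?x + (\<Sum>k\<in>UNIV. norm (?u k))"
    unfolding eq by (intro order_trans[OF norm_triangle_ineq] add_left_mono norm_sum)
  also have "\<dots> \<le> amp * sqrt 2 * P powr (1 / 2) + (\<Sum>k\<in>(UNIV :: 'k set). amp * sqrt 2 * P powr (1 / 2))"
  proof (intro add_mono sum_mono)
    show "norm ?x \<le> amp * sqrt 2 * P powr (1 / 2)"
    proof -
      have "norm (axis k0 c :: complex ^ 'k) = cmod c" for c
        by (simp add: norm_eq_sqrt_inner inner_axis_axis)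
      then show ?thesis
        using common_symbol_le[OF alphabet_grid(2)[OF cw refl]] by (simp add: norm_mult)
    qed
    fix k
    have "norm (?u k) \<le> amp * sqrt 2 * P powr (\<beta> m / 2)"
      unfolding nu by (intro private_symbol_le alphabet_grid cw)
    also have "\<dots> \<le> amp * sqrt 2 * P powr (1 / 2)"
      using \<beta>[of m] P1 amp by (intro mult_left_mono powr_mono) auto
    finally show "norm (?u k) \<le> amp * sqrt 2 * P powr (1 / 2)" .
  qed
  also have "\<dots> = (amp * (sqrt 2 * (real CARD('k) + 1))) * P powr (1 / 2)" by (simp add: algebra_simps)
  also have "\<dots> = sqrt P" using P1 by (simp add: amp_def powr_half_sqrt add_nonneg_eq_0_iff)
  finally show ?thesis .
qed

lemma clean_output_encode:
  "clean_output \<alpha> P (encode cw) k w g d m t =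
    of_real (common_amp m) * chan \<alpha> P k m (g (k, m, t)) (d (k, m, t)) $ k0 * fst (cw k0 (w k0) t m) +
    (\<Sum>l\<in>UNIV. of_real (private_amp l m) * gain \<alpha> P k l g d m t * snd (cw l (w l) t m))"
proof -
  let ?h = "chan \<alpha> P k m (g (k, m, t)) (d (k, m, t))"
  have "clean_output \<alpha> P (encode cw) k w g d m t =
    (\<Sum>i\<in>UNIV. (if i = k0 then ?h $ i * (of_real (common_amp m) * fst (cw k0 (w k0) t m)) else 0)) +
    (\<Sum>i\<in>UNIV. \<Sum>l\<in>UNIV. ?h $ i * (of_real (private_amp l m) * snd (cw l (w l) t m) * direction P g l m t $ i))"
    unfolding clean_output_def encode_def
    by (simp add: distrib_left sum.distrib sum_distrib_left if_distrib[of "(*) _"] cong: if_cong)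
  also have "(\<Sum>i\<in>UNIV. (if i = k0 then ?h $ i * (of_real (common_amp m) * fst (cw k0 (w k0) t m)) else 0)) =
    of_real (common_amp m) * ?h $ k0 * fst (cw k0 (w k0) t m)"
    by (simp add: mult.commute mult.left_commute)
  also have "(\<Sum>i\<in>UNIV. \<Sum>l\<in>UNIV. ?h $ i * (of_real (private_amp l m) * snd (cw l (w l) t m) * direction P g l m t $ i)) =
    (\<Sum>l\<in>UNIV. of_real (private_amp l m) * gain \<alpha> P k l g d m t * snd (cw l (w l) t m))"
    by (subst sum.swap) (simp add: gain_def row_times_def sum_distrib_left sum_distrib_right ac_simps)
  finally show ?thesis .
qed

text \<open>With the true common symbol and the own private symbol removed, leaked private symbols
  and noise remain. A leak has amplitude exponent \<open>\<beta> m / 2\<close> from the symbol and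
  \<open>- \<alpha> k m / 2\<close> from the gain, which together stay within
  \<open>tolerance\<close>.\<close>

lemma sent_symbol_consistent:
  assumes cw: "\<And>k. cw k (w k) t \<in> alphabet k" and reg: "regular n g d" and t: "t < n"
    and z: "cmod (z (k, m, t)) \<le> \<tau>"
  shows "consistent k (received \<alpha> n P (encode cw) k w g d z) g d (cw k (w k) t) m t"
proof -
  let ?c = "fst (cw k0 (w k0) t m)"
  let ?f = "\<lambda>l. of_real (private_amp l m) * gain \<alpha> P k l g d m t * snd (cw l (w l) t m)"
  have "residual k (received \<alpha> n P (encode cw) k w g d z) g d ?c (snd (cw k (w k) t m)) m t = (\<Sum>l\<in>UNIV - {k}. ?f l) + z (k, m, t)"
    unfolding residual_def received_clean_output using t
    by (simp add: clean_output_encode sum.remove[of UNIV k])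
  also have "cmod \<dots> \<le> (\<Sum>l\<in>UNIV - {k}. cmod (?f l)) + \<tau>"
    using z by (intro order_trans[OF norm_triangle_ineq] add_mono norm_sum)
  also have "\<dots> \<le> (\<Sum>l\<in>UNIV - {k}. P powr ((\<beta> m - level k m) / 2) * (1 + 4 * real CARD('k) * hi)) + \<tau>"
  proof (intro add_right_mono sum_mono)
    fix l assume l: "l \<in> UNIV - {k}"
    have "cmod (?f l) = (private_amp l m * cmod (snd (cw l (w l) t m))) * cmod (gain \<alpha> P k l g d m t)"
      by (simp add: norm_mult)
    also have "\<dots> \<le> (amp * sqrt 2 * P powr (\<beta> m / 2)) * ((1 + 4 * real CARD('k) * hi) * P powr (- \<alpha> k m / 2))"
    proof (rule mult_mono[OF private_symbol_le[OF alphabet_grid(1)[OF cw]] interference_le[where n = n]])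
      show "bounded_chan \<alpha> hi P n g d" using reg by (simp add: regular_def)
      show "cmod (d (k, m, t) $ i) \<le> 4 * hi" if "0 < \<alpha> k m" for i
        using reg that t by (auto simp: regular_def)
    qed (use t P1 hi quality l amp in auto)
    also have "\<dots> \<le> (1 * P powr (\<beta> m / 2)) * ((1 + 4 * real CARD('k) * hi) * P powr (- level k m / 2))"
    proof (intro mult_mono powr_mono)
      show "amp * sqrt 2 \<le> 1" by (simp add: amp_def)
    qed (use level_bounds[of k m] P1 hi amp in auto)
    also have "\<dots> = P powr ((\<beta> m - level k m) / 2) * (1 + 4 * real CARD('k) * hi)"
    proof -
      have "(\<beta> m - level k m) / 2 = \<beta> m / 2 + (- level k m / 2)" by (simp add: diff_divide_distrib)
      then show ?thesis by (simp only: powr_add) (simp only: mult_1 mult.assoc mult.commute mult.left_commute)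
    qed
    finally show "cmod (?f l) \<le> P powr ((\<beta> m - level k m) / 2) * (1 + 4 * real CARD('k) * hi)" .
  qed
  also have "\<dots> \<le> real CARD('k) * (P powr ((\<beta> m - level k m) / 2) * (1 + 4 * real CARD('k) * hi)) + \<tau> * P powr ((\<beta> m - level k m) / 2)"
  proof (intro add_mono)
    have "1 \<le> P powr ((\<beta> m - level k m) / 2)"
      using P1 level_bounds[of k m] by (intro ge_one_powr_ge_zero) auto
    then show "\<tau> \<le> \<tau> * P powr ((\<beta> m - level k m) / 2)" using \<tau> mult_left_mono[of 1 "P powr ((\<beta> m - level k m) / 2)" \<tau>] by simp
    show "(\<Sum>l\<in>UNIV - {k}. P powr ((\<beta> m - level k m) / 2) * (1 + 4 * real CARD('k) * hi)) \<le>
      real CARD('k) * (P powr ((\<beta> m - level k m) / 2) * (1 + 4 * real CARD('k) * hi))"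
      unfolding sum_constant using hi by (intro mult_right_mono of_nat_mono card_mono) auto
  qed
  also have "\<dots> = tolerance k m" by (simp add: tolerance_def algebra_simps)
  finally have le: "cmod (residual k (received \<alpha> n P (encode cw) k w g d z) g d ?c (snd (cw k (w k) t m)) m t) \<le> tolerance k m" .
  show ?thesis unfolding consistent_def
    by (rule bexI[of _ ?c]) (use le alphabet_grid(2)[OF cw refl] in auto)
qed

lemma consistent_unique:
  assumes reg: "regular n g d" and t: "t < n" and \<sigma>: "\<sigma> \<in> alphabet k" "\<sigma>' \<in> alphabet k"
    and strong: "\<eta> \<le> cmod (gain \<alpha> P k k g d m t)"
    and cons: "consistent k y g d \<sigma> m t" "consistent k y g d \<sigma>' m t"
  shows "\<sigma> m = \<sigma>' m"
proof -
  obtain c where c: "c \<in> grid (common_size m)" "k = k0 \<Longrightarrow> c = fst (\<sigma> m)" "cmod (residual k y g d c (snd (\<sigma> m)) m t) \<le> tolerance k m"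
    using cons(1) unfolding consistent_def by blast
  obtain c' where c': "c' \<in> grid (common_size m)" "k = k0 \<Longrightarrow> c' = fst (\<sigma>' m)" "cmod (residual k y g d c' (snd (\<sigma>' m)) m t) \<le> tolerance k m"
    using cons(2) unfolding consistent_def by blast
  let ?h = "chan \<alpha> P k m (g (k, m, t)) (d (k, m, t)) $ k0"
  let ?C = "real CARD('k) * (1 + 4 * real CARD('k) * hi) + \<tau>"
  have C0: "?C \<ge> 0" using hi \<tau> by simp
  have "c = c' \<and> snd (\<sigma> m) = snd (\<sigma>' m)"
  proof (rule detection_unique[OF c(1) c'(1) alphabet_grid(1)[OF \<sigma>(1)] alphabet_grid(1)[OF \<sigma>(2)]
        c(3)[unfolded residual_def] c'(3)[unfolded residual_def] amp_nonneg _ strong _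
        private_symbol_le[OF alphabet_grid(1)[OF \<sigma>(1)]] private_symbol_le[OF alphabet_grid(1)[OF \<sigma>(2)]]])
    show "lo \<le> cmod ?h" using reg t by (simp add: regular_def)
    show "cmod (gain \<alpha> P k k g d m t) \<le> real CARD('k) * hi"
      using reg t by (intro cmod_gain_le) (auto simp: regular_def)
    \<comment> \<open>First gap: everything below the common layer has amplitude exponent at most
      \<open>\<beta> m / 2\<close>.\<close>
    have "tolerance k m \<le> ?C * P powr (\<beta> m / 2)"
      unfolding tolerance_def using level_bounds[of k m] P1 C0 by (intro mult_left_mono powr_mono) auto
    moreover have "amp * sqrt 2 \<le> 1" by (simp add: amp_def)
    then have "(real CARD('k) * hi) * (amp * sqrt 2 * P powr (\<beta> m / 2)) \<le> (real CARD('k) * hi) * (1 * P powr (\<beta> m / 2))"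
      using hi by (intro mult_left_mono mult_right_mono) auto
    moreover have "(2 * ?C + 2 * (real CARD('k) * hi)) * P powr (\<beta> m / 2) =
      2 * (?C * P powr (\<beta> m / 2)) + 2 * ((real CARD('k) * hi) * (1 * P powr (\<beta> m / 2)))"
      by (simp add: algebra_simps)
    ultimately have "2 * tolerance k m + 2 * (real CARD('k) * hi * (amp * sqrt 2 * P powr (\<beta> m / 2))) \<le>
      (2 * ?C + 2 * (real CARD('k) * hi)) * P powr (\<beta> m / 2)" by linarith
    also have "\<dots> < (P powr (\<epsilon> / 2) * (lo / (sqrt 2 * (real CARD('k) + 1)))) * P powr (\<beta> m / 2)"
      using large(1) P1 by (intro mult_strict_right_mono) auto
    also have "\<dots> = common_amp m * lo"
      by (simp add: common_amp_def amp_def add_divide_distrib powr_add)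
    finally show "2 * tolerance k m + 2 * (real CARD('k) * hi * (amp * sqrt 2 * P powr (\<beta> m / 2))) < common_amp m * lo" .
    \<comment> \<open>Second gap: tolerance and private spacing share the exponent
      \<open>(\<beta> m - level k m) / 2\<close>, and only \<open>P powr (\<epsilon> / 2)\<close> is
      left to compare.\<close>
    have "2 * tolerance k m = (2 * ?C) * P powr ((\<beta> m - level k m) / 2)"
      by (simp add: tolerance_def)
    also have "\<dots> < (P powr (\<epsilon> / 2) * (\<eta> / (sqrt 2 * (real CARD('k) + 1)))) * P powr ((\<beta> m - level k m) / 2)"
      using large(2) P1 by (intro mult_strict_right_mono) auto
    also have "\<dots> = private_amp k m * \<eta>"
      by (simp add: private_amp_def amp_def add_divide_distrib powr_add)
    finally show "2 * tolerance k m < private_amp k m * \<eta>" .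
  qed
  then show ?thesis
    using c(2) c'(2) alphabet_grid(3)[OF \<sigma>(1)] alphabet_grid(3)[OF \<sigma>(2)] by (cases "k = k0") (auto simp: prod_eq_iff)
qed

text \<open>Outside at most \<open>r\<close> spoiled channel uses the sent letter is consistent, and
  it is the only letter that is. A second index with at most \<open>r\<close> conflicts would differ
  from the sent one in at most \<open>2 * r\<close> places, against the distance of the
  code.\<close>

lemma decode_correct:
  assumes cw: "\<And>k i t. t < n \<Longrightarrow> cw k i t \<in> alphabet k" and reg: "regular n g d"
    and dist: "\<And>i j. i \<in> {1..N k} \<Longrightarrow> j \<in> {1..N k} \<Longrightarrow> i \<noteq> j \<Longrightarrow> 2 * r < card {t\<in>{..<n}. cw k i t \<noteq> cw k j t}"
    and w: "w k \<in> {1..N k}"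
    and few: "card {j\<in>UNIV \<times> {..<n}. cmod (gain \<alpha> P k k g d (fst j) (snd j)) \<le> \<eta> \<or> \<tau> < cmod (z (k, j))} \<le> r"
  shows "decode n r N cw k (received \<alpha> n P (encode cw) k w g d z, g, d) = w k"
proof -
  let ?y = "received \<alpha> n P (encode cw) k w g d z"
  define Bad where "Bad = {j\<in>(UNIV :: 'm set) \<times> {..<n}. cmod (gain \<alpha> P k k g d (fst j) (snd j)) \<le> \<eta> \<or> \<tau> < cmod (z (k, j))}"
  define T where "T = {t\<in>{..<n}. \<exists>m. (m, t) \<in> Bad}"
  have finB: "finite Bad" by (simp add: Bad_def)
  have "T \<subseteq> snd ` Bad" by (force simp: T_def)
  then have "card T \<le> card (snd ` Bad)" using finB by (intro card_mono) auto
  also have "\<dots> \<le> card Bad" by (rule card_image_le[OF finB])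
  finally have cT: "card T \<le> r" using few by (simp add: Bad_def)
  have good: "\<eta> \<le> cmod (gain \<alpha> P k k g d m t)" "cmod (z (k, m, t)) \<le> \<tau>" if "t < n" "t \<notin> T" for m t
  proof -
    have "(m, t) \<notin> Bad" using that by (auto simp: T_def)
    then show "\<eta> \<le> cmod (gain \<alpha> P k k g d m t)" "cmod (z (k, m, t)) \<le> \<tau>" using that by (auto simp: Bad_def)
  qed
  have true_cons: "consistent k ?y g d (cw k (w k) t) m t" if "t < n" "t \<notin> T" for m t
    using that good by (intro sent_symbol_consistent[OF cw reg]) auto
  have "conflicts n k ?y g d (cw k (w k)) \<le> card T"
    unfolding conflicts_def using true_cons by (intro card_mono) (auto simp: T_def)
  then have ok: "conflicts n k ?y g d (cw k (w k)) \<le> r" using cT by simp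
  have uniq: "i = w k" if i: "1 \<le> i" "i \<le> N k" "conflicts n k ?y g d (cw k i) \<le> r" for i
  proof (rule ccontr)
    assume ne: "i \<noteq> w k"
    let ?D = "{t\<in>{..<n}. cw k i t \<noteq> cw k (w k) t}"
    have "?D \<subseteq> T \<union> {t\<in>{..<n}. \<exists>m. \<not> consistent k ?y g d (cw k i t) m t}"
    proof
      fix t assume t: "t \<in> ?D"
      show "t \<in> T \<union> {t\<in>{..<n}. \<exists>m. \<not> consistent k ?y g d (cw k i t) m t}"
      proof (rule ccontr)
        assume "\<not> ?thesis"
        then have tT: "t \<notin> T" and all: "\<And>m. consistent k ?y g d (cw k i t) m t" using t by auto
        have "cw k i t m = cw k (w k) t m" for m
          using t tT all true_cons good by (intro consistent_unique[OF reg _ cw cw]) auto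
        then show False using t by auto
      qed
    qed
    then have "card ?D \<le> card (T \<union> {t\<in>{..<n}. \<exists>m. \<not> consistent k ?y g d (cw k i t) m t})"
      by (intro card_mono) (auto simp: T_def)
    also have "\<dots> \<le> card T + conflicts n k ?y g d (cw k i)"
      unfolding conflicts_def by (rule card_Un_le)
    also have "\<dots> \<le> 2 * r" using cT i by simp
    finally show False using dist[of i "w k"] i w ne by simp
  qed
  show ?thesis unfolding decode_def prod.case
    by (rule Least_equality) (use ok w uniq in auto)
qed

end

section \<open>Measurability and error probability of the scheme\<close>

context superposition
begin

lemma encode_measurable:
  assumes t: "t < n"
  shows "(\<lambda>g. encode cw w g m t) \<in> borel_measurable (csi_space n)"
proof -
  have "(\<lambda>g. direction P g k m t $ i) \<in> borel_measurable (csi_space n)" for k i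
    by (rule borel_measurable_vec_nth[OF direction_measurable[OF t]])
  then show ?thesis
    unfolding borel_measurable_vec_iff encode_def vec_lambda_beta
    by (intro allI borel_measurable_add borel_measurable_const borel_measurable_sum borel_measurable_times)
qed

lemma consistent_measurable:
  assumes t: "t < n"
  shows "Measurable.pred ((\<Pi>\<^sub>M j\<in>UNIV \<times> {..<n}. borel) \<Otimes>\<^sub>M csi_space n \<Otimes>\<^sub>M csi_space n)
    (\<lambda>x. consistent k (fst x) (fst (snd x)) (snd (snd x)) \<sigma> m t)"
proof -
  let ?M = "(\<Pi>\<^sub>M j\<in>(UNIV :: 'm set) \<times> {..<n}. (borel :: complex measure)) \<Otimes>\<^sub>M csi_space n \<Otimes>\<^sub>M (csi_space n :: ('k, 'm) csi_block measure)"
  have y: "(\<lambda>x. fst x (m, t)) \<in> borel_measurable ?M"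
    by (rule measurable_compose[OF measurable_fst measurable_component_singleton[where M="\<lambda>_. borel"]]) (use t in simp)
  have h: "(\<lambda>x. chan \<alpha> P k m (fst (snd x) (k, m, t)) (snd (snd x) (k, m, t)) $ k0) \<in> borel_measurable ?M"
    using measurable_compose[OF measurable_snd chan_nth_measurable[OF t, unfolded case_prod_beta']] .
  have \<gamma>: "(\<lambda>x. gain \<alpha> P k k (fst (snd x)) (snd (snd x)) m t) \<in> borel_measurable ?M"
    using measurable_compose[OF measurable_snd gain_measurable[OF t, unfolded case_prod_beta']] .
  have res: "(\<lambda>x. residual k (fst x) (fst (snd x)) (snd (snd x)) c s m t) \<in> borel_measurable ?M" for c s
    unfolding residual_def by (intro borel_measurable_diff borel_measurable_times borel_measurable_const y h \<gamma>)
  have "Measurable.pred ?M (\<lambda>x. \<exists>c\<in>grid (common_size m). (k = k0 \<longrightarrow> c = fst (\<sigma> m)) \<and>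
      cmod (residual k (fst x) (fst (snd x)) (snd (snd x)) c (snd (\<sigma> m)) m t) \<le> tolerance k m)"
  proof (intro pred_intros_finite)
    fix c
    note res[measurable]
    show "Measurable.pred ?M (\<lambda>x. (k = k0 \<longrightarrow> c = fst (\<sigma> m)) \<and>
      cmod (residual k (fst x) (fst (snd x)) (snd (snd x)) c (snd (\<sigma> m)) m t) \<le> tolerance k m)"
      by measurable
  qed simp
  then show ?thesis by (simp only: consistent_def)
qed

lemma decode_measurable:
  "decode n r N cw k \<in> (\<Pi>\<^sub>M j\<in>UNIV \<times> {..<n}. borel) \<Otimes>\<^sub>M csi_space n \<Otimes>\<^sub>M csi_space n \<rightarrow>\<^sub>M count_space UNIV"
proof -
  let ?M = "(\<Pi>\<^sub>M j\<in>(UNIV :: 'm set) \<times> {..<n}. (borel :: complex measure)) \<Otimes>\<^sub>M csi_space n \<Otimes>\<^sub>M (csi_space n :: ('k, 'm) csi_block measure)"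
  have "Measurable.pred ?M (\<lambda>x. 1 \<le> i \<and> i \<le> N k \<and> conflicts n k (fst x) (fst (snd x)) (snd (snd x)) (cw k i) \<le> r)" for i
  proof -
    let ?Q = "\<lambda>t x. \<exists>m. \<not> consistent k (fst x) (fst (snd x)) (snd (snd x)) (cw k i t) m t"
    have "(\<lambda>x. \<Sum>t\<in>{..<n}. of_bool (?Q t x) :: real) \<in> borel_measurable ?M"
    proof (intro borel_measurable_sum of_bool_measurable)
      fix t assume "t \<in> {..<n}"
      then have t: "t < n" by simp
      have "Measurable.pred ?M (\<lambda>x. \<exists>m\<in>UNIV. \<not> consistent k (fst x) (fst (snd x)) (snd (snd x)) (cw k i t) m t)"
        by (intro pred_intros_finite pred_intros_logic consistent_measurable[OF t]) simp
      then show "Measurable.pred ?M (?Q t)" by simp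
    qed
    moreover have "(\<Sum>t\<in>{..<n}. of_bool (?Q t x) :: real) = real (conflicts n k (fst x) (fst (snd x)) (snd (snd x)) (cw k i))" for x
      unfolding conflicts_def by (subst sum_of_bool_eq) (auto intro!: arg_cong[where f=card])
    ultimately have [measurable]: "(\<lambda>x. real (conflicts n k (fst x) (fst (snd x)) (snd (snd x)) (cw k i))) \<in> borel_measurable ?M"
      by simp
    have "Measurable.pred ?M (\<lambda>x. 1 \<le> i \<and> i \<le> N k \<and> real (conflicts n k (fst x) (fst (snd x)) (snd (snd x)) (cw k i)) \<le> real r)"
      by measurable
    then show ?thesis by (simp only: of_nat_le_iff)
  qed
  then show ?thesis
    unfolding decode_def case_prod_beta' by (rule measurable_Least)
qed

lemma encode_decode_is_code:
  assumes cw: "\<And>k i t. t < n \<Longrightarrow> cw k i t \<in> alphabet k" and n: "n \<ge> 1"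
  shows "is_code n P R (encode cw) (decode n r N cw)"
  unfolding is_code_def
proof (intro conjI ballI allI impI)
  fix w g
  have "(norm (encode cw w g m t))\<^sup>2 \<le> P" if "t < n" for m t
  proof -
    have "(norm (encode cw w g m t))\<^sup>2 \<le> (sqrt P)\<^sup>2"
      using that by (intro power_mono norm_encode_le cw) auto
    then show ?thesis using P1 by simp
  qed
  then have "(\<Sum>t<n. \<Sum>m\<in>UNIV. (norm (encode cw w g m t))\<^sup>2) \<le> (\<Sum>t<n. \<Sum>m\<in>(UNIV :: 'm set). P)"
    by (intro sum_mono) auto
  then show "1 / (real n * real CARD('m)) * (\<Sum>t<n. \<Sum>m\<in>UNIV. (norm (encode cw w g m t))\<^sup>2) \<le> P"
    using n by (simp add: divide_le_eq mult.commute mult.left_commute)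
qed (rule encode_measurable decode_measurable; assumption?)+

text \<open>An error needs more than \<open>r\<close> spoiled samples at some user, hence at least
  \<open>x\<close> weak gains or at least \<open>x\<close> loud noise samples;
  \<open>many_bad_events_le\<close> bounds each. Two kinds for \<open>CARD('k)\<close> users give
  the leading factor.\<close>

lemma error_prob_le:
  assumes cw: "\<And>k i t. t < n \<Longrightarrow> cw k i t \<in> alphabet k" and n: "n \<ge> 1"
    and reg: "AE \<omega> in Q. regular n (csi_of n est \<omega>) (csi_of n err \<omega>)"
    and dist: "\<And>k i j. i \<in> {1..N k} \<Longrightarrow> j \<in> {1..N k} \<Longrightarrow> i \<noteq> j \<Longrightarrow> 2 * r < card {t\<in>{..<n}. cw k i t \<noteq> cw k j t}"
    and N: "\<And>k. N k = nat \<lceil>2 powr (real n * R $ k)\<rceil>"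
    and weak: "\<And>k S. S \<subseteq> UNIV \<times> {..<n} \<Longrightarrow>
      emeasure Q {\<omega>\<in>space Q. \<forall>j\<in>S. cmod (gain \<alpha> P k k (csi_of n est \<omega>) (csi_of n err \<omega>) (fst j) (snd j)) \<le> \<eta>} \<le> ennreal (\<epsilon>1 ^ card S)"
    and loud: "\<And>S. S \<subseteq> block n \<Longrightarrow> emeasure (noise_law n) {z\<in>space (noise_law n). \<forall>j\<in>S. \<tau> < cmod (z j)} \<le> ennreal (\<epsilon>1 ^ card S)"
    and \<epsilon>1: "0 < \<epsilon>1" "\<epsilon>1 \<le> 1" and x: "2 * x \<le> real r + 1"
  shows "error_prob Q est err \<alpha> n P R (encode cw) (decode n r N cw) \<le> 2 * real CARD('k) * (2 ^ (CARD('m) * n) * \<epsilon>1 powr x)"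
proof -
  let ?J = "(UNIV :: 'm set) \<times> {..<n}"
  let ?weak = "\<lambda>k \<omega>. {j\<in>?J. cmod (gain \<alpha> P k k (csi_of n est \<omega>) (csi_of n err \<omega>) (fst j) (snd j)) \<le> \<eta>}"
  let ?loud = "\<lambda>k z. {j\<in>?J. \<tau> < cmod (z (k, j))}"
  let ?A = "\<lambda>k. {\<omega>\<in>space Q. x \<le> real (card (?weak k \<omega>))}"
  let ?B = "\<lambda>k. {z\<in>space (noise_law n). x \<le> real (card (?loud k z))}"
  let ?b = "2 ^ (CARD('m) * n) * \<epsilon>1 powr x"
  interpret N: prob_space "noise_law n :: ('k \<times> 'm \<times> nat \<Rightarrow> complex) measure" by (rule prob_space_noise_law)
  have code: "is_code n P R (encode cw) (decode n r N cw)" by (rule encode_decode_is_code[OF cw n])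
  have gm: "(\<lambda>\<omega>. gain \<alpha> P k k (csi_of n est \<omega>) (csi_of n err \<omega>) m t) \<in> borel_measurable Q" if "t < n" for k m t
  proof -
    have "(\<lambda>\<omega>. (csi_of n est \<omega>, csi_of n err \<omega>)) \<in> Q \<rightarrow>\<^sub>M csi_space n \<Otimes>\<^sub>M csi_space n" by measurable
    from measurable_compose[OF this gain_measurable[OF that]] show ?thesis by simp
  qed
  have zm: "(\<lambda>z. z (k, j)) \<in> borel_measurable (noise_law n)" if "j \<in> ?J" for k j
  proof -
    have "(\<lambda>z. z (k, j)) \<in> noise_law n \<rightarrow>\<^sub>M cgauss"
      using that by (intro measurable_component_singleton) (auto simp: block_def)
    then show ?thesis by (simp add: measurable_cong_sets[OF refl sets_cgauss])
  qed
  have weakm: "Measurable.pred Q (\<lambda>\<omega>. cmod (gain \<alpha> P k k (csi_of n est \<omega>) (csi_of n err \<omega>) (fst j) (snd j)) \<le> \<eta>)" if "j \<in> ?J" for k j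
  proof -
    have [measurable]: "(\<lambda>\<omega>. gain \<alpha> P k k (csi_of n est \<omega>) (csi_of n err \<omega>) (fst j) (snd j)) \<in> borel_measurable Q"
      using that by (intro gm) auto
    show ?thesis by measurable
  qed
  have loudm: "Measurable.pred (noise_law n) (\<lambda>z. \<tau> < cmod (z (k, j)))" if "j \<in> ?J" for k j
  proof -
    note zm[OF that, measurable]
    show ?thesis by measurable
  qed
  have A: "emeasure Q (?A k) \<le> ennreal ?b" for k
    using many_bad_events_le[of ?J "\<lambda>j \<omega>. cmod (gain \<alpha> P k k (csi_of n est \<omega>) (csi_of n err \<omega>) (fst j) (snd j)) \<le> \<eta>", OF _ weakm \<epsilon>1 weak]
    by (simp add: card_cartesian_product)
  have B: "emeasure (noise_law n) (?B k) \<le> ennreal ?b" for k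
  proof -
    have "emeasure (noise_law n) {z\<in>space (noise_law n). \<forall>j\<in>S. \<tau> < cmod (z (k, j))} \<le> ennreal (\<epsilon>1 ^ card S)" if S: "S \<subseteq> ?J" for S
    proof -
      have "Pair k ` S \<subseteq> block n" using S by (auto simp: block_def)
      from loud[OF this] show ?thesis by (simp add: card_image inj_on_def)
    qed
    from N.many_bad_events_le[of ?J "\<lambda>j z. \<tau> < cmod (z (k, j))", OF _ loudm \<epsilon>1 this]
    show ?thesis by (simp add: card_cartesian_product)
  qed
  have card_meas: "(\<lambda>y. real (card {j\<in>?J. p j y})) \<in> borel_measurable M'" if "\<And>j. j \<in> ?J \<Longrightarrow> Measurable.pred M' (p j)" for p and M' :: "'x measure"
  proof -
    have "(\<lambda>y. \<Sum>j\<in>?J. of_bool (p j y) :: real) \<in> borel_measurable M'"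
      by (intro borel_measurable_sum of_bool_measurable that)
    moreover have "(\<Sum>j\<in>?J. of_bool (p j y) :: real) = real (card {j\<in>?J. p j y})" for y
      by (subst sum_of_bool_eq) (auto intro!: arg_cong[where f=card])
    ultimately show ?thesis by simp
  qed
  have As: "?A k \<in> sets Q" for k
  proof -
    have [measurable]: "(\<lambda>\<omega>. real (card (?weak k \<omega>))) \<in> borel_measurable Q" by (rule card_meas[OF weakm])
    show ?thesis by measurable
  qed
  have Bs: "?B k \<in> sets (noise_law n)" for k
  proof -
    have [measurable]: "(\<lambda>z. real (card (?loud k z))) \<in> borel_measurable (noise_law n)" by (rule card_meas[OF loudm])
    show ?thesis by measurable
  qed
  have no_error: "\<not> decoding_error n P (encode cw) (decode n r N cw) w \<omega> z"
    if w: "w \<in> messages n R" and r: "regular n (csi_of n est \<omega>) (csi_of n err \<omega>)" and \<omega>: "\<omega> \<in> space Q" "z \<in> space (noise_law n)"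
      and nA: "\<forall>k. \<omega> \<notin> ?A k" and nB: "\<forall>k. z \<notin> ?B k" for w \<omega> z
    unfolding decoding_error_def not_ex not_not
  proof (intro allI decode_correct)
    fix k
    show "w k \<in> {1..N k}" using w by (auto simp: messages_def N PiE_iff)
    let ?bad = "{j\<in>?J. cmod (gain \<alpha> P k k (csi_of n est \<omega>) (csi_of n err \<omega>) (fst j) (snd j)) \<le> \<eta> \<or> \<tau> < cmod (z (k, j))}"
    have "card ?bad \<le> card (?weak k \<omega> \<union> ?loud k z)" by (intro card_mono) auto
    also have "\<dots> \<le> card (?weak k \<omega>) + card (?loud k z)" by (rule card_Un_le)
    finally have "real (card ?bad) \<le> real (card (?weak k \<omega>)) + real (card (?loud k z))" by simp
    also have "\<dots> < 2 * x" using nA nB \<omega> by (auto simp: not_le intro: add_strict_mono[of _ x _ x, simplified])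
    finally have "real (card ?bad) < real r + 1" using x by simp
    then show "card ?bad \<le> r" by linarith
  qed (use cw r dist in auto)
  let ?W = "messages n R"
  have cW: "real (card ?W) > 0" using messages_nonempty by (simp add: card_gt_0_iff)
  let ?err = "\<lambda>\<omega> z. (\<Sum>w\<in>?W. of_bool (decoding_error n P (encode cw) (decode n r N cw) w \<omega> z)) / real (card ?W)"
  have err1: "?err \<omega> z \<le> 1" for \<omega> z
  proof -
    have "(\<Sum>w\<in>?W. of_bool (decoding_error n P (encode cw) (decode n r N cw) w \<omega> z)) \<le> (\<Sum>w\<in>?W. 1 :: real)"
      by (intro sum_mono) simp
    then show ?thesis using cW by (simp add: divide_le_eq)
  qed
  have pointwise: "ennreal (?err \<omega> z) \<le> (\<Sum>k\<in>UNIV. indicator (?A k) \<omega> + indicator (?B k) z)"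
    if "regular n (csi_of n est \<omega>) (csi_of n err \<omega>)" "\<omega> \<in> space Q" "z \<in> space (noise_law n)" for \<omega> z
  proof (cases "(\<forall>k. \<omega> \<notin> ?A k) \<and> (\<forall>k. z \<notin> ?B k)")
    case True
    then have "?err \<omega> z = 0" using no_error[OF _ that] by simp
    then show ?thesis by (simp only: ennreal_0 zero_le)
  next
    case False
    then obtain k where k: "\<omega> \<in> ?A k \<or> z \<in> ?B k" by blast
    have "ennreal (?err \<omega> z) \<le> ennreal 1" by (intro ennreal_leI err1)
    also have "ennreal 1 \<le> indicator (?A k) \<omega> + indicator (?B k) z" using k by (auto simp: indicator_def)
    also have "\<dots> \<le> (\<Sum>k\<in>UNIV. indicator (?A k) \<omega> + indicator (?B k) z)" by (rule member_le_sum) auto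
    finally show ?thesis .
  qed
  have "ennreal (error_prob Q est err \<alpha> n P R (encode cw) (decode n r N cw)) = (\<integral>\<^sup>+\<omega>. \<integral>\<^sup>+z. ennreal (?err \<omega> z) \<partial>noise_law n \<partial>Q)"
    by (rule error_prob_eq[OF code])
  also have "\<dots> \<le> (\<integral>\<^sup>+\<omega>. \<integral>\<^sup>+z. (\<Sum>k\<in>UNIV. indicator (?A k) \<omega> + indicator (?B k) z) \<partial>noise_law n \<partial>Q)"
    by (intro nn_integral_mono_AE, use reg AE_space in eventually_elim) (intro nn_integral_mono pointwise)
  also have "\<dots> = (\<integral>\<^sup>+\<omega>. (\<Sum>k\<in>UNIV. indicator (?A k) \<omega> + emeasure (noise_law n) (?B k)) \<partial>Q)"
  proof (intro nn_integral_cong)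
    fix \<omega>
    have "(\<integral>\<^sup>+z. (\<Sum>k\<in>UNIV. indicator (?A k) \<omega> + indicator (?B k) z) \<partial>noise_law n) =
      (\<Sum>k\<in>UNIV. \<integral>\<^sup>+z. indicator (?A k) \<omega> + indicator (?B k) z \<partial>noise_law n)"
      by (intro nn_integral_sum borel_measurable_add borel_measurable_const borel_measurable_indicator Bs)
    also have "\<dots> = (\<Sum>k\<in>UNIV. indicator (?A k) \<omega> + emeasure (noise_law n) (?B k))"
    proof (intro sum.cong refl)
      fix k
      have "(\<integral>\<^sup>+z. indicator (?A k) \<omega> + indicator (?B k) z \<partial>noise_law n) =
        (\<integral>\<^sup>+z. indicator (?A k) \<omega> \<partial>(noise_law n :: ('k \<times> 'm \<times> nat \<Rightarrow> complex) measure)) + (\<integral>\<^sup>+z. indicator (?B k) z \<partial>noise_law n)"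
        by (intro nn_integral_add borel_measurable_const borel_measurable_indicator Bs)
      then show "(\<integral>\<^sup>+z. indicator (?A k) \<omega> + indicator (?B k) z \<partial>noise_law n) = indicator (?A k) \<omega> + emeasure (noise_law n) (?B k)"
        using Bs[of k] by (simp add: N.emeasure_space_1)
    qed
    finally show "(\<integral>\<^sup>+z. (\<Sum>k\<in>UNIV. indicator (?A k) \<omega> + indicator (?B k) z) \<partial>noise_law n) =
      (\<Sum>k\<in>UNIV. indicator (?A k) \<omega> + emeasure (noise_law n) (?B k))" .
  qed
  also have "\<dots> = (\<Sum>k\<in>UNIV. \<integral>\<^sup>+\<omega>. indicator (?A k) \<omega> + emeasure (noise_law n) (?B k) \<partial>Q)"
    by (intro nn_integral_sum borel_measurable_add borel_measurable_const borel_measurable_indicator As)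
  also have "\<dots> = (\<Sum>k\<in>UNIV. emeasure Q (?A k) + emeasure (noise_law n) (?B k))"
  proof (intro sum.cong refl)
    fix k
    have "(\<integral>\<^sup>+\<omega>. indicator (?A k) \<omega> + emeasure (noise_law n) (?B k) \<partial>Q) = (\<integral>\<^sup>+\<omega>. indicator (?A k) \<omega> \<partial>Q) + (\<integral>\<^sup>+\<omega>. emeasure (noise_law n) (?B k) \<partial>Q)"
      by (intro nn_integral_add borel_measurable_const borel_measurable_indicator As)
    then show "(\<integral>\<^sup>+\<omega>. indicator (?A k) \<omega> + emeasure (noise_law n) (?B k) \<partial>Q) = emeasure Q (?A k) + emeasure (noise_law n) (?B k)"
      using As[of k] by (simp add: emeasure_space_1)
  qed
  also have "\<dots> \<le> (\<Sum>k\<in>(UNIV :: 'k set). ennreal ?b + ennreal ?b)"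
    by (intro sum_mono add_mono A B)
  also have "\<dots> = ennreal (2 * real CARD('k) * ?b)"
  proof -
    have "(\<Sum>k\<in>(UNIV :: 'k set). ennreal ?b + ennreal ?b) = (\<Sum>k\<in>(UNIV :: 'k set). ennreal (2 * ?b))"
      by (intro sum.cong refl) (subst ennreal_plus[symmetric], auto)
    also have "\<dots> = ennreal (\<Sum>k\<in>(UNIV :: 'k set). 2 * ?b)" by (rule sum_ennreal) simp
    also have "(\<Sum>k\<in>(UNIV :: 'k set). 2 * ?b) = 2 * real CARD('k) * ?b" by simp
    finally show ?thesis .
  qed
  finally show ?thesis by (simp add: ennreal_le_iff)
qed

end

section \<open>Achievable rates\<close>

text \<open>Rounding a grid side down costs at most a factor 2, so at most 2 bits per grid, and a
  letter uses at most two nontrivial grids on each subchannel; hence \<open>4 * CARD('m)\<close>.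
  Each grid also gives up the exponent \<open>\<epsilon>\<close>.\<close>

lemma (in superposition) log_card_alphabet_ge:
  "(\<Sum>m\<in>UNIV. level k m + (if k = k0 then 1 - \<beta> m else 0) - 2 * \<epsilon>) * log 2 P - 4 * CARD('m) \<le> log 2 (card (alphabet k))"
  if "\<epsilon> \<ge> 0"
proof -
  let ?q = "\<lambda>m. if k = k0 then common_size m else 1"
  have size1: "common_size m \<ge> 1" "private_size k m \<ge> 1" for m
    unfolding common_size_def private_size_def by (rule level_size_ge1)+
  have L0: "log 2 P \<ge> 0" using P1 by simp
  have lev: "(x - \<epsilon>) * log 2 P - 2 \<le> 2 * log 2 (level_size P \<epsilon> x)" for x
  proof -
    have "log 2 (P powr ((x - \<epsilon>) / 2)) \<le> log 2 (2 * real (level_size P \<epsilon> x))"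
      using P1 level_size_ge level_size_ge1[of P \<epsilon> x] by (intro log_mono) auto
    moreover have "real (level_size P \<epsilon> x) > 0" using level_size_ge1[of P \<epsilon> x] by linarith
    ultimately have "(x - \<epsilon>) / 2 * log 2 P \<le> 1 + log 2 (level_size P \<epsilon> x)"
      using P1 by (simp add: log_powr log_mult)
    then show ?thesis by simp
  qed
  have "log 2 (card (alphabet k)) = log 2 (\<Prod>m\<in>UNIV. real (?q m)^2 * real (private_size k m)^2)"
    by (simp add: alphabet_def card_PiE card_cartesian_product card_grid)
  also have "\<dots> = (\<Sum>m\<in>UNIV. log 2 (real (?q m)^2 * real (private_size k m)^2))"
  proof -
    have "real (?q m)^2 * real (private_size k m)^2 \<noteq> 0" for m using size1[of m] by auto
    then show ?thesis unfolding log_def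
      by (subst ln_prod) (auto simp only: finite_UNIV sum_divide_distrib finite_class.finite_UNIV)
  qed
  also have "\<dots> = (\<Sum>m\<in>UNIV. 2 * log 2 (?q m) + 2 * log 2 (private_size k m))"
  proof (intro sum.cong refl)
    fix m
    have "real (?q m) > 0" "real (private_size k m) > 0" using size1[of m] by auto
    then show "log 2 (real (?q m)^2 * real (private_size k m)^2) = 2 * log 2 (?q m) + 2 * log 2 (private_size k m)"
      by (simp only: log_mult log_nat_power zero_less_power) simp
  qed
  finally have eq: "log 2 (card (alphabet k)) = (\<Sum>m\<in>UNIV. 2 * log 2 (?q m) + 2 * log 2 (private_size k m))" .
  have "(\<Sum>m\<in>UNIV. (level k m + (if k = k0 then 1 - \<beta> m else 0) - 2 * \<epsilon>) * log 2 P - 4) \<le>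
    (\<Sum>m\<in>UNIV. 2 * log 2 (?q m) + 2 * log 2 (private_size k m))"
  proof (rule sum_mono)
    fix m
    have 1: "(level k m - \<epsilon>) * log 2 P - 2 \<le> 2 * log 2 (private_size k m)"
      unfolding private_size_def by (rule lev)
    show "(level k m + (if k = k0 then 1 - \<beta> m else 0) - 2 * \<epsilon>) * log 2 P - 4 \<le> 2 * log 2 (?q m) + 2 * log 2 (private_size k m)"
    proof (cases "k = k0")
      case True
      have 2: "(1 - \<beta> m - \<epsilon>) * log 2 P - 2 \<le> 2 * log 2 (common_size m)"
        unfolding common_size_def by (rule lev)
      have "(level k m + (1 - \<beta> m) - 2 * \<epsilon>) * log 2 P = (level k m - \<epsilon>) * log 2 P + (1 - \<beta> m - \<epsilon>) * log 2 P"
        by (simp add: algebra_simps)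
      then show ?thesis using 1 2 True by simp
    next
      case False
      have "(level k m - 2 * \<epsilon>) * log 2 P \<le> (level k m - \<epsilon>) * log 2 P"
        using L0 that by (intro mult_right_mono) auto
      then show ?thesis using 1 False by simp
    qed
  qed
  moreover have "(\<Sum>m\<in>UNIV. f m * log 2 P - 4) = (\<Sum>m\<in>UNIV. f m) * log 2 P - 4 * CARD('m)" for f :: "'m \<Rightarrow> real"
    by (simp add: sum_subtractf sum_distrib_right)
  ultimately show ?thesis unfolding eq by simp
qed

lemma (in superposition) alphabet_nonempty: "finite (alphabet k)" "alphabet k \<noteq> {}"
proof -
  have "common_size m \<ge> 1" "private_size k m \<ge> 1" for m
    unfolding common_size_def private_size_def by (rule level_size_ge1)+
  then have "0 \<in> grid (if k = k0 then common_size m else 1)" "0 \<in> grid (private_size k m)" for m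
    by (auto intro: zero_in_grid)
  then show "alphabet k \<noteq> {}" unfolding alphabet_def PiE_eq_empty_iff by blast
  show "finite (alphabet k)" unfolding alphabet_def by (intro finite_PiE) auto
qed

text \<open>Of the two spare bits in \<open>rate\<close>, one pays for the factor
  \<open>2 ^ n\<close> of the Hamming ball and one for the ceiling in the codebook size. The
  distance costs the share \<open>2 * \<delta>\<close> of the logarithm of the alphabet
  size.\<close>

lemma codebook_size_bound:
  fixes A n r N :: nat and R \<delta> :: real
  assumes A: "A \<ge> 1" and n: "n \<ge> 1" and R: "R \<ge> 0" and \<delta>: "\<delta> \<ge> 0" and r: "real r \<le> \<delta> * n"
    and N: "N = nat \<lceil>2 powr (real n * R)\<rceil>" and rate: "R + 2 \<le> (1 - 2 * \<delta>) * log 2 A"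
  shows "N * (2 ^ n * A ^ (2 * r)) \<le> A ^ n"
proof -
  have LA: "log 2 A \<ge> 0" using A by simp
  have A_powr: "real A ^ j = 2 powr (j * log 2 A)" for j :: nat
    using A by (simp add: powr_realpow[symmetric] powr_def log_def)
  have "real N \<le> 2 powr (real n * R) + 1" unfolding N by (simp add: of_nat_nat)
  also have "\<dots> \<le> 2 powr (real n * R) + 2 powr (real n * R)"
    using R ge_one_powr_ge_zero[of 2 "real n * R"] by simp
  also have "\<dots> = 2 powr (real n * R + 1)" by (simp add: powr_add)
  finally have "real (N * (2 ^ n * A ^ (2 * r))) \<le> 2 powr (real n * R + 1) * (2 powr real n * 2 powr ((2 * r) * log 2 A))"
    using A_powr[of "2 * r"] by (simp add: powr_realpow mult_right_mono)
  also have "\<dots> = 2 powr (real n * R + 1 + (real n + (2 * r) * log 2 A))" by (simp add: powr_add)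
  also have "\<dots> \<le> 2 powr (n * log 2 A)"
  proof (intro powr_mono)
    have "(2 * r) * log 2 A \<le> (2 * (\<delta> * n)) * log 2 A"
      using r LA by (intro mult_right_mono) auto
    moreover have "real n * (R + 2) \<le> real n * ((1 - 2 * \<delta>) * log 2 A)"
      using rate by (intro mult_left_mono) auto
    moreover have "real n * ((1 - 2 * \<delta>) * log 2 A) = n * log 2 A - (2 * (\<delta> * n)) * log 2 A"
      by (simp add: algebra_simps)
    moreover have "real n \<ge> 1" using n by simp
    moreover have "real n * (R + 2) = real n * R + real n * 2" by (simp add: distrib_left)
    ultimately show "real n * R + 1 + (real n + (2 * r) * log 2 A) \<le> n * log 2 A" by linarith
  qed simp
  also have "\<dots> = real (A ^ n)" by (simp add: A_powr)
  finally show ?thesis by (simp only: of_nat_le_iff)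
qed

context partial_csit_bc
begin

text \<open>The constants are fixed in the order \<open>\<delta>\<close>,
  \<open>\<epsilon>1\<close>, then \<open>\<eta>\<close> and \<open>\<tau>\<close>, and only then
  the power. So the share of samples to be corrected is small and does not depend on
  \<open>P\<close>, and correcting them costs a small share of the rate.\<close>

lemma superposition_rate_achievable:
  fixes \<beta> :: "'m \<Rightarrow> real" and k0 :: 'k and e :: real
  assumes \<beta>: "\<And>m. 0 \<le> \<beta> m" "\<And>m. \<beta> m \<le> 1" and e: "e > 0"
  defines "D \<equiv> \<lambda>k. \<Sum>m\<in>UNIV. min (\<beta> m) (\<alpha> k m) + (if k = k0 then 1 - \<beta> m else 0)"
  obtains P0 where "\<And>P. P \<ge> P0 \<Longrightarrow> achievable_rate Q est err \<alpha> P (\<chi> k. max 0 ((D k - e) * log 2 P))"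
proof -
  define M where "M = real CARD('m)"
  have M1: "M \<ge> 1" by (simp add: M_def Suc_leI)
  obtain lo hi where lo: "0 < lo" and hi: "0 < hi"
    and bd: "\<And>P n. P \<ge> 1 \<Longrightarrow> AE \<omega> in Q. bounded_chan \<alpha> hi P n (csi_of n est \<omega>) (csi_of n err \<omega>)"
    and lobd: "\<And>P n. P \<ge> 1 \<Longrightarrow> AE \<omega> in Q. \<forall>k m. \<forall>t<n. \<forall>i.
       lo \<le> cmod (chan \<alpha> P k m (csi_of n est \<omega> (k, m, t)) (csi_of n err \<omega> (k, m, t)) $ i)"
  proof (rule coefficient_bounds, goal_cases)
    case (1 lo hi) show ?case by (rule 1(1), rule 1(2), rule 1(3), rule 1(4), assumption, rule 1(5))
  qed
  \<comment> \<open>The loss \<open>e\<close> is split up: a quarter for the slack of the two grids,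
    as \<open>2 * \<epsilon> * M = e / 4\<close>, a quarter for the distance of the code, as
    \<open>2 * \<delta> * (2 * M) = e / 4\<close>, and half for the bits that do not grow with
    \<open>P\<close>.\<close>
  define \<epsilon> where "\<epsilon> = e / (8 * M)"
  define \<delta> where "\<delta> = e / (16 * M)"
  have \<epsilon>: "\<epsilon> > 0" and \<delta>: "\<delta> > 0" using e M1 by (simp_all add: \<epsilon>_def \<delta>_def)
  \<comment> \<open>Then \<open>2 ^ (CARD('m) * n) * \<epsilon>1 powr (\<delta> * n / 2)\<close> is
    exactly \<open>(1 / 2) ^ n\<close>, so the error bound beats the number of index sets.\<close>
  define \<epsilon>1 where "\<epsilon>1 = (2::real) powr (- (2 * (M + 1) / \<delta>))"
  have \<epsilon>1: "0 < \<epsilon>1" "\<epsilon>1 \<le> 1"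
  proof -
    have "\<epsilon>1 \<le> 2 powr 0" unfolding \<epsilon>1_def using M1 \<delta> by (intro powr_mono) auto
    then show "\<epsilon>1 \<le> 1" by simp
  qed (simp add: \<epsilon>1_def)
  obtain Cw where Cw: "Cw > 0" and weak: "\<And>n P k S \<eta>. P \<ge> 1 \<Longrightarrow> S \<subseteq> UNIV \<times> {..<n} \<Longrightarrow> \<eta> \<ge> 0 \<Longrightarrow>
      emeasure Q {\<omega>\<in>space Q. \<forall>j\<in>S. cmod (gain \<alpha> P k k (csi_of n est \<omega>) (csi_of n err \<omega>) (fst j) (snd j)) \<le> \<eta>}
      \<le> ennreal ((Cw * \<eta>\<^sup>2) ^ card S)"
  proof (rule weak_gain_probability[OF hi], goal_cases)
    case (1 P n) show ?case by (rule bd[OF 1(2)])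
  next
    case (2 C) show ?case by (rule 2(1), rule 2(2), rule 2(3))
  qed
  define \<eta> where "\<eta> = sqrt (\<epsilon>1 / Cw)"
  have \<eta>: "\<eta> > 0" "Cw * \<eta>\<^sup>2 = \<epsilon>1" using \<epsilon>1 Cw by (simp_all add: \<eta>_def)
  obtain \<tau> where \<tau>: "\<tau> \<ge> 0" and loud: "\<And>n S. S \<subseteq> block n \<Longrightarrow>
      emeasure (noise_law n) {z\<in>space (noise_law n). \<forall>j\<in>S. \<tau> < cmod (z j)} \<le> ennreal (\<epsilon>1 ^ card S)"
  proof (rule loud_noise_probability[OF \<epsilon>1(1)], goal_cases)
    case (1 \<tau>) show ?case by (rule 1(1), rule 1(2), rule 1(3))
  qed
  define c1 where "c1 = 2 * (real CARD('k) * (1 + 4 * real CARD('k) * hi) + \<tau>) + 2 * (real CARD('k) * hi)"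
  define c2 where "c2 = 2 * (real CARD('k) * (1 + 4 * real CARD('k) * hi) + \<tau>)"
  define x1 where "x1 = lo / (sqrt 2 * (real CARD('k) + 1))"
  define x2 where "x2 = \<eta> / (sqrt 2 * (real CARD('k) + 1))"
  have x: "x1 > 0" "x2 > 0" using lo \<eta> by (simp_all add: x1_def x2_def add_nonneg_pos)
  \<comment> \<open>\<open>T\<close> exceeds both quotients, so
    \<open>T \<le> P powr (\<epsilon> / 2)\<close> yields the conditions \<open>large\<close>. The
    other term of \<open>P0\<close> makes \<open>e / 2 * log 2 P\<close> at least
    \<open>4 * M + 2\<close>.\<close>
  define T where "T = max 1 (max (c1 / x1 + 1) (c2 / x2 + 1))"
  define P0 where "P0 = max 1 (max (T powr (2 / \<epsilon>)) (2 powr ((8 * M + 4) / e)))"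
  show thesis
  proof (rule that)
    fix P :: real assume P: "P \<ge> P0"
    have P1: "P \<ge> 1" using P by (simp add: P0_def)
    have L: "log 2 P \<ge> (8 * M + 4) / e"
    proof -
      have "2 powr ((8 * M + 4) / e) \<le> P" using P by (simp add: P0_def)
      then show ?thesis using P1 by (simp add: le_log_iff)
    qed
    then have L0: "log 2 P \<ge> 0" using e M1 P1 by simp
    have T: "T \<le> P powr (\<epsilon> / 2)"
    proof -
      have "(T powr (2 / \<epsilon>)) powr (\<epsilon> / 2) \<le> P powr (\<epsilon> / 2)"
        using P \<epsilon> by (intro powr_mono2) (auto simp: P0_def)
      moreover have "T > 0" by (simp add: T_def)
      ultimately show ?thesis using \<epsilon> by (simp add: powr_powr)
    qed
    interpret S: superposition Q est err \<alpha> \<beta> k0 P lo hi \<eta> \<tau> \<epsilon>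
    proof
      have "c1 < T * x1"
      proof -
        have "c1 / x1 < T" by (simp add: T_def)
        then show ?thesis using x by (simp add: divide_less_eq)
      qed
      also have "\<dots> \<le> P powr (\<epsilon> / 2) * x1" using T x by (intro mult_right_mono) auto
      finally show "2 * (real CARD('k) * (1 + 4 * real CARD('k) * hi) + \<tau>) + 2 * (real CARD('k) * hi) < P powr (\<epsilon> / 2) * (lo / (sqrt 2 * (real CARD('k) + 1)))"
        by (simp only: c1_def x1_def)
      have "c2 < T * x2"
      proof -
        have "c2 / x2 < T" by (simp add: T_def)
        then show ?thesis using x by (simp add: divide_less_eq)
      qed
      also have "\<dots> \<le> P powr (\<epsilon> / 2) * x2" using T x by (intro mult_right_mono) auto
      finally show "2 * (real CARD('k) * (1 + 4 * real CARD('k) * hi) + \<tau>) < P powr (\<epsilon> / 2) * (\<eta> / (sqrt 2 * (real CARD('k) + 1)))"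
        by (simp only: c2_def x2_def)
    qed (use P1 \<beta> lo hi \<eta> \<tau> in auto)
    define R :: "real ^ 'k" where "R = (\<chi> k. max 0 ((D k - e) * log 2 P))"
    have D: "0 \<le> D k" "D k \<le> 2 * M" for k
    proof -
      have "0 \<le> min (\<beta> m) (\<alpha> k m) + (if k = k0 then 1 - \<beta> m else 0)" "min (\<beta> m) (\<alpha> k m) + (if k = k0 then 1 - \<beta> m else 0) \<le> 2" for m
        using \<beta>[of m] quality[of k m] by auto
      then show "0 \<le> D k" "D k \<le> 2 * M" unfolding D_def M_def
        by (auto intro: sum_nonneg order_trans[OF sum_mono[where g="\<lambda>_. 2"]])
    qed
    have reg: "AE \<omega> in Q. S.regular n (csi_of n est \<omega>) (csi_of n err \<omega>)" for n
    proof -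
      have "AE \<omega> in Q. \<forall>k m. \<forall>t<n. \<forall>i. \<alpha> k m > 0 \<longrightarrow> cmod (csi_of n err \<omega> (k, m, t) $ i) \<le> 4 * hi"
        by (rule deviation_bound) (rule bd)
      with bd[OF P1, of n] lobd[OF P1, of n] show ?thesis
        by eventually_elim (auto simp: S.regular_def)
    qed
    have "\<exists>enc dec. is_code n P R enc dec \<and> error_prob Q est err \<alpha> n P R enc dec \<le> 2 * real CARD('k) * (1 / 2) ^ n" if n: "n \<ge> 1" for n
    proof -
      \<comment> \<open>Rounding down still leaves \<open>2 * x \<le> real r + 1\<close> for
        \<open>x = \<delta> * n / 2\<close>, as \<open>error_prob_le\<close> asks.\<close>
      define r where "r = nat \<lfloor>\<delta> * n\<rfloor>"
      have r: "real r \<le> \<delta> * n" "\<delta> * n \<le> real r + 1" using \<delta> by (auto simp: r_def)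
      define N where "N k = nat \<lceil>2 powr (real n * R $ k)\<rceil>" for k
      have "\<exists>c. (\<forall>i. c i \<in> {..<n} \<rightarrow>\<^sub>E S.alphabet k) \<and> (\<forall>i\<in>{1..N k}. \<forall>j\<in>{1..N k}. i \<noteq> j \<longrightarrow> 2 * r < card {t\<in>{..<n}. c i t \<noteq> c j t})" for k
      proof (rule gilbert_varshamov[OF S.alphabet_nonempty])
        show "N k \<le> 1 \<or> N k * (2 ^ n * card (S.alphabet k) ^ (2 * r)) \<le> card (S.alphabet k) ^ n"
        proof (cases "(D k - e) * log 2 P \<le> 0")
          case True
          then have "R $ k = 0" by (simp add: R_def)
          then show ?thesis by (simp add: N_def)
        next
          case False
          then have Rk: "R $ k = (D k - e) * log 2 P" "R $ k \<ge> 0" by (simp_all add: R_def)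
          have A: "card (S.alphabet k) \<ge> 1"
            using S.alphabet_nonempty[of k] by (simp add: Suc_le_eq card_gt_0_iff)
          let ?X = "(D k - 2 * \<epsilon> * M) * log 2 P - 4 * M"
          have logA: "?X \<le> log 2 (card (S.alphabet k))"
            using S.log_card_alphabet_ge[of k] \<epsilon> by (simp add: D_def S.level_def sum_subtractf M_def mult.commute mult.left_commute)
          \<comment> \<open>A positive rate forces \<open>e\<close> below \<open>D k\<close>, which
            is at most \<open>2 * M\<close>; this bounds \<open>\<delta>\<close>.\<close>
          have \<delta>1: "2 * \<delta> \<le> 1"
          proof -
            have "e < D k" using False L0 by (auto simp: not_le zero_less_mult_iff)
            then have "e < 2 * M" using D(2)[of k] by simp
            then show ?thesis using M1 by (simp add: \<delta>_def)
          qed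
          have "R $ k + 2 \<le> (1 - 2 * \<delta>) * ?X"
          proof -
            have "(D k - 2 * \<epsilon> * M) * log 2 P \<le> D k * log 2 P"
              using L0 \<epsilon> M1 by (intro mult_right_mono) auto
            then have "?X \<le> D k * log 2 P" using M1 by linarith
            then have "2 * \<delta> * ?X \<le> 2 * \<delta> * (D k * log 2 P)" using \<delta> by (intro mult_left_mono) auto
            also have "\<dots> \<le> 2 * \<delta> * (2 * M * log 2 P)" using D L0 \<delta> by (intro mult_left_mono mult_right_mono) auto
            also have "\<dots> = e / 4 * log 2 P" using M1 by (simp add: \<delta>_def)
            finally have 1: "2 * \<delta> * ?X \<le> e / 4 * log 2 P" .
            have 2: "2 * \<epsilon> * M = e / 4" using M1 by (simp add: \<epsilon>_def)
            have 3: "e / 2 * log 2 P \<ge> 4 * M + 2"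
            proof -
              have "e / 2 * ((8 * M + 4) / e) \<le> e / 2 * log 2 P" using L e by (intro mult_left_mono) auto
              then show ?thesis using e by simp
            qed
            have "(1 - 2 * \<delta>) * ?X = ?X - 2 * \<delta> * ?X" by (simp add: algebra_simps)
            also have "\<dots> \<ge> ?X - e / 4 * log 2 P" using 1 by linarith
            finally have "(1 - 2 * \<delta>) * ?X \<ge> (D k - e / 4) * log 2 P - 4 * M - e / 4 * log 2 P" unfolding 2 .
            moreover have "(D k - e / 4) * log 2 P - e / 4 * log 2 P = R $ k + e / 2 * log 2 P"
              using Rk by (simp add: algebra_simps)
            ultimately show ?thesis using 3 by linarith
          qed
          also have "\<dots> \<le> (1 - 2 * \<delta>) * log 2 (card (S.alphabet k))"
            using logA \<delta>1 by (intro mult_left_mono) auto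
          finally have "N k * (2 ^ n * card (S.alphabet k) ^ (2 * r)) \<le> card (S.alphabet k) ^ n"
            using \<delta> by (intro codebook_size_bound[OF A n Rk(2) _ r(1) N_def]) auto
          then show ?thesis ..
        qed
      qed
      then have "\<forall>k. \<exists>c. (\<forall>i. c i \<in> {..<n} \<rightarrow>\<^sub>E S.alphabet k) \<and> (\<forall>i\<in>{1..N k}. \<forall>j\<in>{1..N k}. i \<noteq> j \<longrightarrow> 2 * r < card {t\<in>{..<n}. c i t \<noteq> c j t})"
        by (intro allI)
      from choice[OF this] obtain cw where cw0: "\<forall>k. (\<forall>i. cw k i \<in> {..<n} \<rightarrow>\<^sub>E S.alphabet k) \<and>
          (\<forall>i\<in>{1..N k}. \<forall>j\<in>{1..N k}. i \<noteq> j \<longrightarrow> 2 * r < card {t\<in>{..<n}. cw k i t \<noteq> cw k j t})" ..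
      have cw1: "\<And>k i. cw k i \<in> {..<n} \<rightarrow>\<^sub>E S.alphabet k"
        and cw2: "\<And>k i j. i \<in> {1..N k} \<Longrightarrow> j \<in> {1..N k} \<Longrightarrow> i \<noteq> j \<Longrightarrow> 2 * r < card {t\<in>{..<n}. cw k i t \<noteq> cw k j t}"
        using cw0 by blast+
      have cw: "cw k i t \<in> S.alphabet k" if "t < n" for k i t using cw1[of k i] that by (auto simp: PiE_iff)
      have "error_prob Q est err \<alpha> n P R (S.encode cw) (S.decode n r N cw) \<le> 2 * real CARD('k) * (2 ^ (CARD('m) * n) * \<epsilon>1 powr (\<delta> * n / 2))"
      proof (rule S.error_prob_le[OF cw n reg cw2 _ _ loud \<epsilon>1])
        show "N k = nat \<lceil>2 powr (real n * R $ k)\<rceil>" for k by (simp add: N_def)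
        show "emeasure Q {\<omega>\<in>space Q. \<forall>j\<in>S. cmod (gain \<alpha> P k k (csi_of n est \<omega>) (csi_of n err \<omega>) (fst j) (snd j)) \<le> \<eta>} \<le> ennreal (\<epsilon>1 ^ card S)"
          if "S \<subseteq> UNIV \<times> {..<n}" for k S
          using weak[OF P1 that, of \<eta> k] \<eta> by simp
      qed (use r in auto)
      also have "2 ^ (CARD('m) * n) * \<epsilon>1 powr (\<delta> * n / 2) = (1 / 2) ^ n"
      proof -
        have "\<epsilon>1 powr (\<delta> * n / 2) = 2 powr (- ((M + 1) * n))"
        proof -
          have "- (2 * (M + 1) / \<delta>) * (\<delta> * n / 2) = - ((M + 1) * n)" using \<delta> by (simp add: field_simps)
          then show ?thesis unfolding \<epsilon>1_def powr_powr by (simp only:)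
        qed
        also have "\<dots> = 1 / 2 powr real ((CARD('m) + 1) * n)"
        proof -
          have "(M + 1) * n = real ((CARD('m) + 1) * n)" by (simp add: M_def algebra_simps)
          then show ?thesis by (simp only: powr_minus_divide)
        qed
        also have "\<dots> = 1 / (2 ^ (CARD('m) * n) * 2 ^ n)"
          by (subst powr_realpow) (simp_all add: power_add distrib_right)
        finally show ?thesis by (simp add: power_one_over)
      qed
      finally have "error_prob Q est err \<alpha> n P R (S.encode cw) (S.decode n r N cw) \<le> 2 * real CARD('k) * (1 / 2) ^ n" .
      moreover have "is_code n P R (S.encode cw) (S.decode n r N cw)"
        by (rule S.encode_decode_is_code[OF _ n]) (rule cw)
      ultimately show ?thesis by blast
    qed
    then have "\<forall>n. \<exists>p. n \<ge> 1 \<longrightarrow> is_code n P R (fst p) (snd p) \<and>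
      error_prob Q est err \<alpha> n P R (fst p) (snd p) \<le> 2 * real CARD('k) * (1 / 2) ^ n"
      by fastforce
    from choice[OF this] obtain p where p: "\<forall>n. n \<ge> 1 \<longrightarrow> is_code n P R (fst (p n)) (snd (p n)) \<and>
      error_prob Q est err \<alpha> n P R (fst (p n)) (snd (p n)) \<le> 2 * real CARD('k) * (1 / 2) ^ n" ..
    define enc where "enc n = fst (p n)" for n
    define dec where "dec n = snd (p n)" for n
    have code: "\<And>n. n \<ge> 1 \<Longrightarrow> is_code n P R (enc n) (dec n)"
      and errn: "\<And>n. n \<ge> 1 \<Longrightarrow> error_prob Q est err \<alpha> n P R (enc n) (dec n) \<le> 2 * real CARD('k) * (1 / 2) ^ n"
      using p unfolding enc_def dec_def by blast+
    have "(\<lambda>n. error_prob Q est err \<alpha> n P R (enc n) (dec n)) \<longlonglongrightarrow> 0"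
    proof (rule tendsto_sandwich[OF _ _ tendsto_const])
      show "eventually (\<lambda>n. 0 \<le> error_prob Q est err \<alpha> n P R (enc n) (dec n)) sequentially"
        by (simp add: error_prob_def)
      show "eventually (\<lambda>n. error_prob Q est err \<alpha> n P R (enc n) (dec n) \<le> 2 * real CARD('k) * (1 / 2) ^ n) sequentially"
        using eventually_ge_at_top[of 1] by eventually_elim (rule errn)
      have "(\<lambda>n. 2 * real CARD('k) * (1 / 2) ^ n) \<longlonglongrightarrow> 2 * real CARD('k) * 0"
        by (intro tendsto_mult tendsto_const LIMSEQ_realpow_zero) auto
      then show "(\<lambda>n. 2 * real CARD('k) * (1 / 2) ^ n) \<longlonglongrightarrow> 0" by simp
    qed
    then have "achievable_rate Q est err \<alpha> P R"
      unfolding achievable_rate_def using code by (auto simp: R_def)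
    then show "achievable_rate Q est err \<alpha> P (\<chi> k. max 0 ((D k - e) * log 2 P))" by (simp only: R_def)
  qed
qed

text \<open>At rate 0 there is one message tuple, with all components 1 since messages are numbered
  from 1, and a decoder that always answers 1 is right. This fills in the powers at which the scheme
  is not yet available.\<close>

lemma zero_rate_achievable:
  assumes P: "P \<ge> 0"
  shows "achievable_rate Q est err \<alpha> P 0"
proof -
  have msg: "w k = Suc 0" if "w \<in> messages n 0" for w n and k :: 'k
    using that by (auto simp: messages_def PiE_iff)
  define enc :: "('k, 'm) encoder" where "enc = (\<lambda>_ _ _ _. 0)"
  define dec :: "'k \<Rightarrow> ('k, 'm) decoder" where "dec = (\<lambda>_ _. 1)"
  have "is_code n P 0 enc dec" for n
    using P by (simp add: is_code_def enc_def dec_def)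
  moreover have "error_prob Q est err \<alpha> n P 0 enc dec = 0" for n
  proof -
    have "{(w, \<omega>, z) \<in> space (joint_law Q n (0 :: real ^ 'k)).
        \<exists>k. dec k (received \<alpha> n P enc k w (csi_of n est \<omega>) (csi_of n err \<omega>) z, csi_of n est \<omega>, csi_of n err \<omega>) \<noteq> w k} = {}"
      by (auto simp: joint_law_def space_pair_measure space_uniform_count_measure dec_def msg intro!: msg[symmetric])
    then show ?thesis unfolding error_prob_def by (simp only: measure_empty)
  qed
  ultimately show ?thesis unfolding achievable_rate_def
    by (intro conjI exI[of _ "\<lambda>_. enc"] exI[of _ "\<lambda>_. dec"]) auto
qed

text \<open>For fixed \<open>e\<close> the rates are exactly proportional to \<open>log 2 P\<close>
  from some power on, so the DoF limit is that of an eventually constant function. Closedness of the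
  region then allows \<open>e\<close> to tend to 0.\<close>

lemma superposition_dof:
  fixes \<beta> :: "'m \<Rightarrow> real" and k0 :: 'k
  assumes \<beta>: "\<And>m. 0 \<le> \<beta> m" "\<And>m. \<beta> m \<le> 1"
  shows "(\<chi> k. (\<Sum>m\<in>UNIV. min (\<beta> m) (\<alpha> k m) + (if k = k0 then 1 - \<beta> m else 0)) / CARD('m)) \<in> dof_region Q est err \<alpha>"
proof -
  define D where "D k = (\<Sum>m\<in>UNIV. min (\<beta> m) (\<alpha> k m) + (if k = k0 then 1 - \<beta> m else 0))" for k
  have D0: "D k \<ge> 0" for k
  proof -
    have "0 \<le> min (\<beta> m) (\<alpha> k m) + (if k = k0 then 1 - \<beta> m else 0)" for m
      using \<beta>[of m] quality[of k m] by auto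
    then show ?thesis unfolding D_def by (intro sum_nonneg)
  qed
  define d where "d e = (\<chi> k. max 0 (D k - e) / CARD('m))" for e :: real
  have ach: "achievable_dof Q est err \<alpha> (d e)" if e: "e > 0" for e
  proof -
    obtain P0 where P0: "\<And>P. P \<ge> P0 \<Longrightarrow> achievable_rate Q est err \<alpha> P (\<chi> k. max 0 ((D k - e) * log 2 P))"
      unfolding D_def using superposition_rate_achievable[where \<beta> = \<beta> and ?k0.0 = k0, OF \<beta> e] by blast
    define R :: "real \<Rightarrow> real ^ 'k" where "R P = (if P \<ge> P0 then (\<chi> k. max 0 ((D k - e) * log 2 P)) else 0)" for P
    have "R P \<in> capacity_region Q est err \<alpha> P" if "P > 1" for P
    proof -
      have "achievable_rate Q est err \<alpha> P (R P)"
        using P0 zero_rate_achievable[of P] that by (simp add: R_def)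
      then show ?thesis unfolding capacity_region_def using closure_subset by blast
    qed
    moreover have "((\<lambda>P. R P $ k / (real CARD('m) * log 2 P)) \<longlongrightarrow> d e $ k) at_top" for k
    proof (rule tendsto_eventually)
      show "eventually (\<lambda>P. R P $ k / (real CARD('m) * log 2 P) = d e $ k) at_top"
        using eventually_ge_at_top[of P0] eventually_gt_at_top[of 1]
      proof eventually_elim
        case (elim P)
        then have L: "log 2 P > 0" by simp
        have "max 0 ((D k - e) * log 2 P) = max 0 (D k - e) * log 2 P"
          using L by (simp add: max_def zero_le_mult_iff mult_le_0_iff not_le)
        then have "R P $ k = max 0 (D k - e) * log 2 P" using elim by (simp add: R_def)
        moreover have "d e $ k = max 0 (D k - e) / CARD('m)" by (simp add: d_def)
        moreover have "log 2 P \<noteq> 0" using L by linarith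
        ultimately show ?case by (simp only: nonzero_mult_div_cancel_right times_divide_times_eq[symmetric] divide_self mult_1_right if_False not_False_eq_True)
      qed
    qed
    ultimately show ?thesis unfolding achievable_dof_def by blast
  qed
  have mem: "d (1 / real (Suc n)) \<in> dof_region Q est err \<alpha>" for n
    unfolding dof_region_def using ach[of "1 / real (Suc n)"] closure_subset by fastforce
  have lim: "(\<lambda>n. d (1 / real (Suc n))) \<longlonglongrightarrow> (\<chi> k. D k / CARD('m))"
  proof (rule vec_tendstoI)
    fix k
    have "(\<lambda>n. 1 / real (Suc n)) \<longlonglongrightarrow> 0" using LIMSEQ_inverse_real_of_nat by (simp add: inverse_eq_divide)
    then have "(\<lambda>n. max 0 (D k - 1 / real (Suc n)) / CARD('m)) \<longlonglongrightarrow> max 0 (D k - 0) / CARD('m)"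
      by (intro tendsto_intros) auto
    then show "(\<lambda>n. d (1 / real (Suc n)) $ k) \<longlonglongrightarrow> (\<chi> k. D k / CARD('m)) $ k"
      using D0[of k] by (simp add: d_def)
  qed
  have "closed (dof_region Q est err \<alpha>)" by (simp add: dof_region_def)
  then have "(\<chi> k. D k / CARD('m)) \<in> dof_region Q est err \<alpha>"
    by (rule Lim_in_closed_set[OF _ _ _ lim]) (use mem in auto)
  then show ?thesis by (simp only: D_def)
qed

end

section \<open>The sum-DoF formula\<close>

lemma PiM_lborel_reindex:
  fixes h :: "'i \<Rightarrow> 'j"
  assumes h: "bij_betw h I J" and I: "finite I"
  shows "distr (\<Pi>\<^sub>M j\<in>J. (lborel :: complex measure)) (\<Pi>\<^sub>M i\<in>I. lborel) (\<lambda>x. \<lambda>i\<in>I. x (h i)) = (\<Pi>\<^sub>M i\<in>I. lborel)"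
proof (rule complex_PiM.PiM_eqI[OF I])
  let ?\<phi> = "\<lambda>x. \<lambda>i\<in>I. x (h i)"
  have inj: "inj_on h I" and img: "h ` I = J" using h by (auto simp: bij_betw_def)
  have J: "finite J" using I img by auto
  have hJ: "h i \<in> J" if "i \<in> I" for i using that img by auto
  show "sets (distr (\<Pi>\<^sub>M j\<in>J. (lborel :: complex measure)) (\<Pi>\<^sub>M i\<in>I. lborel) ?\<phi>) = sets (\<Pi>\<^sub>M i\<in>I. lborel)" by simp
  have meas: "?\<phi> \<in> (\<Pi>\<^sub>M j\<in>J. (lborel :: complex measure)) \<rightarrow>\<^sub>M (\<Pi>\<^sub>M i\<in>I. lborel)"
    by (intro measurable_restrict measurable_component_singleton hJ)
  fix A :: "'i \<Rightarrow> complex set" assume A: "\<And>i. i \<in> I \<Longrightarrow> A i \<in> sets lborel"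
  let ?g = "the_inv_into I h"
  have g: "?g (h i) = i" if "i \<in> I" for i by (rule the_inv_into_f_f[OF inj that])
  have "emeasure (distr (\<Pi>\<^sub>M j\<in>J. (lborel :: complex measure)) (\<Pi>\<^sub>M i\<in>I. lborel) ?\<phi>) (Pi\<^sub>E I A) =
    emeasure (\<Pi>\<^sub>M j\<in>J. lborel) (?\<phi> -` Pi\<^sub>E I A \<inter> space (\<Pi>\<^sub>M j\<in>J. lborel))"
    using A I by (intro emeasure_distr meas sets_PiM_I_finite)
  also have "?\<phi> -` Pi\<^sub>E I A \<inter> space (\<Pi>\<^sub>M j\<in>J. lborel) = Pi\<^sub>E J (\<lambda>j. A (?g j))"
  proof -
    have all: "(\<forall>j\<in>J. x j \<in> A (?g j)) \<longleftrightarrow> (\<forall>i\<in>I. x (h i) \<in> A i)" for x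
      unfolding img[symmetric] using g by simp
    show ?thesis
    proof (rule set_eqI)
      fix x
      have "x \<in> ?\<phi> -` Pi\<^sub>E I A \<inter> space (\<Pi>\<^sub>M j\<in>J. (lborel :: complex measure)) \<longleftrightarrow> (\<forall>i\<in>I. x (h i) \<in> A i) \<and> x \<in> extensional J"
        by (simp add: PiE_iff space_PiM)
      also have "\<dots> \<longleftrightarrow> x \<in> Pi\<^sub>E J (\<lambda>j. A (?g j))"
        unfolding all[of x, symmetric] PiE_iff ..
      finally show "x \<in> ?\<phi> -` Pi\<^sub>E I A \<inter> space (\<Pi>\<^sub>M j\<in>J. (lborel :: complex measure)) \<longleftrightarrow> x \<in> Pi\<^sub>E J (\<lambda>j. A (?g j))" .
    qed
  qed
  also have "emeasure (\<Pi>\<^sub>M j\<in>J. lborel) (Pi\<^sub>E J (\<lambda>j. A (?g j))) = (\<Prod>j\<in>J. emeasure lborel (A (?g j)))"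
  proof (intro complex_PiM.emeasure_PiM J)
    fix j assume "j \<in> J"
    then have "?g j \<in> I" using the_inv_into_into[OF inj, of j I] img by simp
    then show "A (?g j) \<in> sets lborel" by (rule A)
  qed
  also have "\<dots> = (\<Prod>i\<in>I. emeasure lborel (A i))"
    unfolding img[symmetric] by (subst prod.reindex[OF inj]) (auto simp: g)
  finally show "emeasure (distr (\<Pi>\<^sub>M j\<in>J. (lborel :: complex measure)) (\<Pi>\<^sub>M i\<in>I. lborel) ?\<phi>) (Pi\<^sub>E I A) = (\<Prod>i\<in>I. emeasure lborel (A i))" .
qed

text \<open>The separate network indexes its entries by \<open>unit\<close> in place of the
  subchannel, so the density assumption has to be carried along an injection. The new densities are
  the old ones at image sets, because relabelling preserves Lebesgue measure.\<close>

lemma bounded_densities_reindex: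
  fixes h :: "'j \<Rightarrow> 'i" and X :: "'i \<Rightarrow> 'a \<Rightarrow> complex"
  assumes h: "inj h" and X: "bounded_densities Q X"
  shows "bounded_densities Q (\<lambda>j. X (h j))"
proof -
  obtain fmax f where fmax: "fmax > 0" and A1: "\<forall>B. finite B \<longrightarrow> (\<forall>x. 0 \<le> f B x) \<and>
        distributed Q (\<Pi>\<^sub>M i\<in>B. lborel) (\<lambda>\<omega>. \<lambda>i\<in>B. X i \<omega>) (\<lambda>x. ennreal (f B x))"
    and A2: "\<forall>B1 B2. finite B1 \<longrightarrow> finite B2 \<longrightarrow> B1 \<inter> B2 = {} \<longrightarrow>
        (AE x in \<Pi>\<^sub>M i\<in>B1 \<union> B2. lborel.
          f B2 (restrict x B2) > 0 \<longrightarrow> cond_density f B1 B2 x \<le> fmax ^ card B1)"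
    using X unfolding bounded_densities_def by (elim exE conjE) (rule that)
  \<comment> \<open>The relabelling back to the image of \<open>B\<close>, where the given densities
    live.\<close>
  define \<psi> where "\<psi> B y = (\<lambda>i\<in>h ` B. y (inv h i))" for B and y :: "'j \<Rightarrow> complex"
  define f' where "f' B y = f (h ` B) (\<psi> B y)" for B y
  have inv: "inv h (h j) = j" for j using h by simp
  have bij: "bij_betw h B (h ` B)" "bij_betw (inv h) (h ` B) B" for B
    using h by (auto simp: bij_betw_def inj_on_def inv image_image)
  have \<psi>_meas: "\<psi> B \<in> (\<Pi>\<^sub>M j\<in>B. lborel) \<rightarrow>\<^sub>M (\<Pi>\<^sub>M i\<in>h ` B. lborel)" for B
    unfolding \<psi>_def by (intro measurable_restrict measurable_component_singleton) (auto simp: inv)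
  have \<psi>_distr: "distr (\<Pi>\<^sub>M j\<in>B. lborel) (\<Pi>\<^sub>M i\<in>h ` B. lborel) (\<psi> B) = (\<Pi>\<^sub>M i\<in>h ` B. lborel)" if "finite B" for B
    unfolding \<psi>_def using that by (intro PiM_lborel_reindex bij) auto
  show ?thesis unfolding bounded_densities_def
  proof (intro exI[of _ fmax] exI[of _ f'] conjI allI impI fmax)
    fix B :: "'j set" assume B: "finite B"
    then have hB: "finite (h ` B)" by simp
    show "0 \<le> f' B y" for y using A1 hB by (simp add: f'_def)
    let ?\<phi> = "\<lambda>x. \<lambda>j\<in>B. x (h j)"
    have \<phi>_meas: "?\<phi> \<in> (\<Pi>\<^sub>M i\<in>h ` B. lborel) \<rightarrow>\<^sub>M (\<Pi>\<^sub>M j\<in>B. (lborel :: complex measure))"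
      by (intro measurable_restrict measurable_component_singleton) auto
    have \<phi>_distr: "distr (\<Pi>\<^sub>M i\<in>h ` B. lborel) (\<Pi>\<^sub>M j\<in>B. lborel) ?\<phi> = (\<Pi>\<^sub>M j\<in>B. (lborel :: complex measure))"
      by (rule PiM_lborel_reindex[OF bij(1) B])
    have d: "distributed Q (\<Pi>\<^sub>M i\<in>h ` B. lborel) (\<lambda>\<omega>. \<lambda>i\<in>h ` B. X i \<omega>) (\<lambda>x. ennreal (f (h ` B) x))"
      using A1 hB by blast
    then have Xm: "(\<lambda>\<omega>. \<lambda>i\<in>h ` B. X i \<omega>) \<in> Q \<rightarrow>\<^sub>M (\<Pi>\<^sub>M i\<in>h ` B. lborel)"
      and fm: "(\<lambda>x. ennreal (f (h ` B) x)) \<in> borel_measurable (\<Pi>\<^sub>M i\<in>h ` B. lborel)"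
      and eq: "distr Q (\<Pi>\<^sub>M i\<in>h ` B. lborel) (\<lambda>\<omega>. \<lambda>i\<in>h ` B. X i \<omega>) = density (\<Pi>\<^sub>M i\<in>h ` B. lborel) (\<lambda>x. ennreal (f (h ` B) x))"
      by (auto simp: distributed_def)
    have X': "(\<lambda>\<omega>. \<lambda>j\<in>B. X (h j) \<omega>) = ?\<phi> \<circ> (\<lambda>\<omega>. \<lambda>i\<in>h ` B. X i \<omega>)"
      by (auto simp: fun_eq_iff)
    have X'm: "(\<lambda>\<omega>. \<lambda>j\<in>B. X (h j) \<omega>) \<in> Q \<rightarrow>\<^sub>M (\<Pi>\<^sub>M j\<in>B. lborel)"
      unfolding X' by (rule measurable_comp[OF Xm \<phi>_meas])
    have f'm: "(\<lambda>y. ennreal (f' B y)) \<in> borel_measurable (\<Pi>\<^sub>M j\<in>B. lborel)"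
      unfolding f'_def by (rule measurable_compose[OF \<psi>_meas fm])
    have retract: "\<psi> B (?\<phi> x) = x" if "x \<in> space (\<Pi>\<^sub>M i\<in>h ` B. (lborel :: complex measure))" for x
      using that by (auto simp: \<psi>_def fun_eq_iff space_PiM PiE_iff extensional_def inv)
    have "distr Q (\<Pi>\<^sub>M j\<in>B. lborel) (\<lambda>\<omega>. \<lambda>j\<in>B. X (h j) \<omega>) =
      distr (density (\<Pi>\<^sub>M i\<in>h ` B. lborel) (\<lambda>x. ennreal (f (h ` B) x))) (\<Pi>\<^sub>M j\<in>B. lborel) ?\<phi>"
      unfolding X' eq[symmetric] by (rule distr_distr[OF \<phi>_meas Xm, symmetric])
    also have "density (\<Pi>\<^sub>M i\<in>h ` B. lborel) (\<lambda>x. ennreal (f (h ` B) x)) =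
      density (\<Pi>\<^sub>M i\<in>h ` B. lborel) (\<lambda>x. ennreal (f' B (?\<phi> x)))"
      using fm measurable_compose[OF \<phi>_meas f'm]
      by (intro density_cong) (auto simp: f'_def retract intro!: AE_I2)
    also have "distr \<dots> (\<Pi>\<^sub>M j\<in>B. lborel) ?\<phi> = density (distr (\<Pi>\<^sub>M i\<in>h ` B. lborel) (\<Pi>\<^sub>M j\<in>B. lborel) ?\<phi>) (\<lambda>y. ennreal (f' B y))"
      by (rule density_distr[OF f'm \<phi>_meas, symmetric])
    also have "\<dots> = density (\<Pi>\<^sub>M j\<in>B. lborel) (\<lambda>y. ennreal (f' B y))" unfolding \<phi>_distr ..
    finally show "distributed Q (\<Pi>\<^sub>M j\<in>B. lborel) (\<lambda>\<omega>. \<lambda>j\<in>B. X (h j) \<omega>) (\<lambda>y. ennreal (f' B y))"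
      unfolding distributed_def using X'm f'm by blast
  next
    fix B1 B2 :: "'j set" assume B: "finite B1" "finite B2" "B1 \<inter> B2 = {}"
    have disj: "h ` B1 \<inter> h ` B2 = {}" using B(3) h by (auto simp: inj_def)
    have ae: "AE x in \<Pi>\<^sub>M i\<in>h ` (B1 \<union> B2). lborel.
      f (h ` B2) (restrict x (h ` B2)) > 0 \<longrightarrow> cond_density f (h ` B1) (h ` B2) x \<le> fmax ^ card (h ` B1)"
      unfolding image_Un using B disj by (intro A2[THEN spec, THEN spec, THEN mp, THEN mp, THEN mp]) simp_all
    have "AE y in \<Pi>\<^sub>M j\<in>B1 \<union> B2. lborel.
      f (h ` B2) (restrict (\<psi> (B1 \<union> B2) y) (h ` B2)) > 0 \<longrightarrow> cond_density f (h ` B1) (h ` B2) (\<psi> (B1 \<union> B2) y) \<le> fmax ^ card (h ` B1)"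
    proof (rule AE_distrD[OF \<psi>_meas])
      have "finite (B1 \<union> B2)" using B by simp
      from ae show "AE x in distr (\<Pi>\<^sub>M j\<in>B1 \<union> B2. lborel) (\<Pi>\<^sub>M i\<in>h ` (B1 \<union> B2). lborel) (\<psi> (B1 \<union> B2)).
        f (h ` B2) (restrict x (h ` B2)) > 0 \<longrightarrow> cond_density f (h ` B1) (h ` B2) x \<le> fmax ^ card (h ` B1)"
        unfolding \<psi>_distr[OF \<open>finite (B1 \<union> B2)\<close>] .
    qed
    moreover have "restrict (\<psi> (B1 \<union> B2) y) (h ` B2) = \<psi> B2 (restrict y B2)" for y
      by (auto simp: \<psi>_def fun_eq_iff inv)
    moreover have "card (h ` B1) = card B1" using h by (intro card_image) (auto simp: inj_on_def inj_def)
    ultimately show "AE y in \<Pi>\<^sub>M j\<in>B1 \<union> B2. lborel.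
      f' B2 (restrict y B2) > 0 \<longrightarrow> cond_density f' B1 B2 y \<le> fmax ^ card B1"
      by (simp add: f'_def cond_density_def image_Un)
  qed
qed

lemma (in partial_csit_bc) subchannel_partial_csit_bc:
  "partial_csit_bc Q (subchannel m est) (subchannel m err) (subchannel m \<alpha>)"
proof
  show "0 \<le> subchannel m \<alpha> k u" "subchannel m \<alpha> k u \<le> 1" for k u
    using quality by (simp_all add: subchannel_def)
  let ?h = "\<lambda>(c, k, u :: unit, t, i). (c :: csi_kind, k :: 'k, m, t :: nat, i :: 'k)"
  have "bounded_densities Q (\<lambda>j. csi_entry est err (?h j))"
    by (rule bounded_densities_reindex[OF _ densities]) (auto simp: inj_def)
  moreover have "csi_entry (subchannel m est) (subchannel m err) = (\<lambda>j. csi_entry est err (?h j))"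
    by (auto simp: csi_entry_def subchannel_def fun_eq_iff)
  ultimately show "bounded_densities Q (csi_entry (subchannel m est) (subchannel m err))" by simp
  obtain lo hi where "0 < lo" and b: "\<And>P k m t i. P \<ge> 1 \<Longrightarrow> AE \<omega> in Q.
        lo \<le> cmod (chan \<alpha> P k m (est k m t \<omega>) (err k m t \<omega>) $ i) \<and>
        cmod (chan \<alpha> P k m (est k m t \<omega>) (err k m t \<omega>) $ i) \<le> hi"
    using coefficients by blast
  then show "\<exists>lo hi. 0 < lo \<and>
      (\<forall>P \<ge> 1. \<forall>k u t i. AE \<omega> in Q.
        lo \<le> cmod (chan (subchannel m \<alpha>) P k u (subchannel m est k u t \<omega>) (subchannel m err k u t \<omega>) $ i) \<and>
        cmod (chan (subchannel m \<alpha>) P k u (subchannel m est k u t \<omega>) (subchannel m err k u t \<omega>) $ i) \<le> hi)"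
    by (intro exI[of _ lo] exI[of _ hi] conjI allI impI) (simp_all add: subchannel_def chan_def)
qed

text \<open>User \<open>\<pi> 1\<close> reaches one full degree of freedom, since on each subchannel
  its private part \<open>\<beta> m\<close> and the common part \<open>1 - \<beta> m\<close> add up
  to 1; every later user gets exactly its quality. The common order enters here: it evaluates all
  the minima in the same way on every subchannel.\<close>

theorem (in partial_csit_bc) sum_dof_formula:
  fixes \<pi> :: "nat \<Rightarrow> 'k"
  assumes \<pi>: "bij_betw \<pi> {1..CARD('k)} UNIV"
    and order: "\<And>m i j. 1 \<le> i \<Longrightarrow> i \<le> j \<Longrightarrow> j \<le> CARD('k) \<Longrightarrow> \<alpha> (\<pi> j) m \<le> \<alpha> (\<pi> i) m"
  shows "sum_dof Q est err \<alpha> = 1 + (\<Sum>i\<in>{1..<CARD('k)}. \<Sum>m\<in>UNIV. \<alpha> (\<pi> (Suc i)) m) / CARD('m)"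
proof -
  define K where "K = CARD('k)"
  have K1: "K \<ge> 1" by (simp add: K_def Suc_leI)
  \<comment> \<open>The quality of the second user; for \<open>K = 1\<close> the index
    \<open>min 2 K\<close> falls back to the only user, because \<open>\<pi> 2\<close> would lie
    outside the enumeration.\<close>
  define \<beta> where "\<beta> m = \<alpha> (\<pi> (min 2 K)) m" for m
  define k0 where "k0 = \<pi> 1"
  define d :: "real ^ 'k" where "d = (\<chi> k. (\<Sum>m\<in>UNIV. min (\<beta> m) (\<alpha> k m) + (if k = k0 then 1 - \<beta> m else 0)) / CARD('m))"
  have d: "d \<in> dof_region Q est err \<alpha>"
    unfolding d_def \<beta>_def by (rule superposition_dof) (auto simp: quality)
  have "(\<Sum>k\<in>UNIV. d $ k) = (\<Sum>i\<in>{1..K}. d $ \<pi> i)"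
    using sum.reindex_bij_betw[OF \<pi>, of "\<lambda>k. d $ k"] by (simp add: K_def)
  also have "\<dots> = d $ \<pi> 1 + (\<Sum>i\<in>{1..<K}. d $ \<pi> (Suc i))"
  proof -
    have "{1..K} = insert 1 {Suc 1..<Suc K}" using K1 by auto
    then have "(\<Sum>i\<in>{1..K}. d $ \<pi> i) = d $ \<pi> 1 + (\<Sum>i\<in>{Suc 1..<Suc K}. d $ \<pi> i)" by simp
    then show ?thesis by (simp only: sum.shift_bounds_Suc_ivl)
  qed
  also have "d $ \<pi> 1 = 1"
  proof -
    have "\<beta> m \<le> \<alpha> (\<pi> 1) m" for m unfolding \<beta>_def using K1 by (intro order) (auto simp: K_def)
    then have "min (\<beta> m) (\<alpha> (\<pi> 1) m) + (1 - \<beta> m) = 1" for m by (simp add: min_def)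
    then show ?thesis by (simp add: d_def k0_def)
  qed
  also have "(\<Sum>i\<in>{1..<K}. d $ \<pi> (Suc i)) = (\<Sum>i\<in>{1..<K}. (\<Sum>m\<in>UNIV. \<alpha> (\<pi> (Suc i)) m) / CARD('m))"
  proof (intro sum.cong refl)
    fix i assume i: "i \<in> {1..<K}"
    then have "\<pi> (Suc i) \<noteq> k0" using \<pi> by (auto simp: bij_betw_def k0_def K_def dest: inj_onD)
    moreover have "min (\<beta> m) (\<alpha> (\<pi> (Suc i)) m) = \<alpha> (\<pi> (Suc i)) m" for m
    proof -
      have "\<alpha> (\<pi> (Suc i)) m \<le> \<beta> m" unfolding \<beta>_def using i by (intro order) (auto simp: K_def)
      then show ?thesis by simp
    qed
    ultimately show "d $ \<pi> (Suc i) = (\<Sum>m\<in>UNIV. \<alpha> (\<pi> (Suc i)) m) / CARD('m)"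
      by (simp add: d_def)
  qed
  finally have sum: "(\<Sum>k\<in>UNIV. d $ k) = 1 + (\<Sum>i\<in>{1..<CARD('k)}. \<Sum>m\<in>UNIV. \<alpha> (\<pi> (Suc i)) m) / CARD('m)"
    by (simp add: sum_divide_distrib K_def)
  show ?thesis unfolding sum_dof_def
  proof (rule Greatest_equality)
    show "1 + (\<Sum>i\<in>{1..<CARD('k)}. \<Sum>m\<in>UNIV. \<alpha> (\<pi> (Suc i)) m) / CARD('m) \<in> (\<lambda>d. \<Sum>k\<in>UNIV. d $ k) ` dof_region Q est err \<alpha>"
      using d sum by (intro image_eqI[of _ _ d]) auto
    fix s assume "s \<in> (\<lambda>d. \<Sum>k\<in>UNIV. d $ k) ` dof_region Q est err \<alpha>"
    then show "s \<le> 1 + (\<Sum>i\<in>{1..<CARD('k)}. \<Sum>m\<in>UNIV. \<alpha> (\<pi> (Suc i)) m) / CARD('m)"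
      using sum_dof_region_bound[OF \<pi>] by blast
  qed
qed

theorem corollary1:
  fixes Q :: "'a measure"
    and est err :: "('a, 'k::finite, 'm::finite) csi_process"
    and \<alpha> :: "'k \<Rightarrow> 'm \<Rightarrow> real"
  assumes "partial_csit_bc Q est err \<alpha>"
    and "\<exists>\<pi>. bij_betw \<pi> {1..CARD('k)} (UNIV :: 'k set) \<and>
      (\<forall>m. \<forall>i j. 1 \<le> i \<and> i \<le> j \<and> j \<le> CARD('k) \<longrightarrow> \<alpha> (\<pi> i) m \<ge> \<alpha> (\<pi> j) m)"
  shows "sum_dof Q est err \<alpha> =
    (1 / real CARD('m)) * (\<Sum>m\<in>UNIV. separate_sum_dof Q est err \<alpha> m)"
proof -
  obtain \<pi> where \<pi>: "bij_betw \<pi> {1..CARD('k)} (UNIV :: 'k set)"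
    and order: "\<And>m i j. 1 \<le> i \<Longrightarrow> i \<le> j \<Longrightarrow> j \<le> CARD('k) \<Longrightarrow> \<alpha> (\<pi> j) m \<le> \<alpha> (\<pi> i) m"
    using assms(2) by blast
  define S where "S m = (\<Sum>i\<in>{1..<CARD('k)}. \<alpha> (\<pi> (Suc i)) m)" for m
  have separate: "separate_sum_dof Q est err \<alpha> m = 1 + S m" for m
  proof -
    \<comment> \<open>The separate network is an instance of the same model over
      \<open>unit\<close>, so the same formula holds with a single subchannel, under the same
      enumeration of the users.\<close>
    interpret sub: partial_csit_bc Q "subchannel m est" "subchannel m err" "subchannel m \<alpha>"
      by (rule partial_csit_bc.subchannel_partial_csit_bc[OF assms(1)])
    have "separate_sum_dof Q est err \<alpha> m = 1 + (\<Sum>i\<in>{1..<CARD('k)}. \<Sum>u\<in>UNIV. subchannel m \<alpha> (\<pi> (Suc i)) u) / CARD(unit)"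
      unfolding separate_sum_dof_def by (rule sub.sum_dof_formula[OF \<pi>]) (simp add: subchannel_def order)
    then show ?thesis by (simp add: subchannel_def S_def UNIV_unit)
  qed
  have "sum_dof Q est err \<alpha> = 1 + (\<Sum>i\<in>{1..<CARD('k)}. \<Sum>m\<in>UNIV. \<alpha> (\<pi> (Suc i)) m) / CARD('m)"
    by (rule partial_csit_bc.sum_dof_formula[OF assms(1) \<pi> order])
  also have "(\<Sum>i\<in>{1..<CARD('k)}. \<Sum>m\<in>UNIV. \<alpha> (\<pi> (Suc i)) m) = (\<Sum>m\<in>UNIV. S m)"
    unfolding S_def by (rule sum.swap)
  also have "1 + (\<Sum>m\<in>UNIV. S m) / CARD('m) = (1 / real CARD('m)) * (\<Sum>m\<in>UNIV. 1 + S m)"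
    by (simp add: sum.distrib add_divide_distrib)
  finally show ?thesis by (simp only: separate)
qed

end
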